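(* Let $z\in Z_2$, let $w=\Phi_\lambda(z)\in Z_{r+1}$ be the corresponding Veronese point, and let $X,Y,\tilde\omega$ be as in the context, where $\alpha\in\mathbb{C}^N$ satisfies $\sum_k\alpha_0^{(k)}=0$, and, for $1\le k\le\ell$, $\alpha_{n_k-1}^{(k)}\notin\mathbb{Z}$ if $n_k=1$ and $\alpha_{n_k-1}^{(k)}\neq0$ if $n_k>1$. Assume that either (a) none of the points $p^{(1)},\dots,p^{(\ell)}$ is $x=\infty$, or (b) $p^{(\ell)}$ is the point $x=\infty$. Let $\psi_1,\dots,\psi_{N-2}\in\Omega^1(Y)$ be the $1$-forms obtained from the list of $N-1$ forms $$\text{in case (a):}\quad\begin{cases}d(\theta_i(\mathbf{y}w^{(k)})),&1\le k\le\ell,\ 1\le i<n_k,\\ d(\theta_0(\mathbf{y}w^{(k)}))-d(\theta_0(\mathbf{y}w^{(\ell)})),&1\le k<\ell,\end{cases}$$ $$\text{in case (b):}\quad\begin{cases}d(\theta_i(\mathbf{y}w^{(k)})),&1\le k\le\ell,\ 1\le i<n_k,\\ d(\theta_0(\mathbf{y}w^{(k)})),&1\le k<\ell,\end{cases}$$ by omitting any one member whose coefficient is nonzero, where the coefficient of the member $d(\theta_i(\mathbf{y}w^{(k)}))$ with $i\ge1$ is $\alpha_i^{(k)}$ and the coefficient of the member $d(\theta_0(\mathbf{y}w^{(k)}))-d(\theta_0(\mathbf{y}w^{(\ell)}))$ (case (a)), resp. $d(\theta_0(\mathbf{y}w^{(k)}))$ (case (b)), is $\alpha_0^{(k)}$.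 Then $$\{\psi_{j_1}\wedge\cdots\wedge\psi_{j_r}\mid1\le j_1<\cdots<j_r\le N-2\}\subset\Omega^r(Y)$$ gives a basis of $H^r(\Omega^\bullet(Y),\nabla_{\tilde\omega})$.
   Context: Let $r,N$ be positive integers with $r+1<N$ and let $\lambda=(n_1,\dots,n_\ell)$ be a partition of $N$ (all $n_k\ge1$; the ordering of the blocks is immaterial here). Functions $\theta_m$: for $x=(x_0,x_1,x_2,\dots)$, define $\theta_m(x)$ ($m\ge0$) by $\sum_{m\ge0}\theta_m(x)T^m=\log(x_0+x_1T+x_2T^2+\cdots)$, so $\theta_0(x)=\log x_0$ and, for $m\ge1$, $\theta_m(x)$ is a polynomial in $x_1/x_0,\dots,x_m/x_0$. Since $\theta_m$ involves only $x_0,\dots,x_m$, $\theta_m(x)$ makes sense for $x\in\mathbb{C}^n$ with $m<n$. Generic stratum: a matrix $z\in\mathrm{Mat}_{m,N}(\mathbb{C})$ is written in blocks $z=(z^{(1)},\dots,z^{(\ell)})$, $z^{(k)}=(z^{(k)}_0,\dots,z^{(k)}_{n_k-1})\in\mathrm{Mat}_{m,n_k}(\mathbb{C})$, with columns $z^{(k)}_j$; rows are indexed from $0$. For $\mu=(m_1,\dots,m_\ell)\in\mathbb{Z}_{\ge0}^\ell$ with $0\le m_k\le n_k$ and $\sum_k m_k=m$, put $z_\mu=(z^{(1)}_0,\dots,z^{(1)}_{m_1-1},\dots,z^{(\ell)}_0,\dots,z^{(\ell)}_{m_\ell-1})\in\mathrm{Mat}_m(\mathbb{C})$. Then $Z_m\subset\mathrm{Mat}_{m,N}(\mathbb{C})$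 is the set of $z$ with $\det z_\mu\ne0$ for all such $\mu$. Veronese map: $\Phi_n:\mathrm{Mat}_{2,n}(\mathbb{C})\to\mathrm{Mat}_{r+1,n}(\mathbb{C})$ sends $(w_{ij})_{i=0,1;\,0\le j<n}$ to $(\varphi_{ij}(w))_{0\le i\le r;\,0\le j<n}$, where $\varphi_{ij}(w)=\sum w_{0j_1}\cdots w_{0j_{r-i}}w_{1j_{r-i+1}}\cdots w_{1j_r}$, summed over all $(j_1,\dots,j_r)$ with $0\le j_p<n$, $j_1+\cdots+j_r=j$. The map $\Phi_\lambda:\mathrm{Mat}_{2,N}(\mathbb{C})\to\mathrm{Mat}_{r+1,N}(\mathbb{C})$ is $(z^{(1)},\dots,z^{(\ell)})\mapsto(\Phi_{n_1}(z^{(1)}),\dots,\Phi_{n_\ell}(z^{(\ell)}))$. It is known that $\Phi_\lambda(Z_2)\subset Z_{r+1}$; points of $\Phi_\lambda(Z_2)$ are called Veronese points. Spaces and forms: let $[t_0:t_1]$ be homogeneous coordinates of $\mathbb{P}^1$ and $x=t_1/t_0$. Let $p^{(k)}=\{[t]\in\mathbb{P}^1\mid tz_0^{(k)}=0\}$ ($1\le k\le\ell$), which are distinct points, and $X=\mathbb{P}^1\setminus\{p^{(1)},\dots,p^{(\ell)}\}$. Let $Y=\mathbb{P}^r\setminus\bigcup_{k=1}^\ell\{[t]\in\mathbb{P}^r\mid tw_0^{(k)}=0\}$, with affine coordinates $y_i=t_i/t_0$ and $\mathbf{y}=(1,y_1,\dots,y_r)$. For $\alpha=(\alpha^{(1)},\dots,\alpha^{(\ell)})\in\mathbb{C}^N$,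 $\alpha^{(k)}=(\alpha_0^{(k)},\dots,\alpha_{n_k-1}^{(k)})$, put $\tilde\omega=\sum_{k=1}^\ell\sum_{0\le i<n_k}\alpha_i^{(k)}d\theta_i(\mathbf{y}w^{(k)})$. De Rham cohomology: $\Omega^p(Y)$ is the set of rational $p$-forms on $\mathbb{P}^r$ with poles at most on $\mathbb{P}^r\setminus Y$, $\nabla_{\tilde\omega}=d+\tilde\omega\wedge$, and $H^p(\Omega^\bullet(Y),\nabla_{\tilde\omega})$ is the $p$-th cohomology of the complex $(\Omega^\bullet(Y),\nabla_{\tilde\omega})$. *)

theory Defs
  imports
    "Jordan_Normal_Form.VS_Connect"
    "HOL-Library.Function_Algebras"
    "HOL-Computational_Algebra.Fraction_Field"
    "HOL-Computational_Algebra.Formal_Power_Series"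
    "HOL-Library.Poly_Mapping"
begin

text \<open>
  Blocks, rows, columns and coordinates are all counted from \<open>0\<close>; in particular
  \<open>lam = [n\<^sub>0, \<dots>]\<close> lists the parts of the partition and block \<open>k\<close> ranges over \<open>k < length lam\<close>.
\<close>

section \<open>Polynomials and rational functions\<close>

text \<open>
  A monomial is its exponent vector \<open>nat \<Rightarrow>\<^sub>0 nat\<close>. Infinitely many variables are available;
  the variables actually allowed are restricted where it matters.
\<close>

type_synonym cpoly = "(nat \<Rightarrow>\<^sub>0 nat) \<Rightarrow>\<^sub>0 complex"
type_synonym ratfun = "cpoly fract"

instance fract :: ("{idom, ring_char_0}") field_char_0
proof
  show "inj (of_nat :: nat \<Rightarrow> 'a fract)"
    by (auto intro!: injI simp: of_nat_fract eq_fract)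
qed

definition rconst :: "complex \<Rightarrow> ratfun" where
  "rconst c = Fract (Poly_Mapping.single 0 c) 1"

definition rvar :: "nat \<Rightarrow> ratfun" where
  "rvar i = Fract (Poly_Mapping.single (Poly_Mapping.single i 1) 1) 1"

definition polys_in :: "nat set \<Rightarrow> cpoly set" where
  "polys_in V = {p. \<forall>m\<in>Poly_Mapping.keys p. Poly_Mapping.keys m \<subseteq> V}"

definition homogeneous :: "nat \<Rightarrow> cpoly \<Rightarrow> bool" where
  "homogeneous d p \<longleftrightarrow> (\<forall>m\<in>Poly_Mapping.keys p. (\<Sum>i\<in>Poly_Mapping.keys m. Poly_Mapping.lookup m i) = d)"

text \<open>Substitution of \<open>x i\<close> for the \<open>i\<close>-th variable, coefficients being mapped by \<open>h\<close>.\<close>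

definition poly_subst :: "(complex \<Rightarrow> 'a) \<Rightarrow> (nat \<Rightarrow> 'a) \<Rightarrow> cpoly \<Rightarrow> 'a::comm_ring_1" where
  "poly_subst h x p = (\<Sum>m\<in>Poly_Mapping.keys p. h (Poly_Mapping.lookup p m) * (\<Prod>i\<in>Poly_Mapping.keys m. x i ^ Poly_Mapping.lookup m i))"

text \<open>The function field \<open>\<complex>(y\<^sub>1, \<dots>, y\<^sub>r)\<close> of \<open>\<P>\<^sup>r\<close>.\<close>

definition ratfuns :: "nat \<Rightarrow> ratfun set" where
  "ratfuns r = {Fract a b | a b. a \<in> polys_in {1..r} \<and> b \<in> polys_in {1..r} \<and> b \<noteq> 0}"

definition poly_pd :: "nat \<Rightarrow> cpoly \<Rightarrow> cpoly" where
  "poly_pd i p =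
    (\<Sum>m\<in>Poly_Mapping.keys p. Poly_Mapping.single (m - Poly_Mapping.single i 1) (of_nat (Poly_Mapping.lookup m i) * Poly_Mapping.lookup p m))"

lemma poly_pd_superset:
  assumes "finite S" "Poly_Mapping.keys p \<subseteq> S"
  shows "poly_pd i p =
    (\<Sum>m\<in>S. Poly_Mapping.single (m - Poly_Mapping.single i 1) (of_nat (Poly_Mapping.lookup m i) * Poly_Mapping.lookup p m))"
  unfolding poly_pd_def
  by (rule sum.mono_neutral_left) (use assms in \<open>auto simp: in_keys_iff\<close>)

lemma poly_pd_add: "poly_pd i (p + q) = poly_pd i p + poly_pd i q"
proof -
  let ?S = "Poly_Mapping.keys p \<union> Poly_Mapping.keys q"
  have "finite ?S" "Poly_Mapping.keys (p + q) \<subseteq> ?S" by (auto simp: keys_add)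
  then show ?thesis
    by (subst (1 2 3) poly_pd_superset[where S = ?S])
      (auto simp: lookup_add distrib_left single_add sum.distrib)
qed

lemma poly_pd_zero [simp]: "poly_pd i 0 = 0"
  by (simp add: poly_pd_def)

lemma poly_pd_single:
  "poly_pd i (Poly_Mapping.single m c) =
    Poly_Mapping.single (m - Poly_Mapping.single i 1) (of_nat (Poly_Mapping.lookup m i) * c)"
  by (simp add: poly_pd_def)

lemma poly_pd_sum: "poly_pd i (sum f A) = (\<Sum>a\<in>A. poly_pd i (f a))"
  by (induction A rule: infinite_finite_induct) (auto simp: poly_pd_add)

lemma poly_mapping_eq_sum_single:
  fixes p :: "'a \<Rightarrow>\<^sub>0 'b::comm_monoid_add"
  shows "p = (\<Sum>m\<in>Poly_Mapping.keys p. Poly_Mapping.single m (Poly_Mapping.lookup p m))"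
  by (rule poly_mapping_eqI)
    (auto simp: lookup_sum lookup_single when_def sum.delta in_keys_iff)

lemma monomial_shift:
  fixes a b :: "nat \<Rightarrow>\<^sub>0 nat"
  assumes "Poly_Mapping.lookup a i \<noteq> 0"
  shows "a - Poly_Mapping.single i 1 + b = a + b - Poly_Mapping.single i 1"
  by (rule poly_mapping_eqI)
    (use assms in \<open>auto simp: lookup_add lookup_minus lookup_single when_def\<close>)

lemma poly_pd_mult_single:
  "poly_pd i (Poly_Mapping.single a c * Poly_Mapping.single b d) =
    poly_pd i (Poly_Mapping.single a c) * Poly_Mapping.single b d +
    Poly_Mapping.single a c * poly_pd i (Poly_Mapping.single b d)"
proof -
  let ?e = "Poly_Mapping.single i (1::nat)"
  have 1: "Poly_Mapping.single (a - ?e + b) (of_nat (Poly_Mapping.lookup a i) * c * d) =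
      Poly_Mapping.single (a + b - ?e) (of_nat (Poly_Mapping.lookup a i) * c * d)"
    by (cases "Poly_Mapping.lookup a i = 0") (simp_all add: monomial_shift[of a i b, simplified])
  have 2: "Poly_Mapping.single (a + (b - ?e)) (c * (of_nat (Poly_Mapping.lookup b i) * d)) =
      Poly_Mapping.single (a + b - ?e) (c * (of_nat (Poly_Mapping.lookup b i) * d))"
    by (cases "Poly_Mapping.lookup b i = 0") (use monomial_shift[of b i a] in \<open>simp_all add: add.commute\<close>)
  show ?thesis
    unfolding mult_single poly_pd_single 1 2
    by (simp add: single_add[symmetric] lookup_add algebra_simps)
qed

lemma poly_pd_mult: "poly_pd i (p * q) = poly_pd i p * q + p * poly_pd i q"
proof -
  let ?s = "\<lambda>p m. Poly_Mapping.single m (Poly_Mapping.lookup p m) :: cpoly"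
  have "poly_pd i (sum (?s p) (Poly_Mapping.keys p) * sum (?s q) (Poly_Mapping.keys q)) =
      poly_pd i (sum (?s p) (Poly_Mapping.keys p)) * sum (?s q) (Poly_Mapping.keys q) +
      sum (?s p) (Poly_Mapping.keys p) * poly_pd i (sum (?s q) (Poly_Mapping.keys q))"
    by (simp only: sum_product poly_pd_sum poly_pd_mult_single sum.distrib)
  then show ?thesis
    by (simp only: poly_mapping_eq_sum_single[symmetric])
qed

text \<open>The quotient rule; \<open>rat_pd_Fract\<close> shows that the description is meaningful.\<close>

definition rat_pd :: "nat \<Rightarrow> ratfun \<Rightarrow> ratfun" where
  "rat_pd i f = (THE g. \<forall>a b. b \<noteq> 0 \<and> f = Fract a b \<longrightarrow>
     g = Fract (poly_pd i a * b - a * poly_pd i b) (b * b))"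

lemma rat_pd_welldefined:
  assumes nz: "b \<noteq> 0" "b' \<noteq> 0" and eq: "Fract a b = Fract a' b'"
  shows "Fract (poly_pd i a * b - a * poly_pd i b) (b * b) =
    Fract (poly_pd i a' * b' - a' * poly_pd i b') (b' * b')"
proof -
  let ?D = "poly_pd i"
  have eq: "a * b' = a' * b" using assms by (simp add: eq_fract)
  have "?D (a * b') = ?D (a' * b)" by (simp add: eq)
  then have eq': "?D a * b' + a * ?D b' = ?D a' * b + a' * ?D b"
    by (simp add: poly_pd_mult)
  have "(?D a * b - a * ?D b) * (b' * b') - (?D a' * b' - a' * ?D b') * (b * b) =
      b * b' * ((?D a * b' + a * ?D b') - (?D a' * b + a' * ?D b))
      - (b * ?D b' + b' * ?D b) * (a * b' - a' * b)"
    by (simp add: algebra_simps)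
  also have "\<dots> = 0" by (simp only: eq eq') simp
  finally show ?thesis using nz by (simp add: eq_fract)
qed

lemma rat_pd_Fract:
  assumes "b \<noteq> 0"
  shows "rat_pd i (Fract a b) = Fract (poly_pd i a * b - a * poly_pd i b) (b * b)"
  unfolding rat_pd_def
  by (rule the_equality) (use assms rat_pd_welldefined in blast)+

lemma rat_pd_add: "rat_pd i (f + g) = rat_pd i f + rat_pd i g"
  by (cases f; cases g)
    (simp add: rat_pd_Fract eq_fract poly_pd_add poly_pd_mult algebra_simps)

lemma rat_pd_mult: "rat_pd i (f * g) = rat_pd i f * g + f * rat_pd i g"
  by (cases f; cases g)
    (simp add: rat_pd_Fract eq_fract poly_pd_mult algebra_simps)

lemma poly_pd_one [simp]: "poly_pd i 1 = 0"
  by (simp add: poly_pd_single flip: single_one)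

lemma rat_pd_rconst [simp]: "rat_pd i (rconst c) = 0"
  by (simp add: rconst_def rat_pd_Fract poly_pd_single Zero_fract_def)

lemma rat_pd_rvar: "rat_pd i (rvar j) = (if i = j then 1 else 0)"
  by (simp add: rvar_def rat_pd_Fract poly_pd_single lookup_single when_def
      Zero_fract_def One_fract_def)

section \<open>Rational differential forms\<close>

text \<open>
  \<open>\<eta> I\<close> is the coefficient of \<open>dy\<^bsub>i\<^sub>1\<^esub> \<and> \<dots> \<and> dy\<^bsub>i\<^sub>p\<^esub>\<close>, where \<open>I = {i\<^sub>1 < \<dots> < i\<^sub>p}\<close>.
\<close>

type_synonym form = "nat set \<Rightarrow> ratfun"

definition fscale :: "ratfun \<Rightarrow> form \<Rightarrow> form" where
  "fscale f \<eta> = (\<lambda>I. f * \<eta> I)"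

definition func_form :: "ratfun \<Rightarrow> form" where
  "func_form f = (\<lambda>I. if I = {} then f else 0)"

definition shuffle_sign :: "nat set \<Rightarrow> nat set \<Rightarrow> ratfun" where
  "shuffle_sign I J = (-1) ^ card {(i, j). i \<in> I \<and> j \<in> J \<and> j < i}"

definition wedge :: "form \<Rightarrow> form \<Rightarrow> form" where
  "wedge \<eta> \<zeta> = (\<lambda>K. \<Sum>I\<in>Pow K. shuffle_sign I (K - I) * \<eta> I * \<zeta> (K - I))"

definition wedge_list :: "form list \<Rightarrow> form" where
  "wedge_list \<eta>s = foldr wedge \<eta>s (func_form 1)"

text \<open>\<open>d (f dy\<^sub>I) = (\<Sum>i. (\<partial>f/\<partial>y\<^sub>i) dy\<^sub>i \<and> dy\<^sub>I)\<close>\<close>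

definition ext_d :: "form \<Rightarrow> form" where
  "ext_d \<eta> = (\<lambda>K. \<Sum>i\<in>K. shuffle_sign {i} (K - {i}) * rat_pd i (\<eta> (K - {i})))"

definition dfun :: "ratfun \<Rightarrow> form" where
  "dfun f = ext_d (func_form f)"

definition rational_forms :: "nat \<Rightarrow> nat \<Rightarrow> form set" where
  "rational_forms r p =
    {\<eta>. (\<forall>I. \<eta> I \<in> ratfuns r) \<and> (\<forall>I. \<eta> I \<noteq> 0 \<longrightarrow> I \<subseteq> {1..r} \<and> card I = p)}"

text \<open>
  A point of \<open>\<P>\<^sup>r\<close> is given by a vector \<open>q = (q\<^sub>0, \<dots>, q\<^sub>r) \<noteq> 0\<close> of homogeneous coordinates
  (it may lie on \<open>t\<^sub>0 = 0\<close>). Its local ring consists of the quotients \<open>F(t)/G(t)\<close> of homogeneous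
  polynomials of equal degree with \<open>G(q) \<noteq> 0\<close>, rewritten in the affine coordinates
  \<open>t = (1, y\<^sub>1, \<dots>, y\<^sub>r)\<close>.
\<close>

definition ycoord :: "nat \<Rightarrow> ratfun" where
  "ycoord i = (if i = 0 then 1 else rvar i)"

definition local_ring :: "nat \<Rightarrow> complex vec \<Rightarrow> ratfun set" where
  "local_ring r q =
    {poly_subst rconst ycoord F / poly_subst rconst ycoord G | F G d.
       F \<in> polys_in {0..r} \<and> G \<in> polys_in {0..r} \<and> homogeneous d F \<and> homogeneous d G \<and>
       poly_subst id (\<lambda>i. q $ i) G \<noteq> 0}"

text \<open>
  The stalk at \<open>q\<close> of the sheaf of regular \<open>p\<close>-forms: the module over the local ring \<open>\<O>\<^sub>q\<close>
  generated by \<open>df\<^sub>1 \<and> \<dots> \<and> df\<^sub>p\<close> with \<open>f\<^sub>1, \<dots>, f\<^sub>p \<in> \<O>\<^sub>q\<close>.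
\<close>

definition regular_forms_at :: "nat \<Rightarrow> complex vec \<Rightarrow> nat \<Rightarrow> form set" where
  "regular_forms_at r q p =
    {(\<Sum>s<n. fscale (g s) (wedge_list (map dfun (fs s)))) | n g fs.
       \<forall>s<(n::nat). g s \<in> local_ring r q \<and> length (fs s) = p \<and> set (fs s) \<subseteq> local_ring r q}"

text \<open>
  \<open>\<Omega>\<^sup>p(Y)\<close>, where \<open>Y\<close> is the set of homogeneous coordinate vectors of the points of the variety.
\<close>

definition Omega :: "nat \<Rightarrow> complex vec set \<Rightarrow> nat \<Rightarrow> form set" where
  "Omega r Y p = {\<eta> \<in> rational_forms r p. \<forall>q\<in>Y. \<eta> \<in> regular_forms_at r q p}"

section \<open>Twisted de Rham cohomology\<close>

definition nabla :: "form \<Rightarrow> form \<Rightarrow> form" where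
  "nabla \<omega> \<eta> = ext_d \<eta> + wedge \<omega> \<eta>"

definition cocycles :: "nat \<Rightarrow> complex vec set \<Rightarrow> form \<Rightarrow> nat \<Rightarrow> form set" where
  "cocycles r Y \<omega> p = {\<eta> \<in> Omega r Y p. nabla \<omega> \<eta> = 0}"

definition coboundaries :: "nat \<Rightarrow> complex vec set \<Rightarrow> form \<Rightarrow> nat \<Rightarrow> form set" where
  "coboundaries r Y \<omega> p = (case p of 0 \<Rightarrow> {0} | Suc p' \<Rightarrow> nabla \<omega> ` Omega r Y p')"

definition coh_class :: "nat \<Rightarrow> complex vec set \<Rightarrow> form \<Rightarrow> nat \<Rightarrow> form \<Rightarrow> form set" where
  "coh_class r Y \<omega> p \<eta> = (\<lambda>\<beta>. \<eta> + \<beta>) ` coboundaries r Y \<omega> p"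

text \<open>
  The quotient space of cocycles by coboundaries, as a module record over \<open>\<complex>\<close> (whose
  multiplicative fields carry no information). The coboundaries are added in the scalar
  multiplication so that \<open>0\<close> times a coset is the zero coset.
\<close>

definition cohomology :: "nat \<Rightarrow> complex vec set \<Rightarrow> form \<Rightarrow> nat \<Rightarrow> (complex, form set) module" where
  "cohomology r Y \<omega> p =
    \<lparr>carrier = coh_class r Y \<omega> p ` cocycles r Y \<omega> p,
     monoid.mult = (\<lambda>_ _. undefined),
     one = undefined,
     zero = coboundaries r Y \<omega> p,
     add = (\<lambda>A B. {a + b | a b. a \<in> A \<and> b \<in> B}),
     smult = (\<lambda>c A. {fscale (rconst c) a + b | a b. a \<in> A \<and> b \<in> coboundaries r Y \<omega> p})\<rparr>"

lemma wedge_linear: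
  "wedge \<omega> (\<eta> + \<zeta>) = wedge \<omega> \<eta> + wedge \<omega> \<zeta>"
  "wedge \<omega> (fscale f \<eta>) = fscale f (wedge \<omega> \<eta>)"
  by (auto simp: wedge_def fscale_def fun_eq_iff sum.distrib sum_distrib_left algebra_simps
      intro!: sum.cong)

lemma ext_d_linear:
  "ext_d (\<eta> + \<zeta>) = ext_d \<eta> + ext_d \<zeta>"
  "ext_d (fscale (rconst c) \<eta>) = fscale (rconst c) (ext_d \<eta>)"
  by (auto simp: ext_d_def fscale_def fun_eq_iff rat_pd_add rat_pd_mult sum.distrib
      sum_distrib_left algebra_simps intro!: sum.cong)

lemma fscale_simps:
  "fscale f (\<eta> + \<zeta>) = fscale f \<eta> + fscale f \<zeta>"
  "fscale (f + g) \<eta> = fscale f \<eta> + fscale g \<eta>"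
  "fscale (f * g) \<eta> = fscale f (fscale g \<eta>)"
  "fscale 1 \<eta> = \<eta>" "fscale 0 \<eta> = 0" "fscale f 0 = 0"
  by (auto simp: fscale_def fun_eq_iff algebra_simps)

lemma rconst_simps:
  "rconst (a + b) = rconst a + rconst b" "rconst (a * b) = rconst a * rconst b"
  "rconst 1 = 1" "rconst 0 = 0"
  by (simp_all add: rconst_def single_add mult_single One_fract_def Zero_fract_def)

lemma nabla_linear:
  "nabla \<omega> (\<eta> + \<zeta>) = nabla \<omega> \<eta> + nabla \<omega> \<zeta>"
  "nabla \<omega> (fscale (rconst c) \<eta>) = fscale (rconst c) (nabla \<omega> \<eta>)"
  by (simp_all add: nabla_def wedge_linear ext_d_linear fscale_simps)

lemma polys_in_closed:
  "0 \<in> polys_in V" "1 \<in> polys_in V" "Poly_Mapping.single 0 c \<in> polys_in V"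
  "p \<in> polys_in V \<Longrightarrow> q \<in> polys_in V \<Longrightarrow> p + q \<in> polys_in V"
  "p \<in> polys_in V \<Longrightarrow> q \<in> polys_in V \<Longrightarrow> p * q \<in> polys_in V"
proof -
  show "0 \<in> polys_in V" "1 \<in> polys_in V" "Poly_Mapping.single 0 c \<in> polys_in V"
    by (auto simp: polys_in_def)
  assume pq: "p \<in> polys_in V" "q \<in> polys_in V"
  show "p + q \<in> polys_in V"
    using pq keys_add[of p q] by (auto simp: polys_in_def)
  show "p * q \<in> polys_in V"
    unfolding polys_in_def
  proof (intro CollectI ballI)
    fix m assume "m \<in> Poly_Mapping.keys (p * q)"
    then obtain a b where "a \<in> Poly_Mapping.keys p" "b \<in> Poly_Mapping.keys q" "m = a + b"
      using keys_mult[of p q] by blast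
    then show "Poly_Mapping.keys m \<subseteq> V"
      using pq keys_add[of a b] by (fastforce simp: polys_in_def)
  qed
qed

lemma ratfuns_closed:
  "0 \<in> ratfuns r" "rconst c \<in> ratfuns r"
  "f \<in> ratfuns r \<Longrightarrow> g \<in> ratfuns r \<Longrightarrow> f + g \<in> ratfuns r"
  "f \<in> ratfuns r \<Longrightarrow> g \<in> ratfuns r \<Longrightarrow> f * g \<in> ratfuns r"
proof -
  have *: "Fract a b \<in> ratfuns r"
    if "a \<in> polys_in {1..r}" "b \<in> polys_in {1..r}" "b \<noteq> 0" for a b
    using that by (auto simp: ratfuns_def)
  show "0 \<in> ratfuns r" "rconst c \<in> ratfuns r"
    unfolding Zero_fract_def rconst_def by (rule *; simp add: polys_in_closed)+
  assume "f \<in> ratfuns r" "g \<in> ratfuns r"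
  then obtain a b a' b' where "f = Fract a b" "g = Fract a' b'" "b \<noteq> 0" "b' \<noteq> 0"
    "a \<in> polys_in {1..r}" "b \<in> polys_in {1..r}" "a' \<in> polys_in {1..r}" "b' \<in> polys_in {1..r}"
    by (auto simp: ratfuns_def)
  then show "f + g \<in> ratfuns r" "f * g \<in> ratfuns r"
    by (auto intro!: * polys_in_closed)
qed

lemma local_ring_rconst_mult:
  assumes "f \<in> local_ring r q"
  shows "rconst c * f \<in> local_ring r q"
proof -
  obtain F G d where f: "f = poly_subst rconst ycoord F / poly_subst rconst ycoord G"
    "F \<in> polys_in {0..r}" "G \<in> polys_in {0..r}" "homogeneous d F" "homogeneous d G"
    "poly_subst id (\<lambda>i. q $ i) G \<noteq> 0"
    using assms unfolding local_ring_def by blast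
  let ?F = "Poly_Mapping.map ((*) c) F"
  have keys: "Poly_Mapping.keys ?F \<subseteq> Poly_Mapping.keys F"
    by (auto simp: in_keys_iff map.rep_eq when_def)
  have "poly_subst rconst ycoord ?F = (\<Sum>m\<in>Poly_Mapping.keys F. rconst (Poly_Mapping.lookup ?F m) *
      (\<Prod>i\<in>Poly_Mapping.keys m. ycoord i ^ Poly_Mapping.lookup m i))"
    unfolding poly_subst_def
    by (rule sum.mono_neutral_left) (use keys in \<open>auto simp: in_keys_iff rconst_simps\<close>)
  also have "\<dots> = rconst c * poly_subst rconst ycoord F"
    unfolding poly_subst_def sum_distrib_left
    by (rule sum.cong) (auto simp: in_keys_iff map.rep_eq when_def rconst_simps)
  finally have "rconst c * f = poly_subst rconst ycoord ?F / poly_subst rconst ycoord G"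
    by (simp add: f)
  moreover have "?F \<in> polys_in {0..r}" "homogeneous d ?F"
    using f keys by (auto simp: polys_in_def homogeneous_def)
  ultimately show ?thesis
    using f unfolding local_ring_def by blast
qed

lemma regular_forms_at_closed:
  "0 \<in> regular_forms_at r q p"
  "\<eta> \<in> regular_forms_at r q p \<Longrightarrow> \<zeta> \<in> regular_forms_at r q p \<Longrightarrow> \<eta> + \<zeta> \<in> regular_forms_at r q p"
  "\<eta> \<in> regular_forms_at r q p \<Longrightarrow> fscale (rconst c) \<eta> \<in> regular_forms_at r q p"
proof -
  show "0 \<in> regular_forms_at r q p"
    unfolding regular_forms_at_def by (rule CollectI, rule exI[of _ 0]) auto
  let ?w = "\<lambda>fs (s::nat). wedge_list (map dfun (fs s))"
  assume "\<eta> \<in> regular_forms_at r q p"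
  then obtain n g fs where \<eta>: "\<eta> = (\<Sum>s<n. fscale (g s) (?w fs s))"
    "\<forall>s<n. g s \<in> local_ring r q \<and> length (fs s) = p \<and> set (fs s) \<subseteq> local_ring r q"
    unfolding regular_forms_at_def by blast
  have "fscale (rconst c) \<eta> = (\<Sum>s<n. fscale (rconst c * g s) (?w fs s))"
  proof -
    have "fscale (rconst c) (\<Sum>s\<in>S. h s) = (\<Sum>s\<in>S. fscale (rconst c) (h s))"
      for h and S :: "nat set"
      by (induction S rule: infinite_finite_induct)
        (simp_all only: sum.infinite sum.empty sum.insert fscale_simps not_False_eq_True)
    then show ?thesis by (simp add: \<eta> fscale_simps)
  qed
  then show "fscale (rconst c) \<eta> \<in> regular_forms_at r q p"
    unfolding regular_forms_at_def using \<eta>(2) local_ring_rconst_mult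
    by (intro CollectI exI[of _ n] exI[of _ "\<lambda>s. rconst c * g s"] exI[of _ fs]) auto
  assume "\<zeta> \<in> regular_forms_at r q p"
  then obtain n' g' fs' where \<zeta>: "\<zeta> = (\<Sum>s<n'. fscale (g' s) (?w fs' s))"
    "\<forall>s<n'. g' s \<in> local_ring r q \<and> length (fs' s) = p \<and> set (fs' s) \<subseteq> local_ring r q"
    unfolding regular_forms_at_def by blast
  let ?g = "\<lambda>s. if s < n then g s else g' (s - n)"
  let ?fs = "\<lambda>s. if s < n then fs s else fs' (s - n)"
  have "(\<Sum>s<n + n'. fscale (?g s) (?w ?fs s)) =
      (\<Sum>s<n. fscale (?g s) (?w ?fs s)) + (\<Sum>s\<in>{n..<n + n'}. fscale (?g s) (?w ?fs s))"
    by (subst sum.union_disjoint[symmetric]) (auto intro!: sum.cong)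
  also have "(\<Sum>s<n. fscale (?g s) (?w ?fs s)) = \<eta>"
    by (simp add: \<eta>)
  also have "(\<Sum>s\<in>{n..<n + n'}. fscale (?g s) (?w ?fs s)) = \<zeta>"
    unfolding \<zeta>(1)
    by (rule sum.reindex_bij_witness[of _ "\<lambda>s. s + n" "\<lambda>s. s - n"]) auto
  finally show "\<eta> + \<zeta> \<in> regular_forms_at r q p"
    unfolding regular_forms_at_def using \<eta>(2) \<zeta>(2)
    by (intro CollectI exI[of _ "n + n'"] exI[of _ ?g] exI[of _ ?fs]) auto
qed

lemma rational_forms_closed:
  "0 \<in> rational_forms r p"
  "\<eta> \<in> rational_forms r p \<Longrightarrow> \<zeta> \<in> rational_forms r p \<Longrightarrow> \<eta> + \<zeta> \<in> rational_forms r p"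
  "\<eta> \<in> rational_forms r p \<Longrightarrow> fscale (rconst c) \<eta> \<in> rational_forms r p"
proof -
  show "0 \<in> rational_forms r p"
    by (simp add: rational_forms_def ratfuns_closed)
  assume \<eta>: "\<eta> \<in> rational_forms r p"
  then show "fscale (rconst c) \<eta> \<in> rational_forms r p"
    by (simp add: rational_forms_def fscale_def ratfuns_closed)
  assume \<zeta>: "\<zeta> \<in> rational_forms r p"
  have "\<eta> I \<noteq> 0 \<or> \<zeta> I \<noteq> 0" if "\<eta> I + \<zeta> I \<noteq> 0" for I
    using that by auto
  then show "\<eta> + \<zeta> \<in> rational_forms r p"
    using \<eta> \<zeta> unfolding rational_forms_def by (simp add: ratfuns_closed) blast
qed

lemma Omega_closed:
  "0 \<in> Omega r Y p"
  "\<eta> \<in> Omega r Y p \<Longrightarrow> \<zeta> \<in> Omega r Y p \<Longrightarrow> \<eta> + \<zeta> \<in> Omega r Y p"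
  "\<eta> \<in> Omega r Y p \<Longrightarrow> fscale (rconst c) \<eta> \<in> Omega r Y p"
  by (simp_all add: Omega_def rational_forms_closed regular_forms_at_closed)

lemma cocycles_closed:
  "0 \<in> cocycles r Y \<omega> p"
  "\<eta> \<in> cocycles r Y \<omega> p \<Longrightarrow> \<zeta> \<in> cocycles r Y \<omega> p \<Longrightarrow> \<eta> + \<zeta> \<in> cocycles r Y \<omega> p"
  "\<eta> \<in> cocycles r Y \<omega> p \<Longrightarrow> fscale (rconst c) \<eta> \<in> cocycles r Y \<omega> p"
  using nabla_linear(2)[of \<omega> 0 0]
  by (auto simp: cocycles_def Omega_closed nabla_linear fscale_simps rconst_simps)

lemma coboundaries_closed:
  "0 \<in> coboundaries r Y \<omega> p"
  "\<eta> \<in> coboundaries r Y \<omega> p \<Longrightarrow> \<zeta> \<in> coboundaries r Y \<omega> p \<Longrightarrow> \<eta> + \<zeta> \<in> coboundaries r Y \<omega> p"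
  "\<eta> \<in> coboundaries r Y \<omega> p \<Longrightarrow> fscale (rconst c) \<eta> \<in> coboundaries r Y \<omega> p"
proof -
  have z: "nabla \<omega> 0 = 0"
    using nabla_linear(2)[of \<omega> 0 0] by (simp add: fscale_simps rconst_simps)
  show "0 \<in> coboundaries r Y \<omega> p"
    by (auto simp: coboundaries_def Omega_closed image_iff z split: nat.splits
        intro!: bexI[of _ 0])
  assume \<eta>: "\<eta> \<in> coboundaries r Y \<omega> p"
  then show "fscale (rconst c) \<eta> \<in> coboundaries r Y \<omega> p"
    by (auto simp: coboundaries_def Omega_closed image_iff fscale_simps
        nabla_linear(2)[symmetric] split: nat.splits)
  assume "\<zeta> \<in> coboundaries r Y \<omega> p"
  with \<eta> show "\<eta> + \<zeta> \<in> coboundaries r Y \<omega> p"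
    by (auto simp: coboundaries_def Omega_closed image_iff
        nabla_linear(1)[symmetric] split: nat.splits)
qed

lemma cohomology_simps:
  "coh_class r Y \<omega> p 0 = \<zero>\<^bsub>cohomology r Y \<omega> p\<^esub>"
  "coh_class r Y \<omega> p \<eta> \<oplus>\<^bsub>cohomology r Y \<omega> p\<^esub> coh_class r Y \<omega> p \<zeta> = coh_class r Y \<omega> p (\<eta> + \<zeta>)"
  "c \<odot>\<^bsub>cohomology r Y \<omega> p\<^esub> coh_class r Y \<omega> p \<eta> = coh_class r Y \<omega> p (fscale (rconst c) \<eta>)"
proof -
  let ?B = "coboundaries r Y \<omega> p"
  note B = coboundaries_closed[where r = r and Y = Y and \<omega> = \<omega> and p = p]
  show "coh_class r Y \<omega> p 0 = \<zero>\<^bsub>cohomology r Y \<omega> p\<^esub>"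
    by (simp add: coh_class_def cohomology_def)
  show "coh_class r Y \<omega> p \<eta> \<oplus>\<^bsub>cohomology r Y \<omega> p\<^esub> coh_class r Y \<omega> p \<zeta> = coh_class r Y \<omega> p (\<eta> + \<zeta>)"
  proof -
    have "\<exists>a b. \<eta> + \<zeta> + \<beta> = a + b \<and> a \<in> (+) \<eta> ` ?B \<and> b \<in> (+) \<zeta> ` ?B" if "\<beta> \<in> ?B" for \<beta>
      using that B(1)
      by (intro exI[of _ "\<eta> + 0"] exI[of _ "\<zeta> + \<beta>"]) (simp add: add.assoc)
    moreover have "(\<eta> + \<beta>) + (\<zeta> + \<beta>') \<in> (+) (\<eta> + \<zeta>) ` ?B" if "\<beta> \<in> ?B" "\<beta>' \<in> ?B" for \<beta> \<beta>'
      using B(2)[OF that] by (intro image_eqI[of _ _ "\<beta> + \<beta>'"]) (simp_all add: algebra_simps)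
    ultimately show ?thesis
      by (auto simp: coh_class_def cohomology_def)
  qed
  show "c \<odot>\<^bsub>cohomology r Y \<omega> p\<^esub> coh_class r Y \<omega> p \<eta> = coh_class r Y \<omega> p (fscale (rconst c) \<eta>)"
  proof -
    let ?c = "fscale (rconst c)"
    have "\<exists>a b. ?c \<eta> + \<beta> = ?c a + b \<and> a \<in> (+) \<eta> ` ?B \<and> b \<in> ?B" if "\<beta> \<in> ?B" for \<beta>
      using that B(1)
      by (intro exI[of _ "\<eta> + 0"] exI[of _ "\<beta>"]) simp
    moreover have "?c (\<eta> + \<beta>) + \<beta>' \<in> (+) (?c \<eta>) ` ?B" if "\<beta> \<in> ?B" "\<beta>' \<in> ?B" for \<beta> \<beta>'
      using B(2)[OF B(3)[OF that(1)] that(2)]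
      by (intro image_eqI[of _ _ "?c \<beta> + \<beta>'"]) (simp_all add: fscale_simps algebra_simps)
    ultimately show ?thesis
      by (auto simp: coh_class_def cohomology_def)
  qed
qed

lemma vectorspace_cohomology: "vectorspace class_ring (cohomology r Y \<omega> p)"
proof -
  let ?H = "cohomology r Y \<omega> p" and ?cl = "coh_class r Y \<omega> p"
  note Z = cocycles_closed[where r = r and Y = Y and \<omega> = \<omega> and p = p]
  have carrier: "carrier ?H = ?cl ` cocycles r Y \<omega> p"
    by (simp add: cohomology_def)
  note H = cohomology_simps(2-)[where r = r and Y = Y and \<omega> = \<omega> and p = p]
  have zero: "\<zero>\<^bsub>?H\<^esub> = ?cl 0"
    by (simp only: cohomology_simps(1))
  have elim: thesis if "x \<in> carrier ?H" "\<And>\<eta>. \<eta> \<in> cocycles r Y \<omega> p \<Longrightarrow> x = ?cl \<eta> \<Longrightarrow> thesis"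
    for x thesis
    using that unfolding carrier by (elim imageE) simp
  have intro: "?cl \<eta> \<in> carrier ?H" if "\<eta> \<in> cocycles r Y \<omega> p" for \<eta>
    unfolding carrier using that by (rule imageI)
  have "abelian_group ?H"
  proof (rule abelian_groupI)
    show "\<zero>\<^bsub>?H\<^esub> \<in> carrier ?H"
      unfolding zero by (rule intro[OF Z(1)])
  next
    fix x y assume "x \<in> carrier ?H" "y \<in> carrier ?H"
    then show "x \<oplus>\<^bsub>?H\<^esub> y \<in> carrier ?H" "x \<oplus>\<^bsub>?H\<^esub> y = y \<oplus>\<^bsub>?H\<^esub> x"
      by (elim elim; simp only: H intro Z add.commute)+
  next
    fix x y u assume "x \<in> carrier ?H" "y \<in> carrier ?H" "u \<in> carrier ?H"
    then show "x \<oplus>\<^bsub>?H\<^esub> y \<oplus>\<^bsub>?H\<^esub> u = x \<oplus>\<^bsub>?H\<^esub> (y \<oplus>\<^bsub>?H\<^esub> u)"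
      by (elim elim) (simp only: H add.assoc)
  next
    fix x assume "x \<in> carrier ?H"
    then obtain \<eta> where \<eta>: "\<eta> \<in> cocycles r Y \<omega> p" "x = ?cl \<eta>" by (rule elim)
    show "\<zero>\<^bsub>?H\<^esub> \<oplus>\<^bsub>?H\<^esub> x = x"
      by (simp only: \<eta> zero H add_0)
    have "rconst (-1) + 1 = 0"
      using rconst_simps(1)[of "-1" 1] by (simp add: rconst_simps)
    then have "fscale (rconst (-1) + 1) \<eta> = 0"
      by (simp only: fscale_simps)
    then have "fscale (rconst (-1)) \<eta> + \<eta> = 0"
      by (simp only: fscale_simps)
    then have "?cl (fscale (rconst (-1)) \<eta>) \<oplus>\<^bsub>?H\<^esub> x = \<zero>\<^bsub>?H\<^esub>"
      by (simp only: \<eta> zero H)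
    then show "\<exists>y\<in>carrier ?H. y \<oplus>\<^bsub>?H\<^esub> x = \<zero>\<^bsub>?H\<^esub>"
      using intro[OF Z(3)[OF \<eta>(1)]] by (rule bexI)
  qed
  then have "Module.module class_ring ?H"
  proof (rule moduleI[OF class_cring.is_cring])
    fix a :: complex and x assume "x \<in> carrier ?H"
    then show "a \<odot>\<^bsub>?H\<^esub> x \<in> carrier ?H"
      by (elim elim) (simp only: H intro Z)
  next
    fix a b :: complex and x assume "x \<in> carrier ?H"
    then show "(a \<oplus>\<^bsub>class_ring\<^esub> b) \<odot>\<^bsub>?H\<^esub> x = a \<odot>\<^bsub>?H\<^esub> x \<oplus>\<^bsub>?H\<^esub> b \<odot>\<^bsub>?H\<^esub> x"
      by (elim elim) (simp only: ring.simps H rconst_simps fscale_simps)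
  next
    fix a :: complex and x y assume "x \<in> carrier ?H" "y \<in> carrier ?H"
    then show "a \<odot>\<^bsub>?H\<^esub> (x \<oplus>\<^bsub>?H\<^esub> y) = a \<odot>\<^bsub>?H\<^esub> x \<oplus>\<^bsub>?H\<^esub> a \<odot>\<^bsub>?H\<^esub> y"
      by (elim elim) (simp only: H fscale_simps)
  next
    fix a b :: complex and x assume "x \<in> carrier ?H"
    then show "(a \<otimes>\<^bsub>class_ring\<^esub> b) \<odot>\<^bsub>?H\<^esub> x = a \<odot>\<^bsub>?H\<^esub> (b \<odot>\<^bsub>?H\<^esub> x)"
      by (elim elim) (simp only: monoid.simps H rconst_simps fscale_simps)
  next
    fix x assume "x \<in> carrier ?H"
    then show "\<one>\<^bsub>class_ring\<^esub> \<odot>\<^bsub>?H\<^esub> x = x"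
      by (elim elim) (simp only: monoid.simps H rconst_simps fscale_simps)
  qed
  then show ?thesis
    by (intro vectorspace.intro class_field)
qed

section \<open>Matrices in blocks and the Veronese map\<close>

definition block :: "nat list \<Rightarrow> complex mat \<Rightarrow> nat \<Rightarrow> complex mat" where
  "block lam z k = mat (dim_row z) (lam ! k) (\<lambda>(i, j). z $$ (i, sum_list (take k lam) + j))"

definition block_entry :: "nat list \<Rightarrow> complex vec \<Rightarrow> nat \<Rightarrow> nat \<Rightarrow> complex" where
  "block_entry lam \<alpha> k i = \<alpha> $ (sum_list (take k lam) + i)"

definition sub_columns :: "nat list \<Rightarrow> complex mat \<Rightarrow> nat list \<Rightarrow> complex mat" where
  "sub_columns lam z \<mu> = mat_of_cols (dim_row z)
     (concat (map (\<lambda>k. take (\<mu> ! k) (cols (block lam z k))) [0..<length lam]))"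

definition generic_stratum :: "nat \<Rightarrow> nat list \<Rightarrow> complex mat set" where
  "generic_stratum m lam = {z \<in> carrier_mat m (sum_list lam).
     \<forall>\<mu>. length \<mu> = length lam \<and> (\<forall>k<length lam. \<mu> ! k \<le> lam ! k) \<and> sum_list \<mu> = m \<longrightarrow>
       det (sub_columns lam z \<mu>) \<noteq> 0}"

definition veronese_block :: "nat \<Rightarrow> complex mat \<Rightarrow> complex mat" where
  "veronese_block r w = mat (r + 1) (dim_col w) (\<lambda>(i, j).
     \<Sum>js\<in>{js. length js = r \<and> set js \<subseteq> {..<dim_col w} \<and> sum_list js = j}.
       (\<Prod>s<r - i. w $$ (0, js ! s)) * (\<Prod>s\<in>{r - i..<r}. w $$ (1, js ! s)))"

definition veronese :: "nat \<Rightarrow> nat list \<Rightarrow> complex mat \<Rightarrow> complex mat" where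
  "veronese r lam z = mat_of_cols (r + 1)
     (concat (map (\<lambda>k. cols (veronese_block r (block lam z k))) [0..<length lam]))"

section \<open>The arrangement and the twisting form\<close>

text \<open>Points of \<open>\<P>\<^sup>1\<close> are represented by the sets of all their homogeneous coordinate vectors.\<close>

definition p_point :: "nat list \<Rightarrow> complex mat \<Rightarrow> nat \<Rightarrow> complex vec set" where
  "p_point lam z k = {t \<in> carrier_vec 2. t \<noteq> 0\<^sub>v 2 \<and> t \<bullet> col (block lam z k) 0 = 0}"

text \<open>The point \<open>x = t\<^sub>1/t\<^sub>0 = \<infinity>\<close>.\<close>

definition infinity_point :: "complex vec set" where
  "infinity_point = {t \<in> carrier_vec 2. t \<noteq> 0\<^sub>v 2 \<and> t $ 0 = 0}"

definition hyperplane_complement :: "nat \<Rightarrow> nat list \<Rightarrow> complex mat \<Rightarrow> complex vec set" where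
  "hyperplane_complement r lam w = {t \<in> carrier_vec (r + 1). t \<noteq> 0\<^sub>v (r + 1) \<and>
     (\<forall>k<length lam. t \<bullet> col (block lam w k) 0 \<noteq> 0)}"

text \<open>
  For \<open>m \<ge> 1\<close>, \<open>theta m x\<close> is the coefficient of \<open>T\<^sup>m\<close> in
  \<open>log (x\<^sub>0 + x\<^sub>1 T + \<dots>) = log x\<^sub>0 + log (1 + (x\<^sub>1/x\<^sub>0) T + \<dots>)\<close>; the library series
  \<open>fps_ln 1\<close> is \<open>log (1 + T)\<close>. The remaining \<open>\<theta>\<^sub>0 = log x\<^sub>0\<close> is not a rational function,
  but \<open>d\<theta>\<^sub>0 = dx\<^sub>0/x\<^sub>0\<close> is a rational form.
\<close>

definition theta :: "nat \<Rightarrow> (nat \<Rightarrow> ratfun) \<Rightarrow> ratfun" where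
  "theta m x = fps_nth (fps_ln 1 oo Abs_fps (\<lambda>j. if j = 0 then 0 else x j / x 0)) m"

definition dtheta :: "nat \<Rightarrow> (nat \<Rightarrow> ratfun) \<Rightarrow> form" where
  "dtheta m x = (if m = 0 then fscale (1 / x 0) (dfun (x 0)) else dfun (theta m x))"

text \<open>The row vector \<open>(1, y\<^sub>1, \<dots>, y\<^sub>r) w\<^sup>(\<^sup>k\<^sup>)\<close>, extended by \<open>0\<close> beyond the block.\<close>

definition yw :: "nat \<Rightarrow> nat list \<Rightarrow> complex mat \<Rightarrow> nat \<Rightarrow> nat \<Rightarrow> ratfun" where
  "yw r lam w k j =
    (if j < lam ! k then vec (r + 1) ycoord \<bullet> map_vec rconst (col (block lam w k) j) else 0)"

definition omega :: "nat \<Rightarrow> nat list \<Rightarrow> complex mat \<Rightarrow> complex vec \<Rightarrow> form" where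
  "omega r lam w \<alpha> = (\<Sum>k<length lam. \<Sum>i<lam ! k.
     fscale (rconst (block_entry lam \<alpha> k i)) (dtheta i (yw r lam w k)))"

text \<open>The two lists of \<open>1\<close>-forms, each member being preceded by its coefficient.\<close>

definition members_higher ::
    "nat \<Rightarrow> nat list \<Rightarrow> complex mat \<Rightarrow> complex vec \<Rightarrow> (complex \<times> form) list" where
  "members_higher r lam w \<alpha> = concat (map (\<lambda>k. map (\<lambda>i.
     (block_entry lam \<alpha> k i, dtheta i (yw r lam w k))) [1..<lam ! k]) [0..<length lam])"

definition members_a ::
    "nat \<Rightarrow> nat list \<Rightarrow> complex mat \<Rightarrow> complex vec \<Rightarrow> (complex \<times> form) list" where
  "members_a r lam w \<alpha> = members_higher r lam w \<alpha> @ map (\<lambda>k.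
     (block_entry lam \<alpha> k 0, dtheta 0 (yw r lam w k) - dtheta 0 (yw r lam w (length lam - 1))))
     [0..<length lam - 1]"

definition members_b ::
    "nat \<Rightarrow> nat list \<Rightarrow> complex mat \<Rightarrow> complex vec \<Rightarrow> (complex \<times> form) list" where
  "members_b r lam w \<alpha> = members_higher r lam w \<alpha> @ map (\<lambda>k.
     (block_entry lam \<alpha> k 0, dtheta 0 (yw r lam w k))) [0..<length lam - 1]"

end

theory Submission
  imports Defs
    "HOL-Combinatorics.Multiset_Permutations"
    "HOL-Computational_Algebra.Fundamental_Theorem_Algebra"
begin

text \<open>
  Identify \<open>\<P>\<^sup>r\<close> with the symmetric product of \<open>r\<close> copies of \<open>\<P>\<^sup>1\<close>. Then the linear form \<open>\<^bold>y w\<^sub>0\<^sup>(\<^sup>k\<^sup>)\<close> becomes, up to a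
  common factor, a product of linear forms in the single variables, \<open>Y\<close> becomes the \<open>r\<close>-th symmetric
  product of \<open>X\<close>, and every member of the list pulls back to a sum \<open>\<Sum>\<^sub>s \<phi>(u\<^sub>s) du\<^sub>s\<close>, where \<open>\<phi> du\<close> is the
  corresponding form for \<open>r = 1\<close>.

  On \<open>X\<close>, partial fractions and a comparison of pole orders show that the listed forms span the
  twisted cohomology and that the only relation between them is \<open>\<omega> \<equiv> 0\<close>. A regular \<open>r\<close>-form on
  \<open>Y\<close> pulls back to a tensor of regular forms on \<open>X\<close>; antisymmetrization turns it into a combination of
  products of traces, in which each factor may be replaced by a combination of the \<open>\<psi>\<^sub>j\<close> modulo
  coboundaries. Conversely, products of functionals on the regular functions of \<open>X\<close> that are dual to
  the \<open>\<psi>\<^sub>j\<close> and vanish on coboundaries separate the products \<open>\<psi>\<^sub>j\<^sub>1 \<and> \<dots> \<and> \<psi>\<^sub>j\<^sub>r\<close> and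
  annihilate the coboundaries on \<open>Y\<close>.
\<close>

text \<open>The last point \<open>p\<close> is moved to the parameter value infinity, so that the
  others become punctures of an affine line, where partial fractions give an explicit basis and pole
  orders are compared by limits. This also merges the two cases: members with \<theta>_0 are always
  differences with the last block, and in case (b) the subtracted form is zero. Three obstacles
  shape the rest. Regularity on Y is a condition at each point, with a fraction that may change from
  point to point, so a passage from local to global has to precede every tensor expansion. To return
  from the product of lines to Y, the Jacobian of the quotient map has to be nonzero; it is never
  computed: some top form has a nonzero pullback by the independence argument, and then top forms
  are determined by their pullbacks. Finally, functionals on tensors need not be well defined a
  priori; therefore they are defined on all functions of a complex variable and applied to one
  variable after the other.\<close>

abbreviation pconst :: "complex \<Rightarrow> cpoly" where "pconst c \<equiv> Poly_Mapping.single 0 c"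
abbreviation pvar :: "nat \<Rightarrow> cpoly" where "pvar i \<equiv> Poly_Mapping.single (Poly_Mapping.single i (Suc 0)) 1"

text \<open>One predicate covers the embeddings of scalars, evaluations and substitutions, so that
  any two of them can be compared on constants and variables.\<close>

definition is_hom :: "('a::comm_ring_1 \<Rightarrow> 'b::comm_ring_1) \<Rightarrow> bool" where
  "is_hom h \<longleftrightarrow> h 0 = 0 \<and> h 1 = 1 \<and> (\<forall>a b. h (a + b) = h a + h b) \<and> (\<forall>a b. h (a * b) = h a * h b)"

lemma is_homD:
  assumes "is_hom h"
  shows "h 0 = 0" "h 1 = 1" "h (a + b) = h a + h b" "h (a * b) = h a * h b" "h (- a) = - h a"
    "h (a - b) = h a - h b" "h (a ^ n) = h a ^ n" "h (sum g A) = (\<Sum>i\<in>A. h (g i))"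
    "h (prod g A) = (\<Prod>i\<in>A. h (g i))" "h (of_nat n) = of_nat n"
proof -
  show 1: "h 0 = 0" "h 1 = 1" "\<And>a b. h (a + b) = h a + h b" "\<And>a b. h (a * b) = h a * h b"
    using assms by (auto simp: is_hom_def)
  show m: "h (- a) = - h a" for a
    using 1(3)[of a "- a"] 1(1) by (simp add: add_eq_0_iff)
  show "h (a - b) = h a - h b"
    using 1(3)[of a "- b"] m by simp
  show "h (a ^ n) = h a ^ n" by (induction n) (simp_all add: 1)
  show "h (sum g A) = (\<Sum>i\<in>A. h (g i))" by (induction A rule: infinite_finite_induct) (simp_all add: 1)
  show "h (prod g A) = (\<Prod>i\<in>A. h (g i))" by (induction A rule: infinite_finite_induct) (simp_all add: 1)
  show "h (of_nat n) = of_nat n" by (induction n) (simp_all add: 1)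
qed

lemma is_hom_id: "is_hom id" by (simp add: is_hom_def)
lemma is_hom_rconst: "is_hom rconst" by (simp add: is_hom_def rconst_simps)
lemma is_hom_pconst: "is_hom pconst" by (simp add: is_hom_def single_add mult_single)

lemmas rconst_hom = is_homD[OF is_hom_rconst]

lemma rconst_eq_iff: "rconst a = rconst b \<longleftrightarrow> a = b"
  by (auto simp: rconst_def eq_fract dest: arg_cong[where f = "\<lambda>p. Poly_Mapping.lookup p 0"])

lemma rconst_eq_0_iff: "rconst a = 0 \<longleftrightarrow> a = 0"
  using rconst_eq_iff[of a 0] by (simp add: rconst_simps)

lemma rconst_inverse: "rconst (inverse a) = inverse (rconst a)"
proof (cases "a = 0")
  case False
  then have "rconst (inverse a) * rconst a = 1"
    by (simp flip: rconst_simps)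
  then show ?thesis by (metis inverse_unique inverse_inverse_eq)
qed (simp add: rconst_simps)

lemma rconst_divide: "rconst (a / b) = rconst a / rconst b"
  by (simp add: divide_inverse rconst_simps rconst_inverse)

section \<open>Polynomials and rational functions: substitution, derivation, evaluation\<close>

subsection \<open>Substitution\<close>

definition mon :: "(nat \<Rightarrow> 'a) \<Rightarrow> (nat \<Rightarrow>\<^sub>0 nat) \<Rightarrow> 'a::comm_ring_1" where
  "mon x m = (\<Prod>i\<in>Poly_Mapping.keys m. x i ^ Poly_Mapping.lookup m i)"

lemma mon_superset:
  assumes "finite V" "Poly_Mapping.keys m \<subseteq> V"
  shows "mon x m = (\<Prod>i\<in>V. x i ^ Poly_Mapping.lookup m i)"
  unfolding mon_def by (rule prod.mono_neutral_left) (use assms in \<open>auto simp: in_keys_iff\<close>)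

lemma mon_add: "mon x (a + b) = mon x a * mon x b"
proof -
  let ?V = "Poly_Mapping.keys a \<union> Poly_Mapping.keys b"
  have "Poly_Mapping.keys (a + b) \<subseteq> ?V" by (rule keys_add)
  then show ?thesis
    by (subst (1 2 3) mon_superset[where V = ?V])
      (auto simp: lookup_add power_add prod.distrib)
qed

lemma mon_zero [simp]: "mon x 0 = 1" by (simp add: mon_def)

lemma mon_single [simp]: "mon x (Poly_Mapping.single i n) = x i ^ n"
  by (cases "n = 0") (simp_all add: mon_def)

lemma poly_subst_eq: "poly_subst h x p = (\<Sum>m\<in>Poly_Mapping.keys p. h (Poly_Mapping.lookup p m) * mon x m)"
  by (simp add: poly_subst_def mon_def)

context
  fixes h :: "complex \<Rightarrow> 'a::comm_ring_1"
  assumes h: "is_hom h"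
begin

lemma poly_subst_superset:
  assumes "finite S" "Poly_Mapping.keys p \<subseteq> S"
  shows "poly_subst h x p = (\<Sum>m\<in>S. h (Poly_Mapping.lookup p m) * mon x m)"
  unfolding poly_subst_eq
  by (rule sum.mono_neutral_left) (use assms is_homD[OF h] in \<open>auto simp: in_keys_iff\<close>)

lemma poly_subst_add: "poly_subst h x (p + q) = poly_subst h x p + poly_subst h x q"
proof -
  let ?S = "Poly_Mapping.keys p \<union> Poly_Mapping.keys q"
  have "finite ?S" "Poly_Mapping.keys (p + q) \<subseteq> ?S" by (auto simp: keys_add)
  then show ?thesis
    by (subst (1 2 3) poly_subst_superset[where S = ?S])
      (auto simp: lookup_add is_homD[OF h] distrib_right sum.distrib)
qed

lemma poly_subst_zero: "poly_subst h x 0 = 0"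
  by (simp add: poly_subst_def)

lemma poly_subst_single: "poly_subst h x (Poly_Mapping.single m c) = h c * mon x m"
  by (simp add: poly_subst_eq is_homD[OF h])

lemma poly_subst_sum: "poly_subst h x (sum g A) = (\<Sum>a\<in>A. poly_subst h x (g a))"
  by (induction A rule: infinite_finite_induct) (auto simp: poly_subst_add poly_subst_zero)

lemma poly_subst_mult: "poly_subst h x (p * q) = poly_subst h x p * poly_subst h x q"
proof -
  let ?s = "\<lambda>p m. Poly_Mapping.single m (Poly_Mapping.lookup p m) :: cpoly"
  have "poly_subst h x (sum (?s p) (Poly_Mapping.keys p) * sum (?s q) (Poly_Mapping.keys q)) =
      poly_subst h x (sum (?s p) (Poly_Mapping.keys p)) * poly_subst h x (sum (?s q) (Poly_Mapping.keys q))"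
    by (simp add: sum_product poly_subst_sum poly_subst_single mult_single mon_add is_homD[OF h] mult_ac)
  then show ?thesis
    by (simp only: poly_mapping_eq_sum_single[symmetric])
qed

lemma poly_subst_const: "poly_subst h x (pconst c) = h c"
  by (simp add: poly_subst_single)

lemma poly_subst_var: "poly_subst h x (pvar i) = x i"
  by (simp add: poly_subst_single is_homD[OF h])

lemma is_hom_poly_subst: "is_hom (poly_subst h x)"
  using poly_subst_const[of x 1]
  by (simp add: is_hom_def poly_subst_add poly_subst_mult poly_subst_zero is_homD[OF h])

end

lemmas poly_subst_simps = poly_subst_add poly_subst_mult poly_subst_zero poly_subst_const poly_subst_var

lemma cpoly_induct [consumes 1, case_names const var add mult]:
  assumes "p \<in> polys_in V"
    and const: "\<And>c. P (pconst c)" and var: "\<And>i. i \<in> V \<Longrightarrow> P (pvar i)"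
    and add: "\<And>p q. p \<in> polys_in V \<Longrightarrow> q \<in> polys_in V \<Longrightarrow> P p \<Longrightarrow> P q \<Longrightarrow> P (p + q)"
    and mult: "\<And>p q. p \<in> polys_in V \<Longrightarrow> q \<in> polys_in V \<Longrightarrow> P p \<Longrightarrow> P q \<Longrightarrow> P (p * q)"
  shows "P p"
proof -
  \<comment> \<open>Membership in \<open>polys_in V\<close> is carried along with \<open>P\<close>,
    because the cases for sums and products assume it.\<close>
  let ?A = "\<lambda>p. p \<in> polys_in V \<and> P p"
  have var': "?A (pvar i)" if "i \<in> V" for i
    using var that by (auto simp: polys_in_def)
  have one: "?A 1" using const[of 1] by (simp add: polys_in_closed)
  have mult': "?A (p * q)" if "?A p" "?A q" for p q
    using that mult by (simp add: polys_in_closed)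
  have pow: "?A (p ^ n)" if "?A p" for p n
    by (induction n) (use that one mult' in auto)
  have prod: "?A (prod f I)" if "\<And>i. i \<in> I \<Longrightarrow> ?A (f i)" for f and I :: "nat set"
    using that by (induction I rule: infinite_finite_induct) (use one mult' in auto)
  have sum: "?A (sum f I)" if "\<And>i. i \<in> I \<Longrightarrow> ?A (f i)" for f and I :: "(nat \<Rightarrow>\<^sub>0 nat) set"
    using that by (induction I rule: infinite_finite_induct) (use const[of 0] add in \<open>auto simp: polys_in_closed\<close>)
  have power_var: "pvar i ^ n = Poly_Mapping.single (Poly_Mapping.single i n) 1" for i n
    by (induction n) (auto simp: mult_single simp flip: single_add)
  have prod_single: "(\<Prod>i\<in>I. Poly_Mapping.single (f i) 1 :: cpoly) = Poly_Mapping.single (sum f I) 1"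
    for f and I :: "nat set"
    by (induction I rule: infinite_finite_induct) (auto simp: mult_single)
  have "?A (Poly_Mapping.single m (Poly_Mapping.lookup p m))" if "m \<in> Poly_Mapping.keys p" for m
  proof -
    have "Poly_Mapping.single m (Poly_Mapping.lookup p m) =
        pconst (Poly_Mapping.lookup p m) * (\<Prod>i\<in>Poly_Mapping.keys m. pvar i ^ Poly_Mapping.lookup m i)"
      unfolding power_var prod_single by (simp add: mult_single flip: poly_mapping_eq_sum_single)
    moreover have "?A (\<Prod>i\<in>Poly_Mapping.keys m. pvar i ^ Poly_Mapping.lookup m i)"
      using assms(1) that by (intro prod pow var') (auto simp: polys_in_def)
    ultimately show ?thesis
      using const mult' by (simp add: polys_in_closed)
  qed
  then have "?A (\<Sum>m\<in>Poly_Mapping.keys p. Poly_Mapping.single m (Poly_Mapping.lookup p m))"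
    by (rule sum)
  then show ?thesis by (simp flip: poly_mapping_eq_sum_single)
qed

lemma pvar_in [intro]: "i \<in> V \<Longrightarrow> pvar i \<in> polys_in V"
  by (auto simp: polys_in_def)

lemma polys_in_UNIV [simp]: "p \<in> polys_in UNIV" by (simp add: polys_in_def)

lemma polys_in_minus: "p \<in> polys_in V \<Longrightarrow> - p \<in> polys_in V"
  by (auto simp: polys_in_def)

lemma polys_in_sum: "(\<And>a. a \<in> A \<Longrightarrow> f a \<in> polys_in V) \<Longrightarrow> sum f A \<in> polys_in V"
  by (induction A rule: infinite_finite_induct) (auto simp: polys_in_closed)

lemma polys_in_mono: "p \<in> polys_in V \<Longrightarrow> V \<subseteq> W \<Longrightarrow> p \<in> polys_in W"
  by (auto simp: polys_in_def)

lemma poly_subst_in: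
  assumes "p \<in> polys_in V" "\<And>i. i \<in> V \<Longrightarrow> x i \<in> polys_in W"
  shows "poly_subst pconst x p \<in> polys_in W"
  using assms(1)
  by (induction p rule: cpoly_induct) (use assms(2) in \<open>auto simp: poly_subst_simps[OF is_hom_pconst] polys_in_closed\<close>)

lemma poly_pd_in: "p \<in> polys_in V \<Longrightarrow> poly_pd i p \<in> polys_in V"
proof (induction p rule: cpoly_induct)
  case (var j)
  then show ?case by (cases "i = j") (auto simp: poly_pd_single lookup_single polys_in_closed when_def)
qed (auto simp: poly_pd_add poly_pd_mult polys_in_closed poly_pd_single)

lemma poly_subst_cong:
  assumes "p \<in> polys_in V" "is_hom h" "\<And>i. i \<in> V \<Longrightarrow> x i = y i"
  shows "poly_subst h x p = poly_subst h y p"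
  using assms(1) by (induction p rule: cpoly_induct) (use assms in \<open>auto simp: poly_subst_simps\<close>)

lemma hom_poly_subst:
  assumes h: "is_hom h" and g: "is_hom g" and h': "is_hom h'"
    and c: "\<And>c. g (h c) = h' c" and x: "\<And>i. i \<in> V \<Longrightarrow> g (x i) = y i" and p: "p \<in> polys_in V"
  shows "g (poly_subst h x p) = poly_subst h' y p"
  using p
  by (induction p rule: cpoly_induct)
    (simp_all add: poly_subst_simps[OF h] poly_subst_simps[OF h'] is_homD[OF g] c x)

definition pe :: "(nat \<Rightarrow> complex) \<Rightarrow> cpoly \<Rightarrow> complex" where
  "pe c = poly_subst id c"

lemma is_hom_pe: "is_hom (pe c)"
  unfolding pe_def by (rule is_hom_poly_subst[OF is_hom_id])

lemmas pe_hom = is_homD[OF is_hom_pe]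

lemma pe_const [simp]: "pe c (pconst a) = a" and pe_var [simp]: "pe c (pvar i) = c i"
  by (simp_all add: pe_def poly_subst_const[OF is_hom_id] poly_subst_var[OF is_hom_id])

lemma pe_single: "pe c (Poly_Mapping.single m a) = a * mon c m"
  by (simp add: pe_def poly_subst_single[OF is_hom_id])

lemmas pe_simps = pe_hom(1-4)

lemma pe_cong: "p \<in> polys_in V \<Longrightarrow> (\<And>i. i \<in> V \<Longrightarrow> c i = c' i) \<Longrightarrow> pe c p = pe c' p"
  unfolding pe_def by (rule poly_subst_cong[OF _ is_hom_id])

lemma pe_subst: "pe c (poly_subst pconst x p) = pe (\<lambda>i. pe c (x i)) p"
  unfolding pe_def[of "\<lambda>i. pe c (x i)"]
  by (rule hom_poly_subst[OF is_hom_pconst is_hom_pe is_hom_id, of _ UNIV]) simp_all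

lemma Fract_eq_divide: "b \<noteq> 0 \<Longrightarrow> Fract a b = Fract a 1 / Fract b (1::cpoly)"
  by (simp add: eq_fract)

lemma Fract_1_eq_0_iff: "Fract a 1 = 0 \<longleftrightarrow> a = (0::cpoly)"
  by (simp add: Zero_fract_def eq_fract)

text \<open>The degree bound \<open>d\<close> does not depend on the remaining coordinates
  \<open>c\<close>. \<open>local_to_global\<close> needs this uniformity: there the number of
  interpolation nodes is fixed before the remaining coordinates are known.\<close>

lemma univariate_slice:
  assumes "x \<in> V" "p \<in> polys_in V"
  shows "\<exists>q. (\<forall>c v. pe (c(x := v)) p = poly (q c) v) \<and> (\<exists>d. \<forall>c. degree (q c) \<le> d)"
  using assms(2)
proof (induction p rule: cpoly_induct)
  case (const c)
  show ?case by (rule exI[of _ "\<lambda>_. [:c:]"]) (auto simp: pe_simps)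
next
  case (var i)
  show ?case
  proof (cases "i = x")
    case True
    then show ?thesis by (intro exI[of _ "\<lambda>_. [:0, 1:]"]) (auto simp: pe_simps)
  next
    case False
    then show ?thesis by (intro exI[of _ "\<lambda>c. [:c i:]"]) (auto simp: pe_simps)
  qed
next
  case (add p q)
  then obtain a b d e where *: "\<And>c v. pe (c(x := v)) p = poly (a c) v" "\<And>c v. pe (c(x := v)) q = poly (b c) v"
    "\<And>c. degree (a c) \<le> d" "\<And>c. degree (b c) \<le> e" by blast
  have "degree (a c + b c) \<le> max d e" for c
    by (rule degree_add_le) (use *(3,4)[of c] in linarith)+
  moreover have "pe (c(x := v)) (p + q) = poly (a c + b c) v" for c v
    by (simp only: pe_simps * poly_add)
  ultimately show ?case by (intro exI[of _ "\<lambda>c. a c + b c"]) blast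
next
  case (mult p q)
  then obtain a b d e where *: "\<And>c v. pe (c(x := v)) p = poly (a c) v" "\<And>c v. pe (c(x := v)) q = poly (b c) v"
    "\<And>c. degree (a c) \<le> d" "\<And>c. degree (b c) \<le> e" by blast
  have "degree (a c * b c) \<le> d + e" for c
    using degree_mult_le[of "a c" "b c"] *(3,4)[of c] by linarith
  moreover have "pe (c(x := v)) (p * q) = poly (a c * b c) v" for c v
    by (simp only: pe_simps * poly_mult)
  ultimately show ?case by (intro exI[of _ "\<lambda>c. a c * b c"]) blast
qed

lemma poly_has_nonroot:
  fixes q :: "complex poly"
  assumes "q \<noteq> 0" "infinite S"
  shows "\<exists>v\<in>S. poly q v \<noteq> 0"
  using poly_roots_finite[OF assms(1)] assms(2)
  by (metis (mono_tags, lifting) finite_subset mem_Collect_eq subsetI)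

lemma exists_nonroot_aux:
  assumes "finite V" "p \<in> polys_in V" "p \<noteq> 0" "infinite S" "\<forall>i::nat. c0 i \<in> S"
  shows "\<exists>c. (\<forall>i. c i \<in> S) \<and> pe c p \<noteq> 0"
  using assms
proof (induction V arbitrary: p rule: finite_induct)
  case empty
  then have keys: "Poly_Mapping.keys p \<subseteq> {0}" by (auto simp: polys_in_def)
  have "p = pconst (Poly_Mapping.lookup p 0)"
    by (rule poly_mapping_eqI) (use keys in \<open>auto simp: lookup_single when_def in_keys_iff\<close>)
  then have "pe c0 p = Poly_Mapping.lookup p 0" "Poly_Mapping.lookup p 0 \<noteq> 0"
    using pe_const[of c0 "Poly_Mapping.lookup p 0"] empty(2) by auto
  with empty(4) show ?case by (intro exI[of _ c0]) simp
next
  case (insert x V)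
  \<comment> \<open>\<open>sl n\<close> is the coefficient of the \<open>n\<close>-th power of the
    variable \<open>x\<close>, a polynomial in the variables of \<open>V\<close>.\<close>
  define sl where "sl n = (\<Sum>m\<in>{m\<in>Poly_Mapping.keys p. Poly_Mapping.lookup m x = n}.
     Poly_Mapping.single (m - Poly_Mapping.single x n) (Poly_Mapping.lookup p m))" for n
  define N where "N = (\<Sum>m\<in>Poly_Mapping.keys p. Poly_Mapping.lookup m x)"
  have le_N: "Poly_Mapping.lookup m x \<le> N" if "m \<in> Poly_Mapping.keys p" for m
    unfolding N_def using that by (intro member_le_sum) auto
  have split: "m - Poly_Mapping.single x n + Poly_Mapping.single x n = m" if "Poly_Mapping.lookup m x = n" for m :: "nat \<Rightarrow>\<^sub>0 nat" and n
    using that by (intro poly_mapping_eqI) (auto simp: lookup_add lookup_minus lookup_single when_def)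
  have dec: "p = (\<Sum>n\<le>N. sl n * Poly_Mapping.single (Poly_Mapping.single x n) 1)"
  proof -
    have "(\<Sum>n\<le>N. sl n * Poly_Mapping.single (Poly_Mapping.single x n) 1) =
      (\<Sum>n\<le>N. \<Sum>m\<in>{m\<in>Poly_Mapping.keys p. Poly_Mapping.lookup m x = n}. Poly_Mapping.single m (Poly_Mapping.lookup p m))"
      unfolding sl_def sum_distrib_right by (intro sum.cong refl) (auto simp: mult_single split)
    also have "\<dots> = (\<Sum>m\<in>Poly_Mapping.keys p. Poly_Mapping.single m (Poly_Mapping.lookup p m))"
      by (rule sum.group) (use le_N in auto)
    finally show ?thesis by (simp flip: poly_mapping_eq_sum_single)
  qed
  have sl_in: "sl n \<in> polys_in V" for n
  proof -
    have "Poly_Mapping.single (m - Poly_Mapping.single x n) (Poly_Mapping.lookup p m) \<in> polys_in V"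
      if m: "m \<in> Poly_Mapping.keys p" "Poly_Mapping.lookup m x = n" for m
    proof -
      have "Poly_Mapping.keys m \<subseteq> insert x V" using insert.prems(1) m by (auto simp: polys_in_def)
      moreover have "x \<notin> Poly_Mapping.keys (m - Poly_Mapping.single x n)"
        using m by (simp add: in_keys_iff lookup_minus)
      moreover have "Poly_Mapping.keys (m - Poly_Mapping.single x n) \<subseteq> Poly_Mapping.keys m"
        by (auto simp: in_keys_iff lookup_minus)
      ultimately have "Poly_Mapping.keys (m - Poly_Mapping.single x n) \<subseteq> V" by blast
      then show ?thesis by (auto simp: polys_in_def)
    qed
    then show ?thesis unfolding sl_def by (intro polys_in_sum) simp
  qed
  have "\<exists>n\<le>N. sl n \<noteq> 0"
    using dec insert.prems(2) by (metis (no_types, lifting) atMost_iff mult_zero_left sum.neutral)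
  then obtain n where n: "n \<le> N" "sl n \<noteq> 0" by blast
  obtain c where c: "\<forall>i. c i \<in> S" "pe c (sl n) \<noteq> 0"
    using insert.IH[OF sl_in n(2) insert.prems(3,4)] by blast
  define q where "q = (\<Sum>n\<le>N. monom (pe c (sl n)) n)"
  have "coeff q n = pe c (sl n)"
    using n(1) by (simp add: q_def coeff_sum)
  then have "q \<noteq> 0" using c(2) by auto
  then obtain v where v: "v \<in> S" "poly q v \<noteq> 0" using poly_has_nonroot insert.prems(3) by blast
  have sl_v: "pe (c(x := v)) (sl k) = pe c (sl k)" for k
    by (rule pe_cong[OF sl_in]) (use insert.hyps in auto)
  have "pe (c(x := v)) p = poly q v"
    by (subst dec) (simp add: q_def pe_hom sl_v poly_sum poly_monom pe_single)
  then have "pe (c(x := v)) p \<noteq> 0" using v(2) by (simp only:) simp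
  moreover have "\<forall>i. (c(x := v)) i \<in> S" using v(1) c(1) by simp
  ultimately show ?case by blast
qed

text \<open>Zariski density of the points with all coordinates in an infinite set. It is applied
  with the whole field or with the complement of the punctures, often to a product of polynomials
  that have to be nonzero at the same point.\<close>

lemma exists_nonroot:
  assumes "p \<noteq> 0" "infinite S"
  obtains c where "\<And>i. c i \<in> S" "pe c p \<noteq> 0"
proof -
  obtain s where "s \<in> S" using infinite_imp_nonempty[OF assms(2)] by blast
  moreover have "finite (\<Union>m\<in>Poly_Mapping.keys p. Poly_Mapping.keys m)" by simp
  moreover have "p \<in> polys_in (\<Union>m\<in>Poly_Mapping.keys p. Poly_Mapping.keys m)" by (auto simp: polys_in_def)
  ultimately show ?thesis
    using exists_nonroot_aux[of "\<Union>m\<in>Poly_Mapping.keys p. Poly_Mapping.keys m" p S "\<lambda>_. s"] assms that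
    by (metis (no_types))
qed

lemma is_hom_field:
  fixes h :: "'a::field \<Rightarrow> 'b::field"
  assumes "is_hom h"
  shows "h (inverse a) = inverse (h a)" "h (a / b) = h a / h b" "h a = 0 \<longleftrightarrow> a = 0" "h a = h b \<longleftrightarrow> a = b"
proof -
  have nz: "h a \<noteq> 0" if "a \<noteq> 0" for a
    using is_homD(4)[OF assms, of a "inverse a"] that is_homD(2)[OF assms] by auto
  show 0: "h a = 0 \<longleftrightarrow> a = 0" for a using nz is_homD(1)[OF assms] by auto
  show 1: "h (inverse a) = inverse (h a)" for a
  proof (cases "a = 0")
    case False
    then have "h a * h (inverse a) = 1"
      using is_homD(2,4)[OF assms] by (metis right_inverse)
    then show ?thesis by (metis inverse_unique)
  qed (simp add: is_homD[OF assms])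
  show "h (a / b) = h a / h b" by (simp add: divide_inverse is_homD[OF assms] 1)
  show "h a = h b \<longleftrightarrow> a = b"
    using 0[of "a - b"] by (simp add: is_homD[OF assms])
qed

subsection \<open>Derivations\<close>

lemma rat_pd_zero [simp]: "rat_pd i 0 = 0" and rat_pd_one [simp]: "rat_pd i 1 = 0"
  using rat_pd_rconst[of i 0] rat_pd_rconst[of i 1] by (simp_all only: rconst_simps)

lemma rat_pd_minus: "rat_pd i (- f) = - rat_pd i f"
  using rat_pd_add[of i f "- f"] by (simp add: add_eq_0_iff)

lemma rat_pd_diff: "rat_pd i (f - g) = rat_pd i f - rat_pd i g"
  using rat_pd_add[of i f "- g"] by (simp add: rat_pd_minus)

lemma rat_pd_sum: "rat_pd i (sum f A) = (\<Sum>a\<in>A. rat_pd i (f a))"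
  by (induction A rule: infinite_finite_induct) (simp_all add: rat_pd_add)

lemma rat_pd_power: "rat_pd i (f ^ n) = of_nat n * f ^ (n - 1) * rat_pd i f"
proof (induction n)
  case (Suc n)
  then show ?case by (cases n) (simp_all add: rat_pd_mult algebra_simps)
qed simp

lemma rat_pd_inverse: "rat_pd i (inverse f) = - rat_pd i f * inverse f * inverse f"
proof (cases "f = 0")
  case False
  then have "0 = rat_pd i f * inverse f + f * rat_pd i (inverse f)"
    using rat_pd_mult[of i f "inverse f"] by simp
  then have "f * rat_pd i (inverse f) = - (rat_pd i f * inverse f)"
    by (simp add: eq_neg_iff_add_eq_0 add.commute)
  then have "inverse f * (f * rat_pd i (inverse f)) = - (rat_pd i f * inverse f) * inverse f" by simp
  then show ?thesis using False by (simp flip: mult.assoc)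
qed simp

lemma rat_pd_divide: "g \<noteq> 0 \<Longrightarrow> rat_pd i (f / g) = (rat_pd i f * g - f * rat_pd i g) / (g * g)"
  by (simp add: divide_inverse rat_pd_mult rat_pd_inverse algebra_simps)

subsection \<open>Fields of rational functions\<close>

definition fracs :: "nat set \<Rightarrow> ratfun set" where
  "fracs V = {Fract a b | a b. a \<in> polys_in V \<and> b \<in> polys_in V \<and> b \<noteq> 0}"

lemma ratfuns_eq: "ratfuns r = fracs {1..r}"
  by (simp add: ratfuns_def fracs_def)

lemma fracs_induct [consumes 1, case_names const var add mult inverse]:
  assumes "f \<in> fracs V"
    and const: "\<And>c. P (rconst c)" and var: "\<And>i. i \<in> V \<Longrightarrow> P (rvar i)"
    and add: "\<And>f g. P f \<Longrightarrow> P g \<Longrightarrow> P (f + g)"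
    and mult: "\<And>f g. P f \<Longrightarrow> P g \<Longrightarrow> P (f * g)"
    and inverse: "\<And>f. f \<noteq> 0 \<Longrightarrow> P f \<Longrightarrow> P (inverse f)"
  shows "P f"
proof -
  have poly: "P (Fract p 1)" if "p \<in> polys_in V" for p
    using that
  proof (induction p rule: cpoly_induct)
    case (const c)
    show ?case using assms(2)[of c] by (simp add: rconst_def)
  next
    case (var i)
    then show ?case using assms(3)[of i] by (simp add: rvar_def)
  next
    case (add p q)
    then show ?case using assms(4)[of "Fract p 1" "Fract q 1"] by simp
  next
    case (mult p q)
    then show ?case using assms(5)[of "Fract p 1" "Fract q 1"] by simp
  qed
  obtain a b where ab: "f = Fract a b" "a \<in> polys_in V" "b \<in> polys_in V" "b \<noteq> 0"
    using assms(1) by (auto simp: fracs_def)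
  have "P (Fract a 1 * inverse (Fract b 1))"
    by (intro mult inverse poly ab) (simp add: Fract_1_eq_0_iff ab)
  then show ?thesis unfolding ab(1) Fract_eq_divide[OF ab(4), of a] by (simp only: divide_inverse)
qed

lemma fracs_UNIV [simp]: "f \<in> fracs UNIV"
  by (cases f) (auto simp: fracs_def)

lemma fracs_closed:
  "rconst c \<in> fracs V" "0 \<in> fracs V" "1 \<in> fracs V" "i \<in> V \<Longrightarrow> rvar i \<in> fracs V"
  "f \<in> fracs V \<Longrightarrow> g \<in> fracs V \<Longrightarrow> f + g \<in> fracs V"
  "f \<in> fracs V \<Longrightarrow> g \<in> fracs V \<Longrightarrow> f * g \<in> fracs V"
  "f \<in> fracs V \<Longrightarrow> - f \<in> fracs V"
  "f \<in> fracs V \<Longrightarrow> g \<in> fracs V \<Longrightarrow> f - g \<in> fracs V"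
  "f \<in> fracs V \<Longrightarrow> inverse f \<in> fracs V"
  "f \<in> fracs V \<Longrightarrow> g \<in> fracs V \<Longrightarrow> f / g \<in> fracs V"
proof -
  have *: "Fract a b \<in> fracs V"
    if "a \<in> polys_in V" "b \<in> polys_in V" "b \<noteq> 0" for a b
    using that by (auto simp: fracs_def)
  show c: "rconst c \<in> fracs V" for c
    unfolding rconst_def by (rule *) (simp_all add: polys_in_closed)
  show 0: "0 \<in> fracs V" and "1 \<in> fracs V" using c[of 0] c[of 1] by (simp_all only: rconst_simps)
  show "i \<in> V \<Longrightarrow> rvar i \<in> fracs V"
    unfolding rvar_def by (rule *) (auto simp: polys_in_closed)
  have e: thesis if "f \<in> fracs V" "\<And>a b. f = Fract a b \<Longrightarrow> a \<in> polys_in V \<Longrightarrow> b \<in> polys_in V \<Longrightarrow> b \<noteq> 0 \<Longrightarrow> thesis"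
    for f thesis using that unfolding fracs_def by blast
  show add: "f + g \<in> fracs V" and mult: "f * g \<in> fracs V" if "f \<in> fracs V" "g \<in> fracs V" for f g
    using that by (auto intro!: * polys_in_closed elim!: e[where f = f] e[where f = g])
  show minus: "- f \<in> fracs V" if "f \<in> fracs V" for f
    using that by (auto intro!: * polys_in_minus elim!: e)
  show inv: "inverse f \<in> fracs V" if f: "f \<in> fracs V" for f
  proof (cases "f = 0")
    case False
    obtain a b where "f = Fract a b" "a \<in> polys_in V" "b \<in> polys_in V" "b \<noteq> 0"
      using f unfolding fracs_def by blast
    then show ?thesis using False by (auto intro!: * simp: Zero_fract_def eq_fract)
  qed (simp add: 0)
  show "f \<in> fracs V \<Longrightarrow> g \<in> fracs V \<Longrightarrow> f - g \<in> fracs V"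
    using add[of f "- g"] minus[of g] by simp
  show "f \<in> fracs V \<Longrightarrow> g \<in> fracs V \<Longrightarrow> f / g \<in> fracs V"
    using mult[of f "inverse g"] inv[of g] by (simp add: divide_inverse)
qed

lemma fracs_sum: "(\<And>a. a \<in> A \<Longrightarrow> f a \<in> fracs V) \<Longrightarrow> sum f A \<in> fracs V"
  by (induction A rule: infinite_finite_induct) (auto simp: fracs_closed)

lemma fracs_prod: "(\<And>a. a \<in> A \<Longrightarrow> f a \<in> fracs V) \<Longrightarrow> prod f A \<in> fracs V"
  by (induction A rule: infinite_finite_induct) (auto simp: fracs_closed)

lemma fracs_rat_pd: "f \<in> fracs V \<Longrightarrow> rat_pd i f \<in> fracs V"
proof -
  assume "f \<in> fracs V"
  then have "f \<in> fracs V \<and> rat_pd i f \<in> fracs V"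
    by (induction f rule: fracs_induct)
      (auto simp: fracs_closed rat_pd_add rat_pd_mult rat_pd_rvar rat_pd_inverse)
  then show ?thesis by blast
qed

lemma rat_pd_notin: "f \<in> fracs V \<Longrightarrow> i \<notin> V \<Longrightarrow> rat_pd i f = 0"
  by (induction f rule: fracs_induct) (auto simp: rat_pd_add rat_pd_mult rat_pd_rvar rat_pd_inverse)

lemma rat_pd_commute: "rat_pd i (rat_pd j f) = rat_pd j (rat_pd i f)"
proof -
  have "f \<in> fracs UNIV" by simp
  then show ?thesis
  proof (induction f rule: fracs_induct)
    case (inverse f)
    then show ?case
      by (simp add: rat_pd_inverse rat_pd_mult rat_pd_minus algebra_simps)
  qed (simp_all add: rat_pd_add rat_pd_mult rat_pd_rvar)
qed

subsection \<open>Substitution into rational functions\<close>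

definition rsub :: "(nat \<Rightarrow> ratfun) \<Rightarrow> ratfun \<Rightarrow> ratfun" where
  "rsub x f = (THE g. \<exists>a b. b \<noteq> 0 \<and> f = Fract a b \<and> g = poly_subst rconst x a / poly_subst rconst x b)"

text \<open>The assumption is algebraic independence of the functions \<open>x i\<close>. It keeps
  denominators nonzero, so substitution extends to fractions and becomes a homomorphism of
  fields.\<close>

locale inj_subst =
  fixes x :: "nat \<Rightarrow> ratfun"
  assumes inj: "p \<noteq> 0 \<Longrightarrow> poly_subst rconst x p \<noteq> 0"
begin

lemmas ps_simps = poly_subst_simps[OF is_hom_rconst]
lemma rsub_Fract:
  assumes "b \<noteq> 0"
  shows "rsub x (Fract a b) = poly_subst rconst x a / poly_subst rconst x b"
  unfolding rsub_def
proof (rule the_equality)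
  show "\<exists>a' b'. b' \<noteq> 0 \<and> Fract a b = Fract a' b' \<and>
      poly_subst rconst x a / poly_subst rconst x b = poly_subst rconst x a' / poly_subst rconst x b'"
    using assms by blast
next
  fix g assume "\<exists>a' b'. b' \<noteq> 0 \<and> Fract a b = Fract a' b' \<and> g = poly_subst rconst x a' / poly_subst rconst x b'"
  then obtain a' b' where *: "b' \<noteq> 0" "Fract a b = Fract a' b'" "g = poly_subst rconst x a' / poly_subst rconst x b'"
    by blast
  then have "a * b' = a' * b" using assms by (simp add: eq_fract)
  then have "poly_subst rconst x a * poly_subst rconst x b' = poly_subst rconst x a' * poly_subst rconst x b"
    by (simp flip: ps_simps)
  then show "g = poly_subst rconst x a / poly_subst rconst x b"
    using * assms inj by (simp add: frac_eq_eq)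
qed

lemma is_hom_rsub: "is_hom (rsub x)"
proof -
  have ps1: "poly_subst rconst x 1 = 1"
    using ps_simps(4)[of x 1] by (simp add: rconst_simps)
  have "rsub x 0 = 0" "rsub x 1 = 1"
    by (simp_all add: Zero_fract_def One_fract_def rsub_Fract ps_simps ps1)
  moreover have "rsub x (f + g) = rsub x f + rsub x g" "rsub x (f * g) = rsub x f * rsub x g" for f g
    by (cases f; cases g; simp add: rsub_Fract inj ps_simps add_frac_eq)+
  ultimately show ?thesis by (simp add: is_hom_def)
qed

lemmas rsub_hom = is_homD[OF is_hom_rsub] is_hom_field[OF is_hom_rsub]

lemma rsub_poly: "rsub x (Fract p 1) = poly_subst rconst x p"
  using ps_simps(4)[of x 1] by (simp add: rsub_Fract rconst_simps)

lemma rsub_rconst [simp]: "rsub x (rconst c) = rconst c"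
  using rsub_poly[of "pconst c"] by (simp only: ps_simps) (simp add: rconst_def)

lemma rsub_rvar [simp]: "rsub x (rvar i) = x i"
  by (simp add: rvar_def rsub_poly ps_simps)

lemma rat_pd_rsub:
  assumes "f \<in> fracs V" "finite V"
  shows "rat_pd j (rsub x f) = (\<Sum>i\<in>V. rsub x (rat_pd i f) * rat_pd j (x i))"
  using assms(1)
proof (induction f rule: fracs_induct)
  case (var i)
  have "(\<Sum>k\<in>V. rsub x (rat_pd k (rvar i)) * rat_pd j (x k)) = (\<Sum>k\<in>V. if k = i then rat_pd j (x i) else 0)"
    by (intro sum.cong) (auto simp: rat_pd_rvar rsub_hom)
  then show ?case using assms(2) var by simp
qed (simp_all add: rsub_hom rat_pd_add rat_pd_mult rat_pd_inverse sum.distrib sum_distrib_left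
      sum_distrib_right sum_negf algebra_simps)

end

lemma rsub_comp:
  assumes "inj_subst x" "inj_subst y" "inj_subst z" "\<And>i. i \<in> V \<Longrightarrow> rsub x (y i) = z i" "f \<in> fracs V"
  shows "rsub x (rsub y f) = rsub z f"
  using assms(5)
  by (induction f rule: fracs_induct)
    (use assms(4) in \<open>auto simp: inj_subst.rsub_hom[OF assms(1)] inj_subst.rsub_hom[OF assms(2)] inj_subst.rsub_hom[OF assms(3)]
      inj_subst.rsub_rconst[OF assms(1)] inj_subst.rsub_rconst[OF assms(2)] inj_subst.rsub_rconst[OF assms(3)]
      inj_subst.rsub_rvar[OF assms(2)] inj_subst.rsub_rvar[OF assms(3)]\<close>)

subsection \<open>Regularity and evaluation at a point\<close>

text \<open>The local ring of affine space at \<open>c\<close>, in the variables \<open>V\<close>.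
  The representing fraction may depend on \<open>c\<close>; a description valid at all points at
  once is the content of \<open>local_to_global\<close>.\<close>

definition reg :: "nat set \<Rightarrow> (nat \<Rightarrow> complex) \<Rightarrow> ratfun \<Rightarrow> bool" where
  "reg V c f \<longleftrightarrow> (\<exists>a b. a \<in> polys_in V \<and> b \<in> polys_in V \<and> f = Fract a b \<and> pe c b \<noteq> 0)"

definition ev :: "(nat \<Rightarrow> complex) \<Rightarrow> ratfun \<Rightarrow> complex" where
  "ev c f = (THE v. \<exists>a b. pe c b \<noteq> 0 \<and> f = Fract a b \<and> v = pe c a / pe c b)"

lemma pe_0 [simp]: "pe c 0 = 0" and pe_1 [simp]: "pe c 1 = 1"
  by (simp_all add: pe_hom)

lemma ev_Fract:
  assumes "pe c b \<noteq> 0"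
  shows "ev c (Fract a b) = pe c a / pe c b"
  unfolding ev_def
proof (rule the_equality)
  fix v assume "\<exists>a' b'. pe c b' \<noteq> 0 \<and> Fract a b = Fract a' b' \<and> v = pe c a' / pe c b'"
  then obtain a' b' where *: "pe c b' \<noteq> 0" "Fract a b = Fract a' b'" "v = pe c a' / pe c b'"
    by blast
  then have "a * b' = a' * b" using assms by (metis eq_fract(1) pe_0)
  then have "pe c a * pe c b' = pe c a' * pe c b"
    by (simp flip: pe_simps)
  then show "v = pe c a / pe c b"
    using * assms by (simp add: frac_eq_eq)
qed (use assms in blast)

lemma regI: "a \<in> polys_in V \<Longrightarrow> b \<in> polys_in V \<Longrightarrow> pe c b \<noteq> 0 \<Longrightarrow> reg V c (Fract a b)"
  unfolding reg_def by blast

lemma regE: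
  assumes "reg V c f"
  obtains a b where "a \<in> polys_in V" "b \<in> polys_in V" "f = Fract a b" "pe c b \<noteq> 0" "b \<noteq> 0"
    "ev c f = pe c a / pe c b"
  using assms unfolding reg_def by (metis ev_Fract pe_0)

lemma reg_poly: "p \<in> polys_in V \<Longrightarrow> reg V c (Fract p 1)" and ev_poly: "ev c (Fract p 1) = pe c p"
  by (auto intro!: regI simp: polys_in_closed ev_Fract)

lemma reg_const: "reg V c (rconst a)" and ev_const [simp]: "ev c (rconst a) = a"
  by (simp_all add: rconst_def reg_poly ev_poly polys_in_closed)

lemma reg_0: "reg V c 0" and reg_1: "reg V c 1" and ev_0 [simp]: "ev c 0 = 0" and ev_1 [simp]: "ev c 1 = 1"
  using reg_const[of V c 0] reg_const[of V c 1] ev_const[of c 0] ev_const[of c 1] by (simp_all only: rconst_simps)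

lemma reg_var: "i \<in> V \<Longrightarrow> reg V c (rvar i)" and ev_var [simp]: "ev c (rvar i) = c i"
  by (simp_all add: rvar_def reg_poly ev_poly pvar_in)

lemma
  assumes "reg V c f" "reg V c g"
  shows reg_add: "reg V c (f + g)" and ev_add: "ev c (f + g) = ev c f + ev c g"
    and reg_mult: "reg V c (f * g)" and ev_mult: "ev c (f * g) = ev c f * ev c g"
proof -
  obtain a b where 1: "a \<in> polys_in V" "b \<in> polys_in V" "f = Fract a b" "pe c b \<noteq> 0" "b \<noteq> 0" "ev c f = pe c a / pe c b"
    using assms(1) by (rule regE)
  obtain a' b' where 2: "a' \<in> polys_in V" "b' \<in> polys_in V" "g = Fract a' b'" "pe c b' \<noteq> 0" "b' \<noteq> 0" "ev c g = pe c a' / pe c b'"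
    using assms(2) by (rule regE)
  have bb: "pe c (b * b') \<noteq> 0" using 1 2 by (simp add: pe_simps)
  have s: "f + g = Fract (a * b' + a' * b) (b * b')" "f * g = Fract (a * a') (b * b')"
    using 1 2 by simp_all
  show "reg V c (f + g)" "reg V c (f * g)"
    unfolding s by (rule regI; use 1 2 bb in \<open>auto simp: polys_in_closed\<close>)+
  show "ev c (f + g) = ev c f + ev c g" "ev c (f * g) = ev c f * ev c g"
    unfolding s ev_Fract[OF bb] using 1 2 by (simp_all add: pe_simps add_frac_eq)
qed

lemma
  assumes "reg V c f" "ev c f \<noteq> 0"
  shows reg_inverse: "reg V c (inverse f)" and ev_inverse: "ev c (inverse f) = inverse (ev c f)"
proof -
  obtain a b where 1: "a \<in> polys_in V" "b \<in> polys_in V" "f = Fract a b" "pe c b \<noteq> 0" "b \<noteq> 0" "ev c f = pe c a / pe c b"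
    using assms(1) by (rule regE)
  then have "pe c a \<noteq> 0" using assms(2) by auto
  then show "reg V c (inverse f)" "ev c (inverse f) = inverse (ev c f)"
    using 1 regI[of b V a c] by (simp_all add: ev_Fract)
qed

lemma reg_minus: "reg V c f \<Longrightarrow> reg V c (- f)" and ev_minus: "reg V c f \<Longrightarrow> ev c (- f) = - ev c f"
  by (elim regE; simp add: regI ev_Fract polys_in_minus pe_hom)+

lemma reg_diff: "reg V c f \<Longrightarrow> reg V c g \<Longrightarrow> reg V c (f - g)"
  and ev_diff: "reg V c f \<Longrightarrow> reg V c g \<Longrightarrow> ev c (f - g) = ev c f - ev c g"
  using reg_add[of V c f "- g"] ev_add[of V c f "- g"] reg_minus[of V c g] ev_minus[of V c g] by simp_all

lemma reg_divide: "reg V c f \<Longrightarrow> reg V c g \<Longrightarrow> ev c g \<noteq> 0 \<Longrightarrow> reg V c (f / g)"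
  and ev_divide: "reg V c f \<Longrightarrow> reg V c g \<Longrightarrow> ev c g \<noteq> 0 \<Longrightarrow> ev c (f / g) = ev c f / ev c g"
  by (simp_all add: divide_inverse reg_mult ev_mult[where V = V] reg_inverse ev_inverse[where V = V])

lemma reg_sum: "(\<And>i. i \<in> A \<Longrightarrow> reg V c (f i)) \<Longrightarrow> reg V c (sum f A)"
  and ev_sum: "(\<And>i. i \<in> A \<Longrightarrow> reg V c (f i)) \<Longrightarrow> ev c (sum f A) = (\<Sum>i\<in>A. ev c (f i))"
proof -
  assume *: "\<And>i. i \<in> A \<Longrightarrow> reg V c (f i)"
  have "reg V c (sum f A) \<and> ev c (sum f A) = (\<Sum>i\<in>A. ev c (f i))"
    using * by (induction A rule: infinite_finite_induct) (auto simp: reg_0 reg_add ev_add[where V = V])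
  then show "reg V c (sum f A)" "ev c (sum f A) = (\<Sum>i\<in>A. ev c (f i))" by auto
qed

lemma reg_prod: "(\<And>i. i \<in> A \<Longrightarrow> reg V c (f i)) \<Longrightarrow> reg V c (prod f A)"
  and ev_prod: "(\<And>i. i \<in> A \<Longrightarrow> reg V c (f i)) \<Longrightarrow> ev c (prod f A) = (\<Prod>i\<in>A. ev c (f i))"
proof -
  assume *: "\<And>i. i \<in> A \<Longrightarrow> reg V c (f i)"
  have "reg V c (prod f A) \<and> ev c (prod f A) = (\<Prod>i\<in>A. ev c (f i))"
    using * by (induction A rule: infinite_finite_induct) (auto simp: reg_1 reg_mult ev_mult[where V = V])
  then show "reg V c (prod f A)" "ev c (prod f A) = (\<Prod>i\<in>A. ev c (f i))" by auto
qed

lemma reg_rat_pd: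
  assumes "reg V c f"
  shows "reg V c (rat_pd i f)"
proof -
  obtain a b where "a \<in> polys_in V" "b \<in> polys_in V" "f = Fract a b" "pe c b \<noteq> 0" "b \<noteq> 0"
    using assms by (rule regE)
  then have "rat_pd i f = Fract (poly_pd i a * b + - (a * poly_pd i b)) (b * b)" "pe c (b * b) \<noteq> 0"
    by (simp_all add: rat_pd_Fract pe_simps)
  with \<open>a \<in> _\<close> \<open>b \<in> _\<close> show ?thesis
    by (simp only:) (intro regI polys_in_closed polys_in_minus poly_pd_in; simp)
qed

lemma reg_fracs: "reg V c f \<Longrightarrow> f \<in> fracs V"
  by (elim regE) (auto simp: fracs_def)

lemma reg_mono: "reg V c f \<Longrightarrow> V \<subseteq> W \<Longrightarrow> reg W c f"
  by (elim regE) (auto intro: regI polys_in_mono)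

lemma
  assumes "p \<in> polys_in W" "\<And>i. i \<in> W \<Longrightarrow> reg V c (x i)" "\<And>i. i \<in> W \<Longrightarrow> ev c (x i) = v i"
  shows reg_poly_subst: "reg V c (poly_subst rconst x p)"
    and ev_poly_subst: "ev c (poly_subst rconst x p) = pe v p"
proof -
  have "reg V c (poly_subst rconst x p) \<and> ev c (poly_subst rconst x p) = pe v p"
    using assms(1) by (induction p rule: cpoly_induct)
     (use assms in \<open>auto simp: poly_subst_simps[OF is_hom_rconst] pe_simps reg_const reg_add reg_mult
       ev_add[where V = V] ev_mult[where V = V]\<close>)
  then show "reg V c (poly_subst rconst x p)" "ev c (poly_subst rconst x p) = pe v p" by auto
qed

section \<open>Rational differential forms: products, exterior derivative, pullback\<close>

subsection \<open>Exterior algebra\<close>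

text \<open>Unification produces eta-long terms, in which these rules would destroy the operations on forms.\<close>

declare plus_fun_apply [simp del] zero_fun_apply [simp del] uminus_apply [simp del] minus_apply [simp del]
lemmas form_apply = plus_fun_apply zero_fun_apply uminus_apply minus_apply

definition inv_count :: "nat set \<Rightarrow> nat set \<Rightarrow> nat" where
  "inv_count I J = card {(i, j). i \<in> I \<and> j \<in> J \<and> j < i}"

lemma shuffle_sign_eq: "shuffle_sign I J = (-1) ^ inv_count I J"
  by (simp add: shuffle_sign_def inv_count_def)

lemma inv_count_finite: "finite I \<Longrightarrow> finite {(i, j). i \<in> I \<and> j \<in> J \<and> j < (i::nat)}"
  by (rule finite_subset[of _ "\<Union>i\<in>I. {i} \<times> {..<i}"]) auto

lemma inv_count_Un_left:
  assumes "finite I" "finite I'" "I \<inter> I' = {}"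
  shows "inv_count (I \<union> I') J = inv_count I J + inv_count I' J"
proof -
  have "{(i, j). i \<in> I \<union> I' \<and> j \<in> J \<and> j < i} = {(i, j). i \<in> I \<and> j \<in> J \<and> j < i} \<union> {(i, j). i \<in> I' \<and> j \<in> J \<and> j < i}"
    by auto
  moreover have "card (\<dots>) = inv_count I J + inv_count I' J"
    unfolding inv_count_def
    by (rule card_Un_disjoint) (use assms in \<open>auto intro: inv_count_finite\<close>)
  ultimately show ?thesis by (simp only: inv_count_def)
qed

lemma inv_count_Un_right:
  assumes "finite I" "J \<inter> J' = {}"
  shows "inv_count I (J \<union> J') = inv_count I J + inv_count I J'"
proof -
  have "{(i, j). i \<in> I \<and> j \<in> J \<union> J' \<and> j < i} = {(i, j). i \<in> I \<and> j \<in> J \<and> j < i} \<union> {(i, j). i \<in> I \<and> j \<in> J' \<and> j < i}"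
    by auto
  moreover have "card (\<dots>) = inv_count I J + inv_count I J'"
    unfolding inv_count_def
    by (rule card_Un_disjoint) (use assms in \<open>auto intro: inv_count_finite\<close>)
  ultimately show ?thesis by (simp only: inv_count_def)
qed

lemma shuffle_sign_Un_left:
  "finite I \<Longrightarrow> finite I' \<Longrightarrow> I \<inter> I' = {} \<Longrightarrow> shuffle_sign (I \<union> I') J = shuffle_sign I J * shuffle_sign I' J"
  by (simp add: shuffle_sign_eq inv_count_Un_left power_add)

lemma shuffle_sign_Un_right:
  "finite I \<Longrightarrow> J \<inter> J' = {} \<Longrightarrow> shuffle_sign I (J \<union> J') = shuffle_sign I J * shuffle_sign I J'"
  by (simp add: shuffle_sign_eq inv_count_Un_right power_add)

lemma shuffle_sign_empty [simp]: "shuffle_sign {} J = 1" "shuffle_sign I {} = 1"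
  by (simp_all add: shuffle_sign_def)

lemma shuffle_sign_less: "(\<And>i j. i \<in> I \<Longrightarrow> j \<in> J \<Longrightarrow> i < j) \<Longrightarrow> shuffle_sign I J = 1"
proof -
  assume "\<And>i j. i \<in> I \<Longrightarrow> j \<in> J \<Longrightarrow> i < j"
  then have "{(i, j). i \<in> I \<and> j \<in> J \<and> j < i} = {}" by fastforce
  then show ?thesis unfolding shuffle_sign_def by (simp only: card.empty power_0)
qed

lemma shuffle_sign_single: "shuffle_sign {i} {j} = (if j < i then - 1 else 1)"
proof -
  have "{(i', j'). i' \<in> {i} \<and> j' \<in> {j} \<and> j' < i'} = (if j < i then {(i, j)} else {})" by auto
  then show ?thesis by (simp add: shuffle_sign_def)
qed

lemma shuffle_sign_cases: "shuffle_sign I J = 1 \<or> shuffle_sign I J = - 1"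
  unfolding shuffle_sign_eq by (metis neg_one_even_power neg_one_odd_power)

text \<open>Extracting \<open>i\<close> and \<open>j\<close> from \<open>K\<close> in the two
  possible orders differs by one transposition. This single sign is responsible for the
  anticommutativity of 1-forms as well as for the vanishing of \<open>d\<close> applied
  twice.\<close>

lemma shuffle_sign_swap:
  assumes "finite K" "i \<in> K" "j \<in> K" "i \<noteq> j"
  shows "shuffle_sign {j} (K - {j}) * shuffle_sign {i} (K - {j} - {i}) =
    - (shuffle_sign {i} (K - {i}) * shuffle_sign {j} (K - {i} - {j}))"
proof -
  let ?M = "K - {i} - {j}"
  have 1: "K - {j} = {i} \<union> ?M" "K - {i} = {j} \<union> ?M" "K - {j} - {i} = ?M" using assms by auto
  have "shuffle_sign {j} ({i} \<union> ?M) = shuffle_sign {j} {i} * shuffle_sign {j} ?M"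
    "shuffle_sign {i} ({j} \<union> ?M) = shuffle_sign {i} {j} * shuffle_sign {i} ?M"
    by (rule shuffle_sign_Un_right; auto)+
  moreover have "shuffle_sign {j} {i} = - shuffle_sign {i} {j}"
    using assms(4) by (auto simp: shuffle_sign_single)
  ultimately show ?thesis using 1 by simp
qed

definition one_form :: "form \<Rightarrow> bool" where
  "one_form \<eta> \<longleftrightarrow> (\<forall>I. \<eta> I \<noteq> 0 \<longrightarrow> (\<exists>i. I = {i}))"

lemma wedge_one_form:
  assumes "one_form \<eta>"
  shows "wedge \<eta> \<zeta> K = (\<Sum>i\<in>K. shuffle_sign {i} (K - {i}) * \<eta> {i} * \<zeta> (K - {i}))"
proof (cases "finite K")
  case True
  have "wedge \<eta> \<zeta> K = (\<Sum>I\<in>(\<lambda>i. {i}) ` K. shuffle_sign I (K - I) * \<eta> I * \<zeta> (K - I))"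
    unfolding wedge_def
  proof (rule sum.mono_neutral_right)
    show "\<forall>I\<in>Pow K - (\<lambda>i. {i}) ` K. shuffle_sign I (K - I) * \<eta> I * \<zeta> (K - I) = 0"
    proof
      fix I assume "I \<in> Pow K - (\<lambda>i. {i}) ` K"
      then have "\<eta> I = 0" using assms unfolding one_form_def by blast
      then show "shuffle_sign I (K - I) * \<eta> I * \<zeta> (K - I) = 0" by simp
    qed
  qed (use True in auto)
  also have "\<dots> = (\<Sum>i\<in>K. shuffle_sign {i} (K - {i}) * \<eta> {i} * \<zeta> (K - {i}))"
    by (subst sum.reindex) (auto simp: inj_on_def)
  finally show ?thesis .
next
  case False
  then show ?thesis by (simp add: wedge_def)
qed

lemma wedge_left_linear:
  "wedge (\<eta> + \<eta>') \<zeta> = wedge \<eta> \<zeta> + wedge \<eta>' \<zeta>"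
  "wedge (fscale f \<eta>) \<zeta> = fscale f (wedge \<eta> \<zeta>)"
  by (auto simp: wedge_def form_apply fscale_def fun_eq_iff sum.distrib sum_distrib_left algebra_simps
      intro!: sum.cong)

lemma fscale_minus1: "fscale (- 1) \<eta> = - \<eta>"
  by (simp add: fscale_def fun_eq_iff form_apply)

lemma fscale_neg: "fscale (- f) \<eta> = - fscale f \<eta>" "fscale f (- \<eta>) = - fscale f \<eta>"
  by (simp_all add: fscale_def fun_eq_iff form_apply)

lemma fscale_diff: "fscale f (\<eta> - \<zeta>) = fscale f \<eta> - fscale f \<zeta>"
  by (simp add: fscale_def fun_eq_iff form_apply algebra_simps)

lemma fscale_sum: "fscale f (sum g A) = (\<Sum>a\<in>A. fscale f (g a))"
  by (induction A rule: infinite_finite_induct) (simp_all add: fscale_simps)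

lemma fscale_sum_left: "fscale (sum g A) \<eta> = (\<Sum>a\<in>A. fscale (g a) \<eta>)"
  by (induction A rule: infinite_finite_induct) (simp_all add: fscale_simps)

lemma wedge_zero [simp]: "wedge 0 \<eta> = 0" "wedge \<eta> 0 = 0"
  by (auto simp: wedge_def fun_eq_iff form_apply)

lemma wedge_minus: "wedge (- \<eta>) \<zeta> = - wedge \<eta> \<zeta>" "wedge \<eta> (- \<zeta>) = - wedge \<eta> \<zeta>"
  using wedge_left_linear(2)[of "-1" \<eta> \<zeta>] wedge_linear(2)[of \<eta> "-1" \<zeta>] by (simp_all only: fscale_minus1)

lemma wedge_diff: "wedge (\<eta> - \<eta>') \<zeta> = wedge \<eta> \<zeta> - wedge \<eta>' \<zeta>" "wedge \<zeta> (\<eta> - \<eta>') = wedge \<zeta> \<eta> - wedge \<zeta> \<eta>'"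
  using wedge_left_linear(1)[of \<eta> "- \<eta>'" \<zeta>] wedge_linear(1)[of \<zeta> \<eta> "- \<eta>'"] by (simp_all add: wedge_minus)

lemma wedge_sum_right: "wedge \<eta> (sum g A) = (\<Sum>a\<in>A. wedge \<eta> (g a))"
  by (induction A rule: infinite_finite_induct) (simp_all add: wedge_linear)

lemma wedge_sum_left: "wedge (sum g A) \<eta> = (\<Sum>a\<in>A. wedge (g a) \<eta>)"
  by (induction A rule: infinite_finite_induct) (simp_all add: wedge_left_linear)

lemma wedge_assoc: "wedge (wedge \<eta> \<zeta>) \<theta> = wedge \<eta> (wedge \<zeta> \<theta>)"
proof
  fix K
  show "wedge (wedge \<eta> \<zeta>) \<theta> K = wedge \<eta> (wedge \<zeta> \<theta>) K"
  proof (cases "finite K")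
    case True
    have fin: "finite I" if "I \<subseteq> K" for I using True that by (rule finite_subset[rotated])
    have "wedge (wedge \<eta> \<zeta>) \<theta> K =
      (\<Sum>(M, I)\<in>(SIGMA M:Pow K. Pow M). shuffle_sign M (K - M) * (shuffle_sign I (M - I) * \<eta> I * \<zeta> (M - I)) * \<theta> (K - M))"
      using True fin
      by (simp add: wedge_def sum_distrib_left sum_distrib_right sum.Sigma)
    also have "\<dots> = (\<Sum>(I, J)\<in>(SIGMA I:Pow K. Pow (K - I)).
        shuffle_sign I (K - I) * \<eta> I * (shuffle_sign J (K - I - J) * \<zeta> J * \<theta> (K - I - J)))"
    \<comment> \<open>Both index pairs describe a decomposition of \<open>K\<close> into three
      disjoint sets, \<open>M\<close> being the union of the first two; both signs count the
      inversions among the three sets.\<close>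
    proof (rule sum.reindex_bij_witness[of _ "\<lambda>(I, J). (I \<union> J, I)" "\<lambda>(M, I). (I, M - I)"])
      fix a assume a: "a \<in> (SIGMA M:Pow K. Pow M)"
      obtain M I where aM: "a = (M, I)" by (cases a)
      with a have MI: "I \<subseteq> M" "M \<subseteq> K" by auto
      let ?J = "M - I" and ?L = "K - M"
      have eq: "M = I \<union> ?J" "K - I = ?J \<union> ?L" "K - I - ?J = ?L" using MI by auto
      have "shuffle_sign (I \<union> ?J) ?L = shuffle_sign I ?L * shuffle_sign ?J ?L"
        by (rule shuffle_sign_Un_left) (use MI in \<open>auto intro: fin\<close>)
      moreover have "shuffle_sign I (?J \<union> ?L) = shuffle_sign I ?J * shuffle_sign I ?L"
        by (rule shuffle_sign_Un_right) (use MI in \<open>auto intro: fin\<close>)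
      ultimately have "shuffle_sign M ?L * shuffle_sign I ?J = shuffle_sign I (K - I) * shuffle_sign ?J ?L"
        using eq by (metis (no_types, lifting) mult.commute mult.left_commute)
      then show "(case case a of (M, I) \<Rightarrow> (I, M - I) of (I, J) \<Rightarrow>
          shuffle_sign I (K - I) * \<eta> I * (shuffle_sign J (K - I - J) * \<zeta> J * \<theta> (K - I - J))) =
        (case a of (M, I) \<Rightarrow> shuffle_sign M (K - M) * (shuffle_sign I (M - I) * \<eta> I * \<zeta> (M - I)) * \<theta> (K - M))"
        unfolding aM split_conv eq(3) by (metis (no_types, opaque_lifting) mult.assoc mult.commute mult.left_commute)
    qed auto
    also have "\<dots> = wedge \<eta> (wedge \<zeta> \<theta>) K"
      using True fin by (simp add: wedge_def sum_distrib_left sum.Sigma)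
    finally show ?thesis .
  next
    \<comment> \<open>For infinite \<open>K\<close> the sum over \<open>Pow K\<close> has an
      infinite index set and is 0 by convention.\<close>
    case False
    then show ?thesis by (simp add: wedge_def)
  qed
qed

lemma wedge_func_form: "finite K \<Longrightarrow> wedge (func_form f) \<eta> K = f * \<eta> K"
  by (simp add: wedge_def func_form_def if_distrib[of "\<lambda>x. _ * x"] if_distrib[of "\<lambda>x. x * _"] cong: if_cong)

lemma wedge_func_form_right: "finite K \<Longrightarrow> wedge \<eta> (func_form f) K = \<eta> K * f"
proof -
  assume K: "finite K"
  have "wedge \<eta> (func_form f) K = (\<Sum>I\<in>Pow K. if I = K then \<eta> K * f else 0)"
    unfolding wedge_def func_form_def by (rule sum.cong) auto
  then show ?thesis using K by simp
qed

lemma wedge_one_right: "one_form \<eta> \<Longrightarrow> wedge \<eta> (func_form 1) = \<eta>"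
proof
  fix K assume "one_form \<eta>"
  then show "wedge \<eta> (func_form 1) K = \<eta> K"
  proof (cases "finite K")
    case False
    then have "\<eta> K = 0" using \<open>one_form \<eta>\<close> unfolding one_form_def by (metis finite.emptyI finite.insertI)
    then show ?thesis using False by (simp add: wedge_def)
  qed (simp add: wedge_func_form_right)
qed

lemma wedge_list_simps [simp]: "wedge_list [] = func_form 1" "wedge_list (\<eta> # \<eta>s) = wedge \<eta> (wedge_list \<eta>s)"
  by (simp_all add: wedge_list_def)

lemma wedge_list_infinite: "infinite K \<Longrightarrow> wedge_list \<eta>s K = 0"
  by (cases \<eta>s) (auto simp: func_form_def wedge_def)

lemma wedge_list_append: "wedge_list (\<eta>s @ \<zeta>s) = wedge (wedge_list \<eta>s) (wedge_list \<zeta>s)"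
proof (induction \<eta>s)
  case Nil
  show ?case
  proof
    fix K show "wedge_list ([] @ \<zeta>s) K = wedge (wedge_list []) (wedge_list \<zeta>s) K"
      by (cases "finite K") (simp_all add: wedge_func_form wedge_list_infinite, simp add: wedge_def)
  qed
qed (simp add: wedge_assoc)

lemma wedge_swap:
  assumes "one_form \<eta>" "one_form \<zeta>"
  shows "wedge \<eta> (wedge \<zeta> \<theta>) = - wedge \<zeta> (wedge \<eta> \<theta>)"
proof
  fix K
  show "wedge \<eta> (wedge \<zeta> \<theta>) K = (- wedge \<zeta> (wedge \<eta> \<theta>)) K"
  proof (cases "finite K")
    case True
    let ?P = "{(i, j). i \<in> K \<and> j \<in> K \<and> i \<noteq> j}"
    have S: "(\<Sum>i\<in>K. \<Sum>j\<in>K - {i}. f i j) = (\<Sum>(i, j)\<in>?P. f i j)" for f :: "nat \<Rightarrow> nat \<Rightarrow> ratfun"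
    proof -
      have "(SIGMA i:K. K - {i}) = ?P" by auto
      then show ?thesis using True by (simp add: sum.Sigma)
    qed
    have "wedge \<eta> (wedge \<zeta> \<theta>) K = (\<Sum>(i, j)\<in>?P. shuffle_sign {i} (K - {i}) * \<eta> {i} *
        (shuffle_sign {j} (K - {i} - {j}) * \<zeta> {j} * \<theta> (K - {i} - {j})))"
      by (simp add: wedge_one_form assms sum_distrib_left S)
    also have "\<dots> = (\<Sum>(j, i)\<in>?P. shuffle_sign {i} (K - {i}) * \<eta> {i} *
        (shuffle_sign {j} (K - {i} - {j}) * \<zeta> {j} * \<theta> (K - {i} - {j})))"
      by (rule sum.reindex_bij_witness[of _ "\<lambda>(i, j). (j, i)" "\<lambda>(i, j). (j, i)"]) auto
    also have "\<dots> = - (\<Sum>(j, i)\<in>?P. shuffle_sign {j} (K - {j}) * \<zeta> {j} *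
        (shuffle_sign {i} (K - {j} - {i}) * \<eta> {i} * \<theta> (K - {j} - {i})))"
      unfolding sum_negf[symmetric]
    proof (rule sum.cong[OF refl], clarify)
      fix j i assume ij: "j \<in> K" "i \<in> K" "j \<noteq> i"
      have "K - {i} - {j} = K - {j} - {i}" by auto
      then show "shuffle_sign {i} (K - {i}) * \<eta> {i} * (shuffle_sign {j} (K - {i} - {j}) * \<zeta> {j} * \<theta> (K - {i} - {j})) =
        - (shuffle_sign {j} (K - {j}) * \<zeta> {j} * (shuffle_sign {i} (K - {j} - {i}) * \<eta> {i} * \<theta> (K - {j} - {i})))"
        using shuffle_sign_swap[OF True ij(2,1)] ij(3) by (simp add: mult_ac)
    qed
    also have "\<dots> = (- wedge \<zeta> (wedge \<eta> \<theta>)) K"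
      by (simp add: wedge_one_form assms sum_distrib_left S form_apply)
    finally show ?thesis .
  next
    case False
    then show ?thesis by (simp add: form_apply) (simp add: wedge_def)
  qed
qed

lemma wedge_self: "one_form \<eta> \<Longrightarrow> wedge \<eta> (wedge \<eta> \<theta>) = 0"
proof
  fix K assume "one_form \<eta>"
  then have "wedge \<eta> (wedge \<eta> \<theta>) K = - wedge \<eta> (wedge \<eta> \<theta>) K"
    using wedge_swap[of \<eta> \<eta> \<theta>] by (metis uminus_apply)
  then have "2 * wedge \<eta> (wedge \<eta> \<theta>) K = 0" by (simp only: mult_2 eq_neg_iff_add_eq_0)
  then show "wedge \<eta> (wedge \<eta> \<theta>) K = 0 K" by (simp add: form_apply)
qed

lemma wedge_list_swap:
  assumes "one_form \<eta>" "\<forall>\<zeta>\<in>set \<zeta>s. one_form \<zeta>"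
  shows "wedge_list (\<zeta>s @ \<eta> # \<zeta>s') = fscale ((-1) ^ length \<zeta>s) (wedge_list (\<eta> # \<zeta>s @ \<zeta>s'))"
  using assms(2)
proof (induction \<zeta>s)
  case (Cons \<zeta> \<zeta>s)
  then have "wedge_list ((\<zeta> # \<zeta>s) @ \<eta> # \<zeta>s') = fscale ((-1) ^ length \<zeta>s) (wedge \<zeta> (wedge \<eta> (wedge_list (\<zeta>s @ \<zeta>s'))))"
    by (simp add: wedge_linear)
  also have "\<dots> = fscale ((-1) ^ length \<zeta>s) (- wedge \<eta> (wedge \<zeta> (wedge_list (\<zeta>s @ \<zeta>s'))))"
    using Cons.prems assms(1) by (simp add: wedge_swap[of \<zeta> \<eta>])
  finally show ?case by (simp add: fscale_neg)
qed (simp add: fscale_simps)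

subsection \<open>The exterior derivative\<close>

lemma dfun_eq: "dfun f K = (if \<exists>i. K = {i} then rat_pd (the_elem K) f else 0)"
proof (cases "\<exists>i. K = {i}")
  case True
  then show ?thesis by (auto simp: dfun_def ext_d_def func_form_def)
next
  case False
  have "K - {i} \<noteq> {}" if "i \<in> K" for i using False that by blast
  then have "dfun f K = 0"
    unfolding dfun_def ext_d_def func_form_def by (intro sum.neutral) (auto simp: rconst_simps)
  then show ?thesis using False by simp
qed

lemma dfun_single [simp]: "dfun f {i} = rat_pd i f"
  by (simp add: dfun_eq)

lemma one_form_dfun: "one_form (dfun f)"
  unfolding one_form_def dfun_eq by auto

lemma one_form_add: "one_form \<eta> \<Longrightarrow> one_form \<zeta> \<Longrightarrow> one_form (\<eta> + \<zeta>)"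
  unfolding one_form_def by (metis add_0 plus_fun_apply)

lemma one_form_fscale: "one_form \<eta> \<Longrightarrow> one_form (fscale f \<eta>)"
  unfolding one_form_def fscale_def by auto

lemma one_form_eqI: "one_form \<eta> \<Longrightarrow> one_form \<zeta> \<Longrightarrow> (\<And>i. \<eta> {i} = \<zeta> {i}) \<Longrightarrow> \<eta> = \<zeta>"
  unfolding one_form_def fun_eq_iff by metis

lemma ext_d_add: "ext_d (\<eta> + \<zeta>) = ext_d \<eta> + ext_d \<zeta>" by (rule ext_d_linear)

lemma ext_d_zero [simp]: "ext_d 0 = 0"
  by (simp add: ext_d_def fun_eq_iff form_apply)

lemma ext_d_sum: "ext_d (sum g A) = (\<Sum>a\<in>A. ext_d (g a))"
  by (induction A rule: infinite_finite_induct) (simp_all add: ext_d_add)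

lemma ext_d_fscale: "ext_d (fscale f \<eta>) = wedge (dfun f) \<eta> + fscale f (ext_d \<eta>)"
  by (rule ext) (simp add: form_apply ext_d_def fscale_def wedge_one_form[OF one_form_dfun] rat_pd_mult
      sum.distrib sum_distrib_left algebra_simps)

text \<open>The second derivatives of \<open>f\<close> are symmetric in the two extracted indices
  while the sign is antisymmetric, so they cancel; exchanging the indices in the other terms
  produces the minus sign.\<close>

lemma ext_d_wedge_dfun: "ext_d (wedge (dfun f) \<eta>) = - wedge (dfun f) (ext_d \<eta>)"
proof
  fix K
  show "ext_d (wedge (dfun f) \<eta>) K = (- wedge (dfun f) (ext_d \<eta>)) K"
  proof (cases "finite K")
    case True
    let ?P = "{(i, j). i \<in> K \<and> j \<in> K \<and> i \<noteq> j}"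
    let ?s = "\<lambda>i j. shuffle_sign {i} (K - {i}) * shuffle_sign {j} (K - {i} - {j})"
    have S: "(\<Sum>i\<in>K. \<Sum>j\<in>K - {i}. h i j) = (\<Sum>(i, j)\<in>?P. h i j)" for h :: "nat \<Rightarrow> nat \<Rightarrow> ratfun"
    proof -
      have "(SIGMA i:K. K - {i}) = ?P" by auto
      then show ?thesis using True by (simp add: sum.Sigma)
    qed
    have rs: "rat_pd i (shuffle_sign I J * h) = shuffle_sign I J * rat_pd i h" for i I J h
      using shuffle_sign_cases[of I J] by (auto simp: rat_pd_minus)
    have swap: "(\<Sum>(i, j)\<in>?P. h i j) = (\<Sum>(i, j)\<in>?P. h j i)" for h :: "nat \<Rightarrow> nat \<Rightarrow> ratfun"
      by (rule sum.reindex_bij_witness[of _ "\<lambda>(i, j). (j, i)" "\<lambda>(i, j). (j, i)"]) auto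
    have comm: "K - {i} - {j} = K - {j} - {i}" for i j by auto
    have anti: "?s i j = - ?s j i" if "(i, j) \<in> ?P" for i j
      using shuffle_sign_swap[OF True, of j i] that by auto
    have "ext_d (wedge (dfun f) \<eta>) K = (\<Sum>(i, j)\<in>?P. ?s i j * rat_pd i (rat_pd j f * \<eta> (K - {i} - {j})))"
      by (simp add: ext_d_def wedge_one_form[OF one_form_dfun] rat_pd_sum rs sum_distrib_left S mult.assoc)
    also have "\<dots> = (\<Sum>(i, j)\<in>?P. ?s i j * (rat_pd i (rat_pd j f) * \<eta> (K - {i} - {j}))) +
        (\<Sum>(i, j)\<in>?P. ?s i j * (rat_pd j f * rat_pd i (\<eta> (K - {i} - {j}))))"
      by (simp add: rat_pd_mult distrib_left split_def sum.distrib)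
    also have "(\<Sum>(i, j)\<in>?P. ?s i j * (rat_pd i (rat_pd j f) * \<eta> (K - {i} - {j}))) = 0" (is "?A = 0")
    proof -
      have "?A = (\<Sum>(i, j)\<in>?P. ?s j i * (rat_pd j (rat_pd i f) * \<eta> (K - {j} - {i})))" by (rule swap)
      also have "\<dots> = (\<Sum>(i, j)\<in>?P. - (?s i j * (rat_pd i (rat_pd j f) * \<eta> (K - {i} - {j}))))"
      proof (rule sum.cong[OF refl], clarify)
        fix i j assume "i \<in> K" "j \<in> K" "i \<noteq> j"
        then show "?s j i * (rat_pd j (rat_pd i f) * \<eta> (K - {j} - {i})) = - (?s i j * (rat_pd i (rat_pd j f) * \<eta> (K - {i} - {j})))"
          by (subst anti[of i j]) (simp_all add: rat_pd_commute[of j i] comm[of j i])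
      qed
      also have "\<dots> = - ?A" by (simp add: split_def sum_negf)
      finally have "2 * ?A = 0" by (simp only: mult_2 eq_neg_iff_add_eq_0)
      then show ?thesis by simp
    qed
    also have "(\<Sum>(i, j)\<in>?P. ?s i j * (rat_pd j f * rat_pd i (\<eta> (K - {i} - {j})))) =
        (\<Sum>(i, j)\<in>?P. ?s j i * (rat_pd i f * rat_pd j (\<eta> (K - {j} - {i}))))" by (rule swap)
    also have "\<dots> = (\<Sum>(i, j)\<in>?P. - (?s i j * (rat_pd i f * rat_pd j (\<eta> (K - {i} - {j})))))"
    proof (rule sum.cong[OF refl], clarify)
      fix i j assume "i \<in> K" "j \<in> K" "i \<noteq> j"
      then show "?s j i * (rat_pd i f * rat_pd j (\<eta> (K - {j} - {i}))) = - (?s i j * (rat_pd i f * rat_pd j (\<eta> (K - {i} - {j}))))"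
        by (subst anti[of i j]) (simp_all add: comm[of j i])
    qed
    also have "\<dots> = - (\<Sum>(i, j)\<in>?P. shuffle_sign {i} (K - {i}) * rat_pd i f * (shuffle_sign {j} (K - {i} - {j}) * rat_pd j (\<eta> (K - {i} - {j}))))"
      by (simp add: split_def sum_negf mult_ac)
    also have "\<dots> = (- wedge (dfun f) (ext_d \<eta>)) K"
      by (simp only: ext_d_def wedge_one_form[OF one_form_dfun] sum_distrib_left S uminus_apply dfun_single)
    finally show ?thesis by simp
  next
    case False
    then show ?thesis by (simp add: form_apply) (simp add: wedge_def ext_d_def)
  qed
qed

lemma ext_d_one: "ext_d (func_form 1) = 0"
proof -
  have "dfun 1 = 0" by (simp add: dfun_eq fun_eq_iff form_apply)
  then show ?thesis by (simp add: dfun_def)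
qed

lemma ext_d_wedge_list_dfun: "ext_d (wedge_list (map (\<lambda>i. dfun (f i)) is)) = 0"
  by (induction "is") (simp_all add: ext_d_one ext_d_wedge_dfun)

subsection \<open>Wedge products over index sets\<close>

definition EE :: "(nat \<Rightarrow> form) \<Rightarrow> nat set \<Rightarrow> form" where
  "EE e I = wedge_list (map e (sorted_list_of_set I))"

lemma EE_empty [simp]: "EE e {} = func_form 1"
  by (simp add: EE_def)

lemma EE_Min:
  assumes "finite I" "\<And>j. j \<in> I \<Longrightarrow> i < j"
  shows "EE e (insert i I) = wedge (e i) (EE e I)"
proof -
  have "sorted_list_of_set (insert i I) = i # sorted_list_of_set I"
  proof -
    have "i \<notin> I" using assms(2) by blast
    moreover have "sorted_list_of_set (insert i I) = insort i (sorted_list_of_set I)"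
      using assms(1) \<open>i \<notin> I\<close> by simp
    moreover have "insort i (sorted_list_of_set I) = i # sorted_list_of_set I"
      using assms by (intro insort_is_Cons) (auto simp: less_imp_le)
    ultimately show ?thesis by simp
  qed
  then show ?thesis by (simp add: EE_def)
qed

text \<open>Peeling off the smallest index fits the increasing order used in \<open>EE\<close>: a
  new minimum goes to the front and costs no sign.\<close>

lemma finite_induct_Min [consumes 1, case_names empty insert]:
  fixes I :: "nat set"
  assumes "finite I" "P {}"
    and "\<And>i I. finite I \<Longrightarrow> (\<And>j. j \<in> I \<Longrightarrow> i < j) \<Longrightarrow> P I \<Longrightarrow> P (insert i I)"
  shows "P I"
  using assms(1)
proof (induction "card I" arbitrary: I)
  case 0
  then show ?case using assms(2) by simp
next
  case (Suc n)
  then have ne: "I \<noteq> {}" by auto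
  let ?m = "Min I"
  have m: "?m \<in> I" using Suc.prems ne by simp
  have "P (insert ?m (I - {?m}))"
  proof (rule assms(3))
    show "P (I - {?m})" using Suc m by (intro Suc.hyps(1)) auto
    show "?m < j" if "j \<in> I - {?m}" for j
      using that Suc.prems by (metis DiffE Min_le insertI1 le_neq_implies_less)
  qed (use Suc in auto)
  then show ?case using m by (simp add: insert_absorb)
qed

lemma EE_insert:
  assumes e: "\<And>i. one_form (e i)" and "finite J"
  shows "wedge (e i) (EE e J) = (if i \<in> J then 0 else fscale (shuffle_sign {i} J) (EE e (insert i J)))"
  using assms(2)
proof (induction J rule: finite_induct_Min)
  case empty
  then show ?case using EE_Min[of "{}" i e] by (simp add: fscale_simps)
next
  case (insert m J)
  have mJ: "m \<notin> J" using insert by blast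
  have E: "EE e (insert m J) = wedge (e m) (EE e J)"
    by (rule EE_Min) (use insert in auto)
  consider "i = m" | "i < m" | "m < i" by linarith
  then show ?case
  proof cases
    case 1
    then show ?thesis by (simp add: E wedge_self e)
  next
    case 2
    have 3: "i < j" if "j \<in> insert m J" for j using that 2 insert(2) by force
    then have "wedge (e i) (EE e (insert m J)) = EE e (insert i (insert m J))"
      using insert(1) by (subst EE_Min[of "insert m J" i]) auto
    moreover have "i \<notin> insert m J" using 3 by blast
    moreover have "shuffle_sign {i} (insert m J) = 1"
      by (rule shuffle_sign_less) (use 3 in auto)
    ultimately show ?thesis by (simp add: fscale_simps)
  next
    case 3
    have 1: "wedge (e i) (EE e (insert m J)) = - wedge (e m) (wedge (e i) (EE e J))"
      unfolding E by (rule wedge_swap) (rule e)+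
    show ?thesis
    proof (cases "i \<in> J")
      case True
      then show ?thesis using 1 insert.IH by simp
    next
      case False
      have "EE e (insert m (insert i J)) = wedge (e m) (EE e (insert i J))"
        by (rule EE_Min) (use insert 3 in auto)
      moreover have "shuffle_sign {i} ({m} \<union> J) = shuffle_sign {i} {m} * shuffle_sign {i} J"
        by (rule shuffle_sign_Un_right) (use mJ in auto)
      ultimately show ?thesis using 1 insert.IH False 3
        by (simp add: wedge_linear shuffle_sign_single insert_commute fscale_neg)
    qed
  qed
qed

lemma EE_wedge:
  assumes e: "\<And>i. one_form (e i)" and "finite I" "finite J"
  shows "wedge (EE e I) (EE e J) = (if I \<inter> J = {} then fscale (shuffle_sign I J) (EE e (I \<union> J)) else 0)"
  using assms(2)
proof (induction I rule: finite_induct_Min)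
  case empty
  have "wedge (func_form 1) (EE e J) = EE e J"
    using wedge_list_append[of "[]" "map e (sorted_list_of_set J)"] by (simp add: EE_def)
  then show ?case by (simp add: fscale_simps)
next
  case (insert m I)
  have mI: "m \<notin> I" using insert by blast
  have E: "wedge (EE e (insert m I)) (EE e J) = wedge (e m) (wedge (EE e I) (EE e J))"
    using insert by (simp add: EE_Min wedge_assoc)
  show ?case
  proof (cases "I \<inter> J = {}")
    case True
    then have 1: "wedge (EE e (insert m I)) (EE e J) = fscale (shuffle_sign I J) (wedge (e m) (EE e (I \<union> J)))"
      using insert.IH by (simp add: E wedge_linear)
    show ?thesis
    proof (cases "m \<in> J")
      case True
      then show ?thesis using 1 insert(1) assms(3) e by (simp add: EE_insert fscale_simps)
    next
      case False
      have "shuffle_sign ({m} \<union> I) J = shuffle_sign {m} J * shuffle_sign I J"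
        by (rule shuffle_sign_Un_left) (use mI insert(1) in auto)
      moreover have "shuffle_sign {m} (I \<union> J) = shuffle_sign {m} I * shuffle_sign {m} J"
        by (rule shuffle_sign_Un_right) (use True in auto)
      moreover have "shuffle_sign {m} I = 1"
        by (rule shuffle_sign_less) (use insert(2) in auto)
      ultimately show ?thesis using 1 insert(1) assms(3) mI False True e
        by (simp add: EE_insert mult.commute flip: fscale_simps)
    qed
  next
    case False
    then show ?thesis using insert.IH E by auto
  qed
qed

text \<open>Sorting the factors costs a sign, and a repeated factor gives 0. It suffices to know
  that the scalar lies in a set of complex constants, because then it acts on cohomology.\<close>

lemma EE_eq_wedge_list:
  fixes e :: "nat \<Rightarrow> form"
  assumes e: "\<And>i. one_form (e i)"
  shows "\<exists>s\<in>{0, 1, -1}. wedge_list (map e js) = fscale s (EE e (set js))"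
proof (induction js)
  case (Cons j js)
  then obtain s where s: "s \<in> {0, 1, -1}" "wedge_list (map e js) = fscale s (EE e (set js))" by blast
  then have "wedge_list (map e (j # js)) = fscale s (wedge (e j) (EE e (set js)))"
    by (simp add: wedge_linear)
  also have "\<dots> = fscale (s * (if j \<in> set js then 0 else shuffle_sign {j} (set js))) (EE e (set (j # js)))"
    using e by (simp add: EE_insert fscale_simps)
  finally have eq: "wedge_list (map e (j # js)) =
    fscale (s * (if j \<in> set js then 0 else shuffle_sign {j} (set js))) (EE e (set (j # js)))" .
  have "s * (if j \<in> set js then 0 else shuffle_sign {j} (set js)) \<in> {0, 1, -1}"
    using s(1) shuffle_sign_cases[of "{j}" "set js"] by auto
  with eq show ?case by blast
qed (auto simp: fscale_simps)

lemma EE_wedge_eq_0: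
  fixes e :: "nat \<Rightarrow> form"
  assumes e: "\<And>i. one_form (e i)" and "\<not> distinct js"
  shows "wedge_list (map e js) = 0"
  using assms(2)
proof (induction js)
  case (Cons j js)
  show ?case
  proof (cases "distinct js")
    case True
    then have j: "j \<in> set js" using Cons.prems by simp
    obtain s where "wedge_list (map e js) = fscale s (EE e (set js))"
      using EE_eq_wedge_list[of e js] e by blast
    then show ?thesis using j e by (simp add: wedge_linear EE_insert fscale_simps)
  qed (use Cons.IH in simp)
qed simp

definition unit_form :: "nat set \<Rightarrow> form" where
  "unit_form I = (\<lambda>K. if K = I then 1 else 0)"

lemma EE_unit: "finite I \<Longrightarrow> EE (\<lambda>i. dfun (rvar i)) I = unit_form I"
proof (induction I rule: finite_induct_Min)
  case empty
  then show ?case by (auto simp: unit_form_def func_form_def)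
next
  case (insert m I)
  have mI: "m \<notin> I" using insert by blast
  have "wedge (dfun (rvar m)) (unit_form I) K = unit_form (insert m I) K" for K
  proof (cases "finite K \<and> m \<in> K")
    case True
    have "wedge (dfun (rvar m)) (unit_form I) K = (\<Sum>i\<in>K. if i = m then shuffle_sign {m} (K - {m}) * unit_form I (K - {m}) else 0)"
      unfolding wedge_one_form[OF one_form_dfun] by (rule sum.cong) (auto simp: rat_pd_rvar)
    also have "\<dots> = shuffle_sign {m} (K - {m}) * unit_form I (K - {m})" using True by simp
    also have "\<dots> = unit_form (insert m I) K"
    proof (cases "K = insert m I")
      case True
      then have "K - {m} = I" using mI by auto
      moreover have "shuffle_sign {m} I = 1" by (rule shuffle_sign_less) (use insert(2) in auto)
      ultimately show ?thesis using True by (simp add: unit_form_def)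
    next
      case False
      then have "K - {m} \<noteq> I" using \<open>finite K \<and> m \<in> K\<close> by auto
      then show ?thesis using False by (simp add: unit_form_def)
    qed
    finally show ?thesis .
  next
    case False
    then have "K \<noteq> insert m I" using insert(1) by auto
    moreover have "wedge (dfun (rvar m)) (unit_form I) K = 0"
      unfolding wedge_one_form[OF one_form_dfun] using False
      by (cases "finite K") (auto simp: rat_pd_rvar intro!: sum.neutral)
    ultimately show ?thesis by (simp add: unit_form_def)
  qed
  then show ?case using insert by (auto simp: EE_Min)
qed

text \<open>The sign of a list of indices, read off from the expansion of a product of 1-forms.\<close>

fun eps :: "nat list \<Rightarrow> ratfun" where
  "eps [] = 1"
| "eps (j # js) = shuffle_sign {j} (set js) * eps js"

text \<open>The Leibniz formula for a determinant: expand along the first 1-form and collect the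
  permutations of \<open>K\<close> by their first entry.\<close>

lemma wedge_list_expand:
  assumes "\<forall>\<eta>\<in>set \<eta>s. one_form \<eta>" "finite K" "card K = length \<eta>s"
  shows "wedge_list \<eta>s K = (\<Sum>js\<in>permutations_of_set K. eps js * (\<Prod>i<length \<eta>s. (\<eta>s ! i) {js ! i}))"
  using assms
proof (induction \<eta>s arbitrary: K)
  case Nil
  then show ?case by (simp add: func_form_def)
next
  case (Cons \<eta> \<eta>s)
  then have ne: "K \<noteq> {}" by auto
  have "wedge_list (\<eta> # \<eta>s) K = (\<Sum>j\<in>K. shuffle_sign {j} (K - {j}) * \<eta> {j} * wedge_list \<eta>s (K - {j}))"
    using Cons.prems by (simp add: wedge_one_form)
  also have "\<dots> = (\<Sum>j\<in>K. \<Sum>js\<in>permutations_of_set (K - {j}).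
      eps (j # js) * (\<Prod>i<length (\<eta> # \<eta>s). ((\<eta> # \<eta>s) ! i) {(j # js) ! i}))"
  proof (rule sum.cong[OF refl])
    fix j assume j: "j \<in> K"
    then have "wedge_list \<eta>s (K - {j}) = (\<Sum>js\<in>permutations_of_set (K - {j}). eps js * (\<Prod>i<length \<eta>s. (\<eta>s ! i) {js ! i}))"
      using Cons.prems by (intro Cons.IH) auto
    then show "shuffle_sign {j} (K - {j}) * \<eta> {j} * wedge_list \<eta>s (K - {j}) =
      (\<Sum>js\<in>permutations_of_set (K - {j}). eps (j # js) * (\<Prod>i<length (\<eta> # \<eta>s). ((\<eta> # \<eta>s) ! i) {(j # js) ! i}))"
      by (auto simp: sum_distrib_left prod.lessThan_Suc_shift permutations_of_set_def mult_ac intro!: sum.cong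
        simp del: prod.lessThan_Suc)
  qed
  also have "\<dots> = (\<Sum>js\<in>permutations_of_set K. eps js * (\<Prod>i<length (\<eta> # \<eta>s). ((\<eta> # \<eta>s) ! i) {js ! i}))"
    unfolding permutations_of_set_nonempty[OF ne] using Cons.prems(2)
    by (subst sum.UNION_disjoint) (auto simp: sum.reindex inj_on_def)
  finally show ?case .
qed

lemma eps_sorted: "sorted js \<Longrightarrow> distinct js \<Longrightarrow> eps js = 1"
  by (induction js) (auto intro!: shuffle_sign_less simp: less_le)

lemma eps_cases: "eps js = 1 \<or> eps js = - 1"
  by (induction js) (use shuffle_sign_cases in force)+

lemma wedge_list_degree:
  assumes "\<forall>\<eta>\<in>set \<eta>s. one_form \<eta>" "wedge_list \<eta>s K \<noteq> 0"
  shows "finite K \<and> card K = length \<eta>s"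
  using assms
proof (induction \<eta>s arbitrary: K)
  case Nil
  then show ?case by (simp add: func_form_def split: if_splits)
next
  case (Cons \<eta> \<eta>s)
  have "(\<Sum>j\<in>K. shuffle_sign {j} (K - {j}) * \<eta> {j} * wedge_list \<eta>s (K - {j})) \<noteq> 0"
    using Cons.prems by (simp add: wedge_one_form)
  then obtain j where j: "j \<in> K" "wedge_list \<eta>s (K - {j}) \<noteq> 0"
    by (metis (no_types, lifting) mult_zero_right sum.neutral)
  then have *: "finite (K - {j})" "card (K - {j}) = length \<eta>s"
    using Cons.IH[of "K - {j}"] Cons.prems(1) by auto
  then have K: "finite K" using finite_Diff2[of "{j}" K] by blast
  have "card K = Suc (card (K - {j}))" using K j(1) by (rule card.remove)
  then show ?case using K * by simp
qed

subsection \<open>Supports and degrees\<close>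

definition supported :: "nat \<Rightarrow> form \<Rightarrow> bool" where
  "supported r \<eta> \<longleftrightarrow> (\<forall>I. \<eta> I \<noteq> 0 \<longrightarrow> I \<subseteq> {1..r})"

lemma supported_fscale: "supported r \<eta> \<Longrightarrow> supported r (fscale f \<eta>)"
  unfolding supported_def fscale_def by auto

lemma supported_func_form: "supported r (func_form f)"
  unfolding supported_def func_form_def by auto

lemma supported_wedge:
  assumes "supported r \<eta>" "supported r \<zeta>"
  shows "supported r (wedge \<eta> \<zeta>)"
  unfolding supported_def
proof (intro allI impI)
  fix K assume "wedge \<eta> \<zeta> K \<noteq> 0"
  then obtain I where I: "I \<subseteq> K" "shuffle_sign I (K - I) * \<eta> I * \<zeta> (K - I) \<noteq> 0"
    unfolding wedge_def by (metis (no_types, lifting) Pow_iff sum.neutral)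
  then have "\<eta> I \<noteq> 0" "\<zeta> (K - I) \<noteq> 0" by auto
  then have "I \<subseteq> {1..r}" "K - I \<subseteq> {1..r}" using assms unfolding supported_def by blast+
  then show "K \<subseteq> {1..r}" by blast
qed

lemma supported_dfun:
  assumes "f \<in> fracs {1..r}"
  shows "supported r (dfun f)"
  unfolding supported_def
proof (intro allI impI)
  fix I assume "dfun f I \<noteq> 0"
  then obtain i where "I = {i}" "rat_pd i f \<noteq> 0" by (auto simp: dfun_eq split: if_splits)
  then show "I \<subseteq> {1..r}" using rat_pd_notin[OF assms, of i] by blast
qed

lemma supported_wedge_list: "(\<forall>\<eta>\<in>set \<eta>s. supported r \<eta>) \<Longrightarrow> supported r (wedge_list \<eta>s)"
  by (induction \<eta>s) (auto simp: supported_func_form supported_wedge)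

lemma rational_forms_supported: "\<eta> \<in> rational_forms r p \<Longrightarrow> supported r \<eta>"
  by (auto simp: rational_forms_def supported_def)

lemma rational_forms_one_form: "\<eta> \<in> rational_forms r 1 \<Longrightarrow> one_form \<eta>"
  unfolding rational_forms_def one_form_def by (auto simp: card_1_singleton_iff)

lemma rational_forms_wedge:
  assumes \<eta>: "\<eta> \<in> rational_forms r p" and \<zeta>: "\<zeta> \<in> rational_forms r q"
  shows "wedge \<eta> \<zeta> \<in> rational_forms r (p + q)"
proof -
  have "wedge \<eta> \<zeta> K \<in> ratfuns r" for K
  proof -
    have "shuffle_sign I J \<in> fracs {1..r}" for I J
      using shuffle_sign_cases[of I J] by (auto simp: fracs_closed)
    then show ?thesis
      using \<eta> \<zeta> unfolding wedge_def rational_forms_def ratfuns_eq by (auto intro!: fracs_sum fracs_closed(6))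
  qed
  moreover have "K \<subseteq> {1..r} \<and> card K = p + q" if "wedge \<eta> \<zeta> K \<noteq> 0" for K
  proof -
    have K: "K \<subseteq> {1..r}"
      using supported_wedge[OF \<eta>[THEN rational_forms_supported] \<zeta>[THEN rational_forms_supported]] that
      unfolding supported_def by blast
    then have "finite K" by (rule finite_subset) simp
    from that obtain I where I: "I \<subseteq> K" "shuffle_sign I (K - I) * \<eta> I * \<zeta> (K - I) \<noteq> 0"
      unfolding wedge_def by (metis (no_types, lifting) Pow_iff sum.neutral)
    then have "\<eta> I \<noteq> 0" "\<zeta> (K - I) \<noteq> 0" by auto
    then have "card I = p" "card (K - I) = q" using \<eta> \<zeta> unfolding rational_forms_def by blast+
    then show ?thesis using K I(1) \<open>finite K\<close> by (metis card_Diff_subset card_mono finite_subset le_add_diff_inverse)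
  qed
  ultimately show ?thesis by (simp add: rational_forms_def)
qed

lemma rational_forms_dfun:
  assumes "f \<in> fracs {1..r}"
  shows "dfun f \<in> rational_forms r 1"
  using supported_dfun[OF assms] fracs_rat_pd[OF assms]
  unfolding rational_forms_def supported_def ratfuns_eq by (auto simp: dfun_eq fracs_closed split: if_splits)

lemma rational_forms_func_form: "f \<in> fracs {1..r} \<Longrightarrow> func_form f \<in> rational_forms r 0"
  unfolding rational_forms_def func_form_def ratfuns_eq by (auto simp: fracs_closed split: if_splits)

lemma rational_forms_fscale: "f \<in> fracs {1..r} \<Longrightarrow> \<eta> \<in> rational_forms r p \<Longrightarrow> fscale f \<eta> \<in> rational_forms r p"
  unfolding rational_forms_def fscale_def ratfuns_eq by (auto simp: fracs_closed)

lemma rational_forms_ext_d: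
  assumes \<eta>: "\<eta> \<in> rational_forms r p"
  shows "ext_d \<eta> \<in> rational_forms r (Suc p)"
proof -
  have coeff: "\<eta> I \<in> fracs {1..r}" for I using \<eta> by (simp add: rational_forms_def ratfuns_eq)
  have "ext_d \<eta> K \<in> ratfuns r" for K
  proof -
    have "shuffle_sign I J \<in> fracs {1..r}" for I J
      using shuffle_sign_cases[of I J] by (auto simp: fracs_closed)
    then show ?thesis
      using coeff unfolding ext_d_def ratfuns_eq by (auto intro!: fracs_sum fracs_closed(6) fracs_rat_pd)
  qed
  moreover have "K \<subseteq> {1..r} \<and> card K = Suc p" if "ext_d \<eta> K \<noteq> 0" for K
  proof -
    from that obtain i where i: "i \<in> K" "shuffle_sign {i} (K - {i}) * rat_pd i (\<eta> (K - {i})) \<noteq> 0"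
      unfolding ext_d_def by (metis (no_types, lifting) sum.neutral)
    then have pd: "rat_pd i (\<eta> (K - {i})) \<noteq> 0" and "\<eta> (K - {i}) \<noteq> 0" by auto
    then have 1: "K - {i} \<subseteq> {1..r}" "card (K - {i}) = p" using \<eta> unfolding rational_forms_def by blast+
    have "i \<in> {1..r}" using pd rat_pd_notin[OF coeff] by blast
    with 1 i(1) have "K \<subseteq> {1..r}" by blast
    moreover then have "finite K" by (rule finite_subset) simp
    then have "card K = Suc (card (K - {i}))" using i(1) by (rule card.remove)
    ultimately show ?thesis using 1 by simp
  qed
  ultimately show ?thesis by (simp add: rational_forms_def)
qed

lemma rational_forms_above: "p > r \<Longrightarrow> \<eta> \<in> rational_forms r p \<Longrightarrow> \<eta> = 0"
proof
  fix K assume p: "p > r" and \<eta>: "\<eta> \<in> rational_forms r p"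
  have "\<not> (K \<subseteq> {1..r} \<and> card K = p)"
    using p card_mono[of "{1..r}" K] by auto
  then show "\<eta> K = 0 K" using \<eta> unfolding rational_forms_def zero_fun_apply by blast
qed

subsection \<open>Pullback of forms\<close>

text \<open>Only the coefficients at subsets of \<open>{1..r}\<close> enter, so this is the pullback
  for forms with support in these variables; hence the conditions \<open>supported\<close> below.
  The functions \<open>x i\<close> may involve other variables.\<close>

definition pb :: "nat \<Rightarrow> (nat \<Rightarrow> ratfun) \<Rightarrow> form \<Rightarrow> form" where
  "pb r x \<eta> = (\<Sum>I\<in>Pow {1..r}. fscale (rsub x (\<eta> I)) (EE (\<lambda>i. dfun (x i)) I))"

lemma form_sum_apply: "sum g A K = (\<Sum>a\<in>A. g a K)" for g :: "_ \<Rightarrow> form"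
  by (induction A rule: infinite_finite_induct) (simp_all add: form_apply)

lemma one_form_sum: "(\<And>a. a \<in> A \<Longrightarrow> one_form (g a)) \<Longrightarrow> one_form (sum g A)"
proof (induction A rule: infinite_finite_induct)
  case (insert a A)
  then show ?case by (simp add: one_form_add)
qed (simp_all add: one_form_def zero_fun_apply)

lemma form_decompose:
  assumes "supported r \<eta>"
  shows "\<eta> = (\<Sum>I\<in>Pow {1..r}. fscale (\<eta> I) (unit_form I))"
proof
  fix K
  have "(\<Sum>I\<in>Pow {1..r}. fscale (\<eta> I) (unit_form I)) K = (\<Sum>I\<in>Pow {1..r}. if I = K then \<eta> K else 0)"
    unfolding form_sum_apply by (rule sum.cong) (auto simp: fscale_def unit_form_def)
  also have "\<dots> = \<eta> K" using assms by (auto simp: supported_def)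
  finally show "\<eta> K = (\<Sum>I\<in>Pow {1..r}. fscale (\<eta> I) (unit_form I)) K" by simp
qed

context inj_subst
begin

abbreviation "E \<equiv> EE (\<lambda>i. dfun (x i))"

lemma pb_add: "pb r x (\<eta> + \<zeta>) = pb r x \<eta> + pb r x \<zeta>"
  by (simp add: pb_def plus_fun_apply rsub_hom fscale_simps sum.distrib)

lemma pb_fscale: "pb r x (fscale f \<eta>) = fscale (rsub x f) (pb r x \<eta>)"
  by (simp add: pb_def fscale_sum rsub_hom flip: fscale_simps) (simp add: fscale_def rsub_hom)

lemma pb_zero: "pb r x 0 = 0"
  by (simp add: pb_def zero_fun_apply rsub_hom fscale_simps)

lemma pb_sum: "pb r x (sum g A) = (\<Sum>a\<in>A. pb r x (g a))"
  by (induction A rule: infinite_finite_induct) (simp_all add: pb_zero pb_add)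

lemma pb_unit: "I \<subseteq> {1..r} \<Longrightarrow> pb r x (unit_form I) = E I"
proof -
  assume I: "I \<subseteq> {1..r}"
  have "pb r x (unit_form I) = (\<Sum>J\<in>Pow {1..r}. if J = I then E I else 0)"
    unfolding pb_def by (rule sum.cong) (auto simp: unit_form_def rsub_hom fscale_simps)
  then show ?thesis using I by simp
qed

lemma pb_func_form: "pb r x (func_form f) = func_form (rsub x f)"
proof -
  have "func_form f = fscale f (unit_form {})"
    by (auto simp: func_form_def unit_form_def fscale_def)
  then have "pb r x (func_form f) = fscale (rsub x f) (func_form 1)"
    by (simp add: pb_fscale pb_unit)
  also have "\<dots> = func_form (rsub x f)" by (auto simp: func_form_def fscale_def)
  finally show ?thesis .
qed

lemma rsub_sign: "rsub x (shuffle_sign I J) = shuffle_sign I J"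
  using shuffle_sign_cases[of I J] by (auto simp: rsub_hom)

lemma pb_wedge:
  assumes "supported r \<eta>" "supported r \<zeta>"
  shows "pb r x (wedge \<eta> \<zeta>) = wedge (pb r x \<eta>) (pb r x \<zeta>)"
proof -
  let ?R = "Pow {1..r}" and ?h = "\<lambda>\<eta> I. rsub x (\<eta> I)"
  have fin: "finite I" if "I \<subseteq> {1..r}" for I using that by (rule finite_subset) simp
  have "wedge (pb r x \<eta>) (pb r x \<zeta>) =
     (\<Sum>I\<in>?R. \<Sum>J\<in>?R. fscale (?h \<eta> I * ?h \<zeta> J) (wedge (E I) (E J)))"
    unfolding pb_def wedge_sum_left unfolding wedge_sum_right
    by (intro sum.cong refl) (simp only: wedge_linear wedge_left_linear, simp add: fscale_def mult_ac)
  \<comment> \<open>Overlapping \<open>I\<close> and \<open>J\<close> contribute 0 because a factor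
    is repeated. The disjoint pairs are then regrouped by their union, and
    \<open>shuffle_sign I J\<close> turns into the sign in the definition of
    \<open>wedge\<close>.\<close>
  also have "\<dots> = (\<Sum>I\<in>?R. \<Sum>J\<in>Pow ({1..r} - I). fscale (?h \<eta> I * ?h \<zeta> J * shuffle_sign I J) (E (I \<union> J)))"
  proof (rule sum.cong[OF refl])
    fix I assume I: "I \<in> ?R"
    have "(\<Sum>J\<in>?R. fscale (?h \<eta> I * ?h \<zeta> J) (wedge (E I) (E J))) =
      (\<Sum>J\<in>Pow ({1..r} - I). fscale (?h \<eta> I * ?h \<zeta> J) (wedge (E I) (E J)))"
      by (rule sum.mono_neutral_right) (use I fin in \<open>auto simp: EE_wedge one_form_dfun fscale_simps\<close>)
    also have "\<dots> = (\<Sum>J\<in>Pow ({1..r} - I). fscale (?h \<eta> I * ?h \<zeta> J * shuffle_sign I J) (E (I \<union> J)))"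
    proof (rule sum.cong[OF refl])
      fix J assume J: "J \<in> Pow ({1..r} - I)"
      then have "I \<inter> J = {}" by auto
      moreover have "finite I" using I by (intro fin) simp
      moreover have "finite J" using J by (intro fin) blast
      ultimately show "fscale (?h \<eta> I * ?h \<zeta> J) (wedge (E I) (E J)) = fscale (?h \<eta> I * ?h \<zeta> J * shuffle_sign I J) (E (I \<union> J))"
        by (simp add: EE_wedge one_form_dfun fscale_simps)
    qed
    finally show "(\<Sum>J\<in>?R. fscale (?h \<eta> I * ?h \<zeta> J) (wedge (E I) (E J))) = \<dots>" .
  qed
  also have "\<dots> = (\<Sum>(I, J)\<in>(SIGMA I:?R. Pow ({1..r} - I)). fscale (?h \<eta> I * ?h \<zeta> J * shuffle_sign I J) (E (I \<union> J)))"
    by (rule sum.Sigma) auto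
  also have "\<dots> = (\<Sum>(K, I)\<in>(SIGMA K:?R. Pow K). fscale (?h \<eta> I * ?h \<zeta> (K - I) * shuffle_sign I (K - I)) (E K))"
  proof (rule sum.reindex_bij_witness[of _ "\<lambda>(K, I). (I, K - I)" "\<lambda>(I, J). (I \<union> J, I)"])
    fix a assume "a \<in> (SIGMA I:?R. Pow ({1..r} - I))"
    then obtain I J where a: "a = (I, J)" "I \<subseteq> {1..r}" "J \<subseteq> {1..r} - I" by blast
    have "I \<union> J - I = J" using a by auto
    then show "(case case a of (I, J) \<Rightarrow> (I \<union> J, I) of (K, I) \<Rightarrow> fscale (?h \<eta> I * ?h \<zeta> (K - I) * shuffle_sign I (K - I)) (E K)) =
        (case a of (I, J) \<Rightarrow> fscale (?h \<eta> I * ?h \<zeta> J * shuffle_sign I J) (E (I \<union> J)))"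
      by (simp add: a)
  qed auto
  also have "\<dots> = (\<Sum>K\<in>?R. \<Sum>I\<in>Pow K. fscale (?h \<eta> I * ?h \<zeta> (K - I) * shuffle_sign I (K - I)) (E K))"
    by (rule sum.Sigma[symmetric]) (auto dest: finite_subset)
  also have "\<dots> = pb r x (wedge \<eta> \<zeta>)"
    unfolding pb_def wedge_def by (simp add: rsub_hom rsub_sign fscale_sum_left mult_ac)
  finally show ?thesis by simp
qed

lemma pb_wedge_list: "(\<forall>\<eta>\<in>set \<eta>s. supported r \<eta>) \<Longrightarrow> pb r x (wedge_list \<eta>s) = wedge_list (map (pb r x) \<eta>s)"
proof (induction \<eta>s)
  case Nil
  then show ?case by (simp add: pb_func_form rsub_hom)
next
  case (Cons \<eta> \<eta>s)
  then show ?case by (simp add: pb_wedge supported_wedge_list)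
qed

lemma pb_one_form:
  assumes "one_form \<eta>" "supported r \<eta>"
  shows "pb r x \<eta> = (\<Sum>i\<in>{1..r}. fscale (rsub x (\<eta> {i})) (dfun (x i)))"
proof -
  have "pb r x \<eta> = (\<Sum>I\<in>(\<lambda>i. {i}) ` {1..r}. fscale (rsub x (\<eta> I)) (E I))"
    unfolding pb_def
  proof (rule sum.mono_neutral_right)
    show "\<forall>I\<in>Pow {1..r} - (\<lambda>i. {i}) ` {1..r}. fscale (rsub x (\<eta> I)) (E I) = 0"
    proof
      fix I assume "I \<in> Pow {1..r} - (\<lambda>i. {i}) ` {1..r}"
      then have "\<eta> I = 0" using assms(1) unfolding one_form_def by blast
      then show "fscale (rsub x (\<eta> I)) (E I) = 0" by (simp add: rsub_hom fscale_simps)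
    qed
  qed auto
  also have "\<dots> = (\<Sum>i\<in>{1..r}. fscale (rsub x (\<eta> {i})) (E {i}))"
    by (subst sum.reindex) (auto simp: inj_on_def)
  also have "\<dots> = (\<Sum>i\<in>{1..r}. fscale (rsub x (\<eta> {i})) (dfun (x i)))"
    by (simp add: EE_def wedge_one_right one_form_dfun)
  finally show ?thesis .
qed

lemma pb_dfun:
  assumes "f \<in> fracs {1..r}"
  shows "pb r x (dfun f) = dfun (rsub x f)"
proof (rule one_form_eqI)
  show "one_form (pb r x (dfun f))"
    unfolding pb_one_form[OF one_form_dfun supported_dfun[OF assms]]
    by (intro one_form_sum one_form_fscale one_form_dfun)
  show "pb r x (dfun f) {j} = dfun (rsub x f) {j}" for j
    unfolding pb_one_form[OF one_form_dfun supported_dfun[OF assms]]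
    by (simp add: form_sum_apply fscale_def rat_pd_rsub[OF assms])
qed (rule one_form_dfun)

lemma ext_d_unit: "finite I \<Longrightarrow> ext_d (unit_form I) = 0"
  using ext_d_wedge_list_dfun[of rvar "sorted_list_of_set I"] by (simp add: EE_unit[symmetric] EE_def)

text \<open>Decompose into functions times the closed forms \<open>unit_form I\<close>; only
  differentials of the coefficients remain, and for them the claim is the chain rule
  \<open>pb_dfun\<close>.\<close>

lemma pb_ext_d:
  assumes "\<eta> \<in> rational_forms r p"
  shows "pb r x (ext_d \<eta>) = ext_d (pb r x \<eta>)"
proof -
  have c: "\<eta> I \<in> fracs {1..r}" for I using assms by (simp add: rational_forms_def ratfuns_eq)
  have fin: "finite I" if "I \<in> Pow {1..r}" for I using that by (auto intro: finite_subset)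
  have su: "supported r (unit_form I)" if "I \<in> Pow {1..r}" for I
    using that by (auto simp: supported_def unit_form_def)
  have "ext_d \<eta> = (\<Sum>I\<in>Pow {1..r}. wedge (dfun (\<eta> I)) (unit_form I))"
    by (subst form_decompose[OF rational_forms_supported[OF assms]])
      (auto simp: ext_d_sum ext_d_fscale ext_d_unit fin fscale_simps intro!: sum.cong)
  then have "pb r x (ext_d \<eta>) = (\<Sum>I\<in>Pow {1..r}. wedge (dfun (rsub x (\<eta> I))) (E I))"
    by (simp add: pb_sum pb_wedge supported_dfun[OF c] su pb_dfun[OF c] pb_unit)
  also have "\<dots> = ext_d (pb r x \<eta>)"
    unfolding pb_def ext_d_sum ext_d_fscale
    by (rule sum.cong) (simp_all add: EE_def ext_d_wedge_list_dfun fscale_simps)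
  finally show ?thesis .
qed

lemma pb_degree:
  assumes "\<eta> \<in> rational_forms r p" "pb r x \<eta> K \<noteq> 0"
  shows "finite K \<and> card K = p"
proof -
  have "(\<Sum>I\<in>Pow {1..r}. rsub x (\<eta> I) * E I K) \<noteq> 0"
    using assms(2) by (simp add: pb_def form_sum_apply fscale_def)
  then obtain I where I: "I \<subseteq> {1..r}" "rsub x (\<eta> I) * E I K \<noteq> 0"
    by (metis (no_types, lifting) Pow_iff sum.neutral)
  then have "\<eta> I \<noteq> 0" "E I K \<noteq> 0" by (auto simp: rsub_hom)
  then have "card I = p" using assms(1) unfolding rational_forms_def by blast
  moreover have "finite K \<and> card K = length (map (\<lambda>i. dfun (x i)) (sorted_list_of_set I))"
    using \<open>E I K \<noteq> 0\<close> unfolding EE_def by (intro wedge_list_degree) (auto simp: one_form_dfun)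
  moreover have "finite I" using I(1) by (rule finite_subset) simp
  ultimately show ?thesis by simp
qed

end

text \<open>Applied with \<open>y\<close> a permutation of the variables and \<open>z = x\<close>
  the quotient map: it then says that pulled back forms are invariant under permutations.\<close>

lemma pb_pb:
  assumes x: "inj_subst x" and y: "inj_subst y" and z: "inj_subst z"
    and xf: "\<And>i. i \<in> {1..r} \<Longrightarrow> x i \<in> fracs {1..r}"
    and yx: "\<And>i. i \<in> {1..r} \<Longrightarrow> rsub y (x i) = z i" and \<eta>: "\<eta> \<in> rational_forms r p"
  shows "pb r y (pb r x \<eta>) = pb r z \<eta>"
proof -
  have c: "\<eta> I \<in> fracs {1..r}" for I using \<eta> by (simp add: rational_forms_def ratfuns_eq)
  have "pb r y (EE (\<lambda>i. dfun (x i)) I) = EE (\<lambda>i. dfun (z i)) I" if I: "I \<in> Pow {1..r}" for I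
  proof -
    have sI: "set (sorted_list_of_set I) \<subseteq> {1..r}"
      using I by (cases "finite I") auto
    have "pb r y (EE (\<lambda>i. dfun (x i)) I) = wedge_list (map (pb r y) (map (\<lambda>i. dfun (x i)) (sorted_list_of_set I)))"
      unfolding EE_def by (rule inj_subst.pb_wedge_list[OF y]) (use sI xf supported_dfun in auto)
    also have "map (pb r y) (map (\<lambda>i. dfun (x i)) (sorted_list_of_set I)) = map (\<lambda>i. dfun (z i)) (sorted_list_of_set I)"
      using sI xf by (auto simp: inj_subst.pb_dfun[OF y] yx subset_iff)
    finally show ?thesis by (simp add: EE_def)
  qed
  moreover have "rsub y (rsub x (\<eta> I)) = rsub z (\<eta> I)" for I
    by (rule rsub_comp[OF y x z yx c])
  ultimately show ?thesis
    unfolding pb_def[of r x] pb_def[of r z] inj_subst.pb_sum[OF y] inj_subst.pb_fscale[OF y]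
    by (intro sum.cong) auto
qed

section \<open>One variable: partial fractions and the twisted cohomology of a punctured
  line\<close>

subsection \<open>Functions of one variable with prescribed poles\<close>

text \<open>
  An element of \<open>FF Z\<close> is a function of one variable which is regular off \<open>Z \<union> {\<infinity>}\<close>,
  given simultaneously as a rational function \<open>f j\<close> of each of the variables \<open>rvar j\<close>.
\<close>

inductive_set FF :: "complex set \<Rightarrow> (nat \<Rightarrow> ratfun) set" for Z where
  const: "(\<lambda>j. rconst c) \<in> FF Z"
| var: "(\<lambda>j. rvar j) \<in> FF Z"
| inv: "a \<in> Z \<Longrightarrow> (\<lambda>j. inverse (rvar j - rconst a)) \<in> FF Z"
| add: "f \<in> FF Z \<Longrightarrow> g \<in> FF Z \<Longrightarrow> (\<lambda>j. f j + g j) \<in> FF Z"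
| mult: "f \<in> FF Z \<Longrightarrow> g \<in> FF Z \<Longrightarrow> (\<lambda>j. f j * g j) \<in> FF Z"

lemma FF_zero: "(\<lambda>j. 0) \<in> FF Z" and FF_one: "(\<lambda>j. 1) \<in> FF Z"
  using FF.const[of 0 Z] FF.const[of 1 Z] by (simp_all add: rconst_simps)

lemma FF_scale: "f \<in> FF Z \<Longrightarrow> (\<lambda>j. rconst c * f j) \<in> FF Z"
  by (rule FF.mult[OF FF.const])

lemma FF_minus: "f \<in> FF Z \<Longrightarrow> (\<lambda>j. - f j) \<in> FF Z"
  using FF_scale[of f Z "-1"] by (simp add: rconst_hom)

lemma FF_sum: "(\<And>a. a \<in> A \<Longrightarrow> g a \<in> FF Z) \<Longrightarrow> (\<lambda>j. \<Sum>a\<in>A. g a j) \<in> FF Z"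
proof (induction A rule: infinite_finite_induct)
  case (insert a A)
  then have "(\<lambda>j. g a j + (\<Sum>a\<in>A. g a j)) \<in> FF Z" by (intro FF.add) auto
  then show ?case using insert by simp
qed (simp_all add: FF_zero)

lemma FF_power: "f \<in> FF Z \<Longrightarrow> (\<lambda>j. f j ^ m) \<in> FF Z"
  by (induction m) (simp_all add: FF_one FF.mult)

lemma rvar_minus_const_nonzero: "rvar j - rconst a \<noteq> 0"
proof -
  have "ev (\<lambda>_. a + 1) (rvar j - rconst a) = 1"
    using ev_diff[of UNIV "\<lambda>_. a + 1" "rvar j" "rconst a"] by (simp add: reg_var reg_const)
  then show ?thesis by (metis ev_0 zero_neq_one)
qed

lemma FF_fracs: "f \<in> FF Z \<Longrightarrow> j \<in> V \<Longrightarrow> f j \<in> fracs V"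
  by (induction f rule: FF.induct) (auto intro!: fracs_closed)

lemma FF_pd_other: "f \<in> FF Z \<Longrightarrow> i \<noteq> j \<Longrightarrow> rat_pd i (f j) = 0"
  using FF_fracs[of f Z j "{j}"] rat_pd_notin[of "f j" "{j}" i] by simp

lemma FF_pd: "f \<in> FF Z \<Longrightarrow> (\<lambda>j. rat_pd j (f j)) \<in> FF Z"
proof (induction f rule: FF.induct)
  case (const c)
  show ?case by (simp add: FF_zero)
next
  case var
  show ?case by (simp add: rat_pd_rvar FF_one)
next
  case (inv a)
  have "(\<lambda>j. - (inverse (rvar j - rconst a) * inverse (rvar j - rconst a))) \<in> FF Z"
    by (intro FF_minus FF.mult FF.inv inv)
  then show ?case by (simp add: rat_pd_inverse rat_pd_diff rat_pd_rvar)
next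
  case (add f g)
  then show ?case by (simp add: rat_pd_add FF.add)
next
  case (mult f g)
  then have "(\<lambda>j. rat_pd j (f j) * g j + f j * rat_pd j (g j)) \<in> FF Z" by (intro FF.add FF.mult)
  then show ?case by (simp add: rat_pd_mult)
qed

lemma FF_rsub:
  assumes "inj_subst x" "f \<in> FF Z" "x j = rvar k"
  shows "rsub x (f j) = f k"
  using assms(2) by (induction f rule: FF.induct)
    (simp_all add: inj_subst.rsub_hom[OF assms(1)] inj_subst.rsub_rconst[OF assms(1)] inj_subst.rsub_rvar[OF assms(1)] assms(3))

text \<open>The value as a function of one complex number, read off in the variable 0; by
  \<open>FF_ev\<close> every other variable gives the same value off \<open>Z\<close>.\<close>

definition fv :: "(nat \<Rightarrow> ratfun) \<Rightarrow> complex \<Rightarrow> complex" where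
  "fv f v = ev (\<lambda>_. v) (f 0)"

text \<open>The order of the quantifiers matters: one function \<phi> serves all points, all
  variables and all ambient sets of variables.\<close>

lemma FF_ev_aux:
  assumes "f \<in> FF Z"
  shows "\<exists>\<phi>. \<forall>c j V. c j \<notin> Z \<longrightarrow> j \<in> V \<longrightarrow> reg V c (f j) \<and> ev c (f j) = \<phi> (c j)"
  using assms
proof (induction f rule: FF.induct)
  case (const c)
  show ?case by (rule exI[of _ "\<lambda>_. c"]) (simp add: reg_const)
next
  case var
  show ?case by (rule exI[of _ "\<lambda>v. v"]) (simp add: reg_var)
next
  case (inv a)
  have "reg V c (inverse (rvar j - rconst a)) \<and> ev c (inverse (rvar j - rconst a)) = inverse (c j - a)"
    if "c j \<notin> Z" "j \<in> V" for c j V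
  proof -
    have 1: "reg V c (rvar j - rconst a)" "ev c (rvar j - rconst a) = c j - a"
      using that by (simp_all add: reg_diff reg_var reg_const ev_diff[where V = V])
    moreover have "c j - a \<noteq> 0" using that inv by auto
    ultimately show ?thesis by (simp add: reg_inverse ev_inverse[where V = V])
  qed
  then show ?case by (intro exI[of _ "\<lambda>v. inverse (v - a)"]) blast
next
  case (add f g)
  then obtain \<phi> \<gamma> where *: "\<And>c j V. c j \<notin> Z \<Longrightarrow> j \<in> V \<Longrightarrow> reg V c (f j) \<and> ev c (f j) = \<phi> (c j)"
    "\<And>c j V. c j \<notin> Z \<Longrightarrow> j \<in> V \<Longrightarrow> reg V c (g j) \<and> ev c (g j) = \<gamma> (c j)" by blast
  have "reg V c (f j + g j) \<and> ev c (f j + g j) = \<phi> (c j) + \<gamma> (c j)" if "c j \<notin> Z" "j \<in> V" for c j V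
    using *(1)[of c j V] *(2)[of c j V] that by (simp add: reg_add ev_add[where V = V])
  then show ?case by (intro exI[of _ "\<lambda>v. \<phi> v + \<gamma> v"]) blast
next
  case (mult f g)
  then obtain \<phi> \<gamma> where *: "\<And>c j V. c j \<notin> Z \<Longrightarrow> j \<in> V \<Longrightarrow> reg V c (f j) \<and> ev c (f j) = \<phi> (c j)"
    "\<And>c j V. c j \<notin> Z \<Longrightarrow> j \<in> V \<Longrightarrow> reg V c (g j) \<and> ev c (g j) = \<gamma> (c j)" by blast
  have "reg V c (f j * g j) \<and> ev c (f j * g j) = \<phi> (c j) * \<gamma> (c j)" if "c j \<notin> Z" "j \<in> V" for c j V
    using *(1)[of c j V] *(2)[of c j V] that by (simp add: reg_mult ev_mult[where V = V])
  then show ?case by (intro exI[of _ "\<lambda>v. \<phi> v * \<gamma> v"]) blast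
qed

lemma
  assumes "f \<in> FF Z" "c j \<notin> Z"
  shows FF_reg: "j \<in> V \<Longrightarrow> reg V c (f j)" and FF_ev: "ev c (f j) = fv f (c j)"
proof -
  obtain \<phi> where \<phi>: "\<And>c j V. c j \<notin> Z \<Longrightarrow> j \<in> V \<Longrightarrow> reg V c (f j) \<and> ev c (f j) = \<phi> (c j)"
    using FF_ev_aux[OF assms(1)] by blast
  show "j \<in> V \<Longrightarrow> reg V c (f j)" using \<phi> assms(2) by blast
  show "ev c (f j) = fv f (c j)"
    unfolding fv_def using \<phi>[of c j UNIV] \<phi>[of "\<lambda>_. c j" 0 UNIV] assms(2) by simp
qed

lemma fv_const [simp]: "fv (\<lambda>j. rconst c) v = c" and fv_var [simp]: "fv (\<lambda>j. rvar j) v = v"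
  by (simp_all add: fv_def)

lemma
  assumes "f \<in> FF Z" "g \<in> FF Z" "v \<notin> Z"
  shows fv_add: "fv (\<lambda>j. f j + g j) v = fv f v + fv g v"
    and fv_mult: "fv (\<lambda>j. f j * g j) v = fv f v * fv g v"
  unfolding fv_def using FF_reg[OF assms(1), of "\<lambda>_. v" 0 UNIV] FF_reg[OF assms(2), of "\<lambda>_. v" 0 UNIV] assms(3)
  by (simp_all add: ev_add[where V = UNIV] ev_mult[where V = UNIV])

lemma fv_inv: "v \<noteq> a \<Longrightarrow> fv (\<lambda>j. inverse (rvar j - rconst a)) v = inverse (v - a)"
  unfolding fv_def
  using ev_inverse[of UNIV "\<lambda>_. v" "rvar 0 - rconst a"] ev_diff[of UNIV "\<lambda>_. v" "rvar 0" "rconst a"]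
  by (simp add: reg_diff reg_var reg_const)

lemma fv_scale: "f \<in> FF Z \<Longrightarrow> v \<notin> Z \<Longrightarrow> fv (\<lambda>j. rconst c * f j) v = c * fv f v"
  using fv_mult[OF FF.const] by simp

lemma fv_power: "f \<in> FF Z \<Longrightarrow> v \<notin> Z \<Longrightarrow> fv (\<lambda>j. f j ^ m) v = fv f v ^ m"
  using fv_const[of 1] by (induction m) (simp_all add: fv_mult FF_power rconst_simps)

lemma fv_sum: "(\<And>a. a \<in> A \<Longrightarrow> g a \<in> FF Z) \<Longrightarrow> v \<notin> Z \<Longrightarrow> fv (\<lambda>j. \<Sum>a\<in>A. g a j) v = (\<Sum>a\<in>A. fv (g a) v)"
proof (induction A rule: infinite_finite_induct)
  case (insert a A)
  then have "fv (\<lambda>j. g a j + (\<Sum>a\<in>A. g a j)) v = fv (g a) v + fv (\<lambda>j. \<Sum>a\<in>A. g a j) v"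
    by (intro fv_add FF_sum) auto
  then show ?case using insert by simp
qed (use fv_const[of 0] in \<open>simp_all add: rconst_simps\<close>)

subsection \<open>Linear spans\<close>

text \<open>The scalars are the same for every \<open>j\<close>, so these are combinations of
  functions of one variable, whatever variable is inserted.\<close>

definition cs :: "('i \<Rightarrow> nat \<Rightarrow> ratfun) \<Rightarrow> 'i set \<Rightarrow> (nat \<Rightarrow> ratfun) set" where
  "cs g A = {f. \<exists>T c. finite T \<and> T \<subseteq> A \<and> f = (\<lambda>j. \<Sum>i\<in>T. rconst (c i) * g i j)}"

lemma csI: "finite T \<Longrightarrow> T \<subseteq> A \<Longrightarrow> (\<lambda>j. \<Sum>i\<in>T. rconst (c i) * g i j) \<in> cs g A"
  unfolding cs_def by blast

lemma cs_zero: "(\<lambda>j. 0) \<in> cs g A"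
  using csI[of "{}" A _ g] by simp

lemma cs_base: "i \<in> A \<Longrightarrow> (\<lambda>j. g i j) \<in> cs g A"
  using csI[of "{i}" A "\<lambda>_. 1" g] by (simp add: rconst_simps)

lemma cs_add:
  assumes "e \<in> cs g A" "f \<in> cs g A"
  shows "(\<lambda>j. e j + f j) \<in> cs g A"
proof -
  obtain T c T' c' where 1: "finite T" "T \<subseteq> A" "e = (\<lambda>j. \<Sum>i\<in>T. rconst (c i) * g i j)"
    and 2: "finite T'" "T' \<subseteq> A" "f = (\<lambda>j. \<Sum>i\<in>T'. rconst (c' i) * g i j)"
    using assms unfolding cs_def by blast
  let ?c = "\<lambda>i. (if i \<in> T then c i else 0)" and ?c' = "\<lambda>i. (if i \<in> T' then c' i else 0)"
  have "(\<Sum>i\<in>T. rconst (c i) * g i j) = (\<Sum>i\<in>T \<union> T'. rconst (?c i) * g i j)" for j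
    by (rule sum.mono_neutral_cong_left) (use 1 2 in \<open>auto simp: rconst_simps\<close>)
  moreover have "(\<Sum>i\<in>T'. rconst (c' i) * g i j) = (\<Sum>i\<in>T \<union> T'. rconst (?c' i) * g i j)" for j
    by (rule sum.mono_neutral_cong_left) (use 1 2 in \<open>auto simp: rconst_simps\<close>)
  ultimately have "(\<lambda>j. e j + f j) = (\<lambda>j. \<Sum>i\<in>T \<union> T'. rconst (?c i + ?c' i) * g i j)"
    unfolding 1(3) 2(3) by (simp add: rconst_simps(1) distrib_right sum.distrib)
  then show ?thesis using csI[of "T \<union> T'" A] 1 2 by auto
qed

lemma cs_scale:
  assumes "f \<in> cs g A"
  shows "(\<lambda>j. rconst a * f j) \<in> cs g A"
proof -
  obtain T c where 1: "finite T" "T \<subseteq> A" "f = (\<lambda>j. \<Sum>i\<in>T. rconst (c i) * g i j)"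
    using assms unfolding cs_def by blast
  have "(\<lambda>j. rconst a * f j) = (\<lambda>j. \<Sum>i\<in>T. rconst (a * c i) * g i j)"
    unfolding 1(3) by (simp add: sum_distrib_left rconst_simps mult.assoc)
  then show ?thesis using csI[of T A] 1 by auto
qed

lemma cs_sum: "(\<And>i. i \<in> T \<Longrightarrow> h i \<in> cs g A) \<Longrightarrow> (\<lambda>j. \<Sum>i\<in>T. h i j) \<in> cs g A"
proof (induction T rule: infinite_finite_induct)
  case (insert a T)
  then have "(\<lambda>j. h a j + (\<Sum>a\<in>T. h a j)) \<in> cs g A" by (intro cs_add) auto
  then show ?case using insert by simp
qed (simp_all add: cs_zero)

lemma cs_FF: "f \<in> cs g A \<Longrightarrow> (\<And>i. i \<in> A \<Longrightarrow> g i \<in> FF Z) \<Longrightarrow> f \<in> FF Z"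
  unfolding cs_def by (auto intro!: FF_sum FF_scale)

lemma cs_finite:
  assumes "f \<in> cs g A" "finite A"
  shows "\<exists>c. f = (\<lambda>j. \<Sum>i\<in>A. rconst (c i) * g i j)"
proof -
  obtain T c where 1: "finite T" "T \<subseteq> A" "f = (\<lambda>j. \<Sum>i\<in>T. rconst (c i) * g i j)"
    using assms(1) unfolding cs_def by blast
  have "f = (\<lambda>j. \<Sum>i\<in>A. rconst (if i \<in> T then c i else 0) * g i j)"
    unfolding 1(3) by (intro ext sum.mono_neutral_cong_left) (use 1 assms(2) in \<open>auto simp: rconst_simps\<close>)
  then show ?thesis by (rule exI[of _ "\<lambda>i. if i \<in> T then c i else 0"])
qed

subsection \<open>Twisted cohomology of a punctured line\<close>

locale punctured_line =
  fixes q :: nat and u :: "nat \<Rightarrow> complex"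
  assumes inj_u: "inj_on u {..<q}"
begin

abbreviation "Z \<equiv> u ` {..<q}"

text \<open>The places are the points \<open>u k\<close>, \<open>k < q\<close>, and the point \<open>\<infinity>\<close>, which is numbered \<open>q\<close>.\<close>

definition bb :: "nat \<times> nat \<Rightarrow> nat \<Rightarrow> ratfun" where
  "bb p j = (if fst p < q then inverse (rvar j - rconst (u (fst p))) ^ snd p else rvar j ^ snd p)"

definition cb :: "nat \<times> nat \<Rightarrow> complex \<Rightarrow> complex" where
  "cb p v = (if fst p < q then inverse (v - u (fst p)) ^ snd p else v ^ snd p)"

text \<open>The constant function would occur at every place with exponent 0; counting it only at
  infinity makes \<open>bb\<close> linearly independent on \<open>II\<close>.\<close>

definition II :: "(nat \<times> nat) set" where
  "II = {(k, m). k \<le> q \<and> (k < q \<longrightarrow> 0 < m)}"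

lemma u_eq: "k < q \<Longrightarrow> k' < q \<Longrightarrow> u k = u k' \<longleftrightarrow> k = k'"
  using inj_u by (auto simp: inj_on_def)

lemma bb_FF: "bb p \<in> FF Z"
  by (cases "fst p < q") (auto simp: bb_def[abs_def] intro!: FF_power FF.inv FF.var)

lemma fv_bb: "v \<notin> Z \<Longrightarrow> fv (bb p) v = cb p v"
  unfolding bb_def[abs_def] cb_def
  by (cases "fst p < q") (auto simp: fv_power[of _ Z] FF.inv FF.var intro!: arg_cong[where f = "\<lambda>x. x ^ _"] fv_inv)

lemma bb_0: "bb (k, 0) = (\<lambda>j. 1)" by (rule ext) (simp add: bb_def)

lemma cs_const: "(\<lambda>j. rconst c) \<in> cs bb II"
  using cs_scale[OF cs_base[of "(q, 0)" II bb], of c] by (simp add: II_def bb_0)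

lemma bb_any: "k \<le> q \<Longrightarrow> bb (k, m) \<in> cs bb II"
proof (cases "k < q \<and> m = 0")
  case True
  then have "bb (k, m) = (\<lambda>j. rconst 1)" by (simp add: bb_0 rconst_simps)
  then show ?thesis using cs_const[of 1] by simp
next
  case False
  moreover assume "k \<le> q"
  ultimately have "(k, m) \<in> II" by (auto simp: II_def)
  from cs_base[OF this, of bb] show ?thesis by simp
qed

lemma sk_unit: "inverse (rvar j - rconst a) * (rvar j - rconst a) = 1"
  using rvar_minus_const_nonzero by simp

lemma mult_var: "p \<in> II \<Longrightarrow> (\<lambda>j. rvar j * bb p j) \<in> cs bb II"
proof -
  assume p: "p \<in> II"
  obtain k m where km: "p = (k, m)" by (cases p)
  show ?thesis
  proof (cases "k < q")
    case True
    then obtain m' where m: "m = Suc m'" using p km by (cases m) (auto simp: II_def)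
    have "rvar j * bb p j = bb (k, m') j + rconst (u k) * bb (k, m) j" for j
    proof -
      let ?s = "inverse (rvar j - rconst (u k))"
      have "rvar j * (?s * ?s ^ m') = (?s * (rvar j - rconst (u k))) * ?s ^ m' + rconst (u k) * (?s * ?s ^ m')"
        by (simp add: algebra_simps)
      then show ?thesis using True by (simp add: bb_def km m sk_unit)
    qed
    moreover have "(\<lambda>j. bb (k, m') j + rconst (u k) * bb (k, m) j) \<in> cs bb II"
      by (intro cs_add cs_scale bb_any) (use True in auto)
    ultimately show ?thesis by simp
  next
    case False
    then have "(\<lambda>j. rvar j * bb p j) = bb (k, Suc m)" by (simp add: bb_def km fun_eq_iff)
    then show ?thesis using bb_any[of k "Suc m"] p km by (simp add: II_def)
  qed
qed

lemma split_aux: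
  fixes S t T \<kappa> :: ratfun
  assumes "S * t = \<kappa> * (S - t)"
  shows "S * (t * T) = \<kappa> * (S * T) - \<kappa> * (t * T)"
proof -
  have "S * (t * T) = (S * t) * T" by (simp only: mult.assoc)
  also have "\<dots> = \<kappa> * (S * T) - \<kappa> * (t * T)" unfolding assms by (simp only: right_diff_distrib left_diff_distrib mult.assoc)
  finally show ?thesis .
qed

lemma solve_aux: "K \<noteq> 0 \<Longrightarrow> X * K = Y \<Longrightarrow> X = inverse K * Y" for K :: "'a::field"
  by (auto simp: field_simps)

lemma mult_inv:
  assumes k: "k < q" and k': "k' \<le> q"
  shows "(\<lambda>j. inverse (rvar j - rconst (u k)) * bb (k', m) j) \<in> cs bb II"
proof (cases "k' = k")
  case True
  then have "(\<lambda>j. inverse (rvar j - rconst (u k)) * bb (k', m) j) = bb (k, Suc m)"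
    using k by (simp add: bb_def fun_eq_iff)
  then show ?thesis using bb_any[of k "Suc m"] k by simp
next
  case ne: False
  let ?s = "\<lambda>j. inverse (rvar j - rconst (u k))"
  have base: "(\<lambda>j. ?s j) \<in> cs bb II" using bb_any[of k 1] k by (simp add: bb_def[abs_def])
  show ?thesis
  proof (induction m)
    case 0
    show ?case using base by (simp add: bb_0)
  next
    case (Suc m)
    show ?case
    proof (cases "k' < q")
      case True
      let ?d = "u k - u k'"
      have d: "?d \<noteq> 0" using u_eq[OF k True] ne by auto
      \<comment> \<open>The partial fraction identity 1/((x - a)(x - b)) = (1/(x - a) - 1/(x -
        b))/(a - b), which lowers the order at one of the two poles.\<close>
      have "?s j * bb (k', Suc m) j = rconst (inverse ?d) * (?s j * bb (k', m) j) + rconst (- inverse ?d) * bb (k', Suc m) j" for j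
      proof -
        let ?t = "inverse (rvar j - rconst (u k'))"
        have nz: "rvar j - rconst (u k) \<noteq> 0" "rvar j - rconst (u k') \<noteq> 0" "rconst ?d \<noteq> 0"
          using rvar_minus_const_nonzero d by (simp_all only: rconst_eq_0_iff) simp_all
        have "?s j * ?t * rconst ?d = ?s j - ?t"
        proof -
          have "?s j * ?t * ((rvar j - rconst (u k')) - (rvar j - rconst (u k))) =
              ?s j * (?t * (rvar j - rconst (u k'))) - ?t * (?s j * (rvar j - rconst (u k)))"
            by (simp only: right_diff_distrib mult_ac)
          then show ?thesis by (simp only: sk_unit rconst_hom mult_1_right) simp
        qed
        then have "?s j * ?t = rconst (inverse ?d) * (?s j - ?t)"
          unfolding rconst_inverse by (rule solve_aux[OF nz(3)])
        from split_aux[OF this, of "?t ^ m"] have "?s j * (?t * ?t ^ m) =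
            rconst (inverse ?d) * (?s j * ?t ^ m) + rconst (- inverse ?d) * (?t * ?t ^ m)"
          by (simp only: rconst_hom(5) diff_conv_add_uminus mult_minus_left)
        moreover have "bb (k', Suc m) j = ?t * ?t ^ m" "bb (k', m) j = ?t ^ m" using True by (simp_all add: bb_def)
        ultimately show ?thesis by (simp only:)
      qed
      moreover have "(\<lambda>j. rconst (inverse ?d) * (?s j * bb (k', m) j) + rconst (- inverse ?d) * bb (k', Suc m) j) \<in> cs bb II"
        by (intro cs_add cs_scale Suc.IH bb_any k')
      ultimately show ?thesis by simp
    next
      case False
      \<comment> \<open>Division with remainder: x/(x - a) = 1 + a/(x - a) lowers the power of
        x.\<close>
      have "?s j * bb (k', Suc m) j = bb (k', m) j + rconst (u k) * (?s j * bb (k', m) j)" for j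
      proof -
        have "?s j * (rvar j * rvar j ^ m) = (?s j * (rvar j - rconst (u k))) * rvar j ^ m + rconst (u k) * (?s j * rvar j ^ m)"
          by (simp add: algebra_simps)
        then show ?thesis using False by (simp add: bb_def sk_unit)
      qed
      moreover have "(\<lambda>j. bb (k', m) j + rconst (u k) * (?s j * bb (k', m) j)) \<in> cs bb II"
        by (intro cs_add cs_scale Suc.IH bb_any k')
      ultimately show ?thesis by simp
    qed
  qed
qed

lemma cs_mult_closed:
  assumes "\<And>p. p \<in> II \<Longrightarrow> (\<lambda>j. h j * bb p j) \<in> cs bb II" "g \<in> cs bb II"
  shows "(\<lambda>j. h j * g j) \<in> cs bb II"
proof -
  obtain T c where 1: "finite T" "T \<subseteq> II" "g = (\<lambda>j. \<Sum>i\<in>T. rconst (c i) * bb i j)"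
    using assms(2) unfolding cs_def by blast
  have "(\<lambda>j. h j * g j) = (\<lambda>j. \<Sum>i\<in>T. rconst (c i) * (h j * bb i j))"
    unfolding 1(3) by (simp add: sum_distrib_left mult_ac)
  moreover have "(\<lambda>j. \<Sum>i\<in>T. rconst (c i) * (h j * bb i j)) \<in> cs bb II"
    by (intro cs_sum cs_scale assms(1)) (use 1(2) in auto)
  ultimately show ?thesis by simp
qed

lemma FF_mult_cs: "f \<in> FF Z \<Longrightarrow> g \<in> cs bb II \<Longrightarrow> (\<lambda>j. f j * g j) \<in> cs bb II"
proof (induction f arbitrary: g rule: FF.induct)
  case (const c)
  then show ?case by (rule cs_scale)
next
  case var
  show ?case by (rule cs_mult_closed[of "\<lambda>j. rvar j", OF mult_var var])
next
  case (inv a)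
  then obtain k where "k < q" "a = u k" by auto
  then have "(\<lambda>j. inverse (rvar j - rconst a) * bb p j) \<in> cs bb II" if "p \<in> II" for p
    using mult_inv[of k "fst p" "snd p"] that by (auto simp: II_def)
  from cs_mult_closed[of "\<lambda>j. inverse (rvar j - rconst a)", OF this inv.prems] show ?case .
next
  case (add f h)
  then show ?case by (simp add: distrib_right cs_add)
next
  case (mult f h)
  then show ?case by (simp add: mult.assoc)
qed

text \<open>Partial fraction decomposition: the span of \<open>bb\<close> contains the constants and
  is stable under multiplication by the generators of \<open>FF Z\<close>.\<close>

lemma FF_eq: "FF Z = cs bb II"
proof
  show "FF Z \<subseteq> cs bb II"
    using FF_mult_cs[OF _ cs_const[of 1]] by (auto simp: rconst_simps)
  show "cs bb II \<subseteq> FF Z" by (auto intro: cs_FF bb_FF)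
qed

definition Fl :: "nat \<Rightarrow> complex filter" where
  "Fl k = (if k < q then at (u k) else at_infinity)"

text \<open>A power of the local parameter, which is v - u k at a finite place and 1/v at
  infinity.\<close>

definition wF :: "nat \<Rightarrow> nat \<Rightarrow> complex \<Rightarrow> complex" where
  "wF k m v = (if k < q then (v - u k) ^ m else inverse v ^ m)"

text \<open>
  A form \<open>f du\<close> has a pole of order \<open>N\<close> at \<open>\<infinity>\<close> if \<open>f\<close> grows like \<open>v\<close> to the power \<open>N - 2\<close>,
  whence the different normalization at the last place.
\<close>

definition wt :: "nat \<Rightarrow> nat \<Rightarrow> complex \<Rightarrow> complex" where
  "wt k N v = (if k < q then (v - u k) ^ N else v ^ 2 * inverse v ^ N)"

text \<open>The order of the pole at its own place of the form belonging to \<open>bb p\<close>; at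
  infinity the differential of the coordinate adds a double pole.\<close>

definition eo :: "nat \<times> nat \<Rightarrow> nat" where
  "eo p = (if fst p < q then snd p else snd p + 2)"

lemma ev_Fl: "eventually (\<lambda>v. v \<notin> Z) (Fl k)"
proof (cases "k < q")
  case True
  have "open (- (Z - {u k}))" by (intro open_Compl finite_imp_closed) simp
  then have "eventually (\<lambda>v. v \<in> - (Z - {u k})) (at (u k))"
    by (rule eventually_at_in_open') simp
  moreover have "eventually (\<lambda>v. v \<noteq> u k) (at (u k))" by (simp add: eventually_at_filter)
  ultimately have "eventually (\<lambda>v. v \<notin> Z) (at (u k))" by eventually_elim blast
  then show ?thesis unfolding Fl_def using True by simp
next
  case False
  have "v \<notin> Z" if "norm v \<ge> 1 + (\<Sum>z\<in>Z. norm z)" for v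
  proof
    assume "v \<in> Z"
    then have "norm v \<le> (\<Sum>z\<in>Z. norm z)" by (intro member_le_sum) auto
    with that show False by simp
  qed
  then have "eventually (\<lambda>v. v \<notin> Z) at_infinity"
    unfolding eventually_at_infinity by blast
  then show ?thesis using False by (simp add: Fl_def)
qed

lemma ev_nz: "eventually (\<lambda>v. if k < q then v - u k \<noteq> 0 else v \<noteq> 0) (Fl k)"
proof (cases "k < q")
  case True
  then show ?thesis by (simp add: Fl_def eventually_at_filter)
next
  case False
  have "eventually (\<lambda>v::complex. v \<noteq> 0) at_infinity"
    unfolding eventually_at_infinity by (rule exI[of _ 1]) auto
  then show ?thesis using False by (simp add: Fl_def)
qed

lemma Fl_nontrivial: "Fl k \<noteq> bot"
proof -
  have "\<not> eventually (\<lambda>_. False) (at_infinity :: complex filter)"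
    unfolding eventually_at_infinity
  proof
    assume "\<exists>b. \<forall>x::complex. b \<le> norm x \<longrightarrow> False"
    then obtain b where "\<And>x::complex. \<not> b \<le> norm x" by blast
    from this[of "of_real b"] show False by simp
  qed
  then have "at_infinity \<noteq> (bot :: complex filter)" unfolding trivial_limit_def .
  then show ?thesis by (simp add: Fl_def)
qed

lemma wF_tendsto: "(wF k m \<longlongrightarrow> (if m = 0 then 1 else 0)) (Fl k)"
proof (cases "k < q")
  case True
  have "((\<lambda>v. (v - u k) ^ m) \<longlongrightarrow> (u k - u k) ^ m) (at (u k))" by (intro tendsto_intros)
  then show ?thesis using True by (cases m) (simp_all add: wF_def[abs_def] Fl_def)
next
  case False
  have "((\<lambda>v::complex. inverse v ^ m) \<longlongrightarrow> 0 ^ m) at_infinity"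
    by (intro tendsto_power tendsto_inverse_0)
  then show ?thesis using False by (cases m) (simp_all add: wF_def[abs_def] Fl_def)
qed

lemma wF_cb_same: "eventually (\<lambda>v. wF k m v * cb (k, m) v = 1) (Fl k)"
  using ev_nz[of k] by eventually_elim
    (auto simp: wF_def cb_def simp flip: power_mult_distrib split: if_splits)

lemma wF_add: "wF k (m + m') v = wF k m v * wF k m' v"
  by (simp add: wF_def power_add)

lemma wt_add: "wt k (m + m') v = wF k m v * wt k m' v"
  by (simp add: wF_def wt_def power_add mult_ac)

lemma wF_cb_less: "m' \<le> m \<Longrightarrow> ((\<lambda>v. wF k m v * cb (k, m') v) \<longlongrightarrow> (if m' = m then 1 else 0)) (Fl k)"
proof -
  assume "m' \<le> m"
  have "eventually (\<lambda>v. wF k (m - m') v = wF k m v * cb (k, m') v) (Fl k)"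
    using wF_cb_same[of k m']
  proof eventually_elim
    case (elim v)
    have "wF k m v = wF k (m - m') v * wF k m' v"
      using wF_add[of k "m - m'" m' v] \<open>m' \<le> m\<close> by simp
    then show ?case using elim by (simp add: mult.assoc)
  qed
  then have "((\<lambda>v. wF k m v * cb (k, m') v) \<longlongrightarrow> (if m - m' = 0 then 1 else 0)) (Fl k)"
    using wF_tendsto[of k "m - m'"] by (simp only: tendsto_cong)
  moreover have "m - m' = 0 \<longleftrightarrow> m' = m" using \<open>m' \<le> m\<close> by auto
  ultimately show ?thesis by simp
qed

text \<open>A basis function has a pole at its own place only. At infinity the functions of finite
  places vanish, since \<open>II\<close> requires positive exponents there.\<close>

lemma cb_tendsto_other:
  assumes "k' \<noteq> k" "(k', m') \<in> II" "k \<le> q"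
  shows "\<exists>l. (cb (k', m') \<longlongrightarrow> l) (Fl k) \<and> (k = q \<longrightarrow> l = 0)"
proof (cases "k < q")
  case True
  show ?thesis
  proof (cases "k' < q")
    case k': True
    have "u k - u k' \<noteq> 0" using u_eq[OF True k'] assms(1) by auto
    then have "((\<lambda>v. inverse (v - u k') ^ m') \<longlongrightarrow> inverse (u k - u k') ^ m') (at (u k))" by (intro tendsto_intros)
    then show ?thesis using True k' by (auto simp: cb_def[abs_def] Fl_def)
  next
    case False
    have "((\<lambda>v. v ^ m') \<longlongrightarrow> u k ^ m') (at (u k))" by (intro tendsto_intros)
    then show ?thesis using True False by (auto simp: cb_def[abs_def] Fl_def)
  qed
next
  case False
  then have k: "k = q" "k' < q" using assms by (auto simp: II_def)
  have "filterlim (\<lambda>v. v + (- u k')) at_infinity (at_infinity :: complex filter)"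
    by (rule tendsto_add_filterlim_at_infinity'[OF filterlim_ident tendsto_const])
  then have "((\<lambda>v. inverse (v + - u k')) \<longlongrightarrow> 0) at_infinity"
    by (rule filterlim_compose[OF tendsto_inverse_0])
  then have "((\<lambda>v. inverse (v - u k') ^ m') \<longlongrightarrow> 0 ^ m') at_infinity" by (intro tendsto_power) simp
  then show ?thesis using k assms(2) by (intro exI[of _ 0]) (auto simp: cb_def[abs_def] Fl_def II_def power_0_left)
qed

lemma wF_cb:
  assumes "k \<le> q" "(k', m') \<in> II" "0 < m" "k' = k \<longrightarrow> m' \<le> m"
  shows "((\<lambda>v. wF k m v * cb (k', m') v) \<longlongrightarrow> (if k' = k \<and> m' = m then 1 else 0)) (Fl k)"
proof (cases "k' = k")
  case True
  then show ?thesis using wF_cb_less assms by auto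
next
  case False
  then obtain l where "(cb (k', m') \<longlongrightarrow> l) (Fl k)" using cb_tendsto_other assms by blast
  from tendsto_mult[OF wF_tendsto[of k m] this] show ?thesis using False assms by simp
qed

lemma v_over:
  fixes a :: complex
  shows "((\<lambda>v::complex. v * inverse (v - a)) \<longlongrightarrow> 1) (at_infinity :: complex filter)"
proof -
  have "filterlim (\<lambda>v::complex. v + (- a)) at_infinity (at_infinity :: complex filter)"
    by (rule tendsto_add_filterlim_at_infinity'[OF filterlim_ident tendsto_const])
  then have "((\<lambda>v::complex. inverse (v + - a)) \<longlongrightarrow> 0) at_infinity"
    by (rule filterlim_compose[OF tendsto_inverse_0])
  then have "((\<lambda>v::complex. 1 + a * inverse (v - a)) \<longlongrightarrow> 1 + a * 0) at_infinity" by (intro tendsto_intros) simp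
  moreover have "eventually (\<lambda>v::complex. 1 + a * inverse (v - a) = v * inverse (v - a)) at_infinity"
    unfolding eventually_at_infinity
  proof (intro exI[of _ "norm a + 1"] allI impI)
    fix v :: complex assume "norm a + 1 \<le> norm v"
    then have "v - a \<noteq> 0" by auto
    then show "1 + a * inverse (v - a) = v * inverse (v - a)" by (simp add: field_simps)
  qed
  ultimately show ?thesis by (simp add: tendsto_cong)
qed

definition dcb :: "nat \<times> nat \<Rightarrow> complex \<Rightarrow> complex" where
  "dcb p v = (if fst p < q then - of_nat (snd p) * inverse (v - u (fst p)) ^ (snd p + 1)
     else of_nat (snd p) * v ^ (snd p - 1))"

lemma rat_pd_bb:
  "k < q \<Longrightarrow> rat_pd j (bb (k, m) j) = rconst (- of_nat m) * bb (k, m + 1) j"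
  "rat_pd j (bb (q, m + 1) j) = rconst (of_nat (m + 1)) * bb (q, m) j"
proof -
  assume k: "k < q"
  have "rat_pd j (inverse (rvar j - rconst (u k))) = - (inverse (rvar j - rconst (u k)) * inverse (rvar j - rconst (u k)))"
    by (simp add: rat_pd_inverse rat_pd_diff rat_pd_rvar)
  moreover have "bb (k, m) j = inverse (rvar j - rconst (u k)) ^ m" using k by (simp add: bb_def)
  ultimately have "rat_pd j (bb (k, m) j) = of_nat m * inverse (rvar j - rconst (u k)) ^ (m - 1) *
      - (inverse (rvar j - rconst (u k)) * inverse (rvar j - rconst (u k)))"
    by (simp only: rat_pd_power)
  then show "rat_pd j (bb (k, m) j) = rconst (- of_nat m) * bb (k, m + 1) j"
    using k by (cases m) (simp_all add: bb_def rconst_hom mult_ac form_apply del: of_nat_Suc flip: Suc_eq_plus1)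
next
  show "rat_pd j (bb (q, m + 1) j) = rconst (of_nat (m + 1)) * bb (q, m) j"
    by (simp only: bb_def fst_conv snd_conv less_irrefl if_False if_True rat_pd_power rat_pd_rvar refl rconst_hom
        add_diff_cancel_right' mult_1_right)
qed

lemma fv_pd_bb: "v \<notin> Z \<Longrightarrow> fv (\<lambda>j. rat_pd j (bb p j)) v = dcb p v"
proof -
  assume v: "v \<notin> Z"
  obtain k m where p: "p = (k, m)" by (cases p)
  show ?thesis
  proof (cases "k < q")
    case True
    have "fv (\<lambda>j. rconst (- of_nat m) * bb (k, m + 1) j) v = dcb p v"
      using v True unfolding p dcb_def by (subst fv_scale[of _ Z]) (simp_all add: bb_FF fv_bb cb_def)
    then show ?thesis unfolding p rat_pd_bb(1)[OF True] .
  next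
    case False
    have "rat_pd j (bb p j) = rconst (of_nat m) * rvar j ^ (m - 1)" for j
      using False by (simp add: bb_def p rat_pd_power rat_pd_rvar rconst_hom)
    moreover have "fv (\<lambda>j. rconst (of_nat m) * bb (k, m - 1) j) v = dcb p v"
      using v False unfolding p dcb_def by (subst fv_scale[of _ Z]) (simp_all add: bb_FF fv_bb cb_def)
    moreover have "bb (k, m - 1) j = rvar j ^ (m - 1)" for j using False by (simp add: bb_def)
    ultimately show ?thesis by simp
  qed
qed

lemma wt_dcb_same: "eventually (\<lambda>v. wt k (m + 1) v * dcb (k, m) v = (if k < q then - of_nat m else of_nat m)) (Fl k)"
  using ev_nz[of k]
proof eventually_elim
  case (elim v)
  show ?case
  proof (cases "k < q")
    case True
    then have "(v - u k) * inverse (v - u k) = 1" using elim by simp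
    then have "(v - u k) ^ (m + 1) * inverse (v - u k) ^ (m + 1) = 1"
      by (simp only: power_mult_distrib[symmetric] power_one)
    then have "(v - u k) ^ (m + 1) * (- of_nat m * inverse (v - u k) ^ (m + 1)) = - of_nat m"
      by (metis (no_types, lifting) mult.left_commute mult.right_neutral)
    then show ?thesis using True by (simp add: wt_def dcb_def)
  next
    case False
    then show ?thesis using elim
      by (cases m) (simp_all add: wt_def dcb_def power2_eq_square field_simps)
  qed
qed

lemma wt_dcb:
  assumes "k \<le> q" "(k', m') \<in> II" "0 < m" "k' = k \<longrightarrow> m' \<le> m"
  shows "((\<lambda>v. wt k (m + 1) v * dcb (k', m') v) \<longlongrightarrow>
    (if k' = k \<and> m' = m then (if k < q then - of_nat m else of_nat m) else 0)) (Fl k)"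
proof (cases "k' = k")
  case True
  let ?e = "if k < q then - of_nat m' else of_nat m' :: complex"
  have "eventually (\<lambda>v. wF k (m - m') v * ?e = wt k (m + 1) v * dcb (k', m') v) (Fl k)"
    using wt_dcb_same[of k m']
  proof eventually_elim
    case (elim v)
    have "wt k (m + 1) v = wF k (m - m') v * wt k (m' + 1) v"
      using wt_add[of k "m - m'" "m' + 1" v] assms True by simp
    then show ?case using elim True by simp
  qed
  moreover have "((\<lambda>v. wF k (m - m') v * ?e) \<longlongrightarrow> (if m - m' = 0 then 1 else 0) * ?e) (Fl k)"
    by (intro tendsto_mult wF_tendsto tendsto_const)
  ultimately have "((\<lambda>v. wt k (m + 1) v * dcb (k', m') v) \<longlongrightarrow> (if m - m' = 0 then 1 else 0) * ?e) (Fl k)"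
    by (simp add: tendsto_cong)
  then show ?thesis using True assms by (auto split: if_splits)
next
  case ne: False
  show ?thesis
  proof (cases "k < q")
    case True
    have "\<exists>l. (dcb (k', m') \<longlongrightarrow> l) (Fl k)"
    proof (cases "k' < q")
      case k': True
      have "u k - u k' \<noteq> 0" using u_eq[OF True k'] ne by auto
      then have "((\<lambda>v. - of_nat m' * inverse (v - u k') ^ (m' + 1)) \<longlongrightarrow> - of_nat m' * inverse (u k - u k') ^ (m' + 1)) (at (u k))"
        by (intro tendsto_intros)
      then show ?thesis using True k' by (auto simp: dcb_def[abs_def] Fl_def)
    next
      case False
      have "((\<lambda>v. of_nat m' * v ^ (m' - 1)) \<longlongrightarrow> of_nat m' * u k ^ (m' - 1)) (at (u k))" by (intro tendsto_intros)
      then show ?thesis using True False by (auto simp: dcb_def[abs_def] Fl_def)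
    qed
    then obtain l where "(dcb (k', m') \<longlongrightarrow> l) (Fl k)" by blast
    from tendsto_mult[OF wF_tendsto[of k "m + 1"] this] show ?thesis using ne True by (simp add: wF_def wt_def)
  next
    case False
    then have k: "k = q" "k' < q" using assms ne by (auto simp: II_def)
    \<comment> \<open>Up to powers of 1/v, the normalization at infinity contains v squared: one
      factor v balances the extra inverse of v - u k' created by the derivative, the other lowers
      the order from \<open>m + 1\<close> to \<open>m\<close>.\<close>
    have "eventually (\<lambda>v. wF q m v * (- of_nat m' * (v * inverse (v - u k')) * cb (k', m') v) = wt q (m + 1) v * dcb (k', m') v) (Fl q)"
      using ev_nz[of q] by eventually_elim (use k in \<open>simp add: wF_def wt_def cb_def dcb_def power2_eq_square\<close>)
    moreover obtain l where l: "(cb (k', m') \<longlongrightarrow> l) (Fl q)" using cb_tendsto_other[of k' q m'] assms k by auto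
    have "((\<lambda>v. v * inverse (v - u k')) \<longlongrightarrow> 1) (Fl q)" using v_over by (simp add: Fl_def)
    then have "((\<lambda>v. wF q m v * (- of_nat m' * (v * inverse (v - u k')) * cb (k', m') v)) \<longlongrightarrow> (if m = 0 then 1 else 0) * (- of_nat m' * 1 * l)) (Fl q)"
      by (intro tendsto_mult wF_tendsto tendsto_const l)
    ultimately show ?thesis using k assms(3) by (simp add: tendsto_cong)
  qed
qed

text \<open>Coefficients in the basis \<open>bb\<close> are determined by the asymptotic behaviour at the places.\<close>

lemma wt_cb:
  assumes "k \<le> q" "(k', m') \<in> II" "1 \<le> N" "k = q \<longrightarrow> 2 \<le> N" "k' = k \<longrightarrow> eo (k', m') \<le> N"
  shows "((\<lambda>v. wt k N v * cb (k', m') v) \<longlongrightarrow> (if k' = k \<and> eo (k', m') = N then 1 else 0)) (Fl k)"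
proof (cases "k < q")
  case True
  have "wt k N v = wF k N v" for v using True by (simp add: wt_def wF_def)
  moreover have "eo (k', m') = m'" if "k' = k" using True that by (simp add: eo_def)
  ultimately show ?thesis using wF_cb[of k k' m' N] assms by auto
next
  case False
  then have k: "k = q" using assms by simp
  have "eventually (\<lambda>v. wF k (N - 2) v * cb (k', m') v = wt k N v * cb (k', m') v) (Fl k)"
    using ev_nz[of k]
  proof eventually_elim
    case (elim v)
    have "inverse v ^ N = inverse v ^ 2 * inverse v ^ (N - 2)"
      using assms(4) k by (metis le_add_diff_inverse power_add)
    moreover have "v ^ 2 * inverse v ^ 2 = 1" using elim k by (simp flip: power_mult_distrib)
    ultimately have "wt k N v = wF k (N - 2) v" using k by (simp add: wt_def wF_def flip: mult.assoc)
    then show ?case by simp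
  qed
  moreover have "((\<lambda>v. wF k (N - 2) v * cb (k', m') v) \<longlongrightarrow> (if k' = k \<and> eo (k', m') = N then 1 else 0)) (Fl k)"
  proof (cases "k' = k")
    case True
    then have "eo (k', m') = m' + 2" using k by (simp add: eo_def)
    moreover from this have "m' \<le> N - 2" "m' = N - 2 \<longleftrightarrow> eo (k', m') = N" using True assms by auto
    ultimately show ?thesis using wF_cb_less[of m' "N - 2" k] True by simp
  next
    case ne: False
    then obtain l where l: "(cb (k', m') \<longlongrightarrow> l) (Fl k)" "l = 0" using cb_tendsto_other[of k' k m'] assms k by blast
    from tendsto_mult[OF wF_tendsto[of k "N - 2"] l(1)] l(2) ne show ?thesis by simp
  qed
  ultimately show ?thesis by (rule Lim_transform_eventually[rotated])
qed

text \<open>If terms of order above \<open>N\<close> occurred at the place \<open>k\<close>, the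
  highest of them would dominate and give a nonzero limit in its own order; but in that order the
  assumed limit is multiplied by a positive power of the local parameter. Once they are excluded,
  order \<open>N\<close> shows exactly one coefficient. At infinity \<open>N\<close> has to be at
  least 2 because already the constant function has order 2.\<close>

lemma coeff_limit:
  assumes T: "finite T" "T \<subseteq> II" and f: "f = (\<lambda>j. \<Sum>p\<in>T. rconst (c p) * bb p j)"
    and k: "k \<le> q" and N: "1 \<le> N" "k = q \<longrightarrow> 2 \<le> N"
    and L: "((\<lambda>v. wt k N v * fv f v) \<longlongrightarrow> L) (Fl k)"
  shows "\<And>m. (k, m) \<in> T \<Longrightarrow> eo (k, m) > N \<Longrightarrow> c (k, m) = 0"
    and "\<And>m. (k, m) \<in> T \<Longrightarrow> eo (k, m) = N \<Longrightarrow> c (k, m) = L"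
proof -
  have fvf: "fv f v = (\<Sum>p\<in>T. c p * cb p v)" if "v \<notin> Z" for v
    unfolding f using that by (subst fv_sum[of _ _ Z]) (auto intro!: sum.cong FF_scale bb_FF simp: fv_scale[of _ Z] bb_FF fv_bb)
  have lim: "((\<lambda>v. wt k M v * fv f v) \<longlongrightarrow> (\<Sum>p\<in>T. c p * (if fst p = k \<and> eo p = M then 1 else 0))) (Fl k)"
    if M: "1 \<le> M" "k = q \<longrightarrow> 2 \<le> M" "\<And>m. (k, m) \<in> T \<Longrightarrow> eo (k, m) > M \<Longrightarrow> c (k, m) = 0" for M
  proof -
    have "((\<lambda>v. c p * (wt k M v * cb p v)) \<longlongrightarrow> c p * (if fst p = k \<and> eo p = M then 1 else 0)) (Fl k)" if p: "p \<in> T" for p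
    proof (cases "c p = 0")
      case False
      obtain k' m' where p': "p = (k', m')" by (cases p)
      have "((\<lambda>v. wt k M v * cb (k', m') v) \<longlongrightarrow> (if k' = k \<and> eo (k', m') = M then 1 else 0)) (Fl k)"
      proof (rule wt_cb)
        show "k' = k \<longrightarrow> eo (k', m') \<le> M" using M(3)[of m'] p p' False by force
      qed (use k M p p' T(2) in auto)
      then show ?thesis unfolding p' by (intro tendsto_mult tendsto_const) simp
    qed simp
    then have "((\<lambda>v. \<Sum>p\<in>T. c p * (wt k M v * cb p v)) \<longlongrightarrow> (\<Sum>p\<in>T. c p * (if fst p = k \<and> eo p = M then 1 else 0))) (Fl k)"
      by (rule tendsto_sum)
    moreover have "eventually (\<lambda>v. (\<Sum>p\<in>T. c p * (wt k M v * cb p v)) = wt k M v * fv f v) (Fl k)"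
      using ev_Fl by eventually_elim (simp add: fvf sum_distrib_left mult_ac)
    ultimately show ?thesis by (simp add: tendsto_cong)
  qed
  have pick: "(\<Sum>p\<in>T. c p * (if fst p = k \<and> eo p = M then 1 else 0)) = c (k, m)"
    if "(k, m) \<in> T" "eo (k, m) = M" for m M
  proof -
    have "(\<Sum>p\<in>T. c p * (if fst p = k \<and> eo p = M then 1 else 0)) = (\<Sum>p\<in>T. if p = (k, m) then c (k, m) else 0)"
      by (rule sum.cong) (use that in \<open>auto simp: eo_def split: if_splits\<close>)
    then show ?thesis using T(1) that by simp
  qed
  have wt_le: "wt k M v = wF k (M - N) v * wt k N v" if "N \<le> M" for M v
    using wt_add[of k "M - N" N v] that by simp
  show high: "c (k, m) = 0" if m: "(k, m) \<in> T" "eo (k, m) > N" for m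
  proof (rule ccontr)
    assume "c (k, m) \<noteq> 0"
    let ?S = "{m. (k, m) \<in> T \<and> c (k, m) \<noteq> 0}"
    have "?S \<subseteq> snd ` T" by force
    then have fin: "finite ?S" using T(1) finite_surj by blast
    have ne: "m \<in> ?S" using m \<open>c (k, m) \<noteq> 0\<close> by simp
    \<comment> \<open>The highest exponent at the place \<open>k\<close> with a nonzero
      coefficient.\<close>
    define t where "t = Max ?S"
    have t: "t \<in> ?S" unfolding t_def using fin ne by (intro Max_in) auto
    have le: "m' \<le> t" if "m' \<in> ?S" for m' unfolding t_def using fin that by simp
    have big: "N < eo (k, t)" using m(2) le[OF ne] by (auto simp: eo_def split: if_splits)
    let ?M = "eo (k, t)"
    have "((\<lambda>v. wt k ?M v * fv f v) \<longlongrightarrow> c (k, t)) (Fl k)"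
    proof -
      have "c (k, m') = 0" if "(k, m') \<in> T" "eo (k, m') > ?M" for m'
      proof (rule ccontr)
        assume "c (k, m') \<noteq> 0"
        then have "m' \<le> t" using le that(1) by simp
        then show False using that(2) by (auto simp: eo_def split: if_splits)
      qed
      moreover have "1 \<le> ?M" "k = q \<longrightarrow> 2 \<le> ?M" using N big by auto
      moreover have "(\<Sum>p\<in>T. c p * (if fst p = k \<and> eo p = ?M then 1 else 0)) = c (k, t)"
        using pick[of t ?M] t by simp
      ultimately show ?thesis using lim[of ?M] by simp
    qed
    moreover have "((\<lambda>v. wt k ?M v * fv f v) \<longlongrightarrow> 0) (Fl k)"
    proof -
      have "(\<lambda>v. wt k ?M v * fv f v) = (\<lambda>v. wF k (?M - N) v * (wt k N v * fv f v))"
        unfolding wt_le[of ?M, OF less_imp_le[OF big]] by (simp only: mult.assoc)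
      moreover have "((\<lambda>v. wF k (?M - N) v * (wt k N v * fv f v)) \<longlongrightarrow> (if ?M - N = 0 then 1 else 0) * L) (Fl k)"
        by (intro tendsto_mult wF_tendsto L)
      ultimately show ?thesis using big by simp
    qed
    ultimately have "c (k, t) = 0" by (rule tendsto_unique[OF Fl_nontrivial])
    then show False using t by simp
  qed
  show "c (k, m) = L" if m: "(k, m) \<in> T" "eo (k, m) = N" for m
    using tendsto_unique[OF Fl_nontrivial lim[OF N high] L] pick[OF m] by simp
qed

end

locale twisted_line = punctured_line +
  fixes n :: "nat \<Rightarrow> nat" and w :: "nat \<times> nat \<Rightarrow> complex"
  assumes n_pos: "k \<le> q \<Longrightarrow> 1 \<le> n k"
begin

text \<open>As \<open>eo\<close> measures the pole of the form, these indices describe the forms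
  whose pole at the place \<open>k\<close> has order at most \<open>n k\<close>; they will represent
  all classes.\<close>

definition JJ :: "(nat \<times> nat) set" where
  "JJ = {p \<in> II. eo p \<le> n (fst p)}"

definition om :: "nat \<Rightarrow> ratfun" where
  "om j = (\<Sum>p\<in>JJ. rconst (w p) * bb p j)"

definition DD :: "(nat \<Rightarrow> ratfun) \<Rightarrow> nat \<Rightarrow> ratfun" where
  "DD f j = rat_pd j (f j) + om j * f j"

text \<open>The leading coefficient of the twisting form at the place \<open>k\<close>, in order
  \<open>n k\<close>. If \<open>n q = 1\<close>, no basis function at infinity belongs to
  \<open>JJ\<close>; the simple pole there is created by the simple poles at the finite places,
  whose coefficients are added.\<close>

definition WW :: "nat \<Rightarrow> complex" where
  "WW k = (\<Sum>p\<in>JJ. w p * (if fst p = k then (if eo p = n k then 1 else 0) else if k = q \<and> n q = 1 \<and> snd p = 1 then 1 else 0))"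

text \<open>The leading coefficient of \<open>DD (bb (k, m))\<close> at the place \<open>k\<close>.
  The derivative raises the pole order by one only, so it competes with multiplication by
  \<open>om\<close> just when \<open>n k = 1\<close>.\<close>

definition lamb :: "nat \<Rightarrow> nat \<Rightarrow> complex" where
  "lamb k m = WW k + (if n k = 1 then (if k < q then - of_nat m else of_nat m) else 0)"

lemma JJ_II: "JJ \<subseteq> II" by (auto simp: JJ_def)

lemma finite_JJ: "finite JJ"
proof (rule finite_subset)
  show "JJ \<subseteq> {..q} \<times> {..(\<Sum>k\<le>q. n k)}"
  proof
    fix p assume "p \<in> JJ"
    then have p: "fst p \<le> q" "eo p \<le> n (fst p)" by (auto simp: JJ_def II_def)
    have "n (fst p) \<le> (\<Sum>k\<le>q. n k)" using p by (intro member_le_sum) auto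
    moreover have "snd p \<le> eo p" by (simp add: eo_def)
    ultimately show "p \<in> {..q} \<times> {..(\<Sum>k\<le>q. n k)}" using p by (cases p) auto
  qed
qed simp

lemma om_FF: "om \<in> FF Z"
  unfolding om_def[abs_def] by (intro FF_sum FF_scale bb_FF)

lemma DD_FF: "f \<in> FF Z \<Longrightarrow> DD f \<in> FF Z"
  unfolding DD_def[abs_def] by (intro FF.add FF.mult FF_pd om_FF)

lemma DD_sum: "DD (\<lambda>j. \<Sum>i\<in>T. rconst (c i) * h i j) = (\<lambda>j. \<Sum>i\<in>T. rconst (c i) * DD (h i) j)"
  by (rule ext) (simp add: DD_def rat_pd_sum rat_pd_mult sum_distrib_left algebra_simps sum.distrib)

lemma fv_om: "v \<notin> Z \<Longrightarrow> fv om v = (\<Sum>p\<in>JJ. w p * cb p v)"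
  unfolding om_def[abs_def]
  by (subst fv_sum[of _ _ Z]) (auto intro!: sum.cong FF_scale bb_FF simp: fv_scale[of _ Z] bb_FF fv_bb)

lemma wt_om:
  assumes k: "k \<le> q"
  shows "((\<lambda>v. wt k (n k) v * fv om v) \<longlongrightarrow> WW k) (Fl k)"
proof -
  have "((\<lambda>v. wt k (n k) v * cb p v) \<longlongrightarrow>
      (if fst p = k then (if eo p = n k then 1 else 0) else if k = q \<and> n q = 1 \<and> snd p = 1 then 1 else 0)) (Fl k)"
    if p: "p \<in> JJ" for p
  proof -
    obtain k' m' where p': "p = (k', m')" by (cases p)
    have II: "(k', m') \<in> II" using p p' JJ_II by auto
    show ?thesis
    proof (cases "k = q \<and> n q = 1")
      case False
      then have N: "1 \<le> n k" "k = q \<longrightarrow> 2 \<le> n k" using n_pos[OF k] by auto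
      have "k' = k \<longrightarrow> eo (k', m') \<le> n k" using p p' by (auto simp: JJ_def)
      from wt_cb[OF k II N this] show ?thesis using False by (auto simp: p')
    next
      case True
      \<comment> \<open>Here v times the inverse of v - u k' tends to 1, so a simple pole at any
        finite place contributes its coefficient and poles of higher order contribute 0.\<close>
      then have k': "k' < q" "0 < m'" using p p' by (auto simp: JJ_def II_def eo_def split: if_splits)
      have "((\<lambda>v. (v * inverse (v - u k')) * cb (k', m' - 1) v) \<longlongrightarrow> 1 * (if m' = 1 then 1 else 0)) (Fl q)"
      proof (rule tendsto_mult)
        show "((\<lambda>v. v * inverse (v - u k')) \<longlongrightarrow> 1) (Fl q)" using v_over by (simp add: Fl_def)
        show "((\<lambda>v. cb (k', m' - 1) v) \<longlongrightarrow> (if m' = 1 then 1 else 0)) (Fl q)"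
        proof (cases "m' = 1")
          case True
          then show ?thesis using k' by (simp add: cb_def)
        next
          case False
          then show ?thesis using cb_tendsto_other[of k' q "m' - 1"] k' by (auto simp: II_def)
        qed
      qed
      moreover have "eventually (\<lambda>v. (v * inverse (v - u k')) * cb (k', m' - 1) v = wt k (n k) v * cb p v) (Fl q)"
        using ev_nz[of q]
      proof eventually_elim
        case (elim v)
        obtain m'' where "m' = Suc m''" using k' by (cases m') auto
        then show ?case using k' elim True by (simp add: cb_def wt_def p' power2_eq_square)
      qed
      ultimately show ?thesis using True k' by (simp add: tendsto_cong p')
    qed
  qed
  then have "((\<lambda>v. \<Sum>p\<in>JJ. w p * (wt k (n k) v * cb p v)) \<longlongrightarrow> WW k) (Fl k)"
    unfolding WW_def by (intro tendsto_sum tendsto_mult tendsto_const)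
  moreover have "eventually (\<lambda>v. (\<Sum>p\<in>JJ. w p * (wt k (n k) v * cb p v)) = wt k (n k) v * fv om v) (Fl k)"
    using ev_Fl by eventually_elim (simp add: fv_om sum_distrib_left mult_ac)
  ultimately show ?thesis by (simp add: tendsto_cong)
qed

text \<open>The weight of order \<open>m + n k\<close> is split in two ways: into \<open>m\<close>
  and \<open>n k\<close> for multiplication by \<open>om\<close>, and into \<open>n k - 1\<close>
  and \<open>m + 1\<close> for the derivative, whose limit is therefore suppressed unless
  \<open>n k = 1\<close>.\<close>

lemma wt_DD:
  assumes k: "k \<le> q" and II: "(k', m') \<in> II" and m: "0 < m" "k' = k \<longrightarrow> m' \<le> m"
  shows "((\<lambda>v. wt k (m + n k) v * fv (DD (bb (k', m'))) v) \<longlongrightarrow>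
    (if k' = k \<and> m' = m then lamb k m else 0)) (Fl k)"
proof -
  let ?d = "if k' = k \<and> m' = m then 1 else 0 :: complex"
  let ?e = "if k < q then - of_nat m else of_nat m :: complex"
  have "((\<lambda>v. (wF k m v * cb (k', m') v) * (wt k (n k) v * fv om v) +
      wF k (n k - 1) v * (wt k (m + 1) v * dcb (k', m') v)) \<longlongrightarrow>
      ?d * WW k + (if n k - 1 = 0 then 1 else 0) * (if k' = k \<and> m' = m then ?e else 0)) (Fl k)"
    by (intro tendsto_add tendsto_mult wF_cb wt_om wF_tendsto wt_dcb k II m)
  moreover have "?d * WW k + (if n k - 1 = 0 then 1 else 0) * (if k' = k \<and> m' = m then ?e else 0) =
      (if k' = k \<and> m' = m then lamb k m else 0)"
    using n_pos[OF k] by (auto simp: lamb_def)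
  moreover have "eventually (\<lambda>v. (wF k m v * cb (k', m') v) * (wt k (n k) v * fv om v) +
      wF k (n k - 1) v * (wt k (m + 1) v * dcb (k', m') v) = wt k (m + n k) v * fv (DD (bb (k', m'))) v) (Fl k)"
    using ev_Fl
  proof eventually_elim
    case (elim v)
    have "fv (DD (bb (k', m'))) v = dcb (k', m') v + fv om v * cb (k', m') v"
      unfolding DD_def[abs_def] using elim
      by (simp add: fv_add[of _ Z] fv_mult[of _ Z] FF_pd bb_FF om_FF FF.mult fv_pd_bb fv_bb)
    moreover have "wt k (m + n k) v = wF k m v * wt k (n k) v" by (rule wt_add)
    moreover have "wt k (m + n k) v = wF k (n k - 1) v * wt k (m + 1) v"
      using wt_add[of k "n k - 1" "m + 1" v] n_pos[OF k] by (simp add: add.commute)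
    ultimately show ?case by (simp add: algebra_simps)
  qed
  ultimately show ?thesis by (simp add: tendsto_cong)
qed

definition HH :: "(nat \<Rightarrow> ratfun) set" where
  "HH = {f. \<exists>e\<in>cs bb JJ. \<exists>d\<in>FF Z. f = (\<lambda>j. e j + DD d j)}"

lemma HH_I: "e \<in> cs bb JJ \<Longrightarrow> d \<in> FF Z \<Longrightarrow> (\<And>j. f j = e j + DD d j) \<Longrightarrow> f \<in> HH"
  unfolding HH_def by blast

lemma HH_E:
  assumes "f \<in> HH"
  obtains e d where "e \<in> cs bb JJ" "d \<in> FF Z" "\<And>j. f j = e j + DD d j"
  using assms unfolding HH_def by blast

lemma HH_add: "f \<in> HH \<Longrightarrow> g \<in> HH \<Longrightarrow> (\<lambda>j. f j + g j) \<in> HH"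
proof (elim HH_E)
  fix e d e' d'
  assume *: "e \<in> cs bb JJ" "d \<in> FF Z" "\<And>j. f j = e j + DD d j"
    "e' \<in> cs bb JJ" "d' \<in> FF Z" "\<And>j. g j = e' j + DD d' j"
  show ?thesis
    by (rule HH_I[OF cs_add[OF *(1,4)] FF.add[OF *(2,5)]]) (simp add: * DD_def rat_pd_add algebra_simps)
qed

lemma HH_scale: "f \<in> HH \<Longrightarrow> (\<lambda>j. rconst a * f j) \<in> HH"
proof (elim HH_E)
  fix e d
  assume *: "e \<in> cs bb JJ" "d \<in> FF Z" "\<And>j. f j = e j + DD d j"
  show ?thesis
    by (rule HH_I[OF cs_scale[OF *(1), of a] FF_scale[OF *(2), of a]]) (simp add: * DD_def rat_pd_mult algebra_simps)
qed

lemma HH_base: "p \<in> JJ \<Longrightarrow> bb p \<in> HH"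
  by (rule HH_I[OF cs_base FF_zero]) (simp_all add: DD_def)

lemma HH_DD: "f \<in> FF Z \<Longrightarrow> DD f \<in> HH"
  by (rule HH_I[OF cs_zero]) simp_all

lemma HH_sum: "(\<And>i. i \<in> T \<Longrightarrow> h i \<in> HH) \<Longrightarrow> (\<lambda>j. \<Sum>i\<in>T. h i j) \<in> HH"
proof (induction T rule: infinite_finite_induct)
  case (insert a T)
  then have "(\<lambda>j. h a j + (\<Sum>a\<in>T. h a j)) \<in> HH" by (intro HH_add) auto
  then show ?case using insert by simp
next
  case empty
  show ?case using HH_scale[OF HH_DD[OF FF_zero], of 0] by (simp add: rconst_simps)
next
  case infinite
  then show ?case using HH_scale[OF HH_DD[OF FF_zero], of 0] by (simp add: rconst_simps)
qed

end

text \<open>Nonresonance: \<open>DD\<close> never annihilates the leading term of a pole, so it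
  raises the pole order at \<open>k\<close> by exactly \<open>n k\<close>.\<close>

locale generic_twisted_line = twisted_line +
  assumes lamb_nonzero: "k \<le> q \<Longrightarrow> 0 < m \<Longrightarrow> lamb k m \<noteq> 0"
begin

text \<open>Induction on the pole order. A basis function outside \<open>JJ\<close> is, up to a
  nonzero factor, the leading term of \<open>DD\<close> applied to a basis function at the same
  place; the other terms have smaller order there, and at other places they stay within
  \<open>JJ\<close>.\<close>

lemma bb_HH: "p \<in> II \<Longrightarrow> bb p \<in> HH"
proof (induction "eo p" arbitrary: p rule: less_induct)
  case less
  obtain k m where p: "p = (k, m)" by (cases p)
  have k: "k \<le> q" using less.prems p by (auto simp: II_def)
  show ?case
  proof (cases "p \<in> JJ")
    case False
    then have big: "n k < eo p" using less.prems p by (auto simp: JJ_def)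
    \<comment> \<open>Multiplication by \<open>om\<close> adds \<open>n k\<close> to the order, so
      this exponent makes the leading term equal to \<open>bb p\<close>.\<close>
    define m' where "m' = eo p - n k"
    have m': "0 < m'" "m' + n k = eo p" using big by (simp_all add: m'_def)
    have b: "(k, m') \<in> II" using k m' by (auto simp: II_def)
    obtain T c where T: "finite T" "T \<subseteq> II" and f: "DD (bb (k, m')) = (\<lambda>j. \<Sum>p\<in>T. rconst (c p) * bb p j)"
      using DD_FF[OF bb_FF[of "(k, m')"]] unfolding FF_eq cs_def by blast
    have N: "1 \<le> m' + n k" "k = q \<longrightarrow> 2 \<le> m' + n k" for k using m'(1) n_pos[of k] by auto
    have same: "c (k, m'') = 0" if "(k, m'') \<in> T" "eo (k, m'') > eo p" for m''
      using coeff_limit(1)[OF T f k N wt_DD[OF k b m'(1)]] that m'(2) by simp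
    have top: "c p = lamb k m'" if "p \<in> T"
      using coeff_limit(2)[OF T f k N wt_DD[OF k b m'(1)]] that m'(2) p by simp
    \<comment> \<open>At the other places \<open>bb (k, m')\<close> has no pole, so the order there
      does not exceed that of \<open>om\<close>.\<close>
    have other: "c (k', m'') = 0" if "(k', m'') \<in> T" "k' \<noteq> k" "(k', m'') \<notin> JJ" for k' m''
    proof -
      have II: "(k', m'') \<in> II" using that T(2) by auto
      then have k': "k' \<le> q" by (auto simp: II_def)
      have e: "n k' < eo (k', m'')" using II that(3) by (auto simp: JJ_def)
      define M where "M = eo (k', m'') - n k'"
      have M: "0 < M" "M + n k' = eo (k', m'')" using e by (simp_all add: M_def)
      have N': "1 \<le> M + n k'" "k' = q \<longrightarrow> 2 \<le> M + n k'" using M(1) n_pos[of k'] by auto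
      have "k = k' \<longrightarrow> m' \<le> M" using that(2) by simp
      from coeff_limit(2)[OF T f k' N' wt_DD[OF k' b M(1) this]] that M(2) show ?thesis by simp
    qed
    have pT: "p \<in> T"
    proof (rule ccontr)
      assume "p \<notin> T"
      \<comment> \<open>Adding \<open>p\<close> to the index set with coefficient 0 makes the limit
        applicable; it forces this coefficient to be \<open>lamb k m'\<close>, which is
        nonzero.\<close>
      define c' where "c' = c(p := 0)"
      have f': "DD (bb (k, m')) = (\<lambda>j. \<Sum>i\<in>insert p T. rconst (c' i) * bb i j)"
        unfolding f using \<open>p \<notin> T\<close> T(1) by (intro ext) (auto simp: c'_def rconst_simps intro!: sum.cong)
      have "c' p = lamb k m'"
        using coeff_limit(2)[OF _ _ f' k N wt_DD[OF k b m'(1)]] T less.prems p m'(2) by simp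
      then show False using lamb_nonzero[OF k m'(1)] by (simp add: c'_def)
    qed
    have "(\<lambda>j. \<Sum>i\<in>T - {p}. rconst (c i) * bb i j) \<in> HH"
    proof (rule HH_sum)
      fix i assume i: "i \<in> T - {p}"
      obtain k' m'' where i': "i = (k', m'')" by (cases i)
      show "(\<lambda>j. rconst (c i) * bb i j) \<in> HH"
      proof (cases "c i = 0")
        case True
        then show ?thesis using HH_scale[OF HH_DD[OF FF_zero], of 0] by (simp add: rconst_simps)
      next
        case False
        show ?thesis
        proof (cases "k' = k")
          case True
          then have "\<not> eo i > eo p" using same[of m''] i i' False by auto
          moreover have "eo i \<noteq> eo p" using i i' True p by (auto simp: eo_def split: if_splits)
          ultimately have "eo i < eo p" by linarith
          then have "bb i \<in> HH" by (rule less.hyps) (use i T(2) in blast)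
          then show ?thesis by (rule HH_scale)
        next
          case ne: False
          then have "i \<in> JJ" using other[of k' m''] i i' False by auto
          then show ?thesis by (intro HH_scale HH_base)
        qed
      qed
    qed
    then have "(\<lambda>j. rconst (inverse (lamb k m')) * (DD (bb (k, m')) j + rconst (- 1) * (\<Sum>i\<in>T - {p}. rconst (c i) * bb i j))) \<in> HH"
      by (intro HH_scale HH_add HH_DD bb_FF)
    moreover have "rconst (inverse (lamb k m')) * (DD (bb (k, m')) j + rconst (- 1) * (\<Sum>i\<in>T - {p}. rconst (c i) * bb i j)) = bb p j" for j
    proof -
      have "DD (bb (k, m')) j = rconst (lamb k m') * bb p j + (\<Sum>i\<in>T - {p}. rconst (c i) * bb i j)"
        unfolding f using pT T(1) top by (simp add: sum.remove)
      moreover have "rconst (inverse (lamb k m')) * rconst (lamb k m') = 1"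
        using lamb_nonzero[OF k m'(1)] by (simp flip: rconst_simps)
      ultimately show ?thesis by (simp add: rconst_hom flip: mult.assoc)
    qed
    ultimately show ?thesis by simp
  qed (rule HH_base)
qed

theorem FF_reduce:
  assumes "f \<in> FF Z"
  shows "\<exists>c. \<exists>d\<in>FF Z. f = (\<lambda>j. (\<Sum>p\<in>JJ. rconst (c p) * bb p j) + DD d j)"
proof -
  obtain T c where "finite T" "T \<subseteq> II" "f = (\<lambda>j. \<Sum>p\<in>T. rconst (c p) * bb p j)"
    using assms unfolding FF_eq cs_def by blast
  then have "f \<in> HH" using bb_HH by (auto intro!: HH_sum HH_scale)
  then obtain e d where "e \<in> cs bb JJ" "d \<in> FF Z" "f = (\<lambda>j. e j + DD d j)" by (elim HH_E) blast
  then show ?thesis using cs_finite[OF _ finite_JJ] by blast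
qed

text \<open>A nonconstant part of \<open>d\<close> would have a highest pole at some place, and by
  nonresonance its image would exceed the orders allowed in \<open>JJ\<close>. Hence
  \<open>d\<close> is a constant, and \<open>DD\<close> of a constant is a multiple of
  \<open>om\<close>: the class of \<open>om\<close> is the only relation.\<close>

theorem DD_image:
  assumes d: "d \<in> FF Z" and eq: "\<And>v. v \<notin> Z \<Longrightarrow> (\<Sum>p\<in>JJ. c p * cb p v) = fv (DD d) v"
  shows "\<exists>a. \<forall>p\<in>JJ. c p = a * w p"
proof -
  obtain T b where T: "finite T" "T \<subseteq> II" and f: "d = (\<lambda>j. \<Sum>p\<in>T. rconst (b p) * bb p j)"
    using d unfolding FF_eq cs_def by blast
  have fvD: "fv (DD d) v = (\<Sum>p\<in>T. b p * fv (DD (bb p)) v)" if "v \<notin> Z" for v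
    unfolding f DD_sum using that
    by (subst fv_sum[of _ _ Z]) (auto intro!: sum.cong FF_scale DD_FF bb_FF simp: fv_scale[of _ Z] DD_FF bb_FF)
  have zero: "b (k, m) = 0" if km: "(k, m) \<in> T" "0 < m" for k m
  proof (rule ccontr)
    assume "b (k, m) \<noteq> 0"
    let ?S = "{m. (k, m) \<in> T \<and> b (k, m) \<noteq> 0}"
    have "?S \<subseteq> snd ` T" by force
    then have fin: "finite ?S" using T(1) finite_surj by blast
    have ne: "m \<in> ?S" using km \<open>b (k, m) \<noteq> 0\<close> by simp
    define t where "t = Max ?S"
    have t: "t \<in> ?S" unfolding t_def using fin ne by (intro Max_in) auto
    have le: "m' \<le> t" if "m' \<in> ?S" for m' unfolding t_def using fin that by simp
    have tpos: "0 < t" using le[OF ne] km(2) by simp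
    have k: "k \<le> q" using km T(2) by (auto simp: II_def)
    have "((\<lambda>v. b p * (wt k (t + n k) v * fv (DD (bb p)) v)) \<longlongrightarrow> b p * (if p = (k, t) then lamb k t else 0)) (Fl k)"
      if p: "p \<in> T" for p
    proof (cases "b p = 0")
      case False
      obtain k' m' where p': "p = (k', m')" by (cases p)
      have "((\<lambda>v. wt k (t + n k) v * fv (DD (bb (k', m'))) v) \<longlongrightarrow> (if k' = k \<and> m' = t then lamb k t else 0)) (Fl k)"
        by (rule wt_DD) (use k p p' T(2) tpos le False in auto)
      then show ?thesis unfolding p' by (intro tendsto_mult tendsto_const) simp
    qed simp
    then have "((\<lambda>v. \<Sum>p\<in>T. b p * (wt k (t + n k) v * fv (DD (bb p)) v)) \<longlongrightarrow> (\<Sum>p\<in>T. b p * (if p = (k, t) then lamb k t else 0))) (Fl k)"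
      by (rule tendsto_sum)
    moreover have "(\<Sum>p\<in>T. b p * (if p = (k, t) then lamb k t else 0)) = (\<Sum>p\<in>T. if p = (k, t) then b (k, t) * lamb k t else 0)"
      by (rule sum.cong) auto
    then have "(\<Sum>p\<in>T. b p * (if p = (k, t) then lamb k t else 0)) = b (k, t) * lamb k t"
      using t T(1) by simp
    moreover have "eventually (\<lambda>v. (\<Sum>p\<in>T. b p * (wt k (t + n k) v * fv (DD (bb p)) v)) = (\<Sum>p\<in>JJ. c p * (wt k (t + n k) v * cb p v))) (Fl k)"
      using ev_Fl
    proof eventually_elim
      case (elim v)
      have "(\<Sum>p\<in>T. b p * (wt k (t + n k) v * fv (DD (bb p)) v)) = wt k (t + n k) v * fv (DD d) v"
        by (simp add: fvD[OF elim] sum_distrib_left mult_ac)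
      also have "\<dots> = (\<Sum>p\<in>JJ. c p * (wt k (t + n k) v * cb p v))"
        by (simp add: eq[OF elim, symmetric] sum_distrib_left mult_ac)
      finally show ?case .
    qed
    ultimately have L1: "((\<lambda>v. \<Sum>p\<in>JJ. c p * (wt k (t + n k) v * cb p v)) \<longlongrightarrow> b (k, t) * lamb k t) (Fl k)"
      by (simp add: tendsto_cong)
    have "((\<lambda>v. wt k (t + n k) v * cb p v) \<longlongrightarrow> 0) (Fl k)" if p: "p \<in> JJ" for p
    proof -
      obtain k' m' where p': "p = (k', m')" by (cases p)
      have lt: "k' = k \<Longrightarrow> eo (k', m') < t + n k" using p p' tpos by (auto simp: JJ_def)
      have "((\<lambda>v. wt k (t + n k) v * cb (k', m') v) \<longlongrightarrow> (if k' = k \<and> eo (k', m') = t + n k then 1 else 0)) (Fl k)"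
        by (rule wt_cb) (use k p p' JJ_II tpos n_pos[OF k] lt in auto)
      then show ?thesis unfolding p' using lt by (auto split: if_splits)
    qed
    then have "((\<lambda>v. \<Sum>p\<in>JJ. c p * (wt k (t + n k) v * cb p v)) \<longlongrightarrow> (\<Sum>p\<in>JJ. c p * 0)) (Fl k)"
      by (intro tendsto_sum tendsto_mult tendsto_const)
    with L1 have "b (k, t) * lamb k t = 0" using tendsto_unique[OF Fl_nontrivial] by fastforce
    then show False using lamb_nonzero[OF k tpos] t by simp
  qed
  \<comment> \<open>The constant term of \<open>d\<close>, which is the only term left.\<close>
  define a where "a = (if (q, 0) \<in> T then b (q, 0) else 0)"
  have fvd: "fv (DD d) v = (\<Sum>p\<in>JJ. a * w p * cb p v)" if v: "v \<notin> Z" for v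
  proof -
    have "(\<Sum>p\<in>T. b p * fv (DD (bb p)) v) = (\<Sum>p\<in>T. if p = (q, 0) then b (q, 0) * fv (DD (bb (q, 0))) v else 0)"
    proof (rule sum.cong[OF refl])
      fix p assume p: "p \<in> T"
      obtain k' m' where p': "p = (k', m')" by (cases p)
      have "(k', m') \<in> II" using p p' T(2) by auto
      then have "m' = 0 \<Longrightarrow> k' = q" by (auto simp: II_def)
      then show "b p * fv (DD (bb p)) v = (if p = (q, 0) then b (q, 0) * fv (DD (bb (q, 0))) v else 0)"
        using zero[of k' m'] p p' by (cases "m' = 0") auto
    qed
    also have "\<dots> = a * fv (DD (bb (q, 0))) v" using T(1) by (simp add: a_def)
    also have "DD (bb (q, 0)) = om" by (rule ext) (simp add: DD_def bb_0)
    finally show ?thesis using fvD[OF v] fv_om[OF v] by (simp add: sum_distrib_left mult.assoc)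
  qed
  define e where "e p = c p - a * w p" for p
  let ?g = "\<lambda>j. \<Sum>p\<in>JJ. rconst (e p) * bb p j"
  have "fv ?g v = 0" if v: "v \<notin> Z" for v
  proof -
    have "fv ?g v = (\<Sum>p\<in>JJ. e p * cb p v)"
      using v by (subst fv_sum[of _ _ Z]) (auto intro!: sum.cong FF_scale bb_FF simp: fv_scale[of _ Z] bb_FF fv_bb)
    then show ?thesis using eq[OF v] fvd[OF v] by (simp add: e_def left_diff_distrib sum_subtractf)
  qed
  then have lim: "((\<lambda>v. wt k N v * fv ?g v) \<longlongrightarrow> 0) (Fl k)" for k N
    using ev_Fl[of k] by (intro tendsto_eventually) (auto elim: eventually_mono)
  have "e p = 0" if p: "p \<in> JJ" for p
  proof -
    obtain k m where p': "p = (k, m)" by (cases p)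
    have II: "(k, m) \<in> II" using p p' JJ_II by auto
    then have 1: "k \<le> q" "1 \<le> eo (k, m)" "k = q \<longrightarrow> 2 \<le> eo (k, m)" by (auto simp: II_def eo_def)
    from coeff_limit(2)[OF finite_JJ JJ_II refl 1 lim] p p' show ?thesis by simp
  qed
  then have "\<forall>p\<in>JJ. c p = a * w p" by (simp add: e_def)
  then show ?thesis by (rule exI)
qed

end

section \<open>Several variables: functions and functionals on a product of punctured lines\<close>

subsection \<open>Regular functions on a product of punctured lines\<close>

text \<open>The image of the \<open>n\<close>-fold tensor power of \<open>FF Z\<close>: the factor
  in position \<open>s\<close> is inserted into the variable \<open>s\<close>.\<close>

definition TS :: "nat \<Rightarrow> complex set \<Rightarrow> ratfun set" where
  "TS n Z = {g. \<exists>N a G. (\<forall>t s. G t s \<in> FF Z) \<and> g = (\<Sum>t<(N::nat). rconst (a t) * (\<Prod>s\<in>{1..n}. G t s s))}"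

lemma TS_I: "(\<And>t s. G t s \<in> FF Z) \<Longrightarrow> (\<Sum>t<(N::nat). rconst (a t) * (\<Prod>s\<in>{1..n}. G t s s)) \<in> TS n Z"
  unfolding TS_def by blast

lemma TS_zero: "0 \<in> TS n Z"
  using TS_I[where N = 0 and G = "\<lambda>_ _ _. 1" and Z = Z and n = n] by (simp add: FF_one)

lemma TS_add:
  assumes "g \<in> TS n Z" "h \<in> TS n Z"
  shows "g + h \<in> TS n Z"
proof -
  obtain N a G where 1: "\<forall>t s. G t s \<in> FF Z" "g = (\<Sum>t<(N::nat). rconst (a t) * (\<Prod>s\<in>{1..n}. G t s s))"
    using assms(1) unfolding TS_def by blast
  obtain N' a' G' where 2: "\<forall>t s. G' t s \<in> FF Z" "h = (\<Sum>t<(N'::nat). rconst (a' t) * (\<Prod>s\<in>{1..n}. G' t s s))"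
    using assms(2) unfolding TS_def by blast
  let ?a = "\<lambda>t. if t < N then a t else a' (t - N)" and ?G = "\<lambda>t. if t < N then G t else G' (t - N)"
  let ?f = "\<lambda>t. rconst (?a t) * (\<Prod>s\<in>{1..n}. ?G t s s)"
  have "(\<Sum>t<N + N'. ?f t) = (\<Sum>t<N. ?f t) + (\<Sum>t\<in>{N..<N + N'}. ?f t)"
    by (subst sum.union_disjoint[symmetric]) (auto intro!: sum.cong)
  also have "(\<Sum>t<N. ?f t) = g" unfolding 1(2) by (rule sum.cong) auto
  also have "(\<Sum>t\<in>{N..<N + N'}. ?f t) = h"
    unfolding 2(2) by (rule sum.reindex_bij_witness[of _ "\<lambda>t. t + N" "\<lambda>t. t - N"]) auto
  finally have eq: "(\<Sum>t<N + N'. ?f t) = g + h" .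
  have "(\<Sum>t<N + N'. ?f t) \<in> TS n Z" by (rule TS_I) (use 1(1) 2(1) in simp)
  then show ?thesis unfolding eq .
qed

lemma TS_sum: "(\<And>i. i \<in> A \<Longrightarrow> g i \<in> TS n Z) \<Longrightarrow> sum g A \<in> TS n Z"
  by (induction A rule: infinite_finite_induct) (auto simp: TS_zero TS_add)

lemma TS_const: "rconst c \<in> TS 0 Z"
  using TS_I[where N = 1 and G = "\<lambda>_ _ _. 1" and Z = Z and n = 0 and a = "\<lambda>_. c"] by (simp add: FF_one)

lemma TS_mult_Suc:
  assumes "g \<in> TS n Z" "f \<in> FF Z"
  shows "g * f (Suc n) \<in> TS (Suc n) Z"
proof -
  obtain N a G where 1: "\<forall>t s. G t s \<in> FF Z" "g = (\<Sum>t<(N::nat). rconst (a t) * (\<Prod>s\<in>{1..n}. G t s s))"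
    using assms(1) unfolding TS_def by blast
  let ?G = "\<lambda>t s. if s = Suc n then f else G t s"
  have "g * f (Suc n) = (\<Sum>t<N. rconst (a t) * (\<Prod>s\<in>{1..Suc n}. ?G t s s))"
    unfolding 1(2) sum_distrib_right by (intro sum.cong refl) (simp add: mult.assoc)
  moreover have "(\<Sum>t<N. rconst (a t) * (\<Prod>s\<in>{1..Suc n}. ?G t s s)) \<in> TS (Suc n) Z"
    by (rule TS_I) (use 1(1) assms(2) in simp)
  ultimately show ?thesis by simp
qed

lemma FF_poly:
  fixes p :: "complex poly"
  shows "\<exists>e\<in>FF Z. \<forall>v. v \<notin> Z \<longrightarrow> fv e v = poly p v"
proof (induction p)
  case 0
  show ?case by (rule bexI[OF _ FF.const[of 0]]) simp
next
  case (pCons a p)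
  then obtain e where e: "e \<in> FF Z" "\<And>v. v \<notin> Z \<Longrightarrow> fv e v = poly p v" by blast
  have "fv (\<lambda>j. rconst a + rvar j * e j) v = poly (pCons a p) v" if "v \<notin> Z" for v
    using that e by (simp add: fv_add[OF FF.const FF.mult[OF FF.var e(1)]] fv_mult[OF FF.var e(1)])
  moreover have "(\<lambda>j. rconst a + rvar j * e j) \<in> FF Z" by (intro FF.add FF.const FF.mult FF.var e)
  ultimately show ?case by blast
qed

lemma FF_inverse_prod:
  assumes "finite A" "A \<subseteq> Z"
  shows "\<exists>e\<in>FF Z. \<forall>v. v \<notin> Z \<longrightarrow> fv e v = inverse (poly (\<Prod>z\<in>A. [:- z, 1:]) v)"
  using assms
proof (induction A rule: finite_induct)
  case empty
  show ?case by (rule bexI[OF _ FF.const[of 1]]) simp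
next
  case (insert a A)
  then obtain e where e: "e \<in> FF Z" "\<And>v. v \<notin> Z \<Longrightarrow> fv e v = inverse (poly (\<Prod>z\<in>A. [:- z, 1:]) v)" by auto
  have a: "a \<in> Z" using insert.prems by simp
  have "fv (\<lambda>j. inverse (rvar j - rconst a) * e j) v = inverse (poly (\<Prod>z\<in>insert a A. [:- z, 1:]) v)" if "v \<notin> Z" for v
  proof -
    have "v \<noteq> a" using that a by auto
    moreover have "poly (\<Prod>z\<in>insert a A. [:- z, 1:]) v = (v - a) * poly (\<Prod>z\<in>A. [:- z, 1:]) v"
      using insert.hyps by (simp add: algebra_simps)
    ultimately show ?thesis
      unfolding fv_mult[OF FF.inv[OF a] e(1) that] e(2)[OF that] by (simp only: fv_inv[OF \<open>v \<noteq> a\<close>] inverse_mult_distrib)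
  qed
  moreover have "(\<lambda>j. inverse (rvar j - rconst a) * e j) \<in> FF Z" by (intro FF.mult FF.inv a e)
  ultimately show ?case by blast
qed

text \<open>The quotient A/B has poles only in \<open>Z\<close>, where \<open>Q\<close> vanishes.
  Remove the roots of \<open>B\<close> one by one: a root outside \<open>Z\<close> is also a root of
  \<open>A\<close>, a root inside \<open>Z\<close> is absorbed by one factor \<open>Q\<close>. Thus
  the degree of \<open>B\<close> bounds the exponent that is required.\<close>

lemma dvd_of_locally_dvd:
  fixes A B Q :: "complex poly"
  assumes "B \<noteq> 0" "\<And>z. z \<in> Z \<Longrightarrow> poly Q z = 0"
    and "\<And>v. v \<notin> Z \<Longrightarrow> \<exists>A' B'. poly B' v \<noteq> 0 \<and> A * B' = A' * B"
  shows "B dvd A * Q ^ degree B"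
  using assms(1,3)
proof (induction "degree B" arbitrary: A B)
  case 0
  then obtain b where "B = [:b:]" "b \<noteq> 0" by (metis degree_eq_zeroE pCons_0_0)
  then have "A * Q ^ degree B = B * smult (inverse b) (A * Q ^ degree B)" by simp
  then show ?case by (rule dvdI)
next
  case (Suc n)
  then obtain x where x: "poly B x = 0" using alg_closed_imp_poly_has_root[of B] by auto
  then obtain B1 where B1: "B = [:- x, 1:] * B1" by (auto simp: poly_eq_0_iff_dvd)
  have nz: "B1 \<noteq> 0" using Suc.prems(1) B1 by auto
  have "degree B = degree [:- x, 1:] + degree B1" unfolding B1 using nz by (intro degree_mult_eq) simp_all
  then have d: "degree B = Suc (degree B1)" by simp
  show ?case
  proof (cases "x \<in> Z")
    case False
    obtain A' B' where "poly B' x \<noteq> 0" "A * B' = A' * B" using Suc.prems(2)[OF False] by blast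
    then have "poly A x * poly B' x = 0" using x by (metis mult_zero_right poly_mult)
    then have "poly A x = 0" using \<open>poly B' x \<noteq> 0\<close> by simp
    then obtain A1 where A1: "A = [:- x, 1:] * A1" by (auto simp: poly_eq_0_iff_dvd)
    have "B1 dvd A1 * Q ^ degree B1"
    proof (rule Suc.hyps(1))
      show "n = degree B1" using Suc.hyps(2) d by simp
      fix v assume "v \<notin> Z"
      then obtain A' B' where *: "poly B' v \<noteq> 0" "A * B' = A' * B" using Suc.prems(2) by blast
      then have "[:- x, 1:] * (A1 * B') = [:- x, 1:] * (A' * B1)" by (simp only: A1 B1 mult_ac)
      then have "A1 * B' = A' * B1" by (metis mult_cancel_left pCons_eq_0_iff zero_neq_one)
      with *(1) show "\<exists>A' B'. poly B' v \<noteq> 0 \<and> A1 * B' = A' * B1" by blast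
    qed (rule nz)
    then have "B dvd A * Q ^ degree B1" unfolding A1 B1 by (simp only: mult.assoc) (rule mult_dvd_mono[OF dvd_refl])
    also have "A * Q ^ degree B1 dvd A * Q ^ degree B" unfolding d by (simp add: mult_dvd_mono)
    finally show ?thesis .
  next
    case True
    have "B1 dvd A * Q ^ degree B1"
    proof (rule Suc.hyps(1))
      show "n = degree B1" using Suc.hyps(2) d by simp
      fix v assume "v \<notin> Z"
      then obtain A' B' where *: "poly B' v \<noteq> 0" "A * B' = A' * B" using Suc.prems(2) by blast
      then have "A * B' = (A' * [:- x, 1:]) * B1" by (simp only: B1 mult.assoc)
      with *(1) show "\<exists>A' B'. poly B' v \<noteq> 0 \<and> A * B' = A' * B1" by blast
    qed (rule nz)
    moreover have "[:- x, 1:] dvd Q" using assms(2)[OF True] by (simp add: poly_eq_0_iff_dvd)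
    ultimately have "[:- x, 1:] * B1 dvd Q * (A * Q ^ degree B1)" by (rule mult_dvd_mono[rotated])
    then show ?thesis unfolding B1[symmetric] d by (simp add: mult_ac)
  qed
qed

text \<open>The interpolation polynomials \<open>L\<close> are chosen before \<open>P\<close>; in
  \<open>local_to_global\<close> they stay fixed while \<open>P\<close> varies with the other
  coordinates.\<close>

lemma Lagrange_basis:
  fixes S :: "complex set"
  assumes "finite S"
  shows "\<exists>L :: complex \<Rightarrow> complex poly. \<forall>P. degree P < card S \<longrightarrow> P = (\<Sum>s\<in>S. smult (poly P s) (L s))"
proof (rule exI, intro allI impI)
  let ?L = "\<lambda>s. smult (inverse (\<Prod>t\<in>S - {s}. s - t)) (\<Prod>t\<in>S - {s}. [:- t, 1:])"
  fix P :: "complex poly" assume P: "degree P < card S"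
  show "P = (\<Sum>s\<in>S. smult (poly P s) (?L s))"
  proof (rule poly_eqI_degree[of S])
    fix x assume x: "x \<in> S"
    have "poly (?L s) x = (if s = x then 1 else 0)" if "s \<in> S" for s
    proof (cases "s = x")
      case True
      have "(\<Prod>t\<in>S - {x}. x - t) \<noteq> 0" using assms by auto
      then show ?thesis using True by (simp add: poly_prod)
    next
      case False
      have "(\<Prod>t\<in>S - {s}. x - t) = 0" using assms x False by (intro prod_zero) auto
      then show ?thesis using False by (simp add: poly_prod)
    qed
    then have "poly (\<Sum>s\<in>S. smult (poly P s) (?L s)) x = (\<Sum>s\<in>S. if s = x then poly P x else 0)"
      unfolding poly_sum poly_smult[of "poly P _"] by (intro sum.cong) auto
    then show "poly P x = poly (\<Sum>s\<in>S. smult (poly P s) (?L s)) x" using assms x by simp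
  next
    have "degree (smult (poly P s) (?L s)) \<le> card S - 1" if s: "s \<in> S" for s
    proof -
      have "degree (\<Prod>t\<in>S - {s}. [:- t, 1:]) = (\<Sum>t\<in>S - {s}. degree [:- t, 1:])"
        by (rule degree_prod_eq_sum_degree) auto
      also have "\<dots> = card S - 1" using assms s by simp
      finally have "degree (\<Prod>t\<in>S - {s}. [:- t, 1:]) = card S - 1" .
      then show ?thesis by (metis degree_smult_le order_trans)
    qed
    then have "degree (\<Sum>s\<in>S. smult (poly P s) (?L s)) \<le> card S - 1"
      by (intro degree_sum_le assms) auto
    then show "degree (\<Sum>s\<in>S. smult (poly P s) (?L s)) < card S" using P by linarith
  qed (rule P)
qed

text \<open>Restricting one fraction is enough: equality with the fraction that is regular at a
  given point is an identity of products, and this survives the substitution as long as no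
  denominator becomes the zero polynomial.\<close>

lemma restrict_variable:
  assumes reg: "\<And>c. (\<And>i. c i \<notin> Z) \<Longrightarrow> reg {1..Suc n} c f" and s: "s \<notin> Z"
  shows "\<exists>g. \<forall>c. (\<forall>i. c i \<notin> Z) \<longrightarrow> reg {1..n} c g \<and> ev c g = ev (c(Suc n := s)) f"
proof -
  let ?sub = "poly_subst pconst (\<lambda>i. if i = Suc n then pconst s else pvar i)"
  have sub_in: "?sub p \<in> polys_in {1..n}" if "p \<in> polys_in {1..Suc n}" for p
    by (rule poly_subst_in[OF that]) (auto simp: polys_in_closed intro!: pvar_in)
  have sub_pe: "pe c (?sub p) = pe (c(Suc n := s)) p" for c p
    unfolding pe_subst by (rule pe_cong[of _ UNIV]) auto
  note sub_hom = is_homD[OF is_hom_poly_subst[OF is_hom_pconst]]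
  \<comment> \<open>A fraction regular at the point with all coordinates \<open>s\<close>: this
    point lies on the hyperplane, so the denominator restricts to a nonzero polynomial.\<close>
  have "reg {1..Suc n} (\<lambda>_. s) f" using reg s by simp
  then obtain a b where ab: "a \<in> polys_in {1..Suc n}" "b \<in> polys_in {1..Suc n}" "f = Fract a b" "pe (\<lambda>_. s) b \<noteq> 0"
    by (rule regE)
  have "pe (\<lambda>_. s) (?sub b) \<noteq> 0" using ab(4) by (simp add: sub_pe fun_upd_idem)
  then have sb: "?sub b \<noteq> 0" by auto
  have "reg {1..n} c (Fract (?sub a) (?sub b)) \<and> ev c (Fract (?sub a) (?sub b)) = ev (c(Suc n := s)) f"
    if c: "\<forall>i. c i \<notin> Z" for c
  proof -
    have "reg {1..Suc n} (c(Suc n := s)) f" using c s by (intro reg) simp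
    then obtain a' b' where ab': "a' \<in> polys_in {1..Suc n}" "b' \<in> polys_in {1..Suc n}" "f = Fract a' b'"
      "pe (c(Suc n := s)) b' \<noteq> 0" "b' \<noteq> 0" "ev (c(Suc n := s)) f = pe (c(Suc n := s)) a' / pe (c(Suc n := s)) b'"
      by (rule regE)
    have b: "b \<noteq> 0" using sb by (auto simp: sub_hom)
    have pb': "pe c (?sub b') \<noteq> 0" using ab'(4) by (simp add: sub_pe)
    then have sb': "?sub b' \<noteq> 0" by auto
    have "a * b' = a' * b" using ab(3) ab'(3,5) b by (simp add: eq_fract)
    then have "?sub a * ?sub b' = ?sub a' * ?sub b" by (simp flip: sub_hom)
    then have "Fract (?sub a) (?sub b) = Fract (?sub a') (?sub b')" using sb sb' by (simp add: eq_fract)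
    then show ?thesis using regI[OF sub_in[OF ab'(1)] sub_in[OF ab'(2)] pb'] ev_Fract[OF pb'] ab'(6)
      by (simp add: sub_pe)
  qed
  then show ?thesis by blast
qed

text \<open>
  A function which is locally a quotient of polynomials is globally a combination of products of
  functions of one variable: fix all variables but the last one, interpolate the resulting function
  of one variable at sufficiently many points, and apply induction to the values at these points.
\<close>

theorem local_to_global:
  assumes Z: "finite Z" and reg: "\<And>c. (\<And>i. c i \<notin> Z) \<Longrightarrow> reg {1..n} c f"
  shows "f \<in> TS n Z"
  using reg
proof (induction n arbitrary: f)
  case 0
  have "infinite (- Z)" using Z by (simp add: infinite_UNIV_char_0)
  then obtain z where "z \<notin> Z" by (metis Compl_iff ex_in_conv finite.emptyI)
  then have "reg {1..0} (\<lambda>_. z) f" using 0 by simp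
  then obtain a b where ab: "a \<in> polys_in {}" "b \<in> polys_in {}" "f = Fract a b" "b \<noteq> 0"
    by (elim regE) simp
  have const: "\<exists>c. p = pconst c" if "p \<in> polys_in {}" for p
    using that by (induction p rule: cpoly_induct) (auto simp: mult_single simp flip: single_add)
  obtain x y where "a = pconst x" "b = pconst y" using const ab by blast
  then have "f = rconst (x / y)" unfolding ab(3) using ab(4) by (simp add: rconst_divide) (simp add: rconst_def)
  then show ?case using TS_const by simp
next
  case (Suc n)
  have inf: "infinite (- Z)" using Z by (simp add: infinite_UNIV_char_0)
  then obtain z0 where z0: "z0 \<notin> Z" by (metis Compl_iff ex_in_conv finite.emptyI)
  let ?V = "{1..Suc n}"
  have "reg ?V (\<lambda>_. z0) f" using Suc.prems z0 by simp
  then obtain a b where ab: "a \<in> polys_in ?V" "b \<in> polys_in ?V" "f = Fract a b" "b \<noteq> 0"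
    by (rule regE)
  obtain A da where A0: "\<forall>c v. pe (c(Suc n := v)) a = poly (A c) v" "\<forall>c. degree (A c) \<le> da"
    using univariate_slice[of "Suc n" UNIV a] by auto
  note A = A0[rule_format]
  obtain B M where B0: "\<forall>c v. pe (c(Suc n := v)) b = poly (B c) v" "\<forall>c. degree (B c) \<le> M"
    using univariate_slice[of "Suc n" UNIV b] by auto
  note B = B0[rule_format]
  define Q where "Q = (\<Prod>z\<in>Z. [:- z, 1 :: complex:])"
  have Q0: "poly Q v = 0 \<longleftrightarrow> v \<in> Z" for v using Z by (auto simp: Q_def poly_prod)
  \<comment> \<open>A bound for the degree of \<open>P\<close> in the equation A Q^M = P B found
    below, uniform in the other coordinates.\<close>
  define m where "m = da + degree (Q ^ M)"
  obtain S where S: "S \<subseteq> - Z" "finite S" "card S = Suc m"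
    using infinite_arbitrarily_large[OF inf] by blast
  obtain L where L: "\<forall>P. degree P < card S \<longrightarrow> P = (\<Sum>s\<in>S. smult (poly P s) (L s))"
    using Lagrange_basis[OF S(2)] by blast
  have "\<exists>g. \<forall>c. (\<forall>i. c i \<notin> Z) \<longrightarrow> reg {1..n} c g \<and> ev c g = ev (c(Suc n := s)) f" if "s \<in> S" for s
    using restrict_variable[of Z n f s] Suc.prems that S(1) by blast
  then obtain g where g: "\<And>s c. s \<in> S \<Longrightarrow> (\<forall>i. c i \<notin> Z) \<Longrightarrow> reg {1..n} c (g s) \<and> ev c (g s) = ev (c(Suc n := s)) f"
    by metis
  obtain qi where qi: "qi \<in> FF Z" "\<And>v. v \<notin> Z \<Longrightarrow> fv qi v = inverse (poly Q v)"
    using FF_inverse_prod[OF Z, of Z] unfolding Q_def by blast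
  define l where "l s = (SOME e. e \<in> FF Z \<and> (\<forall>v. v \<notin> Z \<longrightarrow> fv e v = poly (smult (poly Q s ^ M) (L s)) v))" for s
  have l0: "l s \<in> FF Z \<and> (\<forall>v. v \<notin> Z \<longrightarrow> fv (l s) v = poly (smult (poly Q s ^ M) (L s)) v)" for s
    unfolding l_def by (rule someI_ex[OF FF_poly[of Z "smult (poly Q s ^ M) (L s)", unfolded Bex_def]])
  then have l: "\<And>s. l s \<in> FF Z" "\<And>s v. v \<notin> Z \<Longrightarrow> fv (l s) v = poly (smult (poly Q s ^ M) (L s)) v" by blast+
  \<comment> \<open>The function (Q(s)/Q)^M times the interpolation polynomial of the node
    \<open>s\<close>: summed against the values of \<open>f\<close> at the nodes, it gives
    P/Q^M.\<close>
  let ?e = "\<lambda>s j. l s j * qi j ^ M"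
  have e: "?e s \<in> FF Z" for s by (intro FF.mult FF_power l qi)
  have fve: "fv (?e s) v = poly Q s ^ M * poly (L s) v / poly Q v ^ M" if "v \<notin> Z" for s v
    using that by (simp add: fv_mult[OF l(1) FF_power[OF qi(1)]] fv_power[OF qi(1)] qi(2) l(2) divide_inverse power_inverse)
  define h where "h = (\<Sum>s\<in>S. g s * ?e s (Suc n))"
  have gTS: "g s \<in> TS n Z" if "s \<in> S" for s
    using g[OF that] by (intro Suc.IH) blast
  have hTS: "h \<in> TS (Suc n) Z"
    unfolding h_def by (intro TS_sum TS_mult_Suc[OF gTS e])
  have regh: "reg ?V c h \<and> ev c h = (\<Sum>s\<in>S. ev (c(Suc n := s)) f * (poly Q s ^ M * poly (L s) (c (Suc n)) / poly Q (c (Suc n)) ^ M))"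
    if c: "\<And>i. c i \<notin> Z" for c
  proof -
    have "reg ?V c (g s) \<and> ev c (g s) = ev (c(Suc n := s)) f" if "s \<in> S" for s
      using g[OF that, of c] c by (auto intro: reg_mono)
    moreover have "reg ?V c (?e s (Suc n))" "ev c (?e s (Suc n)) = fv (?e s) (c (Suc n))" for s
      using FF_reg[OF e] FF_ev[OF e] c by auto
    ultimately have *: "reg ?V c (g s * ?e s (Suc n)) \<and>
        ev c (g s * ?e s (Suc n)) = ev (c(Suc n := s)) f * (poly Q s ^ M * poly (L s) (c (Suc n)) / poly Q (c (Suc n)) ^ M)"
      if "s \<in> S" for s
      using that c by (simp add: reg_mult ev_mult[where V = ?V] fve)
    show ?thesis
      unfolding h_def using * by (auto intro!: reg_sum sum.cong simp: ev_sum[where V = ?V])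
  qed
  \<comment> \<open>For special values of the other coordinates the denominator \<open>B c\<close>
    may be the zero polynomial; hence the comparison is first made where \<open>b\<close> does not
    vanish.\<close>
  have evf: "ev c f = ev c h" if c: "\<And>i. c i \<notin> Z" and b0: "pe c b \<noteq> 0" for c
  proof -
    let ?v = "c (Suc n)"
    have "poly (B c) ?v \<noteq> 0" using b0 B(1)[of c ?v] by simp
    then have Bnz: "B c \<noteq> 0" by auto
    have loc: "\<exists>A' B'. poly B' v \<noteq> 0 \<and> A c * B' = A' * B c \<and> ev (c(Suc n := v)) f = poly A' v / poly B' v"
      if v: "v \<notin> Z" for v
    proof -
      have "reg ?V (c(Suc n := v)) f" using c v by (intro Suc.prems) simp
      then obtain a' b' where ab': "f = Fract a' b'" "pe (c(Suc n := v)) b' \<noteq> 0" "b' \<noteq> 0"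
        "ev (c(Suc n := v)) f = pe (c(Suc n := v)) a' / pe (c(Suc n := v)) b'" by (rule regE)
      obtain A' d where A'0: "\<forall>c v. pe (c(Suc n := v)) a' = poly (A' c) v" "\<forall>c. degree (A' c) \<le> d"
        using univariate_slice[of "Suc n" UNIV a'] by auto
      note A' = A'0[rule_format]
      obtain B' d' where B'0: "\<forall>c v. pe (c(Suc n := v)) b' = poly (B' c) v" "\<forall>c. degree (B' c) \<le> d'"
        using univariate_slice[of "Suc n" UNIV b'] by auto
      note B' = B'0[rule_format]
      have ab_eq: "a * b' = a' * b" using ab(3,4) ab'(1,3) by (simp add: eq_fract)
      have "poly (A c * B' c) t = poly (A' c * B c) t" for t
      proof -
        have "pe (c(Suc n := t)) (a * b') = pe (c(Suc n := t)) (a' * b)" by (simp only: ab_eq)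
        then show ?thesis by (simp only: pe_simps A(1) A'(1) B(1) B'(1) poly_mult)
      qed
      then have "A c * B' c = A' c * B c" by (simp add: poly_eq_poly_eq_iff[symmetric] fun_eq_iff)
      moreover have "poly (B' c) v \<noteq> 0" using ab'(2) B'(1)[of c v] by simp
      moreover have "ev (c(Suc n := v)) f = poly (A' c) v / poly (B' c) v"
        using ab'(4) A'(1)[of c v] B'(1)[of c v] by simp
      ultimately show ?thesis by blast
    qed
    have "B c dvd A c * Q ^ degree (B c)"
      by (rule dvd_of_locally_dvd[of _ Z]) (use Bnz Q0 loc in blast)+
    also have "\<dots> dvd A c * Q ^ M" using B(2)[of c] by (intro mult_dvd_mono le_imp_power_dvd) auto
    finally obtain P where P: "A c * Q ^ M = P * B c" by (metis dvd_def mult.commute)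
    have "degree P \<le> m"
    proof (cases "P = 0")
      case False
      have "degree (A c * Q ^ M) \<le> m" using A(2)[of c] degree_mult_le[of "A c" "Q ^ M"] by (simp add: m_def)
      then show ?thesis unfolding P using False Bnz by (simp add: degree_mult_eq)
    qed simp
    then have PL: "P = (\<Sum>s\<in>S. smult (poly P s) (L s))" using S(3) by (intro L[rule_format]) simp
    have val: "ev (c(Suc n := v)) f * poly Q v ^ M = poly P v" if v: "v \<notin> Z" for v
    proof -
      obtain A' B' where *: "poly B' v \<noteq> 0" "A c * B' = A' * B c" "ev (c(Suc n := v)) f = poly A' v / poly B' v"
        using loc[OF v] by blast
      have "(A' * Q ^ M) * B c = (A' * B c) * Q ^ M" by (simp only: mult_ac)
      also have "\<dots> = (A c * B') * Q ^ M" by (simp only: *(2))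
      also have "\<dots> = (P * B') * B c" using P by (metis mult.assoc mult.commute)
      finally have "A' * Q ^ M = P * B'" using Bnz by (metis mult_cancel_right)
      then have "poly A' v * poly Q v ^ M = poly P v * poly B' v" by (metis poly_mult poly_power)
      moreover have "poly A' v / poly B' v * poly Q v ^ M = (poly A' v * poly Q v ^ M) / poly B' v" by simp
      ultimately show ?thesis using *(1) unfolding *(3) by simp
    qed
    have QV: "poly Q ?v \<noteq> 0" using Q0 c by simp
    have "ev c h = (\<Sum>s\<in>S. poly P s * poly (L s) ?v / poly Q ?v ^ M)"
      using regh[OF c] val S(1) by (auto intro!: sum.cong simp: mult.assoc[symmetric] subset_iff)
    also have "\<dots> = poly (\<Sum>s\<in>S. smult (poly P s) (L s)) ?v / poly Q ?v ^ M"
      by (simp add: poly_sum sum_divide_distrib)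
    also have "\<dots> = poly P ?v / poly Q ?v ^ M" using PL by simp
    also have "\<dots> = ev (c(Suc n := ?v)) f" using val[of ?v] c QV by (simp add: field_simps)
    finally show ?thesis by simp
  qed
  have "f = h"
  proof (rule ccontr)
    assume "f \<noteq> h"
    have "f \<in> fracs ?V" "h \<in> fracs ?V"
      using reg_fracs[of ?V "\<lambda>_. z0" f] reg_fracs[of ?V "\<lambda>_. z0" h] Suc.prems[of "\<lambda>_. z0"] regh[of "\<lambda>_. z0"] z0 by auto
    then have "f - h \<in> fracs ?V" by (rule fracs_closed)
    then obtain p p' where p: "f - h = Fract p p'" "p' \<noteq> 0" unfolding fracs_def by blast
    have "Fract 0 p' = 0" using p(2) by (simp add: Zero_fract_def eq_fract)
    then have "p \<noteq> 0" using \<open>f \<noteq> h\<close> p(1) by (metis right_minus_eq)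
    \<comment> \<open>By density there is a point off the punctures at which the difference is
      nonzero although \<open>evf\<close> applies.\<close>
    then have "p * p' * b \<noteq> 0" using p ab by simp
    then obtain c where c: "\<And>i. c i \<in> - Z" "pe c (p * p' * b) \<noteq> 0"
      using exists_nonroot[OF _ inf] by blast
    then have nz: "pe c p \<noteq> 0" "pe c p' \<noteq> 0" "pe c b \<noteq> 0" by (auto simp: pe_simps)
    have c': "c i \<notin> Z" for i using c(1) by blast
    have "ev c (f - h) = ev c f - ev c h"
      using Suc.prems[OF c'] regh[OF c'] by (intro ev_diff[where V = ?V]) auto
    also have "\<dots> = 0" using evf[OF c' nz(3)] by simp
    finally show False using nz unfolding p(1) by (simp add: ev_Fract)
  qed
  then show ?case using hTS by simp
qed

subsection \<open>Products of linear functionals\<close>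

definition fun_linear :: "((complex \<Rightarrow> complex) \<Rightarrow> complex) \<Rightarrow> bool" where
  "fun_linear \<phi> \<longleftrightarrow> (\<forall>f g. \<phi> (\<lambda>v. f v + g v) = \<phi> f + \<phi> g) \<and> (\<forall>a f. \<phi> (\<lambda>v. a * f v) = a * \<phi> f)"

lemma fun_linear_add: "fun_linear \<phi> \<Longrightarrow> \<phi> (\<lambda>v. f v + g v) = \<phi> f + \<phi> g"
  and fun_linear_scale: "fun_linear \<phi> \<Longrightarrow> \<phi> (\<lambda>v. a * f v) = a * \<phi> f"
  unfolding fun_linear_def by blast+

lemma fun_linear_zero: "fun_linear \<phi> \<Longrightarrow> \<phi> (\<lambda>v. 0) = 0"
  using fun_linear_scale[of \<phi> 0 "\<lambda>v. 0"] by simp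

lemma fun_linear_sum: "fun_linear \<phi> \<Longrightarrow> \<phi> (\<lambda>v. \<Sum>t\<in>T. a t * f t v) = (\<Sum>t\<in>T. a t * \<phi> (f t))"
proof (induction T rule: infinite_finite_induct)
  case (insert t T)
  have "\<phi> (\<lambda>v. a t * f t v + (\<Sum>t\<in>T. a t * f t v)) = a t * \<phi> (f t) + (\<Sum>t\<in>T. a t * \<phi> (f t))"
    using fun_linear_add[OF insert.prems, of "\<lambda>v. a t * f t v" "\<lambda>v. \<Sum>t\<in>T. a t * f t v"]
      fun_linear_scale[OF insert.prems, of "a t" "f t"] insert.IH[OF insert.prems] by simp
  then show ?case using insert.hyps by simp
qed (simp_all add: fun_linear_zero)

text \<open>The functionals act on one variable after the other, on arbitrary functions of several
  variables. So the value depends on the function only and not on its expression as a sum of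
  products.\<close>

fun Lam :: "(nat \<Rightarrow> (complex \<Rightarrow> complex) \<Rightarrow> complex) \<Rightarrow> nat \<Rightarrow> ((nat \<Rightarrow> complex) \<Rightarrow> complex) \<Rightarrow> complex" where
  "Lam \<phi> 0 g = g (\<lambda>_. 0)"
| "Lam \<phi> (Suc n) g = \<phi> (Suc n) (\<lambda>v. Lam \<phi> n (\<lambda>c. g (c(Suc n := v))))"

lemma Lam_sum:
  fixes \<phi> :: "nat \<Rightarrow> (complex \<Rightarrow> complex) \<Rightarrow> complex"
  assumes "\<And>s. fun_linear (\<phi> s)"
  shows "Lam \<phi> n (\<lambda>c. \<Sum>t\<in>T. a t * g t c) = (\<Sum>t\<in>T. a t * Lam \<phi> n (g t))"
proof (induction n arbitrary: g)
  case (Suc n)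
  have "Lam \<phi> n (\<lambda>c. \<Sum>t\<in>T. a t * g t (c(Suc n := v))) = (\<Sum>t\<in>T. a t * Lam \<phi> n (\<lambda>c. g t (c(Suc n := v))))" for v
    by (rule Suc.IH)
  then show ?case unfolding Lam.simps by (simp only: fun_linear_sum[OF assms])
qed simp

lemma Lam_prod:
  fixes \<phi> :: "nat \<Rightarrow> (complex \<Rightarrow> complex) \<Rightarrow> complex"
  assumes "\<And>s. fun_linear (\<phi> s)"
  shows "Lam \<phi> n (\<lambda>c. \<Prod>s\<in>{1..n}. F s (c s)) = (\<Prod>s\<in>{1..n}. \<phi> s (F s))"
proof (induction n)
  case (Suc n)
  have "(\<Prod>s\<in>{1..Suc n}. F s ((c(Suc n := v)) s)) = (\<Sum>t\<in>{()}. F (Suc n) v * (\<Prod>s\<in>{1..n}. F s (c s)))" for c v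
    by (simp add: mult.commute)
  then have "Lam \<phi> (Suc n) (\<lambda>c. \<Prod>s\<in>{1..Suc n}. F s (c s)) =
      \<phi> (Suc n) (\<lambda>v. Lam \<phi> n (\<lambda>c. \<Sum>t\<in>{()}. F (Suc n) v * (\<Prod>s\<in>{1..n}. F s (c s))))"
    by (simp only: Lam.simps)
  also have "\<dots> = \<phi> (Suc n) (\<lambda>v. (\<Prod>s\<in>{1..n}. \<phi> s (F s)) * F (Suc n) v)"
    unfolding Lam_sum[OF assms] Suc.IH by (simp add: mult.commute)
  also have "\<dots> = (\<Prod>s\<in>{1..n}. \<phi> s (F s)) * \<phi> (Suc n) (F (Suc n))"
    by (rule fun_linear_scale[OF assms])
  finally show ?case by simp
qed simp

lemma tensor_functional:
  fixes \<phi> :: "nat \<Rightarrow> (complex \<Rightarrow> complex) \<Rightarrow> complex"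
  assumes "\<And>s. fun_linear (\<phi> s)"
    and "\<And>c. (\<Sum>t\<in>T. a t * (\<Prod>s\<in>{1..n}. F t s (c s))) = (\<Sum>t\<in>T'. a' t * (\<Prod>s\<in>{1..n}. F' t s (c s)))"
  shows "(\<Sum>t\<in>T. a t * (\<Prod>s\<in>{1..n}. \<phi> s (F t s))) = (\<Sum>t\<in>T'. a' t * (\<Prod>s\<in>{1..n}. \<phi> s (F' t s)))"
proof -
  have "Lam \<phi> n (\<lambda>c. \<Sum>t\<in>T. a t * (\<Prod>s\<in>{1..n}. F t s (c s))) = Lam \<phi> n (\<lambda>c. \<Sum>t\<in>T'. a' t * (\<Prod>s\<in>{1..n}. F' t s (c s)))"
    by (simp only: assms(2))
  moreover have "Lam \<phi> n (\<lambda>c. \<Prod>s\<in>{1..n}. F t s (c s)) = (\<Prod>s\<in>{1..n}. \<phi> s (F t s))"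
    for t by (rule Lam_prod[OF assms(1)])
  moreover have "Lam \<phi> n (\<lambda>c. \<Prod>s\<in>{1..n}. F' t s (c s)) = (\<Prod>s\<in>{1..n}. \<phi> s (F' t s))" for t
    by (rule Lam_prod[OF assms(1)])
  ultimately show ?thesis by (simp only: Lam_sum[OF assms(1)])
qed

interpretation fun_vs: vector_space "\<lambda>(a::complex) (f::complex \<Rightarrow> complex) v. a * f v"
  by unfold_locales (auto simp: fun_eq_iff plus_fun_apply algebra_simps)

interpretation fun_vs_pair: vector_space_pair "\<lambda>(a::complex) (f::complex \<Rightarrow> complex) v. a * f v" "\<lambda>(a::complex) (b::complex). a * b"
  by unfold_locales (simp_all add: distrib_left distrib_right mult.assoc)

text \<open>The space \<open>V\<close> has infinite dimension in the applications; a basis of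
  \<open>V\<close> together with \<open>x\<close> is still independent, and a linear functional can
  be prescribed on it.\<close>

lemma functional_exists:
  assumes V: "(\<lambda>v. 0) \<in> V" "\<And>f g. f \<in> V \<Longrightarrow> g \<in> V \<Longrightarrow> (\<lambda>v. f v + g v) \<in> V"
    "\<And>a f. f \<in> V \<Longrightarrow> (\<lambda>v. a * f v) \<in> V" and x: "x \<notin> V"
  shows "\<exists>\<phi>. fun_linear \<phi> \<and> \<phi> x = 1 \<and> (\<forall>f\<in>V. \<phi> f = 0)"
proof -
  have sub: "fun_vs.subspace V"
    using V by (auto simp: fun_vs.subspace_def zero_fun_def plus_fun_def)
  obtain B where B: "B \<subseteq> V" "fun_vs.independent B" "V \<subseteq> fun_vs.span B"
    by (rule fun_vs.maximal_independent_subset)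
  have "fun_vs.span B \<subseteq> V" using B(1) sub by (rule fun_vs.span_minimal)
  then have "x \<notin> fun_vs.span B" using x by blast
  then have ind: "fun_vs.independent (insert x B)" using B(2) by (simp add: fun_vs.independent_insert)
  obtain \<phi> where \<phi>: "Vector_Spaces.linear (\<lambda>(a::complex) (f::complex \<Rightarrow> complex) v. a * f v) (\<lambda>(a::complex) (b::complex). a * b) \<phi>"
    "\<forall>y\<in>insert x B. \<phi> y = (if y = x then 1 else 0)"
    using fun_vs_pair.linear_independent_extend[OF ind, of "\<lambda>y. if y = x then 1 else 0"] by blast
  interpret l: Vector_Spaces.linear "\<lambda>(a::complex) (f::complex \<Rightarrow> complex) v. a * f v" "\<lambda>(a::complex) (b::complex). a * b" \<phi>
    by (rule \<phi>(1))
  have "fun_linear \<phi>"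
    unfolding fun_linear_def by (intro conjI allI; rule l.add[unfolded plus_fun_def] l.scale)
  moreover have "\<phi> f = 0" if "f \<in> V" for f
  proof -
    have "f \<in> fun_vs.span B" using that B(3) by blast
    have "x \<notin> B" using x B(1) by blast
    then have z: "\<phi> b = 0" if "b \<in> B" for b using \<phi>(2) that by (metis insertI2)
    show ?thesis by (rule l.eq_0_on_span[OF z \<open>f \<in> fun_vs.span B\<close>])
  qed
  ultimately show ?thesis using \<phi>(2) by auto
qed

declare form_apply [simp]

section \<open>Logarithmic series and elementary symmetric functions\<close>

subsection \<open>The functions \<open>\<theta>\<^sub>m\<close>\<close>

definition LN :: "'a::field_char_0 fps \<Rightarrow> 'a fps" where
  "LN H = fps_ln 1 oo (H - 1)"

lemma LN_0 [simp]: "fps_nth (LN H) 0 = 0"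
  by (simp add: LN_def fps_ln_def)

lemma LN_deriv:
  assumes "fps_nth H 0 = 1"
  shows "fps_deriv (LN H) * H = fps_deriv H"
proof -
  let ?b = "H - 1"
  have b0: "fps_nth ?b 0 = 0" using assms by simp
  have "fps_deriv (LN H) = (fps_deriv (fps_ln 1) oo ?b) * fps_deriv ?b"
    unfolding LN_def by (rule fps_compose_deriv[OF b0])
  also have "fps_deriv (fps_ln 1 :: 'a fps) = inverse (1 + fps_X)"
    by (simp add: fps_ln_deriv)
  also have "inverse (1 + fps_X) oo ?b = inverse ((1 + fps_X) oo ?b)"
    by (rule fps_inverse_compose) (use b0 in auto)
  also have "(1 + fps_X) oo ?b = H" using b0 by (simp add: fps_compose_add_distrib)
  finally have "fps_deriv (LN H) = inverse H * fps_deriv H" by simp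
  then have "fps_deriv (LN H) * H = (inverse H * H) * fps_deriv H" by (simp add: mult_ac)
  then show ?thesis using assms by (simp add: inverse_mult_eq_1)
qed

text \<open>Both sides have the same logarithmic derivative by \<open>LN_deriv\<close> and constant
  term 0; in characteristic 0 this determines a power series.\<close>

lemma LN_mult:
  assumes "fps_nth H 0 = 1" "fps_nth G 0 = 1"
  shows "LN (H * G) = LN H + LN G"
proof -
  have nz: "H * G \<noteq> 0" using assms by (metis fps_mult_nth_0 fps_zero_nth mult_1 zero_neq_one)
  have "fps_deriv (LN (H * G)) * (H * G) = fps_deriv (H * G)"
    using assms by (intro LN_deriv) simp
  also have "\<dots> = (fps_deriv (LN H) * H) * G + H * (fps_deriv (LN G) * G)"
    by (simp add: LN_deriv assms add.commute)
  also have "\<dots> = fps_deriv (LN H + LN G) * (H * G)" by (simp add: algebra_simps)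
  finally have "fps_deriv (LN (H * G)) = fps_deriv (LN H + LN G)" using nz by (metis mult_cancel_right)
  then have "LN (H * G) = fps_const (fps_nth (LN (H * G)) 0 - fps_nth (LN H + LN G) 0) + (LN H + LN G)"
    by (simp only: fps_deriv_eq_iff)
  then show ?thesis by simp
qed

lemma LN_one [simp]: "LN 1 = 0"
  using LN_mult[of 1 1] by simp

lemma prod_nth_0: "(\<And>s. s \<in> A \<Longrightarrow> fps_nth (H s) 0 = 1) \<Longrightarrow> fps_nth (\<Prod>s\<in>A. H s) 0 = 1"
  by (induction A rule: infinite_finite_induct) auto

lemma LN_prod: "(\<And>s. s \<in> A \<Longrightarrow> fps_nth (H s) 0 = 1) \<Longrightarrow> LN (\<Prod>s\<in>A. H s) = (\<Sum>s\<in>A. LN (H s))"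
proof (induction A rule: infinite_finite_induct)
  case (insert a A)
  then show ?case by (simp add: LN_mult prod_nth_0)
qed simp_all

definition nrm :: "(nat \<Rightarrow> ratfun) \<Rightarrow> ratfun fps" where
  "nrm x = Abs_fps (\<lambda>j. if j = 0 then 1 else x j / x 0)"

lemma nrm_0 [simp]: "fps_nth (nrm x) 0 = 1" by (simp add: nrm_def)

lemma theta_eq: "theta m x = fps_nth (LN (nrm x)) m"
proof -
  have "nrm x - 1 = Abs_fps (\<lambda>j. if j = 0 then 0 else x j / x 0)"
    by (rule fps_ext) (simp add: nrm_def)
  then show ?thesis by (simp add: theta_def LN_def)
qed

lemma theta_0: "theta 0 x = 0" by (simp add: theta_eq)

text \<open>Compare coefficients in (log H)' H = H'. The recursion involves only sums, products and
  rational constants, so \<theta>_m stays in every ring containing the quotients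
  \<open>x j / x 0\<close> and commutes with substitutions.\<close>

lemma theta_rec:
  "theta (Suc n) x = x (Suc n) / x 0 - (\<Sum>i<n. rconst (of_nat (Suc i) / of_nat (Suc n)) * (theta (Suc i) x * (x (n - i) / x 0)))"
proof -
  have "fps_nth (fps_deriv (LN (nrm x)) * nrm x) n = fps_nth (fps_deriv (nrm x)) n"
    by (simp add: LN_deriv)
  then have "(\<Sum>i\<le>n. of_nat (Suc i) * theta (Suc i) x * fps_nth (nrm x) (n - i)) = of_nat (Suc n) * (x (Suc n) / x 0)"
    by (simp add: fps_mult_nth theta_eq atLeast0AtMost nrm_def)
  moreover have "(\<Sum>i\<le>n. of_nat (Suc i) * theta (Suc i) x * fps_nth (nrm x) (n - i)) =
    (\<Sum>i<n. of_nat (Suc i) * theta (Suc i) x * (x (n - i) / x 0)) + of_nat (Suc n) * theta (Suc n) x"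
    by (simp add: lessThan_Suc_atMost[symmetric] nrm_def)
  ultimately have *: "of_nat (Suc n) * theta (Suc n) x =
      of_nat (Suc n) * (x (Suc n) / x 0) - (\<Sum>i<n. of_nat (Suc i) * theta (Suc i) x * (x (n - i) / x 0))"
    by (simp only: eq_diff_eq add.commute)
  have nz: "(of_nat (Suc n) :: ratfun) \<noteq> 0" by (simp only: of_nat_eq_0_iff)
  have r: "rconst (of_nat (Suc i) / of_nat (Suc n)) = of_nat (Suc i) / of_nat (Suc n)" for i
    by (simp only: rconst_divide rconst_hom)
  have "of_nat (Suc n) * (x (Suc n) / x 0 - (\<Sum>i<n. rconst (of_nat (Suc i) / of_nat (Suc n)) * (theta (Suc i) x * (x (n - i) / x 0)))) =
     of_nat (Suc n) * (x (Suc n) / x 0) - (\<Sum>i<n. of_nat (Suc i) * theta (Suc i) x * (x (n - i) / x 0))"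
    unfolding right_diff_distrib sum_distrib_left r using nz
    by (intro arg_cong2[where f = minus] sum.cong refl) (simp del: of_nat_Suc)
  from trans[OF * this[symmetric]] show ?thesis by (simp only: mult_left_cancel[OF nz])
qed

lemma theta_induct:
  assumes "\<And>j. j \<le> m \<Longrightarrow> P (x j / x 0)" "P 0"
    and "\<And>f g. P f \<Longrightarrow> P g \<Longrightarrow> P (f + g)" "\<And>f g. P f \<Longrightarrow> P g \<Longrightarrow> P (f * g)" "\<And>c. P (rconst c)"
  shows "P (theta m x)"
  using assms(1)
proof (induction m rule: less_induct)
  case (less m)
  show ?case
  proof (cases m)
    case 0
    then show ?thesis using assms(2) by (simp add: theta_0)
  next
    case (Suc n)
    have sum: "P (sum h A)" if "\<And>i. i \<in> A \<Longrightarrow> P (h i)" for h and A :: "nat set"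
      using that by (induction A rule: infinite_finite_induct) (auto simp: assms)
    have "P (\<Sum>i<n. rconst (of_nat (Suc i) / of_nat (Suc n)) * (theta (Suc i) x * (x (n - i) / x 0)))"
      by (intro sum assms(4,5) less.IH less.prems) (use Suc in auto)
    then have "P (rconst (-1) * (\<Sum>i<n. rconst (of_nat (Suc i) / of_nat (Suc n)) * (theta (Suc i) x * (x (n - i) / x 0))))"
      by (intro assms(4,5))
    then have "P (x (Suc n) / x 0 + rconst (-1) * (\<Sum>i<n. rconst (of_nat (Suc i) / of_nat (Suc n)) * (theta (Suc i) x * (x (n - i) / x 0))))"
      by (intro assms(3) less.prems) (simp_all add: Suc)
    then show ?thesis unfolding Suc theta_rec[of n] by (simp add: rconst_hom)
  qed
qed

lemma theta_cong:
  assumes "\<And>j. j \<le> m \<Longrightarrow> x j = x' j"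
  shows "theta m x = theta m x'"
  using assms
proof (induction m rule: less_induct)
  case (less m)
  show ?case
  proof (cases m)
    case (Suc n)
    have "theta (Suc i) x = theta (Suc i) x'" if "i < n" for i
      using that Suc by (intro less.IH less.prems) auto
    then show ?thesis unfolding Suc theta_rec[of n]
      using less.prems Suc by (intro arg_cong2[where f = minus] sum.cong) auto
  qed (simp add: theta_0)
qed

lemma (in inj_subst) rsub_theta: "rsub x (theta m h) = theta m (\<lambda>j. rsub x (h j))"
proof (induction m rule: less_induct)
  case (less m)
  show ?case
  proof (cases m)
    case 0
    then show ?thesis by (simp add: theta_0 rsub_hom)
  next
    case (Suc n)
    have "rsub x (theta (Suc i) h) = theta (Suc i) (\<lambda>j. rsub x (h j))" if "i < n" for i
      using that Suc less.IH by simp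
    then show ?thesis unfolding Suc theta_rec[of n]
      by (simp only: rsub_hom rsub_rconst) (intro arg_cong2[where f = minus] sum.cong refl; simp)
  qed
qed

text \<open>The logarithm turns the product into a sum; the constant \<open>c\<close> cancels in the
  normalized series, so the common denominator of the quotient map leaves no trace.\<close>

lemma theta_product:
  assumes "finite A" "c \<noteq> 0" "\<And>s. s \<in> A \<Longrightarrow> g s 0 \<noteq> 0"
    and eq: "Abs_fps x = fps_const c * (\<Prod>s\<in>A. Abs_fps (g s))"
  shows "theta m x = (\<Sum>s\<in>A. theta m (g s))"
proof -
  have ab: "Abs_fps y = fps_const (y 0) * nrm y" if "y 0 \<noteq> 0" for y
    by (rule fps_ext) (simp add: nrm_def that)
  have x0: "x 0 = c * (\<Prod>s\<in>A. g s 0)"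
  proof -
    have "fps_nth (\<Prod>s\<in>A. Abs_fps (g s)) 0 = (\<Prod>s\<in>A. g s 0)"
      using assms(1) by (induction A rule: finite_induct) auto
    then show ?thesis using arg_cong[OF eq, of "\<lambda>f. fps_nth f 0"] by simp
  qed
  then have x0': "x 0 \<noteq> 0" using assms by simp
  have "fps_const (x 0) * nrm x = fps_const c * (\<Prod>s\<in>A. fps_const (g s 0) * nrm (g s))"
  proof -
    have "(\<Prod>s\<in>A. Abs_fps (g s)) = (\<Prod>s\<in>A. fps_const (g s 0) * nrm (g s))"
      by (rule prod.cong) (use ab[of "g _", OF assms(3)] in auto)
    then show ?thesis using eq ab[of x, OF x0'] by simp
  qed
  also have "(\<Prod>s\<in>A. fps_const (g s 0) * nrm (g s)) = fps_const (\<Prod>s\<in>A. g s 0) * (\<Prod>s\<in>A. nrm (g s))"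
    using assms(1) by (induction A rule: finite_induct) (auto simp: mult_ac simp flip: fps_const_mult)
  finally have "fps_const (x 0) * nrm x = fps_const (x 0) * (\<Prod>s\<in>A. nrm (g s))"
    by (simp add: x0 mult.assoc[symmetric])
  moreover have "fps_const (x 0) \<noteq> 0" using x0' by simp
  ultimately have "nrm x = (\<Prod>s\<in>A. nrm (g s))" by (simp only: mult_cancel_left) simp
  then show ?thesis by (simp add: theta_eq LN_prod fps_sum_nth)
qed

text \<open>A polynomial expression in \<open>b\<close> of degree at most \<open>m\<close> together
  with its coefficient \<open>L\<close> of the \<open>m\<close>-th power; \<open>L\<close> may be
  0.\<close>

definition prep :: "ratfun \<Rightarrow> nat \<Rightarrow> ratfun \<Rightarrow> complex \<Rightarrow> bool" where
  "prep b m f L \<longleftrightarrow> (\<exists>c. f = (\<Sum>i\<le>m. rconst (c i) * b ^ i) \<and> c m = L)"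

lemma prep_add: "prep b m f L \<Longrightarrow> prep b m g K \<Longrightarrow> prep b m (f + g) (L + K)"
proof -
  assume "prep b m f L" "prep b m g K"
  then obtain c d where "f = (\<Sum>i\<le>m. rconst (c i) * b ^ i)" "c m = L" "g = (\<Sum>i\<le>m. rconst (d i) * b ^ i)" "d m = K"
    unfolding prep_def by blast
  then show ?thesis unfolding prep_def
    by (intro exI[of _ "\<lambda>i. c i + d i"]) (simp add: rconst_simps(1) distrib_right sum.distrib)
qed

lemma prep_scale: "prep b m f L \<Longrightarrow> prep b m (rconst a * f) (a * L)"
proof -
  assume "prep b m f L"
  then obtain c where "f = (\<Sum>i\<le>m. rconst (c i) * b ^ i)" "c m = L" unfolding prep_def by blast
  then show ?thesis unfolding prep_def
    by (intro exI[of _ "\<lambda>i. a * c i"]) (simp add: rconst_simps(2) sum_distrib_left mult.assoc)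
qed

lemma prep_zero: "prep b m 0 0"
  unfolding prep_def by (intro exI[of _ "\<lambda>_. 0"]) (simp add: rconst_simps)

lemma prep_sum: "(\<And>i. i \<in> A \<Longrightarrow> prep b m (f i) (L i)) \<Longrightarrow> prep b m (sum f A) (sum L A)"
  by (induction A rule: infinite_finite_induct) (auto simp: prep_zero prep_add)

lemma prep_Suc: "prep b m f L \<Longrightarrow> prep b (Suc m) f 0"
proof -
  assume "prep b m f L"
  then obtain c where "f = (\<Sum>i\<le>m. rconst (c i) * b ^ i)" "c m = L" unfolding prep_def by blast
  then show ?thesis unfolding prep_def
    by (intro exI[of _ "\<lambda>i. if i = Suc m then 0 else c i"]) (simp add: rconst_simps)
qed

lemma prep_less: "prep b m f L \<Longrightarrow> m < m' \<Longrightarrow> prep b m' f 0"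
proof (induction m' arbitrary: L)
  case (Suc m')
  show ?case
  proof (cases "m = m'")
    case True
    then show ?thesis using Suc.prems prep_Suc by blast
  next
    case False
    then show ?thesis using Suc prep_Suc by (metis less_antisym)
  qed
qed simp

lemma prep_mult_b: "prep b m f L \<Longrightarrow> prep b (Suc m) (f * b) L"
proof -
  assume "prep b m f L"
  then obtain c where f: "f = (\<Sum>i\<le>m. rconst (c i) * b ^ i)" "c m = L" unfolding prep_def by blast
  have "f * b = (\<Sum>i\<le>Suc m. rconst (case i of 0 \<Rightarrow> 0 | Suc i \<Rightarrow> c i) * b ^ i)"
    unfolding sum.atMost_Suc_shift f(1) by (simp add: rconst_simps sum_distrib_right sum_distrib_left mult_ac)
  then show ?thesis unfolding prep_def using f(2) by (intro exI[of _ "\<lambda>i. case i of 0 \<Rightarrow> 0 | Suc i \<Rightarrow> c i"]) simp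
qed

lemma prep_mult_affine:
  assumes "prep b m f L"
  shows "prep b (Suc m) (f * (rconst a + rconst d * b)) (d * L)"
proof -
  have "f * (rconst a + rconst d * b) = rconst a * f + rconst d * (f * b)" by (simp add: algebra_simps)
  then show ?thesis using prep_add[OF prep_Suc[OF prep_scale[OF assms, of a]] prep_scale[OF prep_mult_b[OF assms], of d]] by simp
qed

lemma prep_const: "prep b 0 (rconst a) a"
  unfolding prep_def by (intro exI[of _ "\<lambda>_. a"]) simp

text \<open>Each power of T carries at most one factor \<open>b\<close>. Hence the
  \<open>m\<close>-th power of \<open>b\<close> at T^m arises only from the linear term, and its
  coefficient is that of log(1 + d T) with \<open>d = d 1\<close>.\<close>

lemma theta_prep:
  assumes "\<And>j. 1 \<le> j \<Longrightarrow> j \<le> m \<Longrightarrow> x j / x 0 = rconst (a j) + rconst (d j) * b"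
  shows "prep b m (theta m x) (if m = 0 then 0 else (-1) ^ (m - 1) * d 1 ^ m / of_nat m)"
  using assms
proof (induction m rule: less_induct)
  case (less m)
  show ?case
  proof (cases m)
    case 0
    then show ?thesis using prep_zero[of b 0] by (simp add: theta_0)
  next
    case (Suc n)
    let ?c = "\<lambda>i. of_nat (Suc i) / of_nat (Suc n) :: complex"
    let ?l = "\<lambda>m. (-1) ^ (m - 1) * d 1 ^ m / of_nat m :: complex"
    have x: "x j / x 0 = rconst (a j) + rconst (d j) * b" if "1 \<le> j" "j \<le> m" for j using less.prems that .
    have aff: "prep b 1 (rconst (a j) + rconst (d j) * b) (d j)" for j
      using prep_mult_affine[OF prep_const[of b 1], of "a j" "d j"] by (simp add: rconst_simps)
    have first: "prep b (Suc n) (x (Suc n) / x 0) (if n = 0 then d 1 else 0)"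
    proof (cases n)
      case 0
      then show ?thesis using aff[of 1] x[of 1] Suc by simp
    next
      case (Suc k)
      then show ?thesis using prep_less[OF aff[of "Suc n"], of "Suc n"] x[of "Suc n"] \<open>m = Suc n\<close> by simp
    qed
    \<comment> \<open>Multiplication by an affine factor raises the degree by one, so only the last
      summand of the recursion reaches degree \<open>Suc n\<close>.\<close>
    have "prep b (Suc n) (rconst (?c i) * (theta (Suc i) x * (x (n - i) / x 0))) (if Suc i = n then ?c i * (d 1 * ?l n) else 0)"
      if i: "i < n" for i
    proof -
      have IH: "prep b (Suc i) (theta (Suc i) x) (?l (Suc i))"
        using less.IH[of "Suc i"] x i Suc by simp
      have e: "x (n - i) / x 0 = rconst (a (n - i)) + rconst (d (n - i)) * b" using i Suc by (intro x) auto
      have m: "prep b (Suc (Suc i)) (theta (Suc i) x * (x (n - i) / x 0)) (d (n - i) * ?l (Suc i))"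
        unfolding e by (rule prep_mult_affine[OF IH])
      show ?thesis
      proof (cases "Suc i = n")
        case True
        then have "n - i = 1" by auto
        then show ?thesis using prep_scale[OF m, of "?c i"] True by simp
      next
        case False
        then have "Suc (Suc i) < Suc n" using i by simp
        from prep_scale[OF prep_less[OF m this], of "?c i"] show ?thesis using False by simp
      qed
    qed
    then have "prep b (Suc n) (\<Sum>i<n. rconst (?c i) * (theta (Suc i) x * (x (n - i) / x 0)))
        (\<Sum>i<n. if Suc i = n then ?c i * (d 1 * ?l n) else 0)"
      by (intro prep_sum) auto
    then have "prep b (Suc n) (x (Suc n) / x 0 + rconst (-1) * (\<Sum>i<n. rconst (?c i) * (theta (Suc i) x * (x (n - i) / x 0))))
        ((if n = 0 then d 1 else 0) + (-1) * (\<Sum>i<n. if Suc i = n then ?c i * (d 1 * ?l n) else 0))"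
      by (intro prep_add first prep_scale)
    moreover have "(if n = 0 then d 1 else 0) + (-1) * (\<Sum>i<n. if Suc i = n then ?c i * (d 1 * ?l n) else 0) = ?l (Suc n)"
    proof (cases n)
      case (Suc k)
      have "(\<Sum>i<n. if Suc i = n then ?c i * (d 1 * ?l n) else 0) = (\<Sum>i<n. if i = k then ?c k * (d 1 * ?l n) else 0)"
        by (rule sum.cong) (auto simp: Suc)
      also have "\<dots> = ?c k * (d 1 * ?l n)" using Suc by simp
      finally show ?thesis using Suc by (simp add: uminus_apply del: of_nat_Suc)
    qed (simp add: form_apply)
    ultimately show ?thesis unfolding Suc theta_rec[of n] by (simp add: rconst_hom)
  qed
qed

subsection \<open>Coefficients of products of linear forms\<close>

text \<open>The coefficient of \<open>T\<^sup>i\<close> in \<open>\<Prod>\<^sub>s (X\<^sub>s + Y\<^sub>s T)\<close>.\<close>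

definition tt :: "nat \<Rightarrow> (nat \<Rightarrow> 'a) \<Rightarrow> (nat \<Rightarrow> 'a) \<Rightarrow> nat \<Rightarrow> 'a::comm_ring_1" where
  "tt r X Y i = (\<Sum>S\<in>{S. S \<subseteq> {1..r} \<and> card S = i}. (\<Prod>s\<in>S. Y s) * (\<Prod>s\<in>{1..r} - S. X s))"

lemma tt_identity: "(\<Prod>s\<in>{1..r}. X s * a + Y s * b) = (\<Sum>i\<le>r. tt r X Y i * (a ^ (r - i) * b ^ i))"
proof -
  let ?t = "\<lambda>S. (\<Prod>s\<in>S. Y s * b) * (\<Prod>s\<in>{1..r} - S. X s * a)"
  have "(\<Prod>s\<in>{1..r}. Y s * b + X s * a) = (\<Sum>S\<in>Pow {1..r}. ?t S)"
    by (rule prod_add) simp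
  also have "\<dots> = (\<Sum>i\<le>r. \<Sum>S\<in>{S. S \<in> Pow {1..r} \<and> card S = i}. ?t S)"
    by (rule sum.group[symmetric]) (auto dest: card_mono[rotated])
  also have "\<dots> = (\<Sum>i\<le>r. tt r X Y i * (a ^ (r - i) * b ^ i))"
  proof (rule sum.cong[OF refl])
    fix i
    have "?t S = ((\<Prod>s\<in>S. Y s) * (\<Prod>s\<in>{1..r} - S. X s)) * (a ^ (r - i) * b ^ i)"
      if "S \<in> {S. S \<in> Pow {1..r} \<and> card S = i}" for S
    proof -
      have "finite S" by (rule finite_subset[of _ "{1..r}"]) (use that in auto)
      then have "card ({1..r} - S) = r - i" using that by (subst card_Diff_subset) auto
      then show ?thesis using that by (simp add: prod.distrib mult_ac)
    qed
    then have "(\<Sum>S\<in>{S. S \<in> Pow {1..r} \<and> card S = i}. ?t S) =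
      (\<Sum>S\<in>{S. S \<in> Pow {1..r} \<and> card S = i}. ((\<Prod>s\<in>S. Y s) * (\<Prod>s\<in>{1..r} - S. X s)) * (a ^ (r - i) * b ^ i))"
      by (intro sum.cong) auto
    then show "(\<Sum>S\<in>{S. S \<in> Pow {1..r} \<and> card S = i}. ?t S) = tt r X Y i * (a ^ (r - i) * b ^ i)"
      by (simp add: tt_def sum_distrib_right)
  qed
  finally show ?thesis by (simp add: add.commute)
qed

lemma tt_hom: "is_hom h \<Longrightarrow> h (tt r X Y i) = tt r (\<lambda>s. h (X s)) (\<lambda>s. h (Y s)) i"
  by (simp add: tt_def is_homD)

lemma tt_0: "tt r X Y 0 = (\<Prod>s\<in>{1..r}. X s)"
proof -
  have "{S. S \<subseteq> {1..r} \<and> card S = 0} = {{}}" by (auto dest: finite_subset)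
  then show ?thesis by (simp add: tt_def)
qed

lemma tt_cong: "(\<And>s. s \<in> {1..r} \<Longrightarrow> X s = X' s) \<Longrightarrow> (\<And>s. s \<in> {1..r} \<Longrightarrow> Y s = Y' s) \<Longrightarrow> tt r X Y i = tt r X' Y' i"
  unfolding tt_def by (intro sum.cong refl arg_cong2[where f = times] prod.cong) auto

lemma tt_scale: "tt r (\<lambda>s. c s * X s) (\<lambda>s. c s * Y s) i = (\<Prod>s\<in>{1..r}. c s) * tt r X Y i"
  unfolding tt_def sum_distrib_left
proof (rule sum.cong[OF refl])
  fix S assume "S \<in> {S. S \<subseteq> {1..r} \<and> card S = i}"
  then have "(\<Prod>s\<in>{1..r}. c s) = (\<Prod>s\<in>{1..r} - S. c s) * (\<Prod>s\<in>S. c s)"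
    by (intro prod.subset_diff) auto
  then show "(\<Prod>s\<in>S. c s * Y s) * (\<Prod>s\<in>{1..r} - S. c s * X s) =
    (\<Prod>s\<in>{1..r}. c s) * ((\<Prod>s\<in>S. Y s) * (\<Prod>s\<in>{1..r} - S. X s))"
    by (simp add: prod.distrib mult_ac)
qed

lemma tt_permute:
  assumes "bij_betw \<sigma> {1..r} {1..r}"
  shows "tt r (\<lambda>s. X (\<sigma> s)) (\<lambda>s. Y (\<sigma> s)) i = tt r X Y i"
proof -
  have inj: "inj_on \<sigma> {1..r}" and im: "\<sigma> ` {1..r} = {1..r}" using assms by (auto simp: bij_betw_def)
  let ?A = "{S. S \<subseteq> {1..r} \<and> card S = i}"
  have "tt r X Y i = (\<Sum>S\<in>(\<lambda>S. \<sigma> ` S) ` ?A. (\<Prod>s\<in>S. Y s) * (\<Prod>s\<in>{1..r} - S. X s))"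
  proof -
    have "(\<lambda>S. \<sigma> ` S) ` ?A = ?A"
    proof
      show "(\<lambda>S. \<sigma> ` S) ` ?A \<subseteq> ?A"
        using im by (auto simp: card_image inj_on_subset[OF inj])
      show "?A \<subseteq> (\<lambda>S. \<sigma> ` S) ` ?A"
      proof
        fix S assume S: "S \<in> ?A"
        then obtain T where T: "T \<subseteq> {1..r}" "S = \<sigma> ` T" using im by (metis (mono_tags, lifting) mem_Collect_eq subset_imageE)
        then show "S \<in> (\<lambda>S. \<sigma> ` S) ` ?A" using S by (auto simp: card_image inj_on_subset[OF inj])
      qed
    qed
    then show ?thesis by (simp add: tt_def)
  qed
  also have "\<dots> = (\<Sum>S\<in>?A. (\<Prod>s\<in>\<sigma> ` S. Y s) * (\<Prod>s\<in>{1..r} - \<sigma> ` S. X s))"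
  proof -
    have "inj_on (\<lambda>S. \<sigma> ` S) ?A"
      by (rule inj_on_subset[OF inj_on_image_Pow[OF inj]]) auto
    then show ?thesis by (simp add: sum.reindex)
  qed
  also have "\<dots> = tt r (\<lambda>s. X (\<sigma> s)) (\<lambda>s. Y (\<sigma> s)) i"
    unfolding tt_def
  proof (rule sum.cong[OF refl])
    fix S assume S: "S \<in> ?A"
    then have "\<sigma> ` ({1..r} - S) = \<sigma> ` {1..r} - \<sigma> ` S"
      by (intro inj_on_image_set_diff[OF inj]) auto
    then have "{1..r} - \<sigma> ` S = \<sigma> ` ({1..r} - S)" using im by simp
    moreover have "inj_on \<sigma> S" "inj_on \<sigma> ({1..r} - S)" by (rule inj_on_subset[OF inj]; use S in auto)+
    ultimately show "(\<Prod>s\<in>\<sigma> ` S. Y s) * (\<Prod>s\<in>{1..r} - \<sigma> ` S. X s) = (\<Prod>s\<in>S. Y (\<sigma> s)) * (\<Prod>s\<in>{1..r} - S. X (\<sigma> s))"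
      by (simp add: prod.reindex)
  qed
  finally show ?thesis by simp
qed

declare One_nat_def [simp del]

section \<open>Projective space as a symmetric product of lines\<close>

subsection \<open>Local rings of projective space\<close>

definition tdeg :: "(nat \<Rightarrow>\<^sub>0 nat) \<Rightarrow> nat" where
  "tdeg m = (\<Sum>i\<in>Poly_Mapping.keys m. Poly_Mapping.lookup m i)"

lemma tdeg_superset: "finite V \<Longrightarrow> Poly_Mapping.keys m \<subseteq> V \<Longrightarrow> tdeg m = (\<Sum>i\<in>V. Poly_Mapping.lookup m i)"
  unfolding tdeg_def by (rule sum.mono_neutral_left) (auto simp: in_keys_iff)

lemma tdeg_add: "tdeg (a + b) = tdeg a + tdeg b"
proof -
  let ?V = "Poly_Mapping.keys a \<union> Poly_Mapping.keys b"
  have "Poly_Mapping.keys (a + b) \<subseteq> ?V" by (rule keys_add)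
  then show ?thesis by (subst (1 2 3) tdeg_superset[where V = ?V]) (auto simp: lookup_add sum.distrib)
qed

lemma homogeneous_iff: "homogeneous d p \<longleftrightarrow> (\<forall>m\<in>Poly_Mapping.keys p. tdeg m = d)"
  by (simp add: homogeneous_def tdeg_def)

lemma homogeneous_add: "homogeneous d p \<Longrightarrow> homogeneous d q \<Longrightarrow> homogeneous d (p + q)"
  unfolding homogeneous_iff using keys_add[of p q] by blast

lemma homogeneous_mult: "homogeneous d p \<Longrightarrow> homogeneous d' q \<Longrightarrow> homogeneous (d + d') (p * q)"
  unfolding homogeneous_iff
proof
  fix m assume p: "\<forall>m\<in>Poly_Mapping.keys p. tdeg m = d" and q: "\<forall>m\<in>Poly_Mapping.keys q. tdeg m = d'"
    and "m \<in> Poly_Mapping.keys (p * q)"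
  then obtain a b where "a \<in> Poly_Mapping.keys p" "b \<in> Poly_Mapping.keys q" "m = a + b"
    using keys_mult[of p q] by blast
  then show "tdeg m = d + d'" using p q by (simp add: tdeg_add)
qed

lemma homogeneous_const: "homogeneous 0 (pconst c)"
  by (auto simp: homogeneous_iff tdeg_def)

lemma homogeneous_sum: "(\<And>i. i \<in> A \<Longrightarrow> homogeneous d (f i)) \<Longrightarrow> homogeneous d (sum f A)"
proof (induction A rule: infinite_finite_induct)
  case (insert i A)
  then show ?case by (simp add: homogeneous_add)
qed (simp_all add: homogeneous_iff)

lemma homogeneous_linear: "homogeneous 1 (pconst c * pvar i)"
proof -
  have "homogeneous 1 (pvar i)" by (auto simp: homogeneous_iff tdeg_def)
  from homogeneous_mult[OF homogeneous_const this, of c] show ?thesis by simp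
qed

lemma poly_subst_homogeneous:
  assumes "homogeneous d p"
  shows "poly_subst h (\<lambda>i. a * x i) p = a ^ d * poly_subst h x p"
proof -
  have "mon (\<lambda>i. a * x i) m = a ^ tdeg m * mon x m" for m
    by (simp add: mon_def tdeg_def power_mult_distrib prod.distrib power_sum)
  then show ?thesis using assms
    by (simp add: poly_subst_eq homogeneous_iff sum_distrib_left mult_ac)
qed

lemma ev_dehomogenize: "ev c (poly_subst rconst ycoord p) = pe (\<lambda>i. if i = 0 then 1 else c i) p"
  by (rule ev_poly_subst[of p UNIV UNIV]) (auto simp: ycoord_def reg_1 reg_var)

lemma dehomogenize_nonzero:
  assumes "homogeneous d G" "G \<noteq> 0"
  shows "poly_subst rconst ycoord G \<noteq> 0"
proof -
  have "pvar 0 \<noteq> 0" by (simp flip: keys_eq_empty)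
  \<comment> \<open>The additional factor keeps the point inside the chart where the coordinate 0 is
    nonzero, so that it can be rescaled.\<close>
  then have "G * pvar 0 \<noteq> 0" using assms(2) by simp
  then obtain c where "pe c (G * pvar 0) \<noteq> 0"
    using exists_nonroot[of "G * pvar 0" UNIV] infinite_UNIV_char_0 by blast
  then have c: "pe c G \<noteq> 0" "c 0 \<noteq> 0" by (auto simp: pe_simps)
  let ?v = "\<lambda>i. inverse (c 0) * c i"
  have "ev ?v (poly_subst rconst ycoord G) = pe ?v G"
    unfolding ev_dehomogenize by (rule arg_cong[where f = "\<lambda>v. pe v G"]) (use c(2) in auto)
  also have "\<dots> = inverse (c 0) ^ d * pe c G"
    unfolding pe_def by (rule poly_subst_homogeneous[OF assms(1)])
  finally show ?thesis using c by (metis ev_0 mult_eq_0_iff power_not_zero inverse_nonzero_iff_nonzero)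
qed

lemma local_ringE:
  assumes "f \<in> local_ring r q"
  obtains F G d where "f = poly_subst rconst ycoord F / poly_subst rconst ycoord G"
    "F \<in> polys_in {0..r}" "G \<in> polys_in {0..r}" "homogeneous d F" "homogeneous d G" "pe (\<lambda>i. q $ i) G \<noteq> 0"
    "poly_subst rconst ycoord G \<noteq> 0"
proof -
  obtain F G d where *: "f = poly_subst rconst ycoord F / poly_subst rconst ycoord G"
    "F \<in> polys_in {0..r}" "G \<in> polys_in {0..r}" "homogeneous d F" "homogeneous d G" "pe (\<lambda>i. q $ i) G \<noteq> 0"
    using assms unfolding local_ring_def pe_def by blast
  then have "G \<noteq> 0" by auto
  then show thesis using dehomogenize_nonzero * that by blast
qed

lemma local_ringI:
  "F \<in> polys_in {0..r} \<Longrightarrow> G \<in> polys_in {0..r} \<Longrightarrow> homogeneous d F \<Longrightarrow> homogeneous d G \<Longrightarrow> pe (\<lambda>i. q $ i) G \<noteq> 0 \<Longrightarrow>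
    poly_subst rconst ycoord F / poly_subst rconst ycoord G \<in> local_ring r q"
  unfolding local_ring_def pe_def by blast

lemma
  assumes "f \<in> local_ring r q" "g \<in> local_ring r q"
  shows local_ring_add: "f + g \<in> local_ring r q" and local_ring_mult: "f * g \<in> local_ring r q"
proof -
  obtain F G d where 1: "f = poly_subst rconst ycoord F / poly_subst rconst ycoord G"
    "F \<in> polys_in {0..r}" "G \<in> polys_in {0..r}" "homogeneous d F" "homogeneous d G" "pe (\<lambda>i. q $ i) G \<noteq> 0"
    "poly_subst rconst ycoord G \<noteq> 0" using assms(1) by (rule local_ringE)
  obtain F' G' d' where 2: "g = poly_subst rconst ycoord F' / poly_subst rconst ycoord G'"
    "F' \<in> polys_in {0..r}" "G' \<in> polys_in {0..r}" "homogeneous d' F'" "homogeneous d' G'" "pe (\<lambda>i. q $ i) G' \<noteq> 0"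
    "poly_subst rconst ycoord G' \<noteq> 0" using assms(2) by (rule local_ringE)
  note ps = poly_subst_simps[OF is_hom_rconst]
  have "f + g = poly_subst rconst ycoord (F * G' + F' * G) / poly_subst rconst ycoord (G * G')"
    unfolding 1(1) 2(1) using 1(7) 2(7) by (simp add: ps add_frac_eq)
  moreover have "f * g = poly_subst rconst ycoord (F * F') / poly_subst rconst ycoord (G * G')"
    unfolding 1(1) 2(1) by (simp add: ps)
  moreover have "homogeneous (d + d') (F * G' + F' * G)"
    using homogeneous_mult[OF 1(4) 2(5)] homogeneous_mult[OF 2(4) 1(5)] by (simp add: homogeneous_add add.commute)
  moreover have "homogeneous (d + d') (G * G')" "homogeneous (d + d') (F * F')"
    using 1 2 by (auto intro: homogeneous_mult)
  moreover have "pe (\<lambda>i. q $ i) (G * G') \<noteq> 0" using 1 2 by (simp add: pe_simps)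
  ultimately show "f + g \<in> local_ring r q" "f * g \<in> local_ring r q"
    using 1 2 by (simp_all only:) (intro local_ringI polys_in_closed; assumption)+
qed

lemma local_ring_const: "rconst c \<in> local_ring r q"
proof -
  have "poly_subst rconst ycoord (pconst c) / poly_subst rconst ycoord (pconst 1) \<in> local_ring r q"
    by (rule local_ringI[OF polys_in_closed(3) polys_in_closed(3) homogeneous_const homogeneous_const]) (simp only: pe_const, simp)
  then show ?thesis by (simp only: poly_subst_const[OF is_hom_rconst] rconst_simps div_by_1)
qed

lemma local_ring_sum: "(\<And>i. i \<in> A \<Longrightarrow> g i \<in> local_ring r q) \<Longrightarrow> sum g A \<in> local_ring r q"
  using local_ring_const[of 0 r q]
  by (induction A rule: infinite_finite_induct) (auto simp: local_ring_add rconst_simps)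

lemma ycoord_fracs: "i \<le> r \<Longrightarrow> ycoord i \<in> fracs {1..r}"
  by (auto simp: ycoord_def intro!: fracs_closed)

lemma poly_subst_fracs:
  "p \<in> polys_in W \<Longrightarrow> (\<And>i. i \<in> W \<Longrightarrow> x i \<in> fracs V) \<Longrightarrow> poly_subst rconst x p \<in> fracs V"
  by (induction p rule: cpoly_induct) (auto simp: poly_subst_simps[OF is_hom_rconst] fracs_closed)

lemma local_ring_fracs: "f \<in> local_ring r q \<Longrightarrow> f \<in> fracs {1..r}"
  by (elim local_ringE) (auto intro!: fracs_closed(10) poly_subst_fracs ycoord_fracs)

subsection \<open>Regular forms\<close>

lemma fscale_wedge_fscale: "wedge (fscale f \<eta>) (fscale g \<zeta>) = fscale (f * g) (wedge \<eta> \<zeta>)"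
  by (simp only: wedge_linear wedge_left_linear) (simp add: fscale_def mult_ac)

lemma regular_forms_at_sum:
  "(\<And>i. i \<in> A \<Longrightarrow> h i \<in> regular_forms_at r q p) \<Longrightarrow> sum h A \<in> regular_forms_at r q p"
proof (induction A rule: infinite_finite_induct)
  case (insert i A)
  then show ?case using regular_forms_at_closed(2)[of "h i" r q p "sum h A"] by (simp del: form_apply)
qed (simp_all add: regular_forms_at_closed(1) del: form_apply)

lemma regular_forms_at_single:
  assumes "g \<in> local_ring r q" "set fs \<subseteq> local_ring r q"
  shows "fscale g (wedge_list (map dfun fs)) \<in> regular_forms_at r q (length fs)"
  unfolding regular_forms_at_def
  by (intro CollectI exI[of _ "1::nat"] exI[of _ "\<lambda>_. g"] exI[of _ "\<lambda>_. fs"]) (use assms in auto)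

lemma regular_forms_at_wedge:
  assumes "\<eta> \<in> regular_forms_at r q p" "\<zeta> \<in> regular_forms_at r q p'"
  shows "wedge \<eta> \<zeta> \<in> regular_forms_at r q (p + p')"
proof -
  obtain n g fs where 1: "\<eta> = (\<Sum>s<n. fscale (g s) (wedge_list (map dfun (fs s))))"
    "\<forall>s<(n::nat). g s \<in> local_ring r q \<and> length (fs s) = p \<and> set (fs s) \<subseteq> local_ring r q"
    using assms(1) unfolding regular_forms_at_def by blast
  obtain n' g' fs' where 2: "\<zeta> = (\<Sum>s<n'. fscale (g' s) (wedge_list (map dfun (fs' s))))"
    "\<forall>s<(n'::nat). g' s \<in> local_ring r q \<and> length (fs' s) = p' \<and> set (fs' s) \<subseteq> local_ring r q"
    using assms(2) unfolding regular_forms_at_def by blast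
  have "fscale (g s * g' s') (wedge_list (map dfun (fs s @ fs' s'))) \<in> regular_forms_at r q (p + p')"
    if "s < n" "s' < n'" for s s'
    using regular_forms_at_single[of "g s * g' s'" r q "fs s @ fs' s'"] 1(2) 2(2) that
    by (auto simp: local_ring_mult)
  then show ?thesis
    unfolding 1(1) 2(1) wedge_sum_left unfolding wedge_sum_right fscale_wedge_fscale
    by (intro regular_forms_at_sum) (simp add: wedge_list_append)
qed

lemma regular_forms_at_fscale:
  assumes "f \<in> local_ring r q" "\<eta> \<in> regular_forms_at r q p"
  shows "fscale f \<eta> \<in> regular_forms_at r q p"
proof -
  obtain n g fs where 1: "\<eta> = (\<Sum>s<n. fscale (g s) (wedge_list (map dfun (fs s))))"
    "\<forall>s<(n::nat). g s \<in> local_ring r q \<and> length (fs s) = p \<and> set (fs s) \<subseteq> local_ring r q"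
    using assms(2) unfolding regular_forms_at_def by blast
  have "fscale (f * g s) (wedge_list (map dfun (fs s))) \<in> regular_forms_at r q p" if "s < n" for s
    using regular_forms_at_single[of "f * g s" r q "fs s"] 1(2) that assms(1) by (auto simp: local_ring_mult)
  then show ?thesis
    unfolding 1(1) fscale_sum by (intro regular_forms_at_sum) (simp add: fscale_simps(3))
qed

lemma regular_forms_at_dfun: "f \<in> local_ring r q \<Longrightarrow> dfun f \<in> regular_forms_at r q 1"
  using regular_forms_at_single[of "rconst 1" r q "[f]"] local_ring_const[of 1 r q]
  by (simp add: wedge_one_right one_form_dfun rconst_simps fscale_simps One_nat_def)

definition regf :: "nat set \<Rightarrow> (nat \<Rightarrow> complex) \<Rightarrow> form \<Rightarrow> bool" where
  "regf V c \<eta> \<longleftrightarrow> (\<forall>K. reg V c (\<eta> K))"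

lemma regf_add: "regf V c \<eta> \<Longrightarrow> regf V c \<zeta> \<Longrightarrow> regf V c (\<eta> + \<zeta>)"
  by (simp add: regf_def plus_fun_apply reg_add)

lemma regf_sum: "(\<And>i. i \<in> A \<Longrightarrow> regf V c (h i)) \<Longrightarrow> regf V c (sum h A)"
proof (induction A rule: infinite_finite_induct)
  case (insert i A)
  then show ?case by (simp add: regf_add del: form_apply)
qed (simp_all add: regf_def reg_0)

lemma regf_fscale: "reg V c f \<Longrightarrow> regf V c \<eta> \<Longrightarrow> regf V c (fscale f \<eta>)"
  by (simp add: regf_def fscale_def reg_mult)

lemma regf_wedge: "regf V c \<eta> \<Longrightarrow> regf V c \<zeta> \<Longrightarrow> regf V c (wedge \<eta> \<zeta>)"
proof -
  have "reg V c (shuffle_sign I J)" for I J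
    using shuffle_sign_cases[of I J] by (auto simp: reg_1 reg_minus)
  moreover assume "regf V c \<eta>" "regf V c \<zeta>"
  ultimately show ?thesis unfolding regf_def wedge_def by (intro allI reg_sum reg_mult) auto
qed

lemma regf_dfun: "reg V c f \<Longrightarrow> regf V c (dfun f)"
  by (simp add: regf_def dfun_eq reg_rat_pd reg_0)

lemma regf_wedge_list: "(\<forall>\<eta>\<in>set \<eta>s. regf V c \<eta>) \<Longrightarrow> regf V c (wedge_list \<eta>s)"
proof (induction \<eta>s)
  case Nil
  then show ?case by (simp add: regf_def func_form_def reg_0 reg_1)
qed (simp add: regf_wedge)

subsection \<open>The map from the product of lines to projective space\<close>

lemma linear_nonzero:
  assumes "a \<noteq> 0 \<or> b \<noteq> 0"
  shows "rconst a + rconst b * rvar s \<noteq> 0"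
proof -
  have "\<exists>v. a + b * v \<noteq> 0"
  proof (cases "b = 0")
    case False
    then have "a + b * ((1 - a) / b) \<noteq> 0" by simp
    then show ?thesis by blast
  qed (use assms in auto)
  then obtain v where v: "a + b * v \<noteq> 0" by blast
  have "ev (\<lambda>_. v) (rconst a + rconst b * rvar s) = a + b * v"
    by (simp add: ev_add[where V = UNIV] ev_mult[where V = UNIV] reg_const reg_var reg_mult)
  then show ?thesis using v by (metis ev_0)
qed

lemma div_solve: "D \<noteq> 0 \<Longrightarrow> u = x / D \<Longrightarrow> u * D = x" for D :: complex
  by simp

lemma det_solve:
  fixes a b e0 e1 f0 f1 :: complex
  assumes "e0 * a + e1 * b = 0" "f0 * a + f1 * b = 0" "e0 * f1 - e1 * f0 \<noteq> 0"
  shows "a = 0 \<and> b = 0"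
proof -
  have "(e0 * f1 - e1 * f0) * a = f1 * (e0 * a + e1 * b) - e1 * (f0 * a + f1 * b)"
    by (simp only: ring_distribs mult_ac) simp
  moreover have "(e0 * f1 - e1 * f0) * b = e0 * (f0 * a + f1 * b) - f0 * (e0 * a + e1 * b)"
    by (simp only: ring_distribs mult_ac) simp
  ultimately show ?thesis unfolding assms(1,2) using assms(3) by simp
qed

text \<open>The hypothesis says that \<open>u\<close> is the parameter of the point with affine
  coordinate \<open>x\<close>; the conclusions give its two homogeneous coordinates up to the common
  factor \<open>f0 * x - f1\<close>.\<close>

lemma moebius:
  fixes e0 e1 f0 f1 u x :: complex
  assumes "u * (f0 * x - f1) = e1 - e0 * x"
  shows "(e0 + f0 * u) * (f0 * x - f1) = - (e0 * f1 - e1 * f0)"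
    and "(e1 + f1 * u) * (f0 * x - f1) = - (e0 * f1 - e1 * f0) * x"
proof -
  have "(e0 + f0 * u) * (f0 * x - f1) = e0 * (f0 * x - f1) + f0 * (u * (f0 * x - f1))"
    by (simp only: ring_distribs mult_ac)
  also have "\<dots> = - (e0 * f1 - e1 * f0)" unfolding assms by (simp only: ring_distribs mult_ac) simp
  finally show "(e0 + f0 * u) * (f0 * x - f1) = - (e0 * f1 - e1 * f0)" .
  have "(e1 + f1 * u) * (f0 * x - f1) = e1 * (f0 * x - f1) + f1 * (u * (f0 * x - f1))"
    by (simp only: ring_distribs mult_ac)
  also have "\<dots> = - (e0 * f1 - e1 * f0) * x" unfolding assms minus_diff_eq by (simp only: ring_distribs mult_ac) simp
  finally show "(e1 + f1 * u) * (f0 * x - f1) = - (e0 * f1 - e1 * f0) * x" .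
qed

text \<open>
  The parametrization \<open>v \<mapsto> [e0 + f0 v : e1 + f1 v]\<close> of the projective line induces the quotient map
  of its \<open>r\<close>-th power onto its symmetric product \<open>\<P>\<^sup>r\<close>.
\<close>

locale sym_param =
  fixes r :: nat and e0 e1 f0 f1 :: complex
  assumes r_pos: "0 < r" and det: "e0 * f1 - e1 * f0 \<noteq> 0"
begin

definition X0 :: "nat \<Rightarrow> ratfun" where "X0 s = rconst e0 + rconst f0 * rvar s"
definition X1 :: "nat \<Rightarrow> ratfun" where "X1 s = rconst e1 + rconst f1 * rvar s"
definition x0 :: "complex \<Rightarrow> complex" where "x0 v = e0 + f0 * v"
definition x1 :: "complex \<Rightarrow> complex" where "x1 v = e1 + f1 * v"
definition TT :: "nat \<Rightarrow> ratfun" where "TT i = tt r X0 X1 i"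
definition tv :: "(nat \<Rightarrow> complex) \<Rightarrow> nat \<Rightarrow> complex" where "tv c i = tt r (\<lambda>s. x0 (c s)) (\<lambda>s. x1 (c s)) i"
text \<open>The affine coordinates of the quotient map. Variables outside \<open>{1..r}\<close> are
  left fixed, so that the substitution is injective on polynomials in all variables.\<close>

definition yy :: "nat \<Rightarrow> ratfun" where "yy i = (if i \<in> {1..r} then TT i / TT 0 else rvar i)"

lemma X_reg: "s \<in> V \<Longrightarrow> reg V c (X0 s)" "s \<in> V \<Longrightarrow> reg V c (X1 s)"
  by (simp_all add: X0_def X1_def reg_add reg_mult reg_const reg_var)

lemma X_ev: "ev c (X0 s) = x0 (c s)" "ev c (X1 s) = x1 (c s)"
  by (simp_all add: X0_def X1_def x0_def x1_def ev_add[where V = UNIV] ev_mult[where V = UNIV] reg_const reg_var reg_mult)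

lemma TT_reg: "reg {1..r} c (TT i)" and TT_ev: "ev c (TT i) = tv c i"
proof -
  have r0: "reg {1..r} c (\<Prod>s\<in>S. X1 s)" "ev c (\<Prod>s\<in>S. X1 s) = (\<Prod>s\<in>S. x1 (c s))"
    "reg {1..r} c (\<Prod>s\<in>S. X0 s)" "ev c (\<Prod>s\<in>S. X0 s) = (\<Prod>s\<in>S. x0 (c s))" if "S \<subseteq> {1..r}" for S
  proof -
    have X: "reg {1..r} c (X0 s)" "reg {1..r} c (X1 s)" if "s \<in> S" for s
      using that \<open>S \<subseteq> _\<close> by (auto intro: X_reg)
    then show "reg {1..r} c (\<Prod>s\<in>S. X1 s)" "ev c (\<Prod>s\<in>S. X1 s) = (\<Prod>s\<in>S. x1 (c s))"
      "reg {1..r} c (\<Prod>s\<in>S. X0 s)" "ev c (\<Prod>s\<in>S. X0 s) = (\<Prod>s\<in>S. x0 (c s))"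
      by (auto intro!: reg_prod simp: ev_prod[where V = "{1..r}"] X_ev)
  qed
  have "reg {1..r} c ((\<Prod>s\<in>S. X1 s) * (\<Prod>s\<in>{1..r} - S. X0 s)) \<and>
      ev c ((\<Prod>s\<in>S. X1 s) * (\<Prod>s\<in>{1..r} - S. X0 s)) = (\<Prod>s\<in>S. x1 (c s)) * (\<Prod>s\<in>{1..r} - S. x0 (c s))"
    if "S \<subseteq> {1..r}" for S
    using r0[OF that] r0[of "{1..r} - S"] by (simp add: reg_mult ev_mult[where V = "{1..r}"])
  then have *: "reg {1..r} c ((\<Prod>s\<in>S. X1 s) * (\<Prod>s\<in>{1..r} - S. X0 s))"
      "ev c ((\<Prod>s\<in>S. X1 s) * (\<Prod>s\<in>{1..r} - S. X0 s)) = (\<Prod>s\<in>S. x1 (c s)) * (\<Prod>s\<in>{1..r} - S. x0 (c s))"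
    if "S \<in> {S. S \<subseteq> {1..r} \<and> card S = i}" for S
    using that by blast+
  show "reg {1..r} c (TT i)" unfolding TT_def tt_def by (rule reg_sum) (rule *(1))
  have "ev c (TT i) = (\<Sum>S\<in>{S. S \<subseteq> {1..r} \<and> card S = i}. ev c ((\<Prod>s\<in>S. X1 s) * (\<Prod>s\<in>{1..r} - S. X0 s)))"
    unfolding TT_def tt_def by (rule ev_sum) (rule *(1))
  also have "\<dots> = tv c i" unfolding tv_def tt_def by (rule sum.cong[OF refl]) (rule *(2))
  finally show "ev c (TT i) = tv c i" .
qed

lemma X0_nonzero: "X0 s \<noteq> 0"
  unfolding X0_def by (rule linear_nonzero) (use det in auto)

lemma TT0_nonzero: "TT 0 \<noteq> 0"
  by (simp add: TT_def tt_0 X0_nonzero)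

lemma TT_fracs: "TT i \<in> fracs {1..r}"
  using TT_reg by (rule reg_fracs)

lemma yy_fracs: "i \<in> {1..r} \<Longrightarrow> yy i \<in> fracs {1..r}"
  by (simp add: yy_def TT_fracs fracs_closed)

text \<open>Surjectivity of the quotient map over the affine chart: the coordinates are the
  coefficients of a monic polynomial, which splits into linear factors over the complex
  numbers.\<close>

lemma factor_monic:
  fixes c :: "nat \<Rightarrow> complex"
  assumes "c 0 = 1"
  shows "\<exists>\<xi>. \<forall>i\<le>r. c i = tt r (\<lambda>_. 1) \<xi> i"
proof -
  define R where "R = (\<Sum>i\<le>r. monom (c i) (r - i))"
  have coeffR: "coeff R (r - i) = c i" if "i \<le> r" for i
  proof -
    have "coeff R (r - i) = (\<Sum>j\<le>r. if j = i then c i else 0)"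
      unfolding R_def coeff_sum by (rule sum.cong) (use that in auto)
    then show ?thesis using that by simp
  qed
  have lead: "coeff R r = 1" using coeffR[of 0] assms by simp
  have "degree R \<le> r" unfolding R_def
    by (intro degree_sum_le) (auto intro: order_trans[OF degree_monom_le])
  then have deg: "degree R = r" using lead by (metis le_antisym le_degree zero_neq_one)
  have "R \<noteq> 0" using lead by auto
  then obtain A where A: "size A = r" "R = (\<Prod>x\<in>#A. [:- x, 1:])"
    using alg_closed_imp_factorization[of R] deg lead by auto
  obtain xs where xs: "A = mset xs" using ex_mset by metis
  have len: "length xs = r" using A(1) xs by simp
  \<comment> \<open>The factors are written as X + \<xi>, hence the sign; the list counts from 0 and
    the variables from 1.\<close>
  define \<xi> where "\<xi> s = - (xs ! (s - 1))" for s
  have "R = (\<Prod>i<r. [:- (xs ! i), 1:])"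
    unfolding A(2) xs mset_map[symmetric] prod_mset_prod_list
    by (simp add: prod.list_conv_set_nth len atLeast0LessThan)
  also have "\<dots> = (\<Prod>s\<in>{1..r}. [:\<xi> s, 1:])"
    by (rule prod.reindex_bij_witness[of _ "\<lambda>s. s - 1" Suc]) (auto simp: \<xi>_def)
  also have "\<dots> = (\<Prod>s\<in>{1..r}. 1 * [:0, 1:] + [:\<xi> s:] * 1)" by (simp add: pCons_one)
  also have "\<dots> = (\<Sum>i\<le>r. tt r (\<lambda>_. 1) (\<lambda>s. [:\<xi> s:]) i * ([:0, 1:] ^ (r - i) * 1 ^ i))"
    by (rule tt_identity)
  also have "\<dots> = (\<Sum>i\<le>r. monom (tt r (\<lambda>_. 1) \<xi> i) (r - i))"
  proof (rule sum.cong[OF refl])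
    fix i
    have "is_hom (\<lambda>a::complex. [:a:])" by (simp add: is_hom_def pCons_one)
    from tt_hom[OF this, of r "\<lambda>_. 1" \<xi> i]
    have "tt r (\<lambda>_. 1) (\<lambda>s. [:\<xi> s:]) i = [:tt r (\<lambda>_. 1) \<xi> i:]" by (simp add: pCons_one)
    then show "tt r (\<lambda>_. 1) (\<lambda>s. [:\<xi> s:]) i * ([:0, 1:] ^ (r - i) * 1 ^ i) = monom (tt r (\<lambda>_. 1) \<xi> i) (r - i)"
      by (simp add: monom_altdef)
  qed
  finally have R2: "R = (\<Sum>i\<le>r. monom (tt r (\<lambda>_. 1) \<xi> i) (r - i))" .
  have "c i = tt r (\<lambda>_. 1) \<xi> i" if "i \<le> r" for i
  proof -
    have "coeff R (r - i) = (\<Sum>j\<le>r. if j = i then tt r (\<lambda>_. 1) \<xi> i else 0)"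
      unfolding R2 coeff_sum by (rule sum.cong) (use that in auto)
    then show ?thesis using that coeffR by simp
  qed
  then show ?thesis by blast
qed

text \<open>The quotient map is dominant: a point where \<open>p\<close> is nonzero is lifted to the
  product of lines by factoring a polynomial and inverting the parametrization, and there the
  substituted polynomial takes the same value.\<close>

lemma inj_yy: "inj_subst yy"
proof
  fix p :: cpoly assume p: "p \<noteq> 0"
  \<comment> \<open>In terms of the roots this is the product of all f1 - f0 \<xi>_s. It has to be
    nonzero because f1/f0 is the affine coordinate of the parameter infinity, which no lift can
    attain.\<close>
  define el where "el = (\<Sum>i\<le>r. (if i = 0 then 1 else pvar i) * pconst (f1 ^ (r - i) * (- f0) ^ i))"
  have pe_el: "pe c el = (\<Sum>i\<le>r. (if i = 0 then 1 else c i) * (f1 ^ (r - i) * (- f0) ^ i))" for c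
    unfolding el_def by (simp add: pe_hom if_distrib[of "pe c"] cong: if_cong)
  have "el \<noteq> 0"
  proof (cases "f1 = 0")
    case False
    have "pe (\<lambda>_. 0) el = (\<Sum>i\<le>r. if i = 0 then f1 ^ r else 0)"
      unfolding pe_el by (rule sum.cong) auto
    then show ?thesis using False by auto
  next
    case True
    then have "f0 \<noteq> 0" using det by auto
    have "pe (\<lambda>_. 1) el = (\<Sum>i\<le>r. if i = r then (- f0) ^ r else 0)"
      unfolding pe_el by (rule sum.cong) (auto simp: True)
    then show ?thesis using \<open>f0 \<noteq> 0\<close> by auto
  qed
  then have "p * el \<noteq> 0" using p by simp
  then obtain c where "pe c (p * el) \<noteq> 0"
    using exists_nonroot[of "p * el" UNIV] infinite_UNIV_char_0 by blast
  then have c: "pe c p \<noteq> 0" "pe c el \<noteq> 0" by (auto simp: pe_simps)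
  define c' where "c' i = (if i = 0 then 1 else c i)" for i
  obtain \<xi> where \<xi>: "\<And>i. i \<le> r \<Longrightarrow> c' i = tt r (\<lambda>_. 1) \<xi> i"
    using factor_monic[of c'] by (auto simp: c'_def)
  have "(\<Prod>s\<in>{1..r}. 1 * f1 + \<xi> s * (- f0)) = (\<Sum>i\<le>r. c' i * (f1 ^ (r - i) * (- f0) ^ i))"
    unfolding tt_identity by (rule sum.cong) (auto simp: \<xi>)
  also have "\<dots> = pe c el" by (simp add: pe_el c'_def)
  finally have nz: "f0 * \<xi> s - f1 \<noteq> 0" if "s \<in> {1..r}" for s
  proof -
    assume *: "(\<Prod>s\<in>{1..r}. 1 * f1 + \<xi> s * (- f0)) = pe c el"
    have "1 * f1 + \<xi> s * (- f0) \<noteq> 0" using c(2) that unfolding *[symmetric] by (metis finite_atLeastAtMost prod_zero)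
    then show ?thesis by (auto simp: mult.commute)
  qed
  \<comment> \<open>The inverse of the parametrization at the affine coordinate \<xi>_s; the other
    variables keep their values since \<open>yy\<close> fixes them.\<close>
  define u where "u s = (if s \<in> {1..r} then (e1 - e0 * \<xi> s) / (f0 * \<xi> s - f1) else c s)" for s
  have x: "x0 (u s) \<noteq> 0 \<and> x1 (u s) = x0 (u s) * \<xi> s" if s: "s \<in> {1..r}" for s
  proof -
    let ?D = "f0 * \<xi> s - f1"
    have us: "u s = (e1 - e0 * \<xi> s) / ?D" using s by (simp add: u_def)
    have D: "?D \<noteq> 0" by (rule nz[OF s])
    then have uD: "u s * ?D = e1 - e0 * \<xi> s" using us by (rule div_solve)
    have x0D: "x0 (u s) * ?D = - (e0 * f1 - e1 * f0)" unfolding x0_def by (rule moebius[OF uD])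
    moreover from x0D have "x0 (u s) * ?D = - (e0 * f1 - e1 * f0)" .
    moreover have "x1 (u s) * ?D = - (e0 * f1 - e1 * f0) * \<xi> s" unfolding x1_def by (rule moebius[OF uD])
    ultimately have "x1 (u s) * ?D = (x0 (u s) * ?D) * \<xi> s" by (simp only:)
    also have "\<dots> = (x0 (u s) * \<xi> s) * ?D" by (simp only: mult_ac)
    finally have "x1 (u s) = x0 (u s) * \<xi> s" by (simp only: mult_right_cancel[OF D])
    moreover have "x0 (u s) \<noteq> 0" using x0D det by auto
    ultimately show ?thesis by blast
  qed
  have tvu: "tv u i = (\<Prod>s\<in>{1..r}. x0 (u s)) * c' i" if "i \<le> r" for i
  proof -
    have "tv u i = tt r (\<lambda>s. x0 (u s) * 1) (\<lambda>s. x0 (u s) * \<xi> s) i"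
      unfolding tv_def by (rule tt_cong) (use x in auto)
    also have "\<dots> = (\<Prod>s\<in>{1..r}. x0 (u s)) * tt r (\<lambda>_. 1) \<xi> i" by (rule tt_scale)
    finally show ?thesis using \<xi>[OF that] by simp
  qed
  have P: "(\<Prod>s\<in>{1..r}. x0 (u s)) \<noteq> 0" using x by simp
  then have t0: "tv u 0 \<noteq> 0" using tvu[of 0] by (simp add: c'_def)
  have "reg UNIV u (yy i) \<and> ev u (yy i) = c i" for i
  proof (cases "i \<in> {1..r}")
    case True
    have "reg UNIV u (TT j)" for j using TT_reg by (rule reg_mono) simp
    then show ?thesis using True t0 P tvu[of i] tvu[of 0]
      by (simp add: yy_def reg_divide ev_divide[where V = UNIV] TT_ev c'_def)
  next
    case False
    have "u i = c i" unfolding u_def using False by (rule if_not_P)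
    moreover have "yy i = rvar i" unfolding yy_def using False by (rule if_not_P)
    ultimately show ?thesis by (simp add: reg_var)
  qed
  then have "ev u (poly_subst rconst yy p) = pe c p"
    by (intro ev_poly_subst[of p UNIV UNIV]) auto
  then show "poly_subst rconst yy p \<noteq> 0" using c(1) by (metis ev_0)
qed

sublocale yy: inj_subst yy by (rule inj_yy)

lemma rsub_ycoord: "i \<le> r \<Longrightarrow> rsub yy (ycoord i) = inverse (TT 0) * TT i"
  using TT0_nonzero by (auto simp: ycoord_def yy_def yy.rsub_hom divide_inverse)

text \<open>Numerator and denominator are homogeneous of the same degree, so the powers of
  \<open>TT 0\<close> cancel. Hence the pullback is regular also at points where \<open>TT 0\<close>
  vanishes and the affine coordinates have poles.\<close>

lemma rsub_local_ring:
  assumes f: "f \<in> local_ring r q" and q: "\<And>i. i \<le> r \<Longrightarrow> q $ i = tv c i"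
  shows "reg {1..r} c (rsub yy f)"
proof -
  obtain F G d where *: "f = poly_subst rconst ycoord F / poly_subst rconst ycoord G"
    "F \<in> polys_in {0..r}" "G \<in> polys_in {0..r}" "homogeneous d F" "homogeneous d G" "pe (\<lambda>i. q $ i) G \<noteq> 0"
    using f by (rule local_ringE)
  have s: "rsub yy (poly_subst rconst ycoord P) = inverse (TT 0) ^ d * poly_subst rconst TT P"
    if "P \<in> polys_in {0..r}" "homogeneous d P" for P
  proof -
    have "rsub yy (poly_subst rconst ycoord P) = poly_subst rconst (\<lambda>i. inverse (TT 0) * TT i) P"
      by (rule hom_poly_subst[OF is_hom_rconst yy.is_hom_rsub is_hom_rconst _ _ that(1)]) (auto simp: rsub_ycoord)
    also have "\<dots> = inverse (TT 0) ^ d * poly_subst rconst TT P" by (rule poly_subst_homogeneous[OF that(2)])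
    finally show ?thesis .
  qed
  have "rsub yy f = poly_subst rconst TT F / poly_subst rconst TT G"
    unfolding *(1) yy.rsub_hom s[OF *(2,4)] s[OF *(3,5)] using TT0_nonzero by simp
  moreover have "reg {1..r} c (poly_subst rconst TT P)" "ev c (poly_subst rconst TT P) = pe (tv c) P" for P
    by (auto intro!: reg_poly_subst[of P UNIV] ev_poly_subst[of P UNIV "{1..r}"] TT_reg TT_ev)
  moreover have "pe (tv c) G = pe (\<lambda>i. q $ i) G"
    by (rule pe_cong[OF *(3)]) (simp add: q)
  ultimately show ?thesis using *(6) by (simp add: reg_divide)
qed

lemma pb_regular:
  assumes \<eta>: "\<eta> \<in> regular_forms_at r q p" and q: "\<And>i. i \<le> r \<Longrightarrow> q $ i = tv c i"
  shows "reg {1..r} c (pb r yy \<eta> K)"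
proof -
  obtain n g fs where 1: "\<eta> = (\<Sum>s<n. fscale (g s) (wedge_list (map dfun (fs s))))"
    "\<forall>s<(n::nat). g s \<in> local_ring r q \<and> length (fs s) = p \<and> set (fs s) \<subseteq> local_ring r q"
    using \<eta> unfolding regular_forms_at_def by blast
  have "regf {1..r} c (pb r yy (fscale (g s) (wedge_list (map dfun (fs s)))))" if s: "s < n" for s
  proof -
    have fr: "f \<in> fracs {1..r}" "reg {1..r} c (rsub yy f)" if "f \<in> set (fs s)" for f
    proof -
      have "f \<in> local_ring r q" using 1(2) s that by blast
      then show "f \<in> fracs {1..r}" "reg {1..r} c (rsub yy f)" by (auto intro: local_ring_fracs rsub_local_ring[OF _ q])
    qed
    have "pb r yy (wedge_list (map dfun (fs s))) = wedge_list (map (pb r yy) (map dfun (fs s)))"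
      by (rule yy.pb_wedge_list) (auto intro: supported_dfun fr)
    also have "map (pb r yy) (map dfun (fs s)) = map (\<lambda>f. dfun (rsub yy f)) (fs s)"
      by (auto intro!: yy.pb_dfun fr)
    finally have "pb r yy (wedge_list (map dfun (fs s))) = wedge_list (map (\<lambda>f. dfun (rsub yy f)) (fs s))" .
    moreover have "regf {1..r} c (wedge_list (map (\<lambda>f. dfun (rsub yy f)) (fs s)))"
      by (rule regf_wedge_list) (auto intro: regf_dfun fr)
    moreover have "reg {1..r} c (rsub yy (g s))" using 1(2) s by (intro rsub_local_ring[OF _ q]) auto
    ultimately show ?thesis by (simp add: yy.pb_fscale regf_fscale)
  qed
  then have "regf {1..r} c (pb r yy \<eta>)" unfolding 1(1) yy.pb_sum by (intro regf_sum) auto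
  then show ?thesis by (simp add: regf_def)
qed

text \<open>The linear forms \<open>\<^bold>y w\<^sub>j\<close> for the Veronese image \<open>w\<close> of the columns of \<open>(W0, W1)\<close>.\<close>

definition lin :: "complex fps \<Rightarrow> complex fps \<Rightarrow> nat \<Rightarrow> ratfun" where
  "lin W0 W1 j = (\<Sum>i\<le>r. ycoord i * rconst (fps_nth (W0 ^ (r - i) * W1 ^ i) j))"

definition linv :: "complex fps \<Rightarrow> complex fps \<Rightarrow> nat \<Rightarrow> complex vec \<Rightarrow> complex" where
  "linv W0 W1 j q = (\<Sum>i\<le>r. q $ i * fps_nth (W0 ^ (r - i) * W1 ^ i) j)"

definition AA :: "complex fps \<Rightarrow> complex fps \<Rightarrow> nat \<Rightarrow> nat \<Rightarrow> ratfun" where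
  "AA W0 W1 s j = X0 s * rconst (fps_nth W0 j) + X1 s * rconst (fps_nth W1 j)"

lemma AA_eq: "AA W0 W1 s j = rconst (e0 * fps_nth W0 j + e1 * fps_nth W1 j) + rconst (f0 * fps_nth W0 j + f1 * fps_nth W1 j) * rvar s"
  by (simp add: AA_def X0_def X1_def rconst_simps algebra_simps)

lemma AA_nonzero:
  assumes "fps_nth W0 j \<noteq> 0 \<or> fps_nth W1 j \<noteq> 0"
  shows "AA W0 W1 s j \<noteq> 0"
  unfolding AA_eq
proof (rule linear_nonzero, rule ccontr)
  let ?a = "fps_nth W0 j" and ?b = "fps_nth W1 j"
  assume "\<not> (e0 * ?a + e1 * ?b \<noteq> 0 \<or> f0 * ?a + f1 * ?b \<noteq> 0)"
  then have *: "e0 * ?a + e1 * ?b = 0" "f0 * ?a + f1 * ?b = 0" by auto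
  from det_solve[OF * det] show False using assms by blast
qed

definition rcf :: "complex fps \<Rightarrow> ratfun fps" where
  "rcf W = Abs_fps (\<lambda>j. rconst (fps_nth W j))"

lemma rcf_mult: "rcf (W * W') = rcf W * rcf W'"
  by (rule fps_ext) (simp add: rcf_def fps_mult_nth rconst_hom rconst_simps)

lemma rcf_power: "rcf (W ^ n) = rcf W ^ n"
proof (induction n)
  case 0
  show ?case by (rule fps_ext) (simp add: rcf_def rconst_simps)
qed (simp add: rcf_mult)

text \<open>This is the reason for the Veronese map: its columns are the coefficients of W0^(r - i)
  W1^i, so pairing them with elementary symmetric functions multiplies out a product of one linear
  factor per variable.\<close>

lemma rsub_lin: "Abs_fps (\<lambda>j. rsub yy (lin W0 W1 j)) = fps_const (inverse (TT 0)) * (\<Prod>s\<in>{1..r}. Abs_fps (AA W0 W1 s))"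
proof -
  have "Abs_fps (AA W0 W1 s) = fps_const (X0 s) * rcf W0 + fps_const (X1 s) * rcf W1" for s
    by (rule fps_ext) (simp add: AA_def rcf_def)
  then have "(\<Prod>s\<in>{1..r}. Abs_fps (AA W0 W1 s)) =
      (\<Sum>i\<le>r. tt r (\<lambda>s. fps_const (X0 s)) (\<lambda>s. fps_const (X1 s)) i * (rcf W0 ^ (r - i) * rcf W1 ^ i))"
    by (simp only: tt_identity)
  also have "\<dots> = (\<Sum>i\<le>r. fps_const (TT i) * rcf (W0 ^ (r - i) * W1 ^ i))"
  proof (rule sum.cong[OF refl])
    fix i
    have "is_hom (fps_const :: ratfun \<Rightarrow> _)" by (simp add: is_hom_def)
    from tt_hom[OF this, of r X0 X1 i]
    show "tt r (\<lambda>s. fps_const (X0 s)) (\<lambda>s. fps_const (X1 s)) i * (rcf W0 ^ (r - i) * rcf W1 ^ i) =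
      fps_const (TT i) * rcf (W0 ^ (r - i) * W1 ^ i)"
      by (simp add: TT_def rcf_mult rcf_power)
  qed
  finally have P: "(\<Prod>s\<in>{1..r}. Abs_fps (AA W0 W1 s)) = (\<Sum>i\<le>r. fps_const (TT i) * rcf (W0 ^ (r - i) * W1 ^ i))" .
  show ?thesis
  proof (rule fps_ext)
    fix j
    have "rsub yy (lin W0 W1 j) = (\<Sum>i\<le>r. inverse (TT 0) * TT i * rconst (fps_nth (W0 ^ (r - i) * W1 ^ i) j))"
      unfolding lin_def by (simp add: yy.rsub_hom rsub_ycoord)
    then show "fps_nth (Abs_fps (\<lambda>j. rsub yy (lin W0 W1 j))) j =
      fps_nth (fps_const (inverse (TT 0)) * (\<Prod>s\<in>{1..r}. Abs_fps (AA W0 W1 s))) j"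
      unfolding P by (simp add: fps_sum_nth rcf_def sum_distrib_left mult.assoc)
  qed
qed

lemma rsub_lin_0: "rsub yy (lin W0 W1 0) = inverse (TT 0) * (\<Prod>s\<in>{1..r}. AA W0 W1 s 0)"
proof -
  have "fps_nth (\<Prod>s\<in>A. Abs_fps (AA W0 W1 s)) 0 = (\<Prod>s\<in>A. AA W0 W1 s 0)" if "finite A" for A
    using that by (induction A rule: finite_induct) auto
  from this[of "{1..r}"] show ?thesis
    using arg_cong[OF rsub_lin, of "\<lambda>f. fps_nth f 0" W0 W1] by simp
qed

lemma rsub_theta_lin:
  assumes "fps_nth W0 0 \<noteq> 0 \<or> fps_nth W1 0 \<noteq> 0"
  shows "rsub yy (theta m (lin W0 W1)) = (\<Sum>s\<in>{1..r}. theta m (AA W0 W1 s))"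
  unfolding yy.rsub_theta
  by (rule theta_product[OF _ _ _ rsub_lin]) (use TT0_nonzero AA_nonzero[OF assms] in auto)

text \<open>A quotient of two linear forms is homogeneous of degree 0, whereas a single linear form
  in affine coordinates may have a pole where t_0 vanishes.\<close>

lemma lin_local_ring:
  assumes "linv W0 W1 j q \<noteq> 0"
  shows "lin W0' W1' j' / lin W0 W1 j \<in> local_ring r q"
proof -
  let ?F = "\<lambda>W0 W1 j. \<Sum>i\<le>r. pconst (fps_nth (W0 ^ (r - i) * W1 ^ i) j) * pvar i"
  note ps = is_homD[OF is_hom_poly_subst[OF is_hom_rconst]]
  have 1: "lin W0 W1 j = poly_subst rconst ycoord (?F W0 W1 j)" for W0 W1 j
    by (simp only: ps poly_subst_const[OF is_hom_rconst] poly_subst_var[OF is_hom_rconst] lin_def mult.commute)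
  have "pe (\<lambda>i. q $ i) (?F W0 W1 j) = linv W0 W1 j q"
    by (simp only: pe_hom pe_const pe_var linv_def mult.commute)
  moreover have "?F W0 W1 j \<in> polys_in {0..r}" for W0 W1 j
    by (intro polys_in_sum polys_in_closed pvar_in) auto
  moreover have "homogeneous 1 (?F W0 W1 j)" for W0 W1 j
    by (intro homogeneous_sum homogeneous_linear)
  ultimately show ?thesis unfolding 1 using assms by (intro local_ringI) auto
qed

lemma lin_fracs: "lin W0 W1 j \<in> fracs {1..r}"
  unfolding lin_def by (intro fracs_sum fracs_closed ycoord_fracs) auto

lemma theta_local_ring: "linv W0 W1 0 q \<noteq> 0 \<Longrightarrow> theta m (lin W0 W1) \<in> local_ring r q"
  using local_ring_const[of 0 r q]
  by (intro theta_induct[where P = "\<lambda>f. f \<in> local_ring r q"] local_ring_add local_ring_mult local_ring_const lin_local_ring)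
    (simp_all add: rconst_simps)

lemma theta_fracs: "theta m (lin W0 W1) \<in> fracs {1..r}"
  by (intro theta_induct[where P = "\<lambda>f. f \<in> fracs {1..r}"] fracs_closed lin_fracs)

end

declare form_apply [simp del]

subsection \<open>Regular forms on the complement\<close>

lemma OmegaI: "\<eta> \<in> rational_forms r p \<Longrightarrow> (\<And>q. q \<in> Y \<Longrightarrow> \<eta> \<in> regular_forms_at r q p) \<Longrightarrow> \<eta> \<in> Omega r Y p"
  by (simp add: Omega_def)

lemma OmegaD: "\<eta> \<in> Omega r Y p \<Longrightarrow> \<eta> \<in> rational_forms r p" "\<eta> \<in> Omega r Y p \<Longrightarrow> q \<in> Y \<Longrightarrow> \<eta> \<in> regular_forms_at r q p"
  by (simp_all add: Omega_def)

lemma Omega_wedge: "\<eta> \<in> Omega r Y p \<Longrightarrow> \<zeta> \<in> Omega r Y p' \<Longrightarrow> wedge \<eta> \<zeta> \<in> Omega r Y (p + p')"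
  unfolding Omega_def using rational_forms_wedge regular_forms_at_wedge by simp

lemma Omega_one: "func_form 1 \<in> Omega r Y 0"
proof (rule OmegaI)
  show "func_form 1 \<in> rational_forms r 0" by (intro rational_forms_func_form fracs_closed)
  show "func_form 1 \<in> regular_forms_at r q 0" for q
    using regular_forms_at_single[of "rconst 1" r q "[]"] local_ring_const[of 1 r q] by (simp add: rconst_simps fscale_simps)
qed

lemma Omega_wedge_list: "(\<forall>\<eta>\<in>set \<eta>s. \<eta> \<in> Omega r Y 1) \<Longrightarrow> wedge_list \<eta>s \<in> Omega r Y (length \<eta>s)"
proof (induction \<eta>s)
  case (Cons \<eta> \<eta>s)
  then show ?case using Omega_wedge[of \<eta> r Y 1 "wedge_list \<eta>s" "length \<eta>s"] by (simp add: plus_1_eq_Suc)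
qed (simp add: Omega_one)

definition global_fun :: "nat \<Rightarrow> complex vec set \<Rightarrow> ratfun \<Rightarrow> bool" where
  "global_fun r Y f \<longleftrightarrow> f \<in> fracs {1..r} \<and> (\<forall>q\<in>Y. f \<in> local_ring r q)"

lemma Omega_fscale: "global_fun r Y f \<Longrightarrow> \<eta> \<in> Omega r Y p \<Longrightarrow> fscale f \<eta> \<in> Omega r Y p"
  unfolding Omega_def global_fun_def using rational_forms_fscale regular_forms_at_fscale by simp

lemma Omega_dfun: "global_fun r Y f \<Longrightarrow> dfun f \<in> Omega r Y 1"
  unfolding Omega_def global_fun_def using rational_forms_dfun regular_forms_at_dfun by simp

lemma Omega_sum: "(\<And>i. i \<in> A \<Longrightarrow> h i \<in> Omega r Y p) \<Longrightarrow> sum h A \<in> Omega r Y p"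
proof (induction A rule: infinite_finite_induct)
  case (insert i A)
  then show ?case using Omega_closed(2)[of "h i" r Y p "sum h A"] by simp
qed (simp_all add: Omega_closed(1))

lemma Omega_diff: "\<eta> \<in> Omega r Y p \<Longrightarrow> \<zeta> \<in> Omega r Y p \<Longrightarrow> \<eta> - \<zeta> \<in> Omega r Y p"
proof -
  assume *: "\<eta> \<in> Omega r Y p" "\<zeta> \<in> Omega r Y p"
  have eq: "\<eta> - \<zeta> = \<eta> + fscale (rconst (- 1)) \<zeta>"
    by (simp add: rconst_hom fscale_minus1)
  from Omega_closed(2)[OF *(1) Omega_closed(3)[OF *(2), of "- 1"]] show ?thesis unfolding eq .
qed

lemma global_fun_sum_const:
  "(\<And>i. i \<in> A \<Longrightarrow> global_fun r Y (g i)) \<Longrightarrow> global_fun r Y (\<Sum>i\<in>A. rconst (c i) * g i)"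
  unfolding global_fun_def by (auto intro!: fracs_sum fracs_closed local_ring_sum local_ring_mult local_ring_const)

lemma fscale_eq: "fscale f \<eta> K = f * \<eta> K" by (simp add: fscale_def)

text \<open>The form \<open>\<Sum>\<^sub>j G\<^sub>j du\<^sub>j\<close> on the product of \<open>r\<close> lines with coordinates \<open>rvar 1, \<dots>, rvar r\<close>.\<close>

definition TrF :: "nat \<Rightarrow> (nat \<Rightarrow> ratfun) \<Rightarrow> form" where
  "TrF r G I = (if \<exists>j\<in>{1..r}. I = {j} then G (the_elem I) else 0)"

lemma TrF_single [simp]: "TrF r G {j} = (if j \<in> {1..r} then G j else 0)"
  by (auto simp: TrF_def)

lemma one_form_TrF: "one_form (TrF r G)"
  by (auto simp: one_form_def TrF_def)

lemma TrF_eqI: "one_form \<eta> \<Longrightarrow> (\<And>j. \<eta> {j} = (if j \<in> {1..r} then G j else 0)) \<Longrightarrow> \<eta> = TrF r G"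
  by (rule one_form_eqI[OF _ one_form_TrF]) simp_all

lemma TrF_lincomb: "(\<Sum>i\<in>A. fscale (rconst (c i)) (TrF r (G i))) = TrF r (\<lambda>j. \<Sum>i\<in>A. rconst (c i) * G i j)"
  by (rule TrF_eqI) (auto intro!: one_form_sum one_form_fscale one_form_TrF simp: form_sum_apply fscale_eq)

subsection \<open>Permutations of the variables\<close>

text \<open>The inverse of the enumeration \<open>js\<close>. Positions count from 0 and entries
  from 1, whence the shifts by 1 below.\<close>

definition pos :: "nat list \<Rightarrow> nat \<Rightarrow> nat" where
  "pos js s = inv_into {..<length js} (\<lambda>i. js ! i) s"

context
  fixes r :: nat and js :: "nat list"
  assumes js: "js \<in> permutations_of_set {1..r}"
begin

lemma perm_props: "length js = r" "set js = {1..r}" "distinct js"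
  using js length_finite_permutations_of_set[OF js] by (auto simp: permutations_of_set_def)

lemma perm_bij: "bij_betw (\<lambda>i. js ! i) {..<r} {1..r}"
  using bij_betw_nth[OF perm_props(3), of "{..<r}" "{1..r}"] perm_props by simp

lemma pos_props: "s \<in> {1..r} \<Longrightarrow> pos js s < r" "s \<in> {1..r} \<Longrightarrow> js ! pos js s = s" "i < r \<Longrightarrow> pos js (js ! i) = i"
proof -
  show "s \<in> {1..r} \<Longrightarrow> pos js s < r"
    unfolding pos_def perm_props(1) using inv_into_into[of s "\<lambda>i. js ! i" "{..<r}"] perm_bij by (simp add: bij_betw_def)
  show "s \<in> {1..r} \<Longrightarrow> js ! pos js s = s"
    unfolding pos_def perm_props(1) using f_inv_into_f[of s "\<lambda>i. js ! i" "{..<r}"] perm_bij by (simp add: bij_betw_def)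
  show "i < r \<Longrightarrow> pos js (js ! i) = i"
    unfolding pos_def perm_props(1) using inv_into_f_f[of "\<lambda>i. js ! i" "{..<r}" i] perm_bij by (simp add: bij_betw_def)
qed

lemma perm_prod: "(\<Prod>i<r. h i (js ! i)) = (\<Prod>s\<in>{1..r}. h (pos js s) s)"
proof -
  have "(\<Prod>s\<in>{1..r}. h (pos js s) s) = (\<Prod>i<r. h (pos js (js ! i)) (js ! i))"
    by (rule prod.reindex_bij_betw[OF perm_bij, symmetric])
  also have "\<dots> = (\<Prod>i<r. h i (js ! i))" by (rule prod.cong) (auto simp: pos_props)
  finally show ?thesis by simp
qed

lemma perm_sum: "(\<Sum>i<r. f (js ! i)) = (\<Sum>s\<in>{1..r}. f s)"
  by (rule sum.reindex_bij_betw[OF perm_bij])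

definition sg :: "nat \<Rightarrow> ratfun" where
  "sg i = (if i \<in> {1..r} then rvar (js ! (i - 1)) else rvar i)"

lemma inj_sg: "inj_subst sg"
proof
  fix p :: cpoly assume "p \<noteq> 0"
  then obtain c where c: "pe c p \<noteq> 0"
    using exists_nonroot[of p UNIV] infinite_UNIV_char_0 by blast
  define c' where "c' s = (if s \<in> {1..r} then c (pos js s + 1) else c s)" for s
  have "ev c' (sg i) = c i" for i
  proof (cases "i \<in> {1..r}")
    case True
    then have i: "i - 1 < r" by auto
    then have "js ! (i - 1) \<in> {1..r}" using perm_props nth_mem[of "i - 1" js] by simp
    then show ?thesis using True pos_props(3)[OF i] by (simp add: sg_def c'_def)
  next
    case False
    then have "sg i = rvar i" "c' i = c i" unfolding sg_def c'_def by (simp_all only: if_False)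
    then show ?thesis by simp
  qed
  moreover have "reg UNIV c' (sg i)" for i by (simp add: sg_def reg_var)
  ultimately have "ev c' (poly_subst rconst sg p) = pe c p" by (intro ev_poly_subst[of p UNIV UNIV]) auto
  then show "poly_subst rconst sg p \<noteq> 0" using c by (metis ev_0)
qed

end

context sym_param
begin

lemma rsub_sg_yy:
  assumes js: "js \<in> permutations_of_set {1..r}" and i: "i \<in> {1..r}"
  shows "rsub (sg r js) (yy i) = yy i"
proof -
  interpret sgj: inj_subst "sg r js" by (rule inj_sg[OF js])
  let ?\<sigma> = "\<lambda>s. js ! (s - 1)"
  have "bij_betw (\<lambda>s. s - 1) {1..r} {..<r}"
    by (rule bij_betwI[where g = Suc]) auto
  from bij_betw_trans[OF this perm_bij[OF js]] have bij: "bij_betw ?\<sigma> {1..r} {1..r}" by (simp add: comp_def)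
  have "rsub (sg r js) (TT i) = TT i" for i
  proof -
    have "rsub (sg r js) (TT i) = tt r (\<lambda>s. rsub (sg r js) (X0 s)) (\<lambda>s. rsub (sg r js) (X1 s)) i"
      unfolding TT_def by (rule tt_hom[OF sgj.is_hom_rsub])
    also have "\<dots> = tt r (\<lambda>s. X0 (?\<sigma> s)) (\<lambda>s. X1 (?\<sigma> s)) i"
      by (rule tt_cong) (auto simp: X0_def X1_def sgj.rsub_hom sg_def[OF js])
    also have "\<dots> = TT i" unfolding TT_def by (rule tt_permute[OF bij])
    finally show ?thesis .
  qed
  then show ?thesis using i by (simp add: yy_def sgj.rsub_hom)
qed

lemma supported_pb: "supported r (pb r yy \<eta>)"
proof -
  have "supported r (fscale (rsub yy (\<eta> I)) (EE (\<lambda>i. dfun (yy i)) I))" if "I \<in> Pow {1..r}" for I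
  proof (intro supported_fscale)
    have "finite I" using that finite_subset[of I "{1..r}"] by simp
    then show "supported r (EE (\<lambda>i. dfun (yy i)) I)"
      unfolding EE_def using that by (intro supported_wedge_list) (auto intro!: supported_dfun yy_fracs)
  qed
  then show ?thesis
    unfolding supported_def pb_def form_sum_apply by (metis (no_types, lifting) sum.neutral)
qed

lemma pb_top:
  assumes "\<eta> \<in> rational_forms r r"
  shows "pb r yy \<eta> = fscale (pb r yy \<eta> {1..r}) (unit_form {1..r})"
proof
  fix K
  show "pb r yy \<eta> K = fscale (pb r yy \<eta> {1..r}) (unit_form {1..r}) K"
  proof (cases "K = {1..r}")
    case False
    have "pb r yy \<eta> K = 0"
    proof (rule ccontr)
      assume nz: "pb r yy \<eta> K \<noteq> 0"
      then have "K \<subseteq> {1..r}" using supported_pb by (simp add: supported_def)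
      moreover have "card K = r" using yy.pb_degree[OF assms nz] by simp
      ultimately show False using False card_subset_eq[of "{1..r}" K] by simp
    qed
    then show ?thesis using False by (simp add: fscale_eq unit_form_def)
  qed (simp add: fscale_eq unit_form_def)
qed

text \<open>All top forms pull back to multiples of one Jacobian. That it is nonzero is read off
  from any form \<zeta> with a nonzero pullback.\<close>

lemma pb_top_inj:
  assumes nz: "\<zeta> \<in> rational_forms r r" "pb r yy \<zeta> {1..r} \<noteq> 0"
    and \<eta>: "\<eta> \<in> rational_forms r r" "pb r yy \<eta> {1..r} = 0"
  shows "\<eta> = 0"
proof -
  have *: "\<theta> = fscale (\<theta> {1..r}) (unit_form {1..r})" if "\<theta> \<in> rational_forms r r" for \<theta>
  proof
    fix K
    show "\<theta> K = fscale (\<theta> {1..r}) (unit_form {1..r}) K"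
    proof (cases "K = {1..r}")
      case False
      then have "\<theta> K = 0" using that card_subset_eq[of "{1..r}" K] unfolding rational_forms_def by fastforce
      then show ?thesis using False by (simp add: fscale_eq unit_form_def)
    qed (simp add: fscale_eq unit_form_def)
  qed
  have pb: "pb r yy \<theta> = fscale (rsub yy (\<theta> {1..r})) (EE (\<lambda>i. dfun (yy i)) {1..r})" if "\<theta> \<in> rational_forms r r" for \<theta>
    by (subst *[OF that]) (simp add: yy.pb_fscale yy.pb_unit)
  have "EE (\<lambda>i. dfun (yy i)) {1..r} {1..r} \<noteq> 0" using nz(2) unfolding pb[OF nz(1)] by (auto simp: fscale_eq)
  then have "rsub yy (\<eta> {1..r}) = 0" using \<eta>(2) unfolding pb[OF \<eta>(1)] by (simp add: fscale_eq)
  then have "\<eta> {1..r} = 0" by (simp only: yy.rsub_hom)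
  then show ?thesis using *[OF \<eta>(1)] by (simp add: fscale_simps)
qed

lemma sorted_list_top: "sorted_list_of_set {1..r} = [1..<Suc r]"
  by (metis atLeastLessThanSuc_atLeastAtMost sorted_list_of_set_range)

lemma top_perm: "[1..<Suc r] \<in> permutations_of_set {1..r}"
  by (auto simp: permutations_of_set_def)

text \<open>The quotient map does not change under permutations of the variables, hence neither does
  the pulled back form; but its basis form, the product of all differentials, acquires the sign of
  the permutation.\<close>

lemma pb_invariant:
  assumes \<eta>: "\<eta> \<in> rational_forms r r" and js: "js \<in> permutations_of_set {1..r}"
  shows "pb r yy \<eta> {1..r} = eps js * rsub (sg r js) (pb r yy \<eta> {1..r})"
proof -
  interpret sgj: inj_subst "sg r js" by (rule inj_sg[OF js])
  let ?g = "pb r yy \<eta> {1..r}"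
  have "pb r yy \<eta> = pb r (sg r js) (pb r yy \<eta>)"
    by (rule pb_pb[OF inj_yy inj_sg[OF js] inj_yy yy_fracs rsub_sg_yy[OF js] \<eta>, symmetric])
  also have "\<dots> = pb r (sg r js) (fscale ?g (unit_form {1..r}))" by (subst pb_top[OF \<eta>]) (rule refl)
  also have "\<dots> = fscale (rsub (sg r js) ?g) (EE (\<lambda>i. dfun (sg r js i)) {1..r})"
    by (simp add: sgj.pb_fscale sgj.pb_unit)
  finally have "?g = rsub (sg r js) ?g * EE (\<lambda>i. dfun (sg r js i)) {1..r} {1..r}"
    by (metis fscale_eq)
  also have "EE (\<lambda>i. dfun (sg r js i)) {1..r} {1..r} = eps js"
  proof -
    let ?es = "map (\<lambda>i. dfun (sg r js i)) [1..<Suc r]"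
    have "EE (\<lambda>i. dfun (sg r js i)) {1..r} {1..r} =
      (\<Sum>ks\<in>permutations_of_set {1..r}. eps ks * (\<Prod>i<length ?es. (?es ! i) {ks ! i}))"
      unfolding EE_def sorted_list_top by (rule wedge_list_expand) (auto simp: one_form_dfun)
    also have "\<dots> = (\<Sum>ks\<in>permutations_of_set {1..r}. if ks = js then eps js else 0)"
    proof (rule sum.cong[OF refl])
      fix ks assume ks: "ks \<in> permutations_of_set {1..r}"
      have "(\<Prod>i<length ?es. (?es ! i) {ks ! i}) = (\<Prod>i<r. if ks ! i = js ! i then 1 else 0)"
      proof (rule prod.cong)
        show "{..<length ?es} = {..<r}" by simp
        fix i assume "i \<in> {..<r}"
        then have i: "i < r" by simp
        then have "?es ! i = dfun (rvar (js ! i))" by (simp add: sg_def[OF js] nth_map_upt del: upt_Suc)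
        then show "(?es ! i) {ks ! i} = (if ks ! i = js ! i then 1 else 0)" by (simp add: rat_pd_rvar del: upt_Suc)
      qed
      also have "\<dots> = (if ks = js then 1 else 0)"
      proof (cases "ks = js")
        case False
        then obtain i where "i < r" "ks ! i \<noteq> js ! i"
          using perm_props(1)[OF ks] perm_props(1)[OF js] by (metis nth_equalityI)
        then have "(\<Prod>i<r. if ks ! i = js ! i then 1 else 0 :: ratfun) = 0" by (intro prod_zero) auto
        then show ?thesis using False by simp
      qed simp
      finally show "eps ks * (\<Prod>i<length ?es. (?es ! i) {ks ! i}) = (if ks = js then eps js else 0)" by simp
    qed
    also have "\<dots> = eps js" using js by simp
    finally show ?thesis .
  qed
  finally have "?g = rsub (sg r js) ?g * eps js" .
  then show ?thesis by (rule trans[OF _ mult.commute])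
qed

lemma wedge_TrF_top:
  assumes "length as = r"
  shows "wedge_list (map (TrF r) as) {1..r} = (\<Sum>js\<in>permutations_of_set {1..r}. eps js * (\<Prod>i<r. (as ! i) (js ! i)))"
proof -
  have "wedge_list (map (TrF r) as) {1..r} =
    (\<Sum>js\<in>permutations_of_set {1..r}. eps js * (\<Prod>i<length (map (TrF r) as). (map (TrF r) as ! i) {js ! i}))"
    by (rule wedge_list_expand) (use assms in \<open>auto simp: one_form_TrF\<close>)
  also have "\<dots> = (\<Sum>js\<in>permutations_of_set {1..r}. eps js * (\<Prod>i<r. (as ! i) (js ! i)))"
  proof (rule sum.cong[OF refl])
    fix js assume js: "js \<in> permutations_of_set {1..r}"
    have "js ! i \<in> {1..r}" if "i < r" for i
      using perm_props[OF js] nth_mem[of i js] that by simp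
    then show "eps js * (\<Prod>i<length (map (TrF r) as). (map (TrF r) as ! i) {js ! i}) = eps js * (\<Prod>i<r. (as ! i) (js ! i))"
      using assms by (intro arg_cong[where f = "\<lambda>x. eps js * x"] prod.cong) auto
  qed
  finally show ?thesis .
qed

text \<open>In the term of each permutation, the sum of \<open>f\<close> over all variables is also
  the sum over all positions, and each summand can be attached to the factor in that
  position.\<close>

lemma trace_identity:
  assumes "length as = r"
  shows "(\<Sum>s\<in>{1..r}. f s) * wedge_list (map (TrF r) as) {1..r} =
    (\<Sum>i<r. wedge_list (map (TrF r) (as[i := (\<lambda>j. f j * (as ! i) j)])) {1..r})"
proof -
  let ?P = "permutations_of_set {1..r}"
  have "wedge_list (map (TrF r) (as[i := (\<lambda>j. f j * (as ! i) j)])) {1..r} =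
      (\<Sum>js\<in>?P. f (js ! i) * (eps js * (\<Prod>l<r. (as ! l) (js ! l))))" if i: "i < r" for i
  proof -
    have "(\<Prod>l<r. (as[i := (\<lambda>j. f j * (as ! i) j)] ! l) (js ! l)) = f (js ! i) * (\<Prod>l<r. (as ! l) (js ! l))" for js
    proof -
      have "(\<Prod>l<r. (as[i := (\<lambda>j. f j * (as ! i) j)] ! l) (js ! l)) = (\<Prod>l<r. (if l = i then f (js ! i) else 1) * (as ! l) (js ! l))"
        by (rule prod.cong) (use assms i in \<open>auto simp: nth_list_update\<close>)
      then show ?thesis using i by (simp add: prod.distrib)
    qed
    then show ?thesis using assms by (simp add: wedge_TrF_top mult_ac)
  qed
  then have "(\<Sum>i<r. wedge_list (map (TrF r) (as[i := (\<lambda>j. f j * (as ! i) j)])) {1..r}) =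
      (\<Sum>i<r. \<Sum>js\<in>?P. f (js ! i) * (eps js * (\<Prod>l<r. (as ! l) (js ! l))))" by (intro sum.cong) auto
  also have "\<dots> = (\<Sum>js\<in>?P. (\<Sum>i<r. f (js ! i)) * (eps js * (\<Prod>l<r. (as ! l) (js ! l))))"
    by (subst sum.swap) (simp add: sum_distrib_right)
  also have "\<dots> = (\<Sum>s\<in>{1..r}. f s) * wedge_list (map (TrF r) as) {1..r}"
    unfolding wedge_TrF_top[OF assms] sum_distrib_left
  proof (rule sum.cong[OF refl])
    fix js assume "js \<in> ?P"
    then show "(\<Sum>i<r. f (js ! i)) * (eps js * (\<Prod>l<r. (as ! l) (js ! l))) =
      (\<Sum>s\<in>{1..r}. f s) * (eps js * (\<Prod>l<r. (as ! l) (js ! l)))" by (simp only: perm_sum)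
  qed
  finally show ?thesis by simp
qed

end

lemma TrF_decompose: "TrF r a = (\<Sum>j\<in>{1..r}. fscale (a j) (dfun (rvar j)))"
  by (rule sym, rule TrF_eqI)
    (auto intro!: one_form_sum one_form_fscale one_form_dfun simp: form_sum_apply fscale_eq rat_pd_rvar if_distrib[of "\<lambda>x. _ * x"] cong: if_cong)

text \<open>Each summand of \<open>TrF r a\<close> is closed, because its coefficient
  \<open>a j\<close> depends on the variable \<open>j\<close> alone.\<close>

lemma ext_d_TrF:
  assumes "a \<in> FF Z"
  shows "ext_d (wedge (TrF r a) \<zeta>) = - wedge (TrF r a) (ext_d \<zeta>)"
proof -
  have d: "dfun (a j) = fscale (rat_pd j (a j)) (dfun (rvar j))" for j
    by (rule one_form_eqI) (use FF_pd_other[OF assms] in \<open>auto intro!: one_form_fscale one_form_dfun simp: fscale_eq rat_pd_rvar\<close>)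
  have "ext_d (wedge (TrF r a) \<zeta>) = (\<Sum>j\<in>{1..r}. ext_d (fscale (a j) (wedge (dfun (rvar j)) \<zeta>)))"
    unfolding TrF_decompose wedge_sum_left ext_d_sum wedge_left_linear ..
  also have "\<dots> = (\<Sum>j\<in>{1..r}. - fscale (a j) (wedge (dfun (rvar j)) (ext_d \<zeta>)))"
    by (rule sum.cong[OF refl])
      (simp add: ext_d_fscale ext_d_wedge_dfun d wedge_left_linear wedge_self one_form_dfun fscale_simps fscale_neg)
  also have "\<dots> = - wedge (TrF r a) (ext_d \<zeta>)"
    unfolding TrF_decompose wedge_sum_left wedge_left_linear sum_negf ..
  finally show ?thesis .
qed

lemma ext_d_wedge_list_TrF: "(\<forall>a\<in>set as. a \<in> FF Z) \<Longrightarrow> ext_d (wedge_list (map (TrF r) as)) = 0"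
proof (induction as)
  case (Cons a as)
  then have "ext_d (wedge_list (map (TrF r) as)) = 0" by simp
  moreover have "a \<in> FF Z" using Cons.prems by simp
  ultimately show ?case by (simp add: ext_d_TrF)
qed (simp add: ext_d_one)

lemma dfun_trace:
  assumes "f \<in> FF Z"
  shows "dfun (\<Sum>s\<in>{1..r}. f s) = TrF r (\<lambda>j. rat_pd j (f j))"
proof (rule TrF_eqI[OF one_form_dfun])
  fix j
  have "(\<Sum>s\<in>{1..r}. rat_pd j (f s)) = (\<Sum>s\<in>{1..r}. if s = j then rat_pd j (f j) else 0)"
    by (rule sum.cong) (use FF_pd_other[OF assms] in auto)
  then show "dfun (\<Sum>s\<in>{1..r}. f s) {j} = (if j \<in> {1..r} then rat_pd j (f j) else 0)"
    by (simp add: rat_pd_sum)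
qed

section \<open>Cohomology classes and the top cohomology of the symmetric product\<close>

subsection \<open>Bases of the cohomology space\<close>

context
  fixes r p :: nat and Y :: "complex vec set" and \<omega> :: form
begin

lemma coh_class_cong:
  assumes "\<beta> \<in> coboundaries r Y \<omega> p"
  shows "coh_class r Y \<omega> p (\<eta> + \<beta>) = coh_class r Y \<omega> p \<eta>"
proof -
  let ?B = "coboundaries r Y \<omega> p"
  note B = coboundaries_closed[where r = r and Y = Y and \<omega> = \<omega> and p = p]
  have neg: "fscale (rconst (- 1)) \<beta> = - \<beta>" by (simp add: rconst_hom fscale_minus1)
  have "\<eta> + x \<in> (+) (\<eta> + \<beta>) ` ?B" if "x \<in> ?B" for x
  proof (rule image_eqI)
    show "\<eta> + x = \<eta> + \<beta> + (x - \<beta>)" by simp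
    show "x - \<beta> \<in> ?B" using B(2)[OF that B(3)[OF assms, of "- 1"]] unfolding neg by simp
  qed
  moreover have "\<eta> + \<beta> + x \<in> (+) \<eta> ` ?B" if "x \<in> ?B" for x
    using B(2)[OF assms that] by (intro image_eqI[of _ _ "\<beta> + x"]) (simp_all add: add.assoc)
  ultimately show ?thesis unfolding coh_class_def by blast
qed

lemma coh_class_zeroD:
  assumes "coh_class r Y \<omega> p \<eta> = \<zero>\<^bsub>cohomology r Y \<omega> p\<^esub>"
  shows "\<eta> \<in> coboundaries r Y \<omega> p"
proof -
  have "\<eta> + 0 \<in> coh_class r Y \<omega> p \<eta>" unfolding coh_class_def by (rule imageI) (rule coboundaries_closed)
  then show ?thesis unfolding assms by (simp add: cohomology_def)
qed

text \<open>The hypotheses speak of forms modulo coboundaries with an index set. Independence also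
  forces different indices to have different classes, so sums over indices become linear
  combinations over the set of classes.\<close>

theorem cohomology_basis:
  fixes W :: "'i \<Rightarrow> form"
  assumes fin: "finite I" and W: "\<And>J. J \<in> I \<Longrightarrow> W J \<in> cocycles r Y \<omega> p"
    and span: "\<And>\<eta>. \<eta> \<in> cocycles r Y \<omega> p \<Longrightarrow>
      \<exists>c. \<exists>\<beta>\<in>coboundaries r Y \<omega> p. \<eta> = (\<Sum>J\<in>I. fscale (rconst (c J)) (W J)) + \<beta>"
    and indep: "\<And>c. (\<Sum>J\<in>I. fscale (rconst (c J)) (W J)) \<in> coboundaries r Y \<omega> p \<Longrightarrow> \<forall>J\<in>I. c J = 0"
  shows "inj_on (\<lambda>J. coh_class r Y \<omega> p (W J)) I \<and>
    vectorspace.basis class_ring (cohomology r Y \<omega> p) ((\<lambda>J. coh_class r Y \<omega> p (W J)) ` I)"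
proof -
  let ?H = "cohomology r Y \<omega> p" and ?cl = "coh_class r Y \<omega> p"
  let ?B = "(\<lambda>J. ?cl (W J)) ` I"
  interpret H: vectorspace class_ring ?H by (rule vectorspace_cohomology)
  have carrier: "carrier ?H = ?cl ` cocycles r Y \<omega> p" by (simp add: cohomology_def)
  have clW: "?cl (W J) \<in> carrier ?H" if "J \<in> I" for J unfolding carrier using W[OF that] by blast
  have fs: "finsum ?H (\<lambda>J. c J \<odot>\<^bsub>?H\<^esub> ?cl (W J)) A = ?cl (\<Sum>J\<in>A. fscale (rconst (c J)) (W J))"
    if "finite A" "A \<subseteq> I" for c A
    using that
  proof (induction A rule: finite_induct)
    case empty
    then show ?case by (simp add: cohomology_simps(1))
  next
    case (insert J A)
    have "(\<lambda>J. c J \<odot>\<^bsub>?H\<^esub> ?cl (W J)) \<in> A \<rightarrow> carrier ?H" "c J \<odot>\<^bsub>?H\<^esub> ?cl (W J) \<in> carrier ?H"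
      using insert.prems clW by (auto intro!: H.smult_closed simp: class_ring_simps)
    then show ?case using insert by (simp add: cohomology_simps)
  qed
  have sc: "rconst 1 = 1" "rconst 0 = 0" by (simp_all add: rconst_simps)
  have inj: "inj_on (\<lambda>J. ?cl (W J)) I"
  proof (rule inj_onI, rule ccontr)
    fix J J' assume J: "J \<in> I" "J' \<in> I" "?cl (W J) = ?cl (W J')" "J \<noteq> J'"
    define c :: "'i \<Rightarrow> complex" where "c x = (if x = J then 1 else if x = J' then - 1 else 0)" for x
    have neg: "fscale (rconst (- 1)) (W J') = - W J'" by (simp add: rconst_hom fscale_minus1)
    have "(\<Sum>x\<in>I. fscale (rconst (c x)) (W x)) = (\<Sum>x\<in>{J, J'}. fscale (rconst (c x)) (W x))"
      by (rule sum.mono_neutral_right) (use fin J in \<open>auto simp: c_def sc fscale_simps\<close>)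
    also have "\<dots> = W J - W J'" using J(4) neg by (simp add: c_def sc fscale_simps)
    finally have eq: "(\<Sum>x\<in>I. fscale (rconst (c x)) (W x)) = W J - W J'" .
    have "W J + 0 \<in> ?cl (W J)" unfolding coh_class_def by (rule imageI) (rule coboundaries_closed)
    then obtain \<beta> where "\<beta> \<in> coboundaries r Y \<omega> p" "W J = W J' + \<beta>"
      unfolding J(3) unfolding coh_class_def by auto
    then have "W J - W J' \<in> coboundaries r Y \<omega> p" by simp
    then have "c J = 0" using indep[of c] J(1) unfolding eq by blast
    then show False by (simp add: c_def)
  qed
  have lc: "H.lincomb a ?B = ?cl (\<Sum>J\<in>I. fscale (rconst (a (?cl (W J)))) (W J))" for a
  proof -
    have mem: "(\<lambda>v. a v \<odot>\<^bsub>?H\<^esub> v) \<in> ?B \<rightarrow> carrier ?H"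
      using clW by (auto intro!: H.smult_closed simp: class_ring_simps)
    have "H.lincomb a ?B = finsum ?H (\<lambda>J. a (?cl (W J)) \<odot>\<^bsub>?H\<^esub> ?cl (W J)) I"
      unfolding H.lincomb_def by (rule H.finsum_reindex[OF mem inj])
    then show ?thesis using fs[OF fin subset_refl, of "\<lambda>J. a (?cl (W J))"] by simp
  qed
  have B: "finite ?B" "?B \<subseteq> carrier ?H" using fin clW by auto
  have "H.lin_indpt ?B"
  proof (rule H.finite_lin_indpt2[OF B])
    fix a :: "form set \<Rightarrow> complex" assume "H.lincomb a ?B = \<zero>\<^bsub>?H\<^esub>"
    then have "(\<Sum>J\<in>I. fscale (rconst (a (?cl (W J)))) (W J)) \<in> coboundaries r Y \<omega> p"
      unfolding lc by (rule coh_class_zeroD)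
    from indep[OF this] have a: "\<forall>J\<in>I. a (?cl (W J)) = 0" .
    show "\<forall>v\<in>?B. a v = \<zero>\<^bsub>class_ring\<^esub>"
    proof
      fix v assume "v \<in> ?B"
      then obtain J where "J \<in> I" "v = ?cl (W J)" by blast
      then show "a v = \<zero>\<^bsub>class_ring\<^esub>" using a by (simp only: ring.simps)
    qed
  qed
  moreover have "H.span ?B = carrier ?H"
  proof
    show "H.span ?B \<subseteq> carrier ?H" by (rule H.span_is_subset2[OF B(2)])
    show "carrier ?H \<subseteq> H.span ?B"
    proof
      fix x assume "x \<in> carrier ?H"
      then obtain \<eta> where \<eta>: "\<eta> \<in> cocycles r Y \<omega> p" "x = ?cl \<eta>" unfolding carrier by blast
      obtain c \<beta> where c: "\<beta> \<in> coboundaries r Y \<omega> p" "\<eta> = (\<Sum>J\<in>I. fscale (rconst (c J)) (W J)) + \<beta>"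
        using span[OF \<eta>(1)] by blast
      define a where "a = c \<circ> inv_into I (\<lambda>J. ?cl (W J))"
      have "a (?cl (W J)) = c J" if "J \<in> I" for J
        using inv_into_f_f[OF inj that] by (simp add: a_def)
      then have "H.lincomb a ?B = ?cl (\<Sum>J\<in>I. fscale (rconst (c J)) (W J))" unfolding lc by simp
      then have "x = H.lincomb a ?B" unfolding \<eta>(2) c(2) using coh_class_cong[OF c(1)] by simp
      then show "x \<in> H.span ?B" unfolding H.span_def using B(1) by (auto simp: class_ring_simps)
    qed
  qed
  ultimately show ?thesis unfolding H.basis_def using inj B by blast
qed

end


subsection \<open>Functionals on tensors\<close>

lemma prod_of_bool: "finite A \<Longrightarrow> (\<Prod>s\<in>A. if P s then 1 else 0 :: 'a::comm_semiring_1) = (if \<forall>s\<in>A. P s then 1 else 0)"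
  by (induction A rule: finite_induct) auto

context punctured_line
begin

text \<open>Extension by \<open>0\<close>, so that functionals on all functions \<open>complex \<Rightarrow> complex\<close> can be applied.\<close>

definition ext0 :: "(nat \<Rightarrow> ratfun) \<Rightarrow> complex \<Rightarrow> complex" where
  "ext0 f v = (if v \<in> Z then 0 else fv f v)"

lemma ext0_add: "f \<in> FF Z \<Longrightarrow> g \<in> FF Z \<Longrightarrow> ext0 (\<lambda>j. f j + g j) = (\<lambda>v. ext0 f v + ext0 g v)"
  by (auto simp: ext0_def fv_add)

lemma ext0_scale: "f \<in> FF Z \<Longrightarrow> ext0 (\<lambda>j. rconst a * f j) = (\<lambda>v. a * ext0 f v)"
  by (auto simp: ext0_def fv_scale)

lemma ev_tensor:
  fixes F :: "'i \<Rightarrow> nat \<Rightarrow> nat \<Rightarrow> ratfun" and c :: "nat \<Rightarrow> complex"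
  assumes c: "\<And>s. c s \<notin> Z" and F: "\<And>x s. x \<in> T \<Longrightarrow> F x s \<in> FF Z"
  shows "ev c (\<Sum>x\<in>T. rconst (a x) * (\<Prod>s\<in>S. F x s s)) = (\<Sum>x\<in>T. a x * (\<Prod>s\<in>S. fv (F x s) (c s)))"
proof -
  have r: "reg UNIV c (F x s s)" "ev c (F x s s) = fv (F x s) (c s)" if "x \<in> T" for x s
    using FF_reg[where c = c and j = s and V = UNIV, OF F[OF that] c] FF_ev[where c = c and j = s, OF F[OF that] c] by simp_all
  have p: "reg UNIV c (\<Prod>s\<in>S. F x s s)" "ev c (\<Prod>s\<in>S. F x s s) = (\<Prod>s\<in>S. fv (F x s) (c s))" if "x \<in> T" for x
    using ev_prod[of S UNIV c "\<lambda>s. F x s s"] r[OF that] by (auto intro: reg_prod)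
  have m: "reg UNIV c (rconst (a x) * (\<Prod>s\<in>S. F x s s))"
    "ev c (rconst (a x) * (\<Prod>s\<in>S. F x s s)) = a x * (\<Prod>s\<in>S. fv (F x s) (c s))" if "x \<in> T" for x
    using p[OF that] by (auto simp: reg_mult reg_const ev_mult[where V = UNIV])
  show ?thesis using ev_sum[of T UNIV c "\<lambda>x. rconst (a x) * (\<Prod>s\<in>S. F x s s)"] m by simp
qed

lemma tensor_functional_eq:
  fixes F :: "'i \<Rightarrow> nat \<Rightarrow> nat \<Rightarrow> ratfun" and F' :: "'k \<Rightarrow> nat \<Rightarrow> nat \<Rightarrow> ratfun"
  assumes F: "\<And>x s. x \<in> T \<Longrightarrow> F x s \<in> FF Z" and F': "\<And>x s. x \<in> T' \<Longrightarrow> F' x s \<in> FF Z"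
    and eq: "(\<Sum>x\<in>T. rconst (a x) * (\<Prod>s\<in>{1..r}. F x s s)) = (\<Sum>x\<in>T'. rconst (a' x) * (\<Prod>s\<in>{1..r}. F' x s s))"
    and \<Lambda>: "\<And>s. fun_linear (\<Lambda> s)"
  shows "(\<Sum>x\<in>T. a x * (\<Prod>s\<in>{1..r}. \<Lambda> s (ext0 (F x s)))) = (\<Sum>x\<in>T'. a' x * (\<Prod>s\<in>{1..r}. \<Lambda> s (ext0 (F' x s))))"
proof (rule tensor_functional[OF \<Lambda>])
  fix c
  show "(\<Sum>x\<in>T. a x * (\<Prod>s\<in>{1..r}. ext0 (F x s) (c s))) = (\<Sum>x\<in>T'. a' x * (\<Prod>s\<in>{1..r}. ext0 (F' x s) (c s)))"
  proof (cases "\<exists>s\<in>{1..r}. c s \<in> Z")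
    case True
    then have "(\<Prod>s\<in>{1..r}. ext0 (G s) (c s)) = 0" for G :: "nat \<Rightarrow> nat \<Rightarrow> ratfun"
      by (intro prod_zero) (auto simp: ext0_def)
    then show ?thesis by simp
  next
    case False
    obtain v0 where v0: "v0 \<notin> Z"
      using ex_new_if_finite[of Z] infinite_UNIV_char_0 by blast
    \<comment> \<open>Coordinates outside \<open>{1..r}\<close> may lie in \<open>Z\<close>; they
      are replaced because \<open>ev_tensor\<close> needs a point off the punctures in every
      coordinate.\<close>
    define c' where "c' s = (if s \<in> {1..r} then c s else v0)" for s
    have c': "c' s \<notin> Z" for s using False v0 by (auto simp: c'_def)
    have p: "(\<Prod>s\<in>{1..r}. ext0 (G s) (c s)) = (\<Prod>s\<in>{1..r}. fv (G s) (c' s))" for G :: "nat \<Rightarrow> nat \<Rightarrow> ratfun"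
      by (rule prod.cong) (use False in \<open>auto simp: ext0_def c'_def\<close>)
    show ?thesis
      unfolding p using ev_tensor[of c' T F a "{1..r}"] ev_tensor[of c' T' F' a' "{1..r}"] c' F F' eq by simp
  qed
qed

end

context twisted_line
begin

lemma DD_add: "DD (\<lambda>j. f j + g j) = (\<lambda>j. DD f j + DD g j)"
  by (rule ext) (simp add: DD_def rat_pd_add algebra_simps)

lemma DD_scale: "DD (\<lambda>j. rconst a * f j) = (\<lambda>j. rconst a * DD f j)"
  by (rule ext) (simp add: DD_def rat_pd_mult algebra_simps)

text \<open>Let \<open>V\<close> be spanned by the other functions \<phi> and the image of
  \<open>DD\<close>. Independence modulo this image says that the chosen one lies outside
  \<open>V\<close>, so a functional separates it.\<close>

lemma dual_functional:
  fixes \<phi> :: "nat \<Rightarrow> nat \<Rightarrow> ratfun" and K :: nat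
  assumes \<phi>: "\<And>b. \<phi> b \<in> FF Z" and a: "a < K"
    and indep: "\<And>c d. d \<in> FF Z \<Longrightarrow> (\<And>v. v \<notin> Z \<Longrightarrow> (\<Sum>i<K. c i * fv (\<phi> i) v) = fv (DD d) v) \<Longrightarrow> \<forall>i<K. c i = 0"
  shows "\<exists>\<Lambda>. fun_linear \<Lambda> \<and> (\<forall>b<K. \<Lambda> (ext0 (\<phi> b)) = (if b = a then 1 else 0)) \<and> (\<forall>d\<in>FF Z. \<Lambda> (ext0 (DD d)) = 0)"
proof -
  let ?B = "{..<K} - {a}"
  let ?g = "\<lambda>c d v. (\<Sum>b\<in>?B. c b * ext0 (\<phi> b) v) + ext0 (DD d) v"
  define V where "V = {f. \<exists>c. \<exists>d\<in>FF Z. f = ?g c d}"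
  have V_I: "d \<in> FF Z \<Longrightarrow> ?g c d \<in> V" for c d unfolding V_def by blast
  have z: "ext0 (DD (\<lambda>j. 0)) = (\<lambda>v. 0)"
    using ext0_scale[OF DD_FF[OF FF_zero], of 0] DD_scale[of 0 "\<lambda>j. 0"] by (simp add: rconst_simps form_apply)
  have "\<exists>\<Lambda>. fun_linear \<Lambda> \<and> \<Lambda> (ext0 (\<phi> a)) = 1 \<and> (\<forall>f\<in>V. \<Lambda> f = 0)"
  proof (rule functional_exists)
    show "(\<lambda>v. 0) \<in> V" using V_I[OF FF_zero, of "\<lambda>_. 0"] by (simp add: z form_apply)
  next
    fix f g assume "f \<in> V" "g \<in> V"
    then obtain c d c' d' where 1: "d \<in> FF Z" "d' \<in> FF Z" "f = ?g c d" "g = ?g c' d'" unfolding V_def by blast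
    have eq: "(\<lambda>v. f v + g v) = ?g (\<lambda>b. c b + c' b) (\<lambda>j. d j + d' j)"
      unfolding DD_add ext0_add[OF DD_FF[OF 1(1)] DD_FF[OF 1(2)]]
      by (simp add: 1 sum.distrib distrib_right add_ac)
    show "(\<lambda>v. f v + g v) \<in> V" unfolding eq by (rule V_I[OF FF.add[OF 1(1,2)]])
  next
    fix t f assume "f \<in> V"
    then obtain c d where 1: "d \<in> FF Z" "f = ?g c d" unfolding V_def by blast
    have eq: "(\<lambda>v. t * f v) = ?g (\<lambda>b. t * c b) (\<lambda>j. rconst t * d j)"
      unfolding DD_scale ext0_scale[OF DD_FF[OF 1(1)]]
      by (simp only: 1(2) sum_distrib_left distrib_left mult.assoc)
    show "(\<lambda>v. t * f v) \<in> V" unfolding eq by (rule V_I[OF FF_scale[OF 1(1)]])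
  next
    show "ext0 (\<phi> a) \<notin> V"
    proof
      assume "ext0 (\<phi> a) \<in> V"
      then obtain c d where 1: "d \<in> FF Z" "ext0 (\<phi> a) = ?g c d" unfolding V_def by blast
      define c' where "c' b = (if b = a then 1 else - c b)" for b
      have "(\<Sum>i<K. c' i * fv (\<phi> i) v) = fv (DD d) v" if v: "v \<notin> Z" for v
      proof -
        have "(\<Sum>i<K. c' i * fv (\<phi> i) v) = fv (\<phi> a) v + (\<Sum>b\<in>?B. - (c b * fv (\<phi> b) v))"
        proof -
          have "(\<Sum>i<K. c' i * fv (\<phi> i) v) = c' a * fv (\<phi> a) v + (\<Sum>b\<in>?B. c' b * fv (\<phi> b) v)"
            using a by (intro sum.remove) auto
          moreover have "(\<Sum>b\<in>?B. c' b * fv (\<phi> b) v) = (\<Sum>b\<in>?B. - (c b * fv (\<phi> b) v))"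
          proof (rule sum.cong[OF refl])
            fix b assume "b \<in> ?B"
            then have "c' b = - c b" by (simp add: c'_def)
            then show "c' b * fv (\<phi> b) v = - (c b * fv (\<phi> b) v)" by (simp only: mult_minus_left)
          qed
          moreover have "c' a = 1" by (simp add: c'_def)
          ultimately show ?thesis by (simp only: mult_1)
        qed
        moreover have "fv (\<phi> a) v = (\<Sum>b\<in>?B. c b * fv (\<phi> b) v) + fv (DD d) v"
          using fun_cong[OF 1(2), of v] v by (simp add: ext0_def)
        ultimately show ?thesis by (simp add: sum_negf)
      qed
      from indep[OF 1(1) this] a have "c' a = 0" by simp
      then show False by (simp add: c'_def)
    qed
  qed
  then obtain \<Lambda> where \<Lambda>: "fun_linear \<Lambda>" "\<Lambda> (ext0 (\<phi> a)) = 1" "\<forall>f\<in>V. \<Lambda> f = 0" by blast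
  have "\<Lambda> (ext0 (\<phi> b)) = 0" if b: "b < K" "b \<noteq> a" for b
  proof -
    have "?g (\<lambda>x. if x = b then 1 else 0) (\<lambda>j. 0) = ext0 (\<phi> b)"
      using b by (simp add: z form_apply if_distrib[of "\<lambda>x. x * _"] cong: if_cong)
    then show ?thesis using V_I[OF FF_zero, of "\<lambda>x. if x = b then 1 else 0"] \<Lambda>(3) by metis
  qed
  moreover have "\<Lambda> (ext0 (DD d)) = 0" if "d \<in> FF Z" for d
    using V_I[OF that, of "\<lambda>_. 0"] \<Lambda>(3) by (simp add: form_apply)
  ultimately show ?thesis using \<Lambda> by (intro exI[of _ \<Lambda>]) auto
qed

text \<open>The derivative with respect to the variable \<open>i\<close> reaches only the factor in
  position \<open>i\<close>, which thereby is replaced by its image under the one-variable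
  operator.\<close>

lemma twisted_prod:
  assumes i: "i \<in> {1..r}" and G: "\<And>s. G s \<in> FF Z"
  shows "rat_pd i (\<Prod>s\<in>{1..r}. G s s) + om i * (\<Prod>s\<in>{1..r}. G s s) = (\<Prod>s\<in>{1..r}. (if s = i then DD (G s) else G s) s)"
proof -
  let ?R = "\<Prod>s\<in>{1..r} - {i}. G s s"
  have "?R \<in> fracs ({1..r} - {i})" by (intro fracs_prod) (auto intro: FF_fracs[OF G])
  then have pd: "rat_pd i ?R = 0" by (rule rat_pd_notin) simp
  have 1: "(\<Prod>s\<in>{1..r}. G s s) = G i i * ?R" using i by (intro prod.remove) auto
  have "(\<Prod>s\<in>{1..r}. (if s = i then DD (G s) else G s) s) = DD (G i) i * (\<Prod>s\<in>{1..r} - {i}. (if s = i then DD (G s) else G s) s)"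
    using i by (subst prod.remove[of _ i]) auto
  also have "(\<Prod>s\<in>{1..r} - {i}. (if s = i then DD (G s) else G s) s) = ?R" by (rule prod.cong) auto
  finally have 2: "(\<Prod>s\<in>{1..r}. (if s = i then DD (G s) else G s) s) = DD (G i) i * ?R" .
  show ?thesis unfolding 1 2 DD_def rat_pd_mult pd by (simp add: distrib_right)
qed

end


subsection \<open>The top cohomology of the symmetric product\<close>

text \<open>The functions \<phi> form a basis of the cohomology of the line, and the forms \<Phi> on
  \<open>Y\<close> have them as traces. \<open>trace\<close> and \<open>residue\<close> provide a
  form on \<open>Y\<close> for every basis function \<open>bb p\<close>: all of them are derivatives
  of such functions except the simple poles at finite places.\<close>

locale sym_cohomology = sym_param r e0 e1 f0 f1 + generic_twisted_line q u n w
  for r e0 e1 f0 f1 q u n w +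
  fixes Y :: "complex vec set" and \<omega> :: form and K :: nat
    and \<phi> :: "nat \<Rightarrow> nat \<Rightarrow> ratfun" and \<Phi> :: "nat \<Rightarrow> form"
  assumes Y_point: "(\<And>s. c s \<notin> Z) \<Longrightarrow> vec (r + 1) (tv c) \<in> Y"
    and trace: "p \<in> II \<Longrightarrow> 0 < snd p \<Longrightarrow> \<exists>\<tau>. global_fun r Y \<tau> \<and> rsub yy \<tau> = (\<Sum>s\<in>{1..r}. bb p s)"
    and residue: "k < q \<Longrightarrow> \<exists>T\<in>Omega r Y 1. pb r yy T = TrF r (bb (k, 1))"
    and omega: "\<omega> \<in> Omega r Y 1" "pb r yy \<omega> = TrF r om"
    and phi: "\<phi> i \<in> FF Z"
    and Phi: "\<Phi> i \<in> Omega r Y 1" "pb r yy (\<Phi> i) = TrF r (\<phi> i)"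
    and phi_span: "f \<in> FF Z \<Longrightarrow> \<exists>c. \<exists>d\<in>FF Z. f = (\<lambda>j. (\<Sum>i<K. rconst (c i) * \<phi> i j) + DD d j)"
    and phi_indep: "d \<in> FF Z \<Longrightarrow> (\<And>v. v \<notin> Z \<Longrightarrow> (\<Sum>i<K. c i * fv (\<phi> i) v) = fv (DD d) v) \<Longrightarrow> \<forall>i<K. c i = 0"
    and K: "r \<le> K"
begin

abbreviation ww :: "(nat \<Rightarrow> ratfun) list \<Rightarrow> form" where "ww as \<equiv> wedge_list (map (TrF r) as)"

abbreviation JS :: "nat set set" where "JS \<equiv> {J. J \<subseteq> {..<K} \<and> card J = r}"

abbreviation sl :: "nat set \<Rightarrow> nat list" where "sl J \<equiv> sorted_list_of_set J"

lemma JS_finite: "finite JS"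
  by (rule finite_subset[of _ "Pow {..<K}"]) auto

lemma sl_props:
  assumes "J \<in> JS"
  shows "finite J" "length (sl J) = r" "set (sl J) = J" "distinct (sl J)"
proof -
  show "finite J" using assms finite_subset[of J "{..<K}"] by simp
  then show "length (sl J) = r" "set (sl J) = J" "distinct (sl J)" using assms by auto
qed

lemma pos_top: "s \<in> {1..r} \<Longrightarrow> pos [1..<Suc r] s = s - 1"
proof -
  assume "s \<in> {1..r}"
  then have "s - 1 < r" "Suc (s - 1) = s" by auto
  then show ?thesis using pos_props(3)[OF top_perm, of "s - 1"] by (simp del: upt_Suc)
qed

lemma top_perm_eqI:
  assumes js: "js \<in> permutations_of_set {1..r}" and "\<And>s. s \<in> {1..r} \<Longrightarrow> pos js s = s - 1"
  shows "js = [1..<Suc r]"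
proof (rule nth_equalityI)
  show "length js = length [1..<Suc r]" using perm_props(1)[OF js] by (simp del: upt_Suc)
  fix i assume "i < length js"
  then have i: "i < r" using perm_props(1)[OF js] by simp
  then have "pos js (i + 1) = i" using assms(2)[of "i + 1"] by simp
  then have "js ! i = i + 1" using pos_props(2)[OF js, of "i + 1"] i by simp
  then show "js ! i = [1..<Suc r] ! i" using i by (simp del: upt_Suc)
qed

definition sgn_of :: "nat list \<Rightarrow> complex" where "sgn_of js = (if eps js = 1 then 1 else - 1)"

lemma eps_eq: "eps js = rconst (sgn_of js)"
  using eps_cases[of js] by (auto simp: sgn_of_def rconst_hom)

lemma ww_top_tensor:
  assumes "length as = r"
  shows "ww as {1..r} = (\<Sum>js\<in>permutations_of_set {1..r}. rconst (sgn_of js) * (\<Prod>s\<in>{1..r}. (as ! pos js s) s))"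
  unfolding wedge_TrF_top[OF assms]
proof (rule sum.cong[OF refl])
  fix js assume js: "js \<in> permutations_of_set {1..r}"
  show "eps js * (\<Prod>i<r. (as ! i) (js ! i)) = rconst (sgn_of js) * (\<Prod>s\<in>{1..r}. (as ! pos js s) s)"
    unfolding eps_eq perm_prod[OF js, of "\<lambda>i s. (as ! i) s"] ..
qed

text \<open>
  Hence the top coefficient of a coboundary is annihilated by products of functionals that vanish on
  the image of \<open>DD\<close>.
\<close>

lemma coboundary_tensor:
  assumes \<xi>: "\<xi> \<in> Omega r Y (r - 1)"
  shows "\<exists>N a G. (\<forall>i t s. G i t s \<in> FF Z) \<and>
    (ext_d (pb r yy \<xi>) + wedge (TrF r om) (pb r yy \<xi>)) {1..r} =
    (\<Sum>x\<in>(SIGMA i:{1..r}. {..<(N i::nat)}). rconst (a x) *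
      (\<Prod>s\<in>{1..r}. (if s = fst x then DD (G (fst x) (snd x) s) else G (fst x) (snd x) s) s))"
proof -
  \<comment> \<open>The coefficient at all differentials except that of the variable
    \<open>i\<close>; its twisted derivative in this variable enters the top coefficient.\<close>
  define h where "h i = pb r yy \<xi> ({1..r} - {i})" for i
  have "h i \<in> TS r Z" for i
  proof (rule local_to_global)
    show "finite Z" by simp
    fix c :: "nat \<Rightarrow> complex" assume c: "\<And>i. c i \<notin> Z"
    show "reg {1..r} c (h i)"
      unfolding h_def
    proof (rule pb_regular)
      show "\<xi> \<in> regular_forms_at r (vec (r + 1) (tv c)) (r - 1)" by (rule OmegaD(2)[OF \<xi> Y_point[OF c]])
      show "vec (r + 1) (tv c) $ i = tv c i" if "i \<le> r" for i using that by simp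
    qed
  qed
  then have "\<forall>i. \<exists>N a G. (\<forall>t s. G t s \<in> FF Z) \<and> h i = (\<Sum>t<(N::nat). rconst (a t) * (\<Prod>s\<in>{1..r}. G t s s))"
    unfolding TS_def by blast
  from choice[OF this] obtain N where
    "\<forall>i. \<exists>a G. (\<forall>t s. G t s \<in> FF Z) \<and> h i = (\<Sum>t<(N i::nat). rconst (a t) * (\<Prod>s\<in>{1..r}. G t s s))" ..
  from choice[OF this] obtain a where
    "\<forall>i. \<exists>G. (\<forall>t s. G t s \<in> FF Z) \<and> h i = (\<Sum>t<(N i::nat). rconst (a i t) * (\<Prod>s\<in>{1..r}. G t s s))" ..
  from choice[OF this] obtain G where
    G: "\<forall>i. (\<forall>t s. G i t s \<in> FF Z) \<and> h i = (\<Sum>t<(N i::nat). rconst (a i t) * (\<Prod>s\<in>{1..r}. G i t s s))" ..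
  let ?sh = "\<lambda>i. shuffle_sign {i} ({1..r} - {i})"
  define \<sigma> :: "nat \<Rightarrow> complex" where "\<sigma> i = (if ?sh i = 1 then 1 else - 1)" for i
  have \<sigma>: "?sh i = rconst (\<sigma> i)" for i
    using shuffle_sign_cases[of "{i}" "{1..r} - {i}"] unfolding \<sigma>_def by (auto simp: rconst_hom)
  let ?P = "\<lambda>i t. \<Prod>s\<in>{1..r}. (if s = i then DD (G i t s) else G i t s) s"
  have h: "rat_pd i (h i) + om i * h i = (\<Sum>t<N i. rconst (a i t) * ?P i t)" if i: "i \<in> {1..r}" for i
  proof -
    have hi: "h i = (\<Sum>t<N i. rconst (a i t) * (\<Prod>s\<in>{1..r}. G i t s s))" using G by blast
    have "rat_pd i (h i) + om i * h i = (\<Sum>t<N i. rconst (a i t) *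
      (rat_pd i (\<Prod>s\<in>{1..r}. G i t s s) + om i * (\<Prod>s\<in>{1..r}. G i t s s)))"
      unfolding hi rat_pd_sum sum_distrib_left sum.distrib[symmetric]
      by (rule sum.cong) (simp_all only: rat_pd_mult rat_pd_rconst mult_zero_left add_0 distrib_left mult.left_commute)
    then show ?thesis using twisted_prod[OF i, of "G i _"] G by simp
  qed
  have "(ext_d (pb r yy \<xi>) + wedge (TrF r om) (pb r yy \<xi>)) {1..r} = (\<Sum>i\<in>{1..r}. ?sh i * (rat_pd i (h i) + om i * h i))"
    unfolding plus_fun_apply ext_d_def wedge_one_form[OF one_form_TrF] sum.distrib[symmetric] h_def
    by (rule sum.cong) (simp_all add: distrib_left mult.assoc)
  also have "\<dots> = (\<Sum>i\<in>{1..r}. \<Sum>t<N i. rconst (\<sigma> i * a i t) * ?P i t)"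
    by (rule sum.cong) (simp_all only: h \<sigma> sum_distrib_left rconst_hom mult.assoc)
  also have "\<dots> = (\<Sum>x\<in>(SIGMA i:{1..r}. {..<N i}). rconst (\<sigma> (fst x) * a (fst x) (snd x)) * ?P (fst x) (snd x))"
    by (subst sum.Sigma) (auto simp: case_prod_unfold)
  finally show ?thesis
    using G by (intro exI[of _ N] exI[of _ "\<lambda>x. \<sigma> (fst x) * a (fst x) (snd x)"] exI[of _ G]) blast
qed

text \<open>Evaluate both sides by the product of the functionals dual to the members of
  \<open>J0\<close>, in increasing order. Every term of the coboundary contains a factor in the
  image of \<open>DD\<close> and vanishes; on the left only the set \<open>J0\<close> with the
  identity permutation survives.\<close>

lemma top_independent:
  assumes \<xi>: "\<xi> \<in> Omega r Y (r - 1)"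
    and eq: "(\<Sum>J\<in>JS. rconst (c J) * ww (map \<phi> (sl J)) {1..r}) = (ext_d (pb r yy \<xi>) + wedge (TrF r om) (pb r yy \<xi>)) {1..r}"
    and J0: "J0 \<in> JS"
  shows "c J0 = 0"
proof -
  obtain N a G where G': "\<forall>i t s. G i t s \<in> FF Z" and
    rhs: "(ext_d (pb r yy \<xi>) + wedge (TrF r om) (pb r yy \<xi>)) {1..r} =
    (\<Sum>x\<in>(SIGMA i:{1..r}. {..<(N i::nat)}). rconst (a x) *
      (\<Prod>s\<in>{1..r}. (if s = fst x then DD (G (fst x) (snd x) s) else G (fst x) (snd x) s) s))"
    using coboundary_tensor[OF \<xi>] by (elim exE conjE)
  have G: "G i t s \<in> FF Z" for i t s using G' by blast
  let ?P = "permutations_of_set {1..r}"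
  let ?F = "\<lambda>x s. \<phi> (sl (fst x) ! pos (snd x) s)"
  have "(\<Sum>J\<in>JS. rconst (c J) * ww (map \<phi> (sl J)) {1..r}) =
    (\<Sum>J\<in>JS. \<Sum>js\<in>?P. rconst (c J * sgn_of js) * (\<Prod>s\<in>{1..r}. \<phi> (sl J ! pos js s) s))"
  proof (rule sum.cong[OF refl])
    fix J assume J: "J \<in> JS"
    have "rconst (c J) * ww (map \<phi> (sl J)) {1..r} =
      (\<Sum>js\<in>?P. rconst (c J * sgn_of js) * (\<Prod>s\<in>{1..r}. (map \<phi> (sl J) ! pos js s) s))"
      using ww_top_tensor[of "map \<phi> (sl J)"] sl_props(2)[OF J]
      by (simp only: length_map sum_distrib_left rconst_hom mult.assoc)
    also have "\<dots> = (\<Sum>js\<in>?P. rconst (c J * sgn_of js) * (\<Prod>s\<in>{1..r}. \<phi> (sl J ! pos js s) s))"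
    proof (rule sum.cong[OF refl])
      fix js assume js: "js \<in> ?P"
      have "(map \<phi> (sl J) ! pos js s) s = \<phi> (sl J ! pos js s) s" if "s \<in> {1..r}" for s
        using pos_props(1)[OF js that] sl_props(2)[OF J] by simp
      then show "rconst (c J * sgn_of js) * (\<Prod>s\<in>{1..r}. (map \<phi> (sl J) ! pos js s) s) =
        rconst (c J * sgn_of js) * (\<Prod>s\<in>{1..r}. \<phi> (sl J ! pos js s) s)" by simp
    qed
    finally show "rconst (c J) * ww (map \<phi> (sl J)) {1..r} =
      (\<Sum>js\<in>?P. rconst (c J * sgn_of js) * (\<Prod>s\<in>{1..r}. \<phi> (sl J ! pos js s) s))" .
  qed
  also have "\<dots> = (\<Sum>x\<in>JS \<times> ?P. rconst (c (fst x) * sgn_of (snd x)) * (\<Prod>s\<in>{1..r}. ?F x s s))"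
    by (simp add: sum.cartesian_product case_prod_unfold)
  finally have lhs: "(\<Sum>J\<in>JS. rconst (c J) * ww (map \<phi> (sl J)) {1..r}) =
    (\<Sum>x\<in>JS \<times> ?P. rconst (c (fst x) * sgn_of (snd x)) * (\<Prod>s\<in>{1..r}. ?F x s s))" .
  have "\<forall>b. \<exists>\<Lambda>. b < K \<longrightarrow> fun_linear \<Lambda> \<and> (\<forall>b'<K. \<Lambda> (ext0 (\<phi> b')) = (if b' = b then 1 else 0)) \<and> (\<forall>d\<in>FF Z. \<Lambda> (ext0 (DD d)) = 0)"
  proof
    fix b
    show "\<exists>\<Lambda>. b < K \<longrightarrow> fun_linear \<Lambda> \<and> (\<forall>b'<K. \<Lambda> (ext0 (\<phi> b')) = (if b' = b then 1 else 0)) \<and> (\<forall>d\<in>FF Z. \<Lambda> (ext0 (DD d)) = 0)"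
    proof (cases "b < K")
      case True
      show ?thesis using dual_functional[OF phi True phi_indep] by simp
    qed simp
  qed
  from choice[OF this] obtain \<Lambda> where
    \<Lambda>: "\<forall>b. b < K \<longrightarrow> fun_linear (\<Lambda> b) \<and> (\<forall>b'<K. \<Lambda> b (ext0 (\<phi> b')) = (if b' = b then 1 else 0)) \<and> (\<forall>d\<in>FF Z. \<Lambda> b (ext0 (DD d)) = 0)" ..
  have slK: "sl J ! i < K" if "J \<in> JS" "i < r" for J i
    using nth_mem[of i "sl J"] sl_props[OF that(1)] that by auto
  \<comment> \<open>Outside \<open>{1..r}\<close> the evaluation at 0 serves as a linear default
    value.\<close>
  define \<Lambda>' where "\<Lambda>' s = (if s \<in> {1..r} then \<Lambda> (sl J0 ! (s - 1)) else (\<lambda>f. f 0))" for s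
  have J0K: "sl J0 ! (s - 1) < K" if "s \<in> {1..r}" for s using slK[OF J0, of "s - 1"] that by auto
  have lin: "fun_linear (\<Lambda>' s)" for s
    using \<Lambda> J0K[of s] by (auto simp: \<Lambda>'_def fun_linear_def)
  have "(\<Sum>x\<in>JS \<times> ?P. (c (fst x) * sgn_of (snd x)) * (\<Prod>s\<in>{1..r}. \<Lambda>' s (ext0 (?F x s)))) =
    (\<Sum>x\<in>(SIGMA i:{1..r}. {..<N i}). a x *
      (\<Prod>s\<in>{1..r}. \<Lambda>' s (ext0 (if s = fst x then DD (G (fst x) (snd x) s) else G (fst x) (snd x) s))))"
    by (rule tensor_functional_eq[OF _ _ _ lin]) (use eq lhs rhs phi G DD_FF in auto)
  also have "\<dots> = 0"
  proof (rule sum.neutral, rule ballI)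
    fix x assume x: "x \<in> (SIGMA i:{1..r}. {..<N i})"
    then have i: "fst x \<in> {1..r}" by auto
    have "\<Lambda>' (fst x) (ext0 (DD (G (fst x) (snd x) (fst x)))) = 0"
      using \<Lambda> J0K[OF i] G i by (simp add: \<Lambda>'_def)
    then have "(\<Prod>s\<in>{1..r}. \<Lambda>' s (ext0 (if s = fst x then DD (G (fst x) (snd x) s) else G (fst x) (snd x) s))) = 0"
      using i by (intro prod_zero) (auto intro!: bexI[of _ "fst x"])
    then show "a x * (\<Prod>s\<in>{1..r}. \<Lambda>' s (ext0 (if s = fst x then DD (G (fst x) (snd x) s) else G (fst x) (snd x) s))) = 0"
      by simp
  qed
  finally have zero: "(\<Sum>x\<in>JS \<times> ?P. (c (fst x) * sgn_of (snd x)) * (\<Prod>s\<in>{1..r}. \<Lambda>' s (ext0 (?F x s)))) = 0" .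
  have "(\<Prod>s\<in>{1..r}. \<Lambda>' s (ext0 (?F x s))) = (if x = (J0, [1..<Suc r]) then 1 else 0)" if x: "x \<in> JS \<times> ?P" for x
  proof -
    obtain J js where x': "x = (J, js)" "J \<in> JS" "js \<in> ?P" using x by auto
    have "(\<Prod>s\<in>{1..r}. \<Lambda>' s (ext0 (?F x s))) = (\<Prod>s\<in>{1..r}. if sl J ! pos js s = sl J0 ! (s - 1) then 1 else 0)"
    proof (rule prod.cong[OF refl])
      fix s assume s: "s \<in> {1..r}"
      show "\<Lambda>' s (ext0 (?F x s)) = (if sl J ! pos js s = sl J0 ! (s - 1) then 1 else 0)"
        using s \<Lambda> J0K[OF s] slK[OF x'(2) pos_props(1)[OF x'(3) s]] by (simp add: \<Lambda>'_def x'(1))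
    qed
    also have "\<dots> = (if \<forall>s\<in>{1..r}. sl J ! pos js s = sl J0 ! (s - 1) then 1 else 0)"
      by (rule prod_of_bool) simp
    also have "(\<forall>s\<in>{1..r}. sl J ! pos js s = sl J0 ! (s - 1)) \<longleftrightarrow> x = (J0, [1..<Suc r])"
    \<comment> \<open>If all factors are 1, every member of \<open>J0\<close> occurs in
      \<open>J\<close>; equal cardinalities give equality, and distinctness of the enumeration fixes
      the permutation.\<close>
    proof
      assume *: "\<forall>s\<in>{1..r}. sl J ! pos js s = sl J0 ! (s - 1)"
      have "J0 \<subseteq> J"
      proof
        fix b assume "b \<in> J0"
        then obtain i where i: "i < r" "b = sl J0 ! i" using sl_props[OF J0] by (metis in_set_conv_nth)
        then have "i + 1 \<in> {1..r}" by simp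
        with * have "sl J ! pos js (i + 1) = b" using i by fastforce
        then show "b \<in> J" using pos_props(1)[OF x'(3) \<open>i + 1 \<in> _\<close>] sl_props[OF x'(2)] nth_mem by metis
      qed
      then have J: "J = J0" using card_subset_eq[of J J0] sl_props(1)[OF x'(2)] J0 x'(2) by simp
      have "pos js s = s - 1" if s: "s \<in> {1..r}" for s
      proof -
        have "s - 1 < r" using s by auto
        then show ?thesis
          using * s nth_eq_iff_index_eq[OF sl_props(4)[OF J0], of "pos js s" "s - 1"] pos_props(1)[OF x'(3) s] sl_props(2)[OF J0]
          unfolding J by auto
      qed
      from top_perm_eqI[OF x'(3) this] show "x = (J0, [1..<Suc r])" unfolding x'(1) J by simp
    next
      assume "x = (J0, [1..<Suc r])"
      then show "\<forall>s\<in>{1..r}. sl J ! pos js s = sl J0 ! (s - 1)" using pos_top unfolding x'(1) by (simp del: upt_Suc)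
    qed
    finally show ?thesis .
  qed
  then have "(\<Sum>x\<in>JS \<times> ?P. (c (fst x) * sgn_of (snd x)) * (\<Prod>s\<in>{1..r}. \<Lambda>' s (ext0 (?F x s)))) =
    (\<Sum>x\<in>JS \<times> ?P. if x = (J0, [1..<Suc r]) then c J0 * sgn_of [1..<Suc r] else 0)"
    by (intro sum.cong[OF refl]) (auto simp del: upt_Suc)
  also have "\<dots> = c J0 * sgn_of [1..<Suc r]"
    using J0 top_perm JS_finite by (simp del: upt_Suc)
  also have "sgn_of [1..<Suc r] = 1"
    using eps_sorted[of "[1..<Suc r]"] by (simp add: sgn_of_def del: upt_Suc)
  finally show ?thesis using zero by simp
qed

end

lemma TrF_fscale: "fscale (rconst a) (TrF r g) = TrF r (\<lambda>j. rconst a * g j)"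
  by (rule TrF_eqI) (auto intro!: one_form_fscale one_form_TrF simp: fscale_eq)

lemma TrF_add: "TrF r (\<lambda>j. g j + h j) = TrF r g + TrF r h"
  by (rule sym, rule TrF_eqI) (auto intro!: one_form_add one_form_TrF simp: plus_fun_apply)

lemma Omega_ext_d:
  assumes "\<eta> \<in> Omega r Y p"
  shows "ext_d \<eta> \<in> Omega r Y (Suc p)"
proof (rule OmegaI)
  show "ext_d \<eta> \<in> rational_forms r (Suc p)" by (rule rational_forms_ext_d[OF OmegaD(1)[OF assms]])
  fix q assume "q \<in> Y"
  with assms have "\<eta> \<in> regular_forms_at r q p" by (rule OmegaD(2))
  then obtain n g fs where \<eta>: "\<eta> = (\<Sum>s<n. fscale (g s) (wedge_list (map dfun (fs s))))"
    "\<forall>s<(n::nat). g s \<in> local_ring r q \<and> length (fs s) = p \<and> set (fs s) \<subseteq> local_ring r q"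
    unfolding regular_forms_at_def by blast
  have "ext_d (wedge_list (map dfun xs)) = 0" for xs using ext_d_wedge_list_dfun[of "\<lambda>x. x" xs] by simp
  then have "ext_d (fscale (g s) (wedge_list (map dfun (fs s)))) = fscale (rconst 1) (wedge_list (map dfun (g s # fs s)))" for s
    by (simp add: ext_d_fscale fscale_simps rconst_simps)
  then have "ext_d \<eta> = (\<Sum>s<n. fscale (rconst 1) (wedge_list (map dfun (g s # fs s))))"
    unfolding \<eta>(1) ext_d_sum by (simp only:)
  also have "\<dots> \<in> regular_forms_at r q (Suc p)"
  proof (rule regular_forms_at_sum)
    fix s assume "s \<in> {..<n}"
    then show "fscale (rconst 1) (wedge_list (map dfun (g s # fs s))) \<in> regular_forms_at r q (Suc p)"
      using \<eta>(2) regular_forms_at_single[OF local_ring_const, of "g s # fs s" r q 1] by simp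
  qed
  finally show "ext_d \<eta> \<in> regular_forms_at r q (Suc p)" .
qed

context punctured_line
begin

text \<open>All powers have primitives of the same kind except the exponent -1; these simple poles
  are covered by logarithmic forms.\<close>

lemma bb_primitive:
  assumes "p \<in> II" "\<not> (fst p < q \<and> snd p = 1)"
  shows "\<exists>a h. h \<in> FF Z \<and> bb p = (\<lambda>j. rconst a * rat_pd j (h j))"
proof -
  obtain k m where p: "p = (k, m)" by (cases p)
  show ?thesis
  proof (cases "k < q")
    case True
    with assms p obtain m' where m: "m = m' + 1" "m' \<noteq> 0" unfolding II_def
      by (cases m) auto
    have "1 / of_nat m' * of_nat m' = (1 :: complex)" using m(2) by simp
    then have "- (1 / of_nat m') * - of_nat m' = (1 :: complex)" by (simp only: minus_mult_minus)
    then have "bb p j = rconst (- (1 / of_nat m')) * rat_pd j (bb (k, m') j)" for j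
      using rat_pd_bb(1)[OF True, of j m'] p m(1)
      by (simp only: mult.assoc[symmetric] rconst_hom(4)[symmetric] rconst_hom(2) mult_1)
    then show ?thesis using bb_FF[of "(k, m')"] by (intro exI[of _ "- (1 / of_nat m')"] exI[of _ "bb (k, m')"]) auto
  next
    case False
    then have k: "k = q" using assms p by (auto simp: II_def)
    have nz: "(of_nat (m + 1) :: complex) \<noteq> 0" by (simp only: of_nat_eq_0_iff)
    have "bb p j = rconst (1 / of_nat (m + 1)) * rat_pd j (bb (q, m + 1) j)" for j
      using nz unfolding rat_pd_bb(2) p k mult.assoc[symmetric] rconst_hom(4)[symmetric]
      by (simp add: rconst_hom(2) del: of_nat_add of_nat_Suc)
    then show ?thesis using bb_FF[of "(q, m + 1)"] by (intro exI[of _ "1 / of_nat (m + 1)"] exI[of _ "bb (q, m + 1)"]) auto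
  qed
qed

end

context sym_cohomology
begin

lemma trace_fun:
  assumes "f \<in> FF Z"
  shows "\<exists>\<tau>. global_fun r Y \<tau> \<and> rsub yy \<tau> = (\<Sum>s\<in>{1..r}. f s)"
proof -
  have "\<exists>\<tau>. global_fun r Y \<tau> \<and> rsub yy \<tau> = (\<Sum>s\<in>{1..r}. bb p s)" if p: "p \<in> II" for p
  proof (cases "snd p = 0")
    case True
    then have "bb p s = 1" for s by (simp add: bb_def)
    then have "(\<Sum>s\<in>{1..r}. bb p s) = rconst (of_nat r)" by (simp add: rconst_hom)
    moreover have "global_fun r Y (rconst (of_nat r))"
      unfolding global_fun_def by (auto intro!: fracs_closed local_ring_const)
    ultimately show ?thesis using yy.rsub_rconst by metis
  next
    case False
    then show ?thesis by (intro trace p) simp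
  qed
  then have "\<forall>p. \<exists>\<tau>. p \<in> II \<longrightarrow> global_fun r Y \<tau> \<and> rsub yy \<tau> = (\<Sum>s\<in>{1..r}. bb p s)" by blast
  from choice[OF this] obtain \<tau> where
    \<tau>: "\<forall>p. p \<in> II \<longrightarrow> global_fun r Y (\<tau> p) \<and> rsub yy (\<tau> p) = (\<Sum>s\<in>{1..r}. bb p s)" ..
  obtain T c where T: "finite T" "T \<subseteq> II" and f: "f = (\<lambda>j. \<Sum>p\<in>T. rconst (c p) * bb p j)"
    using assms unfolding FF_eq cs_def by blast
  have "global_fun r Y (\<Sum>p\<in>T. rconst (c p) * \<tau> p)"
    using T(2) \<tau> by (intro global_fun_sum_const) auto
  moreover have "rsub yy (\<Sum>p\<in>T. rconst (c p) * \<tau> p) = (\<Sum>p\<in>T. rconst (c p) * (\<Sum>s\<in>{1..r}. bb p s))"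
    using T(2) \<tau> by (auto simp: yy.rsub_hom intro!: sum.cong)
  moreover have "\<dots> = (\<Sum>s\<in>{1..r}. f s)"
    unfolding f sum_distrib_left by (rule sum.swap)
  ultimately show ?thesis by auto
qed

definition tau :: "(nat \<Rightarrow> ratfun) \<Rightarrow> ratfun" where
  "tau f = (SOME \<tau>. global_fun r Y \<tau> \<and> rsub yy \<tau> = (\<Sum>s\<in>{1..r}. f s))"

lemma tau: "f \<in> FF Z \<Longrightarrow> global_fun r Y (tau f)" "f \<in> FF Z \<Longrightarrow> rsub yy (tau f) = (\<Sum>s\<in>{1..r}. f s)"
  using someI_ex[OF trace_fun, of f] unfolding tau_def by blast+

lemma pb_fscale_const: "pb r yy (fscale (rconst a) \<eta>) = fscale (rconst a) (pb r yy \<eta>)"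
  by (simp add: yy.pb_fscale)

lemma trace_form:
  assumes "f \<in> FF Z"
  shows "\<exists>T. T \<in> Omega r Y 1 \<and> pb r yy T = TrF r f"
proof -
  have "\<exists>T. T \<in> Omega r Y 1 \<and> pb r yy T = TrF r (bb p)" if p: "p \<in> II" for p
  proof (cases "fst p < q \<and> snd p = 1")
    case True
    then show ?thesis using residue[of "fst p"] by (metis prod.collapse)
  next
    case False
    obtain a h where h: "h \<in> FF Z" "bb p = (\<lambda>j. rconst a * rat_pd j (h j))"
      using bb_primitive[OF p False] by blast
    have "fscale (rconst a) (dfun (tau h)) \<in> Omega r Y 1"
      by (intro Omega_closed(3) Omega_dfun tau(1) h(1))
    moreover have "pb r yy (fscale (rconst a) (dfun (tau h))) = TrF r (bb p)"
      using tau(1)[OF h(1)] unfolding global_fun_def h(2)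
      by (simp add: pb_fscale_const yy.pb_dfun tau(2)[OF h(1)] dfun_trace[OF h(1)] TrF_fscale)
    ultimately show ?thesis by blast
  qed
  then have "\<forall>p. \<exists>T. p \<in> II \<longrightarrow> T \<in> Omega r Y 1 \<and> pb r yy T = TrF r (bb p)" by blast
  from choice[OF this] obtain t where
    t: "\<forall>p. p \<in> II \<longrightarrow> t p \<in> Omega r Y 1 \<and> pb r yy (t p) = TrF r (bb p)" ..
  obtain T c where T: "finite T" "T \<subseteq> II" and f: "f = (\<lambda>j. \<Sum>p\<in>T. rconst (c p) * bb p j)"
    using assms unfolding FF_eq cs_def by blast
  have "(\<Sum>p\<in>T. fscale (rconst (c p)) (t p)) \<in> Omega r Y 1"
    using T(2) t by (intro Omega_sum Omega_closed(3)) auto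
  moreover have "pb r yy (\<Sum>p\<in>T. fscale (rconst (c p)) (t p)) = TrF r f"
    unfolding f TrF_lincomb[symmetric] yy.pb_sum pb_fscale_const
    by (rule sum.cong) (use T(2) t in auto)
  ultimately show ?thesis by blast
qed

definition Tf :: "(nat \<Rightarrow> ratfun) \<Rightarrow> form" where
  "Tf f = (SOME T. T \<in> Omega r Y 1 \<and> pb r yy T = TrF r f)"

lemma Tf: "f \<in> FF Z \<Longrightarrow> Tf f \<in> Omega r Y 1" "f \<in> FF Z \<Longrightarrow> pb r yy (Tf f) = TrF r f"
  using someI_ex[OF trace_form, of f] unfolding Tf_def by blast+

abbreviation WL :: "(nat \<Rightarrow> ratfun) list \<Rightarrow> form" where "WL as \<equiv> wedge_list (map Tf as)"

lemma WL:
  assumes "\<forall>a\<in>set as. a \<in> FF Z"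
  shows "WL as \<in> Omega r Y (length as)" "pb r yy (WL as) = ww as"
proof -
  show "WL as \<in> Omega r Y (length as)"
    using Omega_wedge_list[of "map Tf as" r Y] assms Tf(1) by simp
  have "pb r yy (WL as) = wedge_list (map (pb r yy) (map Tf as))"
    by (rule yy.pb_wedge_list) (use assms in \<open>auto intro!: rational_forms_supported[OF OmegaD(1)[OF Tf(1)]]\<close>)
  also have "map (pb r yy) (map Tf as) = map (TrF r) as" using assms Tf(2) by simp
  finally show "pb r yy (WL as) = ww as" .
qed

lemma Omega_zero: "0 \<in> Omega r Y p"
  by (rule Omega_closed(1))

text \<open>The independence statement with coboundary 0 shows that a product of \<open>r\<close>
  traces has a nonzero pullback; this needs \<open>r \<le> K\<close>. It replaces the computation of
  the Jacobian.\<close>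

lemma top_form_exists: "\<exists>\<zeta>\<in>rational_forms r r. pb r yy \<zeta> {1..r} \<noteq> 0"
proof -
  have J: "{..<r} \<in> JS" using K by auto
  let ?as = "map \<phi> (sl {..<r})"
  have "ww ?as {1..r} \<noteq> 0"
  proof
    assume 0: "ww ?as {1..r} = 0"
    have "(\<Sum>J\<in>JS. rconst (if J = {..<r} then 1 else 0) * ww (map \<phi> (sl J)) {1..r}) = 0"
      using 0 by (intro sum.neutral) (auto simp: rconst_simps)
    moreover have "(ext_d (pb r yy 0) + wedge (TrF r om) (pb r yy 0)) {1..r} = 0"
      by (simp add: yy.pb_zero zero_fun_apply)
    ultimately have "(if {..<r} = {..<r} then 1 else 0 :: complex) = 0"
      using top_independent[OF Omega_zero _ J, of "\<lambda>J. if J = {..<r} then 1 else 0"] by simp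
    then show False by simp
  qed
  moreover have "WL ?as \<in> rational_forms r r" "pb r yy (WL ?as) = ww ?as"
    using WL[of ?as] phi sl_props(2)[OF J] OmegaD(1)[of "WL ?as" r Y r] by auto
  ultimately show ?thesis by metis
qed

text \<open>From here on, identities between top forms on \<open>Y\<close> are checked on the single
  top coefficient of their pullbacks.\<close>

lemma top_unique:
  assumes "\<eta> \<in> Omega r Y r" "\<zeta> \<in> Omega r Y r" "pb r yy \<eta> {1..r} = pb r yy \<zeta> {1..r}"
  shows "\<eta> = \<zeta>"
proof -
  obtain \<theta> where \<theta>: "\<theta> \<in> rational_forms r r" "pb r yy \<theta> {1..r} \<noteq> 0" using top_form_exists by blast
  have "\<eta> = (\<eta> - \<zeta>) + \<zeta>" by simp
  from arg_cong[OF this, of "pb r yy"] have "pb r yy \<eta> = pb r yy (\<eta> - \<zeta>) + pb r yy \<zeta>"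
    by (simp only: yy.pb_add)
  then have "pb r yy (\<eta> - \<zeta>) {1..r} = 0" using assms(3) by (simp add: plus_fun_apply)
  moreover have "\<eta> - \<zeta> \<in> rational_forms r r" by (rule OmegaD(1)[OF Omega_diff[OF assms(1,2)]])
  ultimately have "\<eta> - \<zeta> = 0" using pb_top_inj[OF \<theta>] by blast
  then show ?thesis by simp
qed

lemma ww_lincomb:
  "ww (as @ (\<lambda>j. (\<Sum>i\<in>A. rconst (c i) * g i j) + h j) # bs) =
    (\<Sum>i\<in>A. fscale (rconst (c i)) (ww (as @ g i # bs))) + ww (as @ h # bs)"
  by (simp only: TrF_add TrF_lincomb[symmetric] map_append list.map wedge_list_append wedge_list_simps
      wedge_left_linear wedge_sum_left wedge_linear wedge_sum_right)

lemma ww_add: "ww ((\<lambda>j. g j + h j) # bs) = ww (g # bs) + ww (h # bs)"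
  by (simp only: TrF_add list.map wedge_list_simps wedge_left_linear)

lemma pb_nabla:
  assumes "\<xi> \<in> Omega r Y p"
  shows "pb r yy (nabla \<omega> \<xi>) = ext_d (pb r yy \<xi>) + wedge (TrF r om) (pb r yy \<xi>)"
  unfolding nabla_def yy.pb_add yy.pb_ext_d[OF OmegaD(1)[OF assms]]
  using yy.pb_wedge[OF rational_forms_supported[OF OmegaD(1)[OF omega(1)]] rational_forms_supported[OF OmegaD(1)[OF assms]]]
  by (simp only: omega(2))


text \<open>
  The primitive is the trace of \<open>f\<close> times the product of the \<open>as\<close>, corrected by the products in which
  one factor is multiplied by \<open>f\<close>; \<open>trace_identity\<close> makes the superfluous terms cancel.
\<close>

lemma coboundary_DD:
  assumes f: "f \<in> FF Z" and as: "\<forall>a\<in>set as. a \<in> FF Z" "length as = r - 1"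
  shows "WL (DD f # as) \<in> nabla \<omega> ` Omega r Y (r - 1)"
proof -
  define b where "b i = as[i := (\<lambda>j. f j * (as ! i) j)]" for i
  have b: "\<forall>a\<in>set (b i). a \<in> FF Z" "length (b i) = r - 1" if "i < r - 1" for i
  proof -
    have "as ! i \<in> FF Z" using as that by simp
    then show "\<forall>a\<in>set (b i). a \<in> FF Z" using as(1) FF.mult[OF f] set_update_subset_insert[of as i]
      unfolding b_def by blast
    show "length (b i) = r - 1" using as(2) by (simp add: b_def)
  qed
  define S where "S = fscale (tau f) (WL as) - (\<Sum>i<r - 1. WL (b i))"
  have S_Om: "S \<in> Omega r Y (r - 1)"
    unfolding S_def using WL(1)[OF as(1)] as(2) WL(1)[OF b(1)] b(2)
    by (intro Omega_diff Omega_fscale tau(1) f Omega_sum) auto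
  have "pb r yy (fscale (tau f) (WL as)) = pb r yy S + pb r yy (\<Sum>i<r - 1. WL (b i))"
    unfolding yy.pb_add[symmetric] S_def by simp
  then have "pb r yy S = fscale (\<Sum>s\<in>{1..r}. f s) (ww as) - (\<Sum>i<r - 1. ww (b i))"
    using WL(2)[OF b(1)] by (simp add: yy.pb_fscale yy.pb_sum tau(2)[OF f] WL(2)[OF as(1)])
  moreover have "ext_d (\<eta> - \<zeta>) = ext_d \<eta> - ext_d \<zeta>" for \<eta> \<zeta>
    using ext_d_add[of "\<eta> - \<zeta>" \<zeta>] by simp
  moreover have "ext_d (\<Sum>i<r - 1. ww (b i)) = 0"
    unfolding ext_d_sum using ext_d_wedge_list_TrF[OF b(1)] by (intro sum.neutral) simp
  moreover have "ext_d (ww as) = 0" by (rule ext_d_wedge_list_TrF[OF as(1)])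
  ultimately have pbS: "pb r yy S = fscale (\<Sum>s\<in>{1..r}. f s) (ww as) - (\<Sum>i<r - 1. ww (b i))"
    "ext_d (pb r yy S) = ww ((\<lambda>j. rat_pd j (f j)) # as)"
    by (simp_all add: ext_d_fscale fscale_simps dfun_trace[OF f])
  \<comment> \<open>The list \<open>om # as\<close> has \<open>r\<close> entries. Its first position
    yields the term with \<open>f\<close> times \<open>om\<close> that belongs to
    \<open>DD f\<close>; the other positions yield exactly the corrections subtracted in
    \<open>S\<close>.\<close>
  have "ww (om # as) {1..r} * (\<Sum>s\<in>{1..r}. f s) =
    (\<Sum>i<Suc (r - 1). ww ((om # as)[i := (\<lambda>j. f j * ((om # as) ! i) j)]) {1..r})"
    using trace_identity[of "om # as" f] as(2) r_pos by (simp only: list.size) (simp add: mult.commute)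
  also have "\<dots> = ww ((\<lambda>j. f j * om j) # as) {1..r} + (\<Sum>i<r - 1. ww (om # b i) {1..r})"
    by (subst sum.lessThan_Suc_shift) (simp add: b_def)
  finally have tr: "(\<Sum>s\<in>{1..r}. f s) * ww (om # as) {1..r} =
    ww ((\<lambda>j. f j * om j) # as) {1..r} + (\<Sum>i<r - 1. ww (om # b i) {1..r})"
    by (simp only: mult.commute)
  have "wedge (TrF r om) (pb r yy S) = fscale (\<Sum>s\<in>{1..r}. f s) (ww (om # as)) - (\<Sum>i<r - 1. ww (om # b i))"
    unfolding pbS(1) wedge_diff wedge_linear wedge_sum_right by simp
  then have "wedge (TrF r om) (pb r yy S) {1..r} =
    (\<Sum>s\<in>{1..r}. f s) * ww (om # as) {1..r} - (\<Sum>i<r - 1. ww (om # b i) {1..r})"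
    by (simp only: minus_apply fscale_eq form_sum_apply)
  then have "wedge (TrF r om) (pb r yy S) {1..r} = ww ((\<lambda>j. f j * om j) # as) {1..r}"
    unfolding tr by simp
  moreover have "ww (DD f # as) = ww ((\<lambda>j. rat_pd j (f j)) # as) + ww ((\<lambda>j. f j * om j) # as)"
    unfolding ww_add[symmetric] DD_def[abs_def] by (simp only: mult.commute)
  ultimately have top: "pb r yy (WL (DD f # as)) {1..r} = pb r yy (nabla \<omega> S) {1..r}"
    using WL(2)[of "DD f # as"] as(1) DD_FF[OF f] unfolding pb_nabla[OF S_Om] pbS(2) by (simp add: plus_fun_apply)
  have "nabla \<omega> S \<in> Omega r Y r"
  proof -
    have "nabla \<omega> S \<in> Omega r Y (Suc (r - 1))"
      unfolding nabla_def
      by (intro Omega_closed(2) Omega_ext_d S_Om) (use Omega_wedge[OF omega(1) S_Om] in \<open>simp add: plus_1_eq_Suc\<close>)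
    then show ?thesis using r_pos by simp
  qed
  moreover have "WL (DD f # as) \<in> Omega r Y r"
    using WL(1)[of "DD f # as"] as DD_FF[OF f] r_pos by simp
  ultimately have "WL (DD f # as) = nabla \<omega> S" by (intro top_unique top)
  then show ?thesis using S_Om by blast
qed


definition Gd :: "form set" where
  "Gd = {\<eta>. \<exists>c. \<exists>\<beta>\<in>coboundaries r Y \<omega> r. \<eta> = (\<Sum>J\<in>JS. fscale (rconst (c J)) (EE \<Phi> J)) + \<beta>}"

lemma coboundaries_eq: "coboundaries r Y \<omega> r = nabla \<omega> ` Omega r Y (r - 1)"
  using r_pos by (auto simp: coboundaries_def split: nat.splits)

lemma Gd_coboundary:
  assumes "\<beta> \<in> coboundaries r Y \<omega> r"
  shows "\<beta> \<in> Gd"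
proof -
  have "\<beta> = (\<Sum>J\<in>JS. fscale (rconst 0) (EE \<Phi> J)) + \<beta>" by (simp add: rconst_simps fscale_simps)
  then show ?thesis unfolding Gd_def using assms by (intro CollectI exI[of _ "\<lambda>_. 0"] bexI[of _ \<beta>])
qed

lemma Gd_add:
  assumes "\<eta> \<in> Gd" "\<zeta> \<in> Gd"
  shows "\<eta> + \<zeta> \<in> Gd"
proof -
  obtain c \<beta> c' \<beta>' where 1: "\<beta> \<in> coboundaries r Y \<omega> r" "\<beta>' \<in> coboundaries r Y \<omega> r"
    "\<eta> = (\<Sum>J\<in>JS. fscale (rconst (c J)) (EE \<Phi> J)) + \<beta>" "\<zeta> = (\<Sum>J\<in>JS. fscale (rconst (c' J)) (EE \<Phi> J)) + \<beta>'"
    using assms unfolding Gd_def by blast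
  have "\<eta> + \<zeta> = (\<Sum>J\<in>JS. fscale (rconst (c J + c' J)) (EE \<Phi> J)) + (\<beta> + \<beta>')"
    unfolding 1(3,4) rconst_hom fscale_simps(2) sum.distrib by (simp only: add_ac)
  then show ?thesis unfolding Gd_def using coboundaries_closed(2)[OF 1(1,2)]
    by (intro CollectI exI[of _ "\<lambda>J. c J + c' J"] bexI[of _ "\<beta> + \<beta>'"])
qed

lemma Gd_scale:
  assumes "\<eta> \<in> Gd"
  shows "fscale (rconst a) \<eta> \<in> Gd"
proof -
  obtain c \<beta> where 1: "\<beta> \<in> coboundaries r Y \<omega> r" "\<eta> = (\<Sum>J\<in>JS. fscale (rconst (c J)) (EE \<Phi> J)) + \<beta>"
    using assms unfolding Gd_def by blast
  have "fscale (rconst a) \<eta> = (\<Sum>J\<in>JS. fscale (rconst (a * c J)) (EE \<Phi> J)) + fscale (rconst a) \<beta>"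
    unfolding 1(2) fscale_simps(1) fscale_sum rconst_hom fscale_simps(3) ..
  then show ?thesis unfolding Gd_def using coboundaries_closed(3)[OF 1(1), of a]
    by (intro CollectI exI[of _ "\<lambda>J. a * c J"] bexI[of _ "fscale (rconst a) \<beta>"])
qed

lemma Gd_sum: "(\<And>i. i \<in> A \<Longrightarrow> h i \<in> Gd) \<Longrightarrow> sum h A \<in> Gd"
proof (induction A rule: infinite_finite_induct)
  case (insert i A)
  then show ?case using Gd_add[of "h i" "sum h A"] by simp
qed (simp_all add: Gd_coboundary coboundaries_closed(1))

lemma Gd_EE:
  assumes "J \<in> JS"
  shows "EE \<Phi> J \<in> Gd"
proof -
  have "(\<Sum>J'\<in>JS. fscale (rconst (if J' = J then 1 else 0)) (EE \<Phi> J')) = (\<Sum>J'\<in>JS. if J' = J then EE \<Phi> J else 0)"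
    by (rule sum.cong) (auto simp: rconst_simps fscale_simps)
  also have "\<dots> = EE \<Phi> J" using assms JS_finite by simp
  finally have "EE \<Phi> J = (\<Sum>J'\<in>JS. fscale (rconst (if J' = J then 1 else 0)) (EE \<Phi> J')) + 0" by simp
  then show ?thesis unfolding Gd_def using coboundaries_closed(1)
    by (intro CollectI exI[of _ "\<lambda>J'. if J' = J then 1 else 0"] bexI[of _ "0"])
qed

lemma one_form_Phi: "one_form (\<Phi> i)"
  by (rule rational_forms_one_form[OF OmegaD(1)[OF Phi(1)]])

lemma pb_wedge_Phi: "pb r yy (wedge_list (map \<Phi> js)) = ww (map \<phi> js)"
proof -
  have "pb r yy (wedge_list (map \<Phi> js)) = wedge_list (map (pb r yy) (map \<Phi> js))"
    by (rule yy.pb_wedge_list) (auto intro!: rational_forms_supported[OF OmegaD(1)[OF Phi(1)]])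
  then show ?thesis by (simp add: Phi(2) comp_def)
qed

lemma Omega_wedge_Phi: "length js = r \<Longrightarrow> wedge_list (map \<Phi> js) \<in> Omega r Y r"
  using Omega_wedge_list[of "map \<Phi> js" r Y] Phi(1) by auto

text \<open>The factors are exchanged one at a time: \<open>js\<close> lists those already replaced
  by some \<phi>. The rest of each exchange has a factor \<open>DD d\<close> and is a
  coboundary.\<close>

lemma Gd_WL:
  assumes "length js + length as = r" "\<forall>j\<in>set js. j < K" "\<forall>a\<in>set as. a \<in> FF Z"
  shows "WL (map \<phi> js @ as) \<in> Gd"
  using assms
proof (induction as arbitrary: js)
  case Nil
  have "WL (map \<phi> js) \<in> Omega r Y r" "pb r yy (WL (map \<phi> js)) = ww (map \<phi> js)"
    using WL[of "map \<phi> js"] Nil phi by auto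
  then have "WL (map \<phi> js) = wedge_list (map \<Phi> js)"
    using Nil pb_wedge_Phi by (intro top_unique Omega_wedge_Phi) auto
  moreover have "wedge_list (map \<Phi> js) \<in> Gd"
  proof (cases "distinct js")
    case True
    obtain s where s: "s \<in> {0, 1, - 1}" "wedge_list (map \<Phi> js) = fscale s (EE \<Phi> (set js))"
      using EE_eq_wedge_list[of \<Phi> js] one_form_Phi by blast
    from s(1) obtain a where "s = rconst a" by (auto simp flip: rconst_hom)
    moreover have "set js \<in> JS" using Nil distinct_card[OF True] by auto
    ultimately show ?thesis unfolding s(2) by (simp only: Gd_scale Gd_EE)
  next
    case False
    then have "wedge_list (map \<Phi> js) = 0" by (intro EE_wedge_eq_0 one_form_Phi)
    then show ?thesis using Gd_coboundary[OF coboundaries_closed(1)] by (simp only:)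
  qed
  ultimately show ?case by simp
next
  case (Cons a as)
  obtain c d where d: "d \<in> FF Z" and a: "a = (\<lambda>j. (\<Sum>i<K. rconst (c i) * \<phi> i j) + DD d j)"
    using phi_span[of a] Cons.prems(3) by auto
  have FFjs: "\<forall>x\<in>set (map \<phi> js). x \<in> FF Z" for js using phi by auto
  have len: "length (map \<phi> js @ x # as) = r" for x using Cons.prems(1) by simp
  have set: "\<forall>y\<in>set (map \<phi> js @ x # as). y \<in> FF Z" if "x \<in> FF Z" for x
    using FFjs[of js] that Cons.prems(3) by auto
  have Om: "WL (map \<phi> js @ x # as) \<in> Omega r Y r" if "x \<in> FF Z" for x
    using WL(1)[OF set[OF that]] unfolding len .
  have pbw: "pb r yy (WL (map \<phi> js @ x # as)) = ww (map \<phi> js @ x # as)" if "x \<in> FF Z" for x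
    by (rule WL(2)[OF set[OF that]])
  have aF: "a \<in> FF Z" using Cons.prems(3) by simp
  let ?R = "(\<Sum>i<K. fscale (rconst (c i)) (WL (map \<phi> js @ \<phi> i # as))) + WL (map \<phi> js @ DD d # as)"
  have "WL (map \<phi> js @ a # as) = ?R"
  proof (rule top_unique)
    show "?R \<in> Omega r Y r" by (intro Omega_closed(2) Omega_sum Omega_closed(3) Om phi DD_FF d)
    have "pb r yy ?R = ww (map \<phi> js @ a # as)"
      unfolding yy.pb_add yy.pb_sum pb_fscale_const pbw[OF phi] pbw[OF DD_FF[OF d]] unfolding a ww_lincomb ..
    then show "pb r yy (WL (map \<phi> js @ a # as)) {1..r} = pb r yy ?R {1..r}" using pbw[OF aF] by simp
  qed (rule Om[OF aF])
  moreover have "WL (map \<phi> js @ \<phi> i # as) \<in> Gd" if "i < K" for i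
    using Cons.IH[of "js @ [i]"] Cons.prems that by simp
  moreover have "WL (map \<phi> js @ DD d # as) \<in> Gd"
  proof -
    have one: "one_form (Tf x)" if "x \<in> FF Z" for x by (rule rational_forms_one_form[OF OmegaD(1)[OF Tf(1)[OF that]]])
    \<comment> \<open>\<open>coboundary_DD\<close> expects the exact factor in front; moving it
      there costs a sign.\<close>
    have "WL (map \<phi> js @ DD d # as) = fscale ((-1) ^ length js) (WL (DD d # map \<phi> js @ as))"
      using wedge_list_swap[of "Tf (DD d)" "map Tf (map \<phi> js)" "map Tf as"] one[OF DD_FF[OF d]] one[OF phi] by simp
    also have "\<dots> = fscale (rconst ((-1) ^ length js)) (WL (DD d # map \<phi> js @ as))" by (simp add: rconst_hom)
    also have "\<dots> \<in> Gd"
      by (intro Gd_scale Gd_coboundary, unfold coboundaries_eq, rule coboundary_DD[OF d])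
        (use Cons.prems FFjs[of js] in auto)
    finally show ?thesis .
  qed
  ultimately show ?case by (simp only:) (intro Gd_add Gd_sum Gd_scale; simp)
qed

lemma spanning:
  assumes \<eta>: "\<eta> \<in> Omega r Y r"
  shows "\<eta> \<in> Gd"
proof -
  let ?g = "pb r yy \<eta> {1..r}" and ?P = "permutations_of_set {1..r}"
  have "?g \<in> TS r Z"
  proof (rule local_to_global)
    show "finite Z" by simp
    fix c :: "nat \<Rightarrow> complex" assume c: "\<And>i. c i \<notin> Z"
    show "reg {1..r} c ?g"
    proof (rule pb_regular)
      show "\<eta> \<in> regular_forms_at r (vec (r + 1) (tv c)) r" by (rule OmegaD(2)[OF \<eta> Y_point[OF c]])
      show "vec (r + 1) (tv c) $ i = tv c i" if "i \<le> r" for i using that by simp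
    qed
  qed
  then obtain N a G where G: "\<forall>t s. G t s \<in> FF Z" and g: "?g = (\<Sum>t<(N::nat). rconst (a t) * (\<Prod>s\<in>{1..r}. G t s s))"
    unfolding TS_def by blast
  define as where "as t = map (G t) [1..<Suc r]" for t
  have as: "length (as t) = r" "\<forall>x\<in>set (as t). x \<in> FF Z" "i < r \<Longrightarrow> as t ! i = G t (Suc i)" for t i
    using G by (auto simp: as_def nth_map_upt plus_1_eq_Suc simp del: upt_Suc)
  have inv': "eps js * rsub (sg r js) ?g = (\<Sum>t<N. rconst (a t) * (eps js * (\<Prod>i<r. (as t ! i) (js ! i))))" if js: "js \<in> ?P" for js
  proof -
    interpret sgj: inj_subst "sg r js" by (rule inj_sg[OF js])
    have "rsub (sg r js) (\<Prod>s\<in>{1..r}. G t s s) = (\<Prod>i<r. (as t ! i) (js ! i))" for t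
    proof -
      have "rsub (sg r js) (\<Prod>s\<in>{1..r}. G t s s) = (\<Prod>s\<in>{1..r}. G t s (js ! (s - 1)))"
        unfolding sgj.rsub_hom
      proof (rule prod.cong[OF refl])
        fix s assume "s \<in> {1..r}"
        then have "sg r js s = rvar (js ! (s - 1))" by (simp add: sg_def[OF js])
        then show "rsub (sg r js) (G t s s) = G t s (js ! (s - 1))"
          using FF_rsub[OF inj_sg[OF js]] G by blast
      qed
      also have "\<dots> = (\<Prod>i<r. G t (Suc i) (js ! i))"
        by (rule prod.reindex_bij_witness[of _ Suc "\<lambda>s. s - 1"]) auto
      also have "\<dots> = (\<Prod>i<r. (as t ! i) (js ! i))" by (rule prod.cong) (auto simp: as)
      finally show ?thesis .
    qed
    then have "rsub (sg r js) ?g = (\<Sum>t<N. rconst (a t) * (\<Prod>i<r. (as t ! i) (js ! i)))"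
      unfolding g sgj.rsub_hom(8) sgj.rsub_hom(4) sgj.rsub_rconst by (simp only:)
    then show ?thesis by (simp only: sum_distrib_left mult.left_commute)
  qed
  have inv: "?g = (\<Sum>t<N. rconst (a t) * (eps js * (\<Prod>i<r. (as t ! i) (js ! i))))" if "js \<in> ?P" for js
    by (rule trans[OF pb_invariant[OF OmegaD(1)[OF \<eta>] that] inv'[OF that]])
  \<comment> \<open>Average over all permutations: by invariance each contributes the same function,
    while the sum over permutations of one tensor is the top coefficient of a product of
    traces.\<close>
  have "of_nat (card ?P) * ?g = (\<Sum>js\<in>?P. ?g)" by simp
  also have "\<dots> = (\<Sum>js\<in>?P. \<Sum>t<N. rconst (a t) * (eps js * (\<Prod>i<r. (as t ! i) (js ! i))))"
    by (rule sum.cong[OF refl inv])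
  also have "\<dots> = (\<Sum>t<N. rconst (a t) * ww (as t) {1..r})"
    unfolding wedge_TrF_top[OF as(1)] sum_distrib_left by (rule sum.swap)
  finally have top: "of_nat (card ?P) * ?g = (\<Sum>t<N. rconst (a t) * ww (as t) {1..r})" .
  define m where "m = card ?P"
  have "?P \<noteq> {}" using top_perm by auto
  then have m: "of_nat m \<noteq> (0 :: complex)" unfolding m_def by simp
  let ?R = "fscale (rconst (1 / of_nat m)) (\<Sum>t<N. fscale (rconst (a t)) (WL (as t)))"
  have Om: "WL (as t) \<in> Omega r Y r" "pb r yy (WL (as t)) = ww (as t)" for t
    using WL[OF as(2), of t] unfolding as(1) by auto
  have "rconst (1 / of_nat m) * of_nat m = 1"
    using m rconst_hom(4)[of "1 / of_nat m" "of_nat m"] by (simp add: rconst_hom(10) rconst_hom(2))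
  then have "?g = rconst (1 / of_nat m) * (of_nat m * ?g)" by (simp only: mult.assoc[symmetric] mult_1)
  also have "\<dots> = rconst (1 / of_nat m) * (\<Sum>t<N. rconst (a t) * ww (as t) {1..r})"
    unfolding m_def top ..
  also have "\<dots> = pb r yy ?R {1..r}"
    unfolding pb_fscale_const yy.pb_sum Om(2) fscale_eq form_sum_apply ..
  finally have "\<eta> = ?R"
    by (intro top_unique \<eta> Omega_closed(3) Omega_sum Om(1))
  also have "\<dots> \<in> Gd" using Gd_WL[of "[]"] as by (intro Gd_scale Gd_sum) auto
  finally show ?thesis .
qed

text \<open>Forms of degree above \<open>r\<close> vanish, so every top form is closed.\<close>

lemma cocycles_eq: "cocycles r Y \<omega> r = Omega r Y r"
proof -
  have "nabla \<omega> \<eta> = 0" if "\<eta> \<in> Omega r Y r" for \<eta>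
  proof (rule rational_forms_above)
    show "r < Suc r" by simp
    have "wedge \<omega> \<eta> \<in> Omega r Y (Suc r)" using Omega_wedge[OF omega(1) that] by (simp add: plus_1_eq_Suc)
    from Omega_closed(2)[OF Omega_ext_d[OF that] this] show "nabla \<omega> \<eta> \<in> rational_forms r (Suc r)"
      unfolding nabla_def by (rule OmegaD(1))
  qed
  then show ?thesis unfolding cocycles_def by blast
qed

theorem cohomology_top_basis:
  "inj_on (\<lambda>J. coh_class r Y \<omega> r (EE \<Phi> J)) JS \<and>
    vectorspace.basis class_ring (cohomology r Y \<omega> r) ((\<lambda>J. coh_class r Y \<omega> r (EE \<Phi> J)) ` JS)"
proof (rule cohomology_basis[OF JS_finite])
  fix J assume "J \<in> JS"
  then show "EE \<Phi> J \<in> cocycles r Y \<omega> r"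
    unfolding cocycles_eq EE_def by (intro Omega_wedge_Phi sl_props(2))
next
  fix \<eta> assume "\<eta> \<in> cocycles r Y \<omega> r"
  then show "\<exists>c. \<exists>\<beta>\<in>coboundaries r Y \<omega> r. \<eta> = (\<Sum>J\<in>JS. fscale (rconst (c J)) (EE \<Phi> J)) + \<beta>"
    using spanning unfolding cocycles_eq Gd_def by blast
next
  fix c assume "(\<Sum>J\<in>JS. fscale (rconst (c J)) (EE \<Phi> J)) \<in> coboundaries r Y \<omega> r"
  then obtain \<xi> where \<xi>: "\<xi> \<in> Omega r Y (r - 1)" "(\<Sum>J\<in>JS. fscale (rconst (c J)) (EE \<Phi> J)) = nabla \<omega> \<xi>"
    unfolding coboundaries_eq by blast
  have "(\<Sum>J\<in>JS. rconst (c J) * ww (map \<phi> (sl J)) {1..r}) = pb r yy (\<Sum>J\<in>JS. fscale (rconst (c J)) (EE \<Phi> J)) {1..r}"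
    unfolding yy.pb_sum pb_fscale_const EE_def pb_wedge_Phi fscale_eq form_sum_apply ..
  also have "\<dots> = (ext_d (pb r yy \<xi>) + wedge (TrF r om) (pb r yy \<xi>)) {1..r}"
    unfolding \<xi>(2) pb_nabla[OF \<xi>(1)] ..
  finally show "\<forall>J\<in>JS. c J = 0" using top_independent[OF \<xi>(1)] by blast
qed

end

section \<open>The one-variable forms of a Veronese point\<close>

subsection \<open>The forms of a Veronese point\<close>

lemma inj_subst_rvar:
  assumes "inj \<pi>"
  shows "inj_subst (\<lambda>i. rvar (\<pi> i))"
proof
  fix p :: cpoly assume "p \<noteq> 0"
  then obtain c where c: "pe c p \<noteq> 0"
    using exists_nonroot[of p UNIV] infinite_UNIV_char_0 by blast
  define c' where "c' = c \<circ> inv_into UNIV \<pi>"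
  have "ev c' (rvar (\<pi> i)) = c i" for i using assms by (simp add: c'_def)
  then have "ev c' (poly_subst rconst (\<lambda>i. rvar (\<pi> i)) p) = pe c p"
    by (intro ev_poly_subst[of p UNIV UNIV]) (auto simp: reg_var)
  then show "poly_subst rconst (\<lambda>i. rvar (\<pi> i)) p \<noteq> 0" using c by (metis ev_0)
qed

lemma ratio_affine:
  fixes F0 X a b p :: "'a::field"
  assumes "F0 \<noteq> 0" "X \<noteq> 0"
  shows "(a + b * (X + p)) / (F0 * X) = b / F0 + (a + b * p) / F0 * inverse X"
  using assms by (simp add: field_simps)

lemma det_mult:
  fixes a b :: "'a::comm_ring_1"
  shows "(e0 * a + e1 * b) * (f0 * v0 + f1 * v1) - (e0 * v0 + e1 * v1) * (f0 * a + f1 * b) = (e0 * f1 - e1 * f0) * (a * v1 - b * v0)"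
  by (simp only: ring_distribs mult_ac) simp

lemma pole_numerator:
  fixes a b :: "'a::comm_ring_1"
  assumes "c * p = - d"
  shows "c * (a + b * p) = a * c - d * b"
proof -
  have "c * (a + b * p) = a * c + b * (c * p)" by (simp add: distrib_left mult_ac)
  then show ?thesis unfolding assms by (simp add: mult_ac)
qed

lemma rat_pd_prod_log:
  assumes "\<And>s. s \<in> A \<Longrightarrow> rat_pd j (X s) = D s * X s"
  shows "rat_pd j (\<Prod>s\<in>A. X s) = (\<Sum>s\<in>A. D s) * (\<Prod>s\<in>A. X s)"
  using assms
proof (induction A rule: infinite_finite_induct)
  case (insert s A)
  then show ?case by (simp add: rat_pd_mult distrib_right distrib_left mult_ac)
qed auto

locale veronese_fixes = sym_param r e0 e1 f0 f1
  for r e0 e1 f0 f1 +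
  fixes q :: nat and n :: "nat \<Rightarrow> nat" and W0 W1 :: "nat \<Rightarrow> complex fps"
    and \<alpha> :: "nat \<times> nat \<Rightarrow> complex" and Y :: "complex vec set"
begin

text \<open>\<open>E k j + F k j * v\<close> is the value at the parameter \<open>v\<close> of the
  linear form given by the column \<open>j\<close> of block \<open>k\<close>; accordingly
  \<open>pt k\<close> is the parameter at which the first column of the block vanishes.\<close>

definition E :: "nat \<Rightarrow> nat \<Rightarrow> complex" where "E k j = e0 * fps_nth (W0 k) j + e1 * fps_nth (W1 k) j"
definition F :: "nat \<Rightarrow> nat \<Rightarrow> complex" where "F k j = f0 * fps_nth (W0 k) j + f1 * fps_nth (W1 k) j"
definition pt :: "nat \<Rightarrow> complex" where "pt k = - E k 0 / F k 0"

end

text \<open>\<open>F q 0 = 0\<close> says that the point of the last block has the parameter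
  infinity. \<open>pt_inj\<close> and \<open>within\<close> express the nonvanishing of determinants
  of two columns, from two blocks and from one block.\<close>

locale veronese_data = veronese_fixes +
  assumes F_q: "F q 0 = 0" and E_q: "E q 0 \<noteq> 0" and F_nonzero: "k < q \<Longrightarrow> F k 0 \<noteq> 0"
    and pt_inj: "inj_on pt {..<q}"
    and within: "k \<le> q \<Longrightarrow> 2 \<le> n k \<Longrightarrow> E k 0 * F k 1 \<noteq> E k 1 * F k 0"
    and n_pos: "k \<le> q \<Longrightarrow> 1 \<le> n k"
    and Y_def: "Y = {t \<in> carrier_vec (r + 1). t \<noteq> 0\<^sub>v (r + 1) \<and> (\<forall>k\<le>q. linv (W0 k) (W1 k) 0 t \<noteq> 0)}"
    and \<alpha>_sum: "(\<Sum>k\<le>q. \<alpha> (k, 0)) = 0"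
    and \<alpha>_noninteger: "k \<le> q \<Longrightarrow> n k = 1 \<Longrightarrow> \<alpha> (k, 0) \<notin> \<int>"
    and \<alpha>_nonzero: "k \<le> q \<Longrightarrow> 1 < n k \<Longrightarrow> \<alpha> (k, n k - 1) \<noteq> 0"
begin

sublocale line: punctured_line q pt by unfold_locales (rule pt_inj)

abbreviation bb :: "nat \<times> nat \<Rightarrow> nat \<Rightarrow> ratfun" where "bb \<equiv> line.bb"

abbreviation "Z \<equiv> pt ` {..<q}"

lemma EF_nonzero: "k \<le> q \<Longrightarrow> fps_nth (W0 k) 0 \<noteq> 0 \<or> fps_nth (W1 k) 0 \<noteq> 0"
  using F_nonzero[of k] E_q by (cases "k = q") (auto simp: E_def F_def)

lemma bb_power: "line.bb (k, 1) s ^ i = line.bb (k, i) s"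
  by (simp add: line.bb_def)

text \<open>The coefficient of the simple pole, or of v at infinity, in the quotient of the linear
  form \<open>j\<close> by the first one.\<close>

definition dd :: "nat \<Rightarrow> complex fps \<Rightarrow> complex fps \<Rightarrow> nat \<Rightarrow> complex" where
  "dd k V0 V1 j = (let a = e0 * fps_nth V0 j + e1 * fps_nth V1 j; b = f0 * fps_nth V0 j + f1 * fps_nth V1 j in
     if k < q then (a + b * pt k) / F k 0 else b / E k 0)"

text \<open>The series have to agree with the block in the constant term only. Thus a block can be
  extended beyond its size, and its linear term can be changed so that the relevant determinant is
  nonzero.\<close>

context
  fixes k :: nat and V0 V1 :: "complex fps"
  assumes k: "k \<le> q" and V: "fps_nth V0 0 = fps_nth (W0 k) 0" "fps_nth V1 0 = fps_nth (W1 k) 0"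
begin

lemma AA_0: "AA V0 V1 s 0 = (if k < q then rconst (F k 0) * (rvar s - rconst (pt k)) else rconst (E q 0))"
proof (cases "k < q")
  case True
  have "E k 0 = F k 0 * - pt k" using F_nonzero[OF True] by (simp add: pt_def)
  then have "rconst (E k 0) = rconst (F k 0) * - rconst (pt k)" by (simp only: rconst_hom)
  then show ?thesis using True by (simp add: AA_eq V flip: E_def F_def) (simp add: algebra_simps)
next
  case False
  then have "k = q" using k by simp
  then show ?thesis using F_q by (simp add: AA_eq V rconst_simps flip: E_def F_def)
qed

lemma AA_ratio: "\<exists>a. \<forall>s. AA V0 V1 s j / AA V0 V1 s 0 = rconst a + rconst (dd k V0 V1 j) * bb (k, 1) s"
proof (cases "k < q")
  case True
  let ?a = "e0 * fps_nth V0 j + e1 * fps_nth V1 j" and ?b = "f0 * fps_nth V0 j + f1 * fps_nth V1 j"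
  have "AA V0 V1 s j / AA V0 V1 s 0 = rconst (?b / F k 0) + rconst (dd k V0 V1 j) * bb (k, 1) s" for s
  proof -
    have "AA V0 V1 s j = rconst ?a + rconst ?b * ((rvar s - rconst (pt k)) + rconst (pt k))" by (simp add: AA_eq)
    moreover have "AA V0 V1 s 0 = rconst (F k 0) * (rvar s - rconst (pt k))" using AA_0[of s] True by simp
    moreover have "rconst (F k 0) \<noteq> 0" using F_nonzero[OF True] by (simp add: rconst_eq_0_iff)
    ultimately have "AA V0 V1 s j / AA V0 V1 s 0 = rconst ?b / rconst (F k 0) +
      (rconst ?a + rconst ?b * rconst (pt k)) / rconst (F k 0) * inverse (rvar s - rconst (pt k))"
      by (simp only: ratio_affine rvar_minus_const_nonzero not_False_eq_True)
    moreover have "rconst (dd k V0 V1 j) = (rconst ?a + rconst ?b * rconst (pt k)) / rconst (F k 0)"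
      using True by (simp add: dd_def rconst_hom rconst_divide del: mult.commute)
    moreover have "bb (k, 1) s = inverse (rvar s - rconst (pt k))" using True by (simp add: line.bb_def)
    ultimately show ?thesis by (simp only: rconst_divide)
  qed
  then show ?thesis by blast
next
  case False
  then have kq: "k = q" using k by simp
  let ?a = "e0 * fps_nth V0 j + e1 * fps_nth V1 j" and ?b = "f0 * fps_nth V0 j + f1 * fps_nth V1 j"
  have "AA V0 V1 s j / AA V0 V1 s 0 = rconst (?a / E q 0) + rconst (?b / E q 0) * rvar s" for s
    using AA_0[of s] False by (simp only: AA_eq if_False rconst_divide) (simp add: add_divide_distrib)
  moreover have "dd k V0 V1 j = ?b / E q 0" "bb (k, 1) s = rvar s" for s
    using kq by (simp_all add: dd_def line.bb_def)
  ultimately show ?thesis by (intro exI[of _ "?a / E q 0"]) simp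
qed

lemma dd_nonzero:
  assumes "E k 0 * (f0 * fps_nth V0 1 + f1 * fps_nth V1 1) \<noteq> (e0 * fps_nth V0 1 + e1 * fps_nth V1 1) * F k 0"
  shows "dd k V0 V1 1 \<noteq> 0"
proof (cases "k < q")
  case True
  let ?a = "e0 * fps_nth V0 1 + e1 * fps_nth V1 1" and ?b = "f0 * fps_nth V0 1 + f1 * fps_nth V1 1"
  have "F k 0 * pt k = - E k 0" using F_nonzero[OF True] by (simp add: pt_def)
  then have "F k 0 * (?a + ?b * pt k) = ?a * F k 0 - E k 0 * ?b"
    by (rule pole_numerator)
  then have "?a + ?b * pt k \<noteq> 0" using assms by auto
  then show ?thesis using True F_nonzero[OF True] by (simp add: dd_def)
next
  case False
  then have "k = q" using k by simp
  then show ?thesis using assms F_q E_q by (simp add: dd_def Let_def)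
qed

text \<open>By \<open>theta_prep\<close>, \<theta>_m is a polynomial of exact degree
  \<open>m\<close> in the simple pole; the leading coefficient is nonzero because it is a power of a
  determinant up to nonzero factors. The coefficients do not depend on the variable
  \<open>s\<close>.\<close>

lemma theta_bb:
  assumes nd: "E k 0 * (f0 * fps_nth V0 1 + f1 * fps_nth V1 1) \<noteq> (e0 * fps_nth V0 1 + e1 * fps_nth V1 1) * F k 0"
    and m: "1 \<le> m"
  shows "\<exists>c. c m \<noteq> 0 \<and> (\<forall>s. theta m (AA V0 V1 s) = (\<Sum>i\<le>m. rconst (c i) * bb (k, i) s))"
proof -
  have "\<forall>j. \<exists>a. \<forall>s. AA V0 V1 s j / AA V0 V1 s 0 = rconst a + rconst (dd k V0 V1 j) * bb (k, 1) s"
    using AA_ratio by blast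
  from choice[OF this] obtain a where
    a: "\<forall>j s. AA V0 V1 s j / AA V0 V1 s 0 = rconst (a j) + rconst (dd k V0 V1 j) * bb (k, 1) s" ..
  have "prep (bb (k, 1) 0) m (theta m (AA V0 V1 0)) (if m = 0 then 0 else (-1) ^ (m - 1) * dd k V0 V1 1 ^ m / of_nat m)"
    by (rule theta_prep[where a = a]) (use a in blast)
  then obtain c where c: "theta m (AA V0 V1 0) = (\<Sum>i\<le>m. rconst (c i) * bb (k, 1) 0 ^ i)"
    "c m = (-1) ^ (m - 1) * dd k V0 V1 1 ^ m / of_nat m"
    unfolding prep_def using m by auto
  have "theta m (AA V0 V1 s) = (\<Sum>i\<le>m. rconst (c i) * bb (k, i) s)" for s
  proof -
    \<comment> \<open>The expansion is computed in the variable 0 and carried to \<open>s\<close> by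
      exchanging these two variables.\<close>
    define \<pi> where "\<pi> i = (if i = 0 then s else if i = s then 0 else i)" for i
    have inj: "inj_subst (\<lambda>i. rvar (\<pi> i))" by (rule inj_subst_rvar) (auto simp: inj_def \<pi>_def split: if_splits)
    interpret sw: inj_subst "\<lambda>i. rvar (\<pi> i)" by (rule inj)
    have "rsub (\<lambda>i. rvar (\<pi> i)) (AA V0 V1 0 j) = AA V0 V1 s j" for j
    proof -
      have "\<pi> 0 = s" by (simp add: \<pi>_def)
      then show ?thesis unfolding AA_eq by (simp only: sw.rsub_hom sw.rsub_rconst sw.rsub_rvar)
    qed
    then have "theta m (AA V0 V1 s) = rsub (\<lambda>i. rvar (\<pi> i)) (theta m (AA V0 V1 0))"
      by (simp add: sw.rsub_theta)
    also have "\<dots> = (\<Sum>i\<le>m. rconst (c i) * rsub (\<lambda>i. rvar (\<pi> i)) (bb (k, i) 0))"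
      unfolding c(1) bb_power by (simp add: sw.rsub_hom)
    also have "\<dots> = (\<Sum>i\<le>m. rconst (c i) * bb (k, i) s)"
    proof -
      have "rsub (\<lambda>i. rvar (\<pi> i)) (bb (k, i) 0) = bb (k, i) s" for i
        by (rule FF_rsub[OF inj line.bb_FF]) (simp add: \<pi>_def)
      then show ?thesis by simp
    qed
    finally show ?thesis .
  qed
  moreover have "c m \<noteq> 0" unfolding c(2) using dd_nonzero[OF nd] m by simp
  ultimately show ?thesis by blast
qed

end

lemma linv_0: "linv V0 V1 0 t = (\<Sum>i\<le>r. t $ i * (fps_nth V0 0 ^ (r - i) * fps_nth V1 0 ^ i))"
  unfolding linv_def by (simp add: fps_mult_nth_0 fps_nth_power_0)

text \<open>For an auxiliary linear series with the same constant term, \<theta>_m is regular on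
  \<open>Y\<close> and pulls back to the trace of a polynomial of degree \<open>m\<close> in the
  simple pole; traces of the lower powers are available by induction and are subtracted.\<close>

lemma trace_bb:
  assumes k: "k \<le> q" and "1 \<le> m"
  shows "\<exists>\<tau>. global_fun r Y \<tau> \<and> rsub yy \<tau> = (\<Sum>s\<in>{1..r}. bb (k, m) s)"
  using assms(2)
proof (induction m rule: less_induct)
  case (less m)
  let ?a = "fps_nth (W0 k) 0" and ?b = "fps_nth (W1 k) 0"
  \<comment> \<open>A second column independent of the first: the determinant with it is minus the
    lower entry or the upper entry of the first column, whichever is known to be nonzero.\<close>
  define v0 v1 where "v0 = (if ?a = 0 then 1 else 0 :: complex)" and "v1 = (if ?a = 0 then 0 else 1 :: complex)"
  define V0 V1 where "V0 = fps_const ?a + fps_const v0 * fps_X" and "V1 = fps_const ?b + fps_const v1 * fps_X"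
  have V: "fps_nth V0 0 = ?a" "fps_nth V1 0 = ?b" "fps_nth V0 1 = v0" "fps_nth V1 1 = v1"
    by (simp_all add: V0_def V1_def)
  have "?a * v1 - ?b * v0 \<noteq> 0" using EF_nonzero[OF k] by (auto simp: v0_def v1_def form_apply)
  then have "E k 0 * (f0 * v0 + f1 * v1) - (e0 * v0 + e1 * v1) * F k 0 \<noteq> 0"
    unfolding E_def F_def det_mult using det by simp
  then obtain c where c: "c m \<noteq> 0" "\<forall>s. theta m (AA V0 V1 s) = (\<Sum>i\<le>m. rconst (c i) * bb (k, i) s)"
    using theta_bb[OF k V(1,2) _ less.prems] unfolding V by auto
  have "\<forall>i. \<exists>\<tau>. i < m \<longrightarrow> global_fun r Y \<tau> \<and> rsub yy \<tau> = (\<Sum>s\<in>{1..r}. bb (k, i) s)"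
  proof
    fix i
    show "\<exists>\<tau>. i < m \<longrightarrow> global_fun r Y \<tau> \<and> rsub yy \<tau> = (\<Sum>s\<in>{1..r}. bb (k, i) s)"
    proof (cases "i = 0")
      case True
      then have "(\<Sum>s\<in>{1..r}. bb (k, i) s) = rconst (of_nat r)" by (simp add: line.bb_0 rconst_hom)
      moreover have "global_fun r Y (rconst (of_nat r))"
        unfolding global_fun_def by (auto intro!: fracs_closed local_ring_const)
      ultimately show ?thesis using yy.rsub_rconst by metis
    next
      case False
      then show ?thesis using less.IH[of i] by (cases "i < m") auto
    qed
  qed
  from choice[OF this] obtain \<tau> where
    \<tau>: "\<forall>i. i < m \<longrightarrow> global_fun r Y (\<tau> i) \<and> rsub yy (\<tau> i) = (\<Sum>s\<in>{1..r}. bb (k, i) s)" ..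
  define \<tau>' where "\<tau>' i = (if i < m then \<tau> i else theta m (lin V0 V1))" for i
  \<comment> \<open>Solves the expansion of \<theta>_m for its leading power: lower terms are
    subtracted, and everything is divided by \<open>c m\<close>.\<close>
  define c' where "c' i = (if i < m then - c i / c m else 1 / c m)" for i
  have "linv V0 V1 0 t \<noteq> 0" if "t \<in> Y" for t
    using that k unfolding Y_def linv_0 V by auto
  then have "global_fun r Y (theta m (lin V0 V1))"
    unfolding global_fun_def by (auto intro: theta_fracs theta_local_ring)
  then have "global_fun r Y (\<Sum>i\<le>m. rconst (c' i) * \<tau>' i)"
    by (intro global_fun_sum_const) (use \<tau> in \<open>auto simp: \<tau>'_def\<close>)
  moreover have "rsub yy (\<Sum>i\<le>m. rconst (c' i) * \<tau>' i) = (\<Sum>s\<in>{1..r}. bb (k, m) s)"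
  proof -
    let ?S = "\<lambda>i. \<Sum>s\<in>{1..r}. bb (k, i) s"
    have "rsub yy (theta m (lin V0 V1)) = (\<Sum>s\<in>{1..r}. theta m (AA V0 V1 s))"
      by (rule rsub_theta_lin) (use V EF_nonzero[OF k] in simp)
    also have "\<dots> = (\<Sum>i\<le>m. rconst (c i) * ?S i)"
      using c(2) by (simp only: sum_distrib_left) (rule sum.swap)
    also have "\<dots> = (\<Sum>i<m. rconst (c i) * ?S i) + rconst (c m) * ?S m"
      by (simp add: lessThan_Suc_atMost[symmetric] del: sum.lessThan_Suc_shift)
    finally have th: "rsub yy (theta m (lin V0 V1)) = (\<Sum>i<m. rconst (c i) * ?S i) + rconst (c m) * ?S m" .
    have "rsub yy (\<Sum>i\<le>m. rconst (c' i) * \<tau>' i) = (\<Sum>i<m. rconst (c' i) * rsub yy (\<tau>' i)) + rconst (c' m) * rsub yy (\<tau>' m)"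
      by (simp add: yy.rsub_hom lessThan_Suc_atMost[symmetric] del: sum.lessThan_Suc_shift)
    also have "(\<Sum>i<m. rconst (c' i) * rsub yy (\<tau>' i)) = (\<Sum>i<m. rconst (1 / c m) * (rconst (- 1) * (rconst (c i) * ?S i)))"
    proof (rule sum.cong[OF refl])
      fix i assume i: "i \<in> {..<m}"
      have "c' i = 1 / c m * (- 1 * c i)" using i by (simp add: c'_def uminus_apply)
      then have "rconst (c' i) = rconst (1 / c m) * (rconst (- 1) * rconst (c i))" by (simp only: rconst_hom)
      moreover have "rsub yy (\<tau>' i) = ?S i" using i \<tau> by (simp add: \<tau>'_def)
      ultimately show "rconst (c' i) * rsub yy (\<tau>' i) = rconst (1 / c m) * (rconst (- 1) * (rconst (c i) * ?S i))"
        by (simp only: mult.assoc)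
    qed
    also have "\<dots> = rconst (1 / c m) * - (\<Sum>i<m. rconst (c i) * ?S i)"
      by (simp only: sum_distrib_left[symmetric] rconst_hom mult_minus1 sum_negf)
    also have "rconst (c' m) * rsub yy (\<tau>' m) = rconst (1 / c m) * ((\<Sum>i<m. rconst (c i) * ?S i) + rconst (c m) * ?S m)"
      using th by (simp add: c'_def \<tau>'_def)
    also have "rconst (1 / c m) * - (\<Sum>i<m. rconst (c i) * ?S i) + \<dots> = rconst (1 / c m * c m) * ?S m"
      by (simp only: distrib_left[symmetric] rconst_hom(4) mult.assoc) simp
    also have "\<dots> = ?S m" using c(1) by (simp add: rconst_simps)
    finally show ?thesis .
  qed
  ultimately show ?case by blast
qed


text \<open>The indices of the list of members: \<open>(k, i)\<close> with positive \<open>i\<close>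
  stands for a differential of \<theta>_i, and \<open>(k, 0)\<close> for the difference of the
  logarithmic forms of the blocks \<open>k\<close> and \<open>q\<close>, so \<open>(q, 0)\<close> is
  missing.\<close>

definition P :: "(nat \<times> nat) set" where
  "P = {(k, i). k \<le> q \<and> i < n k \<and> (k = q \<longrightarrow> 1 \<le> i)}"

text \<open>The index of the basis function of highest order in the one-variable function of a
  member: differentiation raises the exponent at a finite place and lowers it at infinity, and
  \<open>(k, 0)\<close> corresponds to a simple pole.\<close>

definition bi :: "nat \<times> nat \<Rightarrow> nat \<times> nat" where
  "bi x = (fst x, if fst x < q then snd x + 1 else snd x - 1)"

definition ib :: "nat \<times> nat \<Rightarrow> nat \<times> nat" where
  "ib p = (fst p, if fst p < q then snd p - 1 else snd p + 1)"

abbreviation JJ :: "(nat \<times> nat) set" where "JJ \<equiv> twisted_line.JJ q n"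

lemma twisted_line_axioms': "twisted_line q pt n"
  by unfold_locales (rule n_pos)

lemma JJ_eq: "JJ = {p \<in> line.II. line.eo p \<le> n (fst p)}"
  by (rule twisted_line.JJ_def[OF twisted_line_axioms'])

lemma finite_P: "finite P"
  by (rule finite_subset[of _ "Sigma {..q} (\<lambda>k. {..<n k})"]) (auto simp: P_def)

lemma ib_bi: "x \<in> P \<Longrightarrow> ib (bi x) = x"
  by (cases x) (auto simp: P_def ib_def bi_def)

lemma bi_bij: "bij_betw bi P JJ"
proof (rule bij_betwI[where g = ib])
  show "bi \<in> P \<rightarrow> JJ" unfolding JJ_eq by (auto simp: P_def bi_def line.II_def line.eo_def)
  show "ib \<in> JJ \<rightarrow> P" unfolding JJ_eq by (auto simp: P_def ib_def line.II_def line.eo_def split: if_splits)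
  show "ib (bi x) = x" if "x \<in> P" for x using that by (rule ib_bi)
  show "bi (ib p) = p" if "p \<in> JJ" for p
    using that unfolding JJ_eq by (cases p) (auto simp: bi_def ib_def line.II_def)
qed

text \<open>The function of one variable whose trace is the member. For index 0 the linear form of
  the last block is constant in the parameter, so only the simple pole of block \<open>k\<close>
  remains.\<close>

definition ph :: "nat \<times> nat \<Rightarrow> nat \<Rightarrow> ratfun" where
  "ph x s = (if snd x = 0 then bb (fst x, 1) s else rat_pd s (theta (snd x) (AA (W0 (fst x)) (W1 (fst x)) s)))"

lemma rat_pd_bb': "k \<le> q \<Longrightarrow> rat_pd s (bb (k, i) s) = rconst (if k < q then - of_nat i else of_nat i) * bb (bi (k, i)) s"
proof (cases "k < q")
  case True
  then show ?thesis by (simp add: line.rat_pd_bb(1) bi_def)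
next
  case False
  moreover assume "k \<le> q"
  ultimately have "k = q" by simp
  then show ?thesis using line.rat_pd_bb(2)[of s "i - 1"]
    by (cases i) (simp_all add: bi_def line.bb_0 rconst_simps form_apply del: of_nat_Suc flip: Suc_eq_plus1)
qed

lemma theta_bb_member:
  assumes "(k, i) \<in> P" "1 \<le> i"
  shows "\<exists>c. c i \<noteq> 0 \<and> (\<forall>s. theta i (AA (W0 k) (W1 k) s) = (\<Sum>m\<le>i. rconst (c m) * bb (k, m) s))"
proof (rule theta_bb[OF _ refl refl _ assms(2)])
  show "k \<le> q" using assms by (simp add: P_def)
  moreover have "2 \<le> n k" using assms by (simp add: P_def)
  ultimately show "E k 0 * (f0 * fps_nth (W0 k) 1 + f1 * fps_nth (W1 k) 1) \<noteq> (e0 * fps_nth (W0 k) 1 + e1 * fps_nth (W1 k) 1) * F k 0"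
    using within[of k] by (simp add: E_def F_def)
qed

text \<open>Besides the triangular shape, \<open>T 0\<close> is recorded: a derivative has no
  residue, so simple poles at finite places come from the members with index 0 alone.\<close>

lemma ph_bb:
  assumes x: "x \<in> P"
  shows "\<exists>T. T (snd x) \<noteq> 0 \<and> T 0 = (if snd x = 0 then 1 else 0) \<and>
    (\<forall>s. ph x s = (\<Sum>i\<le>snd x. rconst (T i) * bb (bi (fst x, i)) s))"
proof -
  obtain k i where x': "x = (k, i)" by (cases x)
  have k: "k \<le> q" using x x' by (simp add: P_def)
  show ?thesis
  proof (cases "i = 0")
    case True
    then have "k < q" using x x' by (auto simp: P_def)
    then show ?thesis using True by (intro exI[of _ "\<lambda>_. 1"]) (simp add: x' ph_def bi_def rconst_simps)
  next
    case False
    then obtain c where c: "c i \<noteq> 0" "\<And>s. theta i (AA (W0 k) (W1 k) s) = (\<Sum>m\<le>i. rconst (c m) * bb (k, m) s)"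
      using theta_bb_member[of k i] x x' by auto
    define T where "T m = c m * (if k < q then - of_nat m else of_nat m)" for m
    have "ph x s = (\<Sum>m\<le>i. rconst (T m) * bb (bi (k, m)) s)" for s
    proof -
      have "ph x s = rat_pd s (\<Sum>m\<le>i. rconst (c m) * bb (k, m) s)" using False by (simp add: x' ph_def c(2))
      also have "\<dots> = (\<Sum>m\<le>i. rconst (c m) * (rconst (if k < q then - of_nat m else of_nat m) * bb (bi (k, m)) s))"
        unfolding rat_pd_sum rat_pd_mult rat_pd_rconst mult_zero_left add_0 rat_pd_bb'[OF k] ..
      finally show ?thesis unfolding T_def rconst_hom(4) mult.assoc .
    qed
    moreover have "T i \<noteq> 0" "T 0 = 0" using c(1) False by (auto simp: T_def)
    ultimately show ?thesis using False by (intro exI[of _ T]) (simp add: x')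
  qed
qed

definition TM :: "nat \<times> nat \<Rightarrow> nat \<Rightarrow> complex" where
  "TM x = (SOME T. T (snd x) \<noteq> 0 \<and> T 0 = (if snd x = 0 then 1 else 0) \<and>
    (\<forall>s. ph x s = (\<Sum>i\<le>snd x. rconst (T i) * bb (bi (fst x, i)) s)))"

lemma TM:
  assumes "x \<in> P"
  shows "TM x (snd x) \<noteq> 0" "TM x 0 = (if snd x = 0 then 1 else 0)"
    "ph x s = (\<Sum>i\<le>snd x. rconst (TM x i) * bb (bi (fst x, i)) s)"
  using someI_ex[OF ph_bb[OF assms]] unfolding TM_def[symmetric] by blast+

text \<open>The transition matrix from the basis functions to the members; it is triangular within
  each block and has no entries between blocks.\<close>

definition tm :: "nat \<times> nat \<Rightarrow> nat \<times> nat \<Rightarrow> complex" where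
  "tm x y = (if fst x = fst y \<and> snd y \<le> snd x then TM x (snd y) else 0)"

lemma tm_diag: "x \<in> P \<Longrightarrow> tm x x \<noteq> 0"
  by (simp add: tm_def TM(1))

lemma ph_tm:
  assumes x: "x \<in> P"
  shows "ph x s = (\<Sum>y\<in>P. rconst (tm x y) * bb (bi y) s)"
proof -
  obtain k i where x': "x = (k, i)" by (cases x)
  have "(\<Sum>y\<in>P. rconst (tm x y) * bb (bi y) s) = (\<Sum>y\<in>P \<inter> ({k} \<times> {..i}). rconst (tm x y) * bb (bi y) s)"
    by (rule sum.mono_neutral_right) (use finite_P in \<open>auto simp: tm_def x' rconst_simps\<close>)
  also have "\<dots> = (\<Sum>y\<in>{k} \<times> {..i}. rconst (tm x y) * bb (bi y) s)"
  proof (rule sum.mono_neutral_left)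
    show "\<forall>y\<in>{k} \<times> {..i} - P \<inter> ({k} \<times> {..i}). rconst (tm x y) * bb (bi y) s = 0"
    proof
      fix y assume "y \<in> {k} \<times> {..i} - P \<inter> ({k} \<times> {..i})"
      then have "snd y = 0" "i \<noteq> 0" using x x' by (auto simp: P_def)
      then have "tm x y = 0" using TM(2)[OF x] by (auto simp: tm_def x')
      then show "rconst (tm x y) * bb (bi y) s = 0" by (simp add: rconst_simps)
    qed
  qed auto
  also have "\<dots> = (\<Sum>m\<le>i. rconst (tm x (k, m)) * bb (bi (k, m)) s)"
    by (rule sum.reindex_bij_witness[of _ "\<lambda>m. (k, m)" snd]) auto
  also have "\<dots> = ph x s"
    using TM(3)[OF x, of s] by (simp add: x' tm_def cong: sum.cong_simp)
  finally show ?thesis by simp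
qed

lemma ph_FF:
  assumes "x \<in> P"
  shows "ph x \<in> FF Z"
  using FF_sum[of P "\<lambda>y j. rconst (tm x y) * bb (bi y) j" Z] FF_scale[OF line.bb_FF]
  unfolding ph_tm[OF assms, abs_def] by simp

text \<open>The coefficients of the twisting form in the basis \<open>bb\<close>, obtained from
  \<alpha> by the transition matrix.\<close>

definition wt :: "nat \<times> nat \<Rightarrow> complex" where
  "wt p = (\<Sum>x\<in>P. \<alpha> x * tm x (ib p))"

sublocale tw: twisted_line q pt n wt by (rule twisted_line_axioms')

lemma om_eq: "tw.om j = (\<Sum>x\<in>P. rconst (\<alpha> x) * ph x j)"
proof -
  have "tw.om j = (\<Sum>y\<in>P. rconst (wt (bi y)) * bb (bi y) j)"
    unfolding tw.om_def by (rule sum.reindex_bij_betw[OF bi_bij, symmetric])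
  also have "\<dots> = (\<Sum>y\<in>P. \<Sum>x\<in>P. rconst (\<alpha> x) * (rconst (tm x y) * bb (bi y) j))"
    by (rule sum.cong) (simp_all add: wt_def ib_bi rconst_hom sum_distrib_right mult.assoc)
  also have "\<dots> = (\<Sum>x\<in>P. \<Sum>y\<in>P. rconst (\<alpha> x) * (rconst (tm x y) * bb (bi y) j))" by (rule sum.swap)
  also have "\<dots> = (\<Sum>x\<in>P. rconst (\<alpha> x) * ph x j)"
    by (rule sum.cong) (simp_all add: ph_tm sum_distrib_left)
  finally show ?thesis .
qed

text \<open>Triangularity: in each block only the last member reaches the highest pole
  order.\<close>

lemma wt_top:
  assumes k: "(k, n k - 1) \<in> P"
  shows "wt (bi (k, n k - 1)) = \<alpha> (k, n k - 1) * tm (k, n k - 1) (k, n k - 1)"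
proof -
  have "wt (bi (k, n k - 1)) = (\<Sum>x\<in>P. if x = (k, n k - 1) then \<alpha> (k, n k - 1) * tm (k, n k - 1) (k, n k - 1) else 0)"
    unfolding wt_def ib_bi[OF k]
  proof (rule sum.cong[OF refl])
    fix x assume x: "x \<in> P"
    show "\<alpha> x * tm x (k, n k - 1) = (if x = (k, n k - 1) then \<alpha> (k, n k - 1) * tm (k, n k - 1) (k, n k - 1) else 0)"
    proof (cases "x = (k, n k - 1)")
      case False
      then have "tm x (k, n k - 1) = 0" using x by (cases x) (auto simp: tm_def P_def)
      then show ?thesis using False by simp
    qed simp
  qed
  also have "\<dots> = \<alpha> (k, n k - 1) * tm (k, n k - 1) (k, n k - 1)" using k finite_P by simp
  finally show ?thesis .
qed

lemma WW_top:
  assumes k: "k \<le> q" and top: "(k, n k - 1) \<in> P" and "k < q \<or> n q \<noteq> 1"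
  shows "tw.WW k = \<alpha> (k, n k - 1) * tm (k, n k - 1) (k, n k - 1)"
proof -
  let ?t = "bi (k, n k - 1)"
  have tJ: "?t \<in> tw.JJ" using bi_bij top by (auto simp: bij_betw_def)
  have eo: "fst p = k \<and> line.eo p = n k \<longleftrightarrow> p = ?t" if "p \<in> tw.JJ" for p
    using that n_pos[OF k] k top by (cases p) (auto simp: tw.JJ_def line.II_def line.eo_def bi_def P_def)
  have "tw.WW k = (\<Sum>p\<in>tw.JJ. if p = ?t then wt ?t else 0)"
    unfolding tw.WW_def
  proof (rule sum.cong[OF refl])
    fix p assume p: "p \<in> tw.JJ"
    have "\<not> (k = q \<and> n q = 1 \<and> snd p = 1)" using assms(3) by auto
    then show "wt p * (if fst p = k then (if line.eo p = n k then 1 else 0) else if k = q \<and> n q = 1 \<and> snd p = 1 then 1 else 0) =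
      (if p = ?t then wt ?t else 0)"
      using eo[OF p] by auto
  qed
  also have "\<dots> = wt ?t" using tJ tw.finite_JJ by simp
  finally show ?thesis unfolding wt_top[OF top] .
qed

text \<open>A form of the residue theorem: for \<open>n q = 1\<close> the behaviour at infinity is
  the sum of the residues \<alpha>(k, 0) at the finite places, which is the negative of the last one
  because all of them add up to 0.\<close>

lemma WW_infinity:
  assumes nq: "n q = 1"
  shows "tw.WW q = - \<alpha> (q, 0)"
proof -
  have "tw.WW q = (\<Sum>p\<in>tw.JJ. if snd p = 1 then wt p else 0)"
    unfolding tw.WW_def
  proof (rule sum.cong[OF refl])
    fix p assume p: "p \<in> tw.JJ"
    then have "fst p \<noteq> q" using nq by (auto simp: tw.JJ_def line.II_def line.eo_def)
    then show "wt p * (if fst p = q then (if line.eo p = n q then 1 else 0) else if q = q \<and> n q = 1 \<and> snd p = 1 then 1 else 0) =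
      (if snd p = 1 then wt p else 0)" using nq by simp
  qed
  also have "\<dots> = (\<Sum>y\<in>P. if snd (bi y) = 1 then wt (bi y) else 0)"
    by (rule sum.reindex_bij_betw[OF bi_bij, symmetric])
  also have "\<dots> = (\<Sum>y\<in>P. if snd y = 0 then wt (bi y) else 0)"
    by (rule sum.cong) (use nq in \<open>auto simp: P_def bi_def\<close>)
  also have "\<dots> = (\<Sum>y\<in>(\<lambda>k. (k, 0)) ` {..<q}. if snd y = 0 then wt (bi y) else 0)"
  proof (rule sum.mono_neutral_right[OF finite_P])
    have "0 < n k" if "k < q" for k using n_pos[of k] that by simp
    then show "(\<lambda>k. (k, 0)) ` {..<q} \<subseteq> P" by (auto simp: P_def)
    show "\<forall>y\<in>P - (\<lambda>k. (k, 0)) ` {..<q}. (if snd y = 0 then wt (bi y) else 0) = 0"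
      by (auto simp: P_def)
  qed
  also have "\<dots> = (\<Sum>k<q. wt (bi (k, 0)))" by (subst sum.reindex) (auto simp: inj_on_def)
  also have "\<dots> = (\<Sum>k<q. \<alpha> (k, 0))"
  proof (rule sum.cong[OF refl])
    fix k assume "k \<in> {..<q}"
    then have k: "(k, 0) \<in> P" using n_pos[of k] by (auto simp: P_def)
    have "wt (bi (k, 0)) = (\<Sum>x\<in>P. if x = (k, 0) then \<alpha> (k, 0) else 0)"
      unfolding wt_def ib_bi[OF k]
      by (rule sum.cong[OF refl]) (use TM(2) in \<open>auto simp: tm_def\<close>)
    then show "wt (bi (k, 0)) = \<alpha> (k, 0)" using k finite_P by simp
  qed
  also have "\<dots> = - \<alpha> (q, 0)"
    using \<alpha>_sum unfolding lessThan_Suc_atMost[symmetric] sum.lessThan_Suc by (simp add: eq_neg_iff_add_eq_0)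
  finally show ?thesis .
qed

sublocale tw: generic_twisted_line q pt n wt
proof unfold_locales
  fix k m :: nat assume k: "k \<le> q" and m: "0 < m"
  show "tw.lamb k m \<noteq> 0"
  \<comment> \<open>For \<open>n k > 1\<close> the number is \<alpha>(k, n k - 1) times a diagonal
    entry. For \<open>n k = 1\<close> it is \<alpha>(k, 0) - m at a finite place and m - \<alpha>(q,
    0) at infinity, nonzero since \<alpha>(k, 0) is not an integer.\<close>
  proof (cases "n k = 1")
    case False
    then have nk: "1 < n k" using n_pos[OF k] by simp
    then have top: "(k, n k - 1) \<in> P" using k by (auto simp: P_def)
    have "tw.WW k \<noteq> 0"
      using WW_top[OF k top] False k \<alpha>_nonzero[OF k nk] tm_diag[OF top] by (cases "k = q") auto
    then show ?thesis using False by (simp add: tw.lamb_def)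
  next
    case True
    have ni: "\<alpha> (k, 0) \<noteq> of_nat m" using \<alpha>_noninteger[OF k True] by auto
    show ?thesis
    proof (cases "k < q")
      case kq: True
      have top: "(k, n k - 1) \<in> P" using kq True by (auto simp: P_def)
      have "tw.WW k = \<alpha> (k, 0)" using WW_top[OF k top] kq True TM(2)[OF top] by (simp add: tm_def)
      then show ?thesis using True kq ni by (simp add: tw.lamb_def)
    next
      case False
      then have "k = q" using k by simp
      then show ?thesis using True ni WW_infinity by (simp add: tw.lamb_def)
    qed
  qed
qed

text \<open>Inversion of a triangular matrix with nonzero diagonal, by induction on the index within
  the block.\<close>

lemma bb_span: "x \<in> P \<Longrightarrow> bb (bi x) \<in> cs ph P"
proof (induction "snd x" arbitrary: x rule: less_induct)
  case less
  let ?Q = "{y \<in> P. fst y = fst x \<and> snd y < snd x}"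
  have "(\<lambda>j. rconst (1 / tm x x) * (ph x j + (\<Sum>y\<in>?Q. rconst (- tm x y) * bb (bi y) j))) \<in> cs ph P"
    by (intro cs_scale cs_add cs_base cs_sum less.hyps less.prems) auto
  moreover have "bb (bi x) = (\<lambda>j. rconst (1 / tm x x) * (ph x j + (\<Sum>y\<in>?Q. rconst (- tm x y) * bb (bi y) j)))"
  proof
    fix j
    have "ph x j = (\<Sum>y\<in>insert x ?Q. rconst (tm x y) * bb (bi y) j)"
      unfolding ph_tm[OF less.prems]
      by (rule sum.mono_neutral_right) (use finite_P less.prems in \<open>auto simp: tm_def rconst_simps prod_eq_iff\<close>)
    also have "\<dots> = rconst (tm x x) * bb (bi x) j + (\<Sum>y\<in>?Q. rconst (tm x y) * bb (bi y) j)"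
      using finite_P by (subst sum.insert) auto
    finally have "ph x j + (\<Sum>y\<in>?Q. rconst (- tm x y) * bb (bi y) j) = rconst (tm x x) * bb (bi x) j"
      by (simp add: rconst_hom sum_negf)
    moreover have "rconst (1 / tm x x) * rconst (tm x x) = 1"
      using tm_diag[OF less.prems] by (simp only: rconst_hom(4)[symmetric]) (simp add: rconst_simps)
    ultimately show "bb (bi x) j = rconst (1 / tm x x) * (ph x j + (\<Sum>y\<in>?Q. rconst (- tm x y) * bb (bi y) j))"
      by (simp only: mult.assoc[symmetric] mult_1)
  qed
  ultimately show ?case by (simp only:)
qed

lemma ph_span:
  assumes "f \<in> FF Z"
  shows "\<exists>c. \<exists>d\<in>FF Z. f = (\<lambda>j. (\<Sum>x\<in>P. rconst (c x) * ph x j) + tw.DD d j)"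
proof -
  obtain c d where d: "d \<in> FF Z" and f: "f = (\<lambda>j. (\<Sum>p\<in>tw.JJ. rconst (c p) * bb p j) + tw.DD d j)"
    using tw.FF_reduce[OF assms] by blast
  have bb_cs: "bb p \<in> cs ph P" if "p \<in> tw.JJ" for p
  proof -
    have "p \<in> bi ` P" using that by (simp only: bij_betw_imp_surj_on[OF bi_bij])
    then obtain x where x: "p = bi x" "x \<in> P" by (rule imageE)
    show ?thesis unfolding x(1) by (rule bb_span[OF x(2)])
  qed
  have mem: "(\<lambda>j. rconst (c p) * bb p j) \<in> cs ph P" if "p \<in> tw.JJ" for p
    by (rule cs_scale[OF bb_cs[OF that]])
  have "(\<lambda>j. \<Sum>p\<in>tw.JJ. rconst (c p) * bb p j) \<in> cs ph P" by (rule cs_sum[OF mem])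
  from cs_finite[OF this finite_P] obtain c' where
    c': "(\<lambda>j. \<Sum>p\<in>tw.JJ. rconst (c p) * bb p j) = (\<lambda>j. \<Sum>x\<in>P. rconst (c' x) * ph x j)" ..
  have "f j = (\<Sum>x\<in>P. rconst (c' x) * ph x j) + tw.DD d j" for j
    using fun_cong[OF c', of j] fun_cong[OF f, of j] by (simp only:)
  then have "f = (\<lambda>j. (\<Sum>x\<in>P. rconst (c' x) * ph x j) + tw.DD d j)" by (rule ext)
  then show ?thesis using d by blast
qed

text \<open>\<open>DD_image\<close> gives the relation for the coefficients in the basis
  \<open>bb\<close>; the triangular transition matrix is injective, so it holds for the original
  coefficients as well.\<close>

lemma ph_relation:
  assumes d: "d \<in> FF Z" and eq: "\<And>v. v \<notin> Z \<Longrightarrow> (\<Sum>x\<in>P. c x * fv (ph x) v) = fv (tw.DD d) v"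
  shows "\<exists>a. \<forall>x\<in>P. c x = a * \<alpha> x"
proof -
  define c' where "c' p = (\<Sum>x\<in>P. c x * tm x (ib p))" for p
  have eq': "(\<Sum>p\<in>tw.JJ. c' p * line.cb p v) = fv (tw.DD d) v" if v: "v \<notin> Z" for v
  proof -
    have fv_ph: "fv (ph x) v = (\<Sum>y\<in>P. tm x y * line.cb (bi y) v)" if x: "x \<in> P" for x
    proof -
      have "fv (ph x) v = fv (\<lambda>j. \<Sum>y\<in>P. rconst (tm x y) * bb (bi y) j) v" unfolding ph_tm[OF x, abs_def] ..
      also have "\<dots> = (\<Sum>y\<in>P. fv (\<lambda>j. rconst (tm x y) * bb (bi y) j) v)"
        by (rule fv_sum[OF FF_scale[OF line.bb_FF] v])
      also have "\<dots> = (\<Sum>y\<in>P. tm x y * line.cb (bi y) v)"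
        by (simp only: fv_scale[OF line.bb_FF v] line.fv_bb[OF v])
      finally show ?thesis .
    qed
    have "(\<Sum>p\<in>tw.JJ. c' p * line.cb p v) = (\<Sum>y\<in>P. c' (bi y) * line.cb (bi y) v)"
      by (rule sum.reindex_bij_betw[OF bi_bij, symmetric])
    also have "\<dots> = (\<Sum>y\<in>P. \<Sum>x\<in>P. c x * (tm x y * line.cb (bi y) v))"
      by (rule sum.cong) (simp_all only: c'_def ib_bi sum_distrib_right mult.assoc)
    also have "\<dots> = (\<Sum>x\<in>P. \<Sum>y\<in>P. c x * (tm x y * line.cb (bi y) v))" by (rule sum.swap)
    also have "\<dots> = (\<Sum>x\<in>P. c x * fv (ph x) v)" by (rule sum.cong) (simp_all only: fv_ph sum_distrib_left)
    also have "\<dots> = fv (tw.DD d) v" by (rule eq[OF v])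
    finally show ?thesis .
  qed
  from tw.DD_image[OF d eq'] obtain a where a: "\<forall>p\<in>tw.JJ. c' p = a * wt p" by blast
  define g where "g x = c x - a * \<alpha> x" for x
  have g: "(\<Sum>x\<in>P. g x * tm x y) = 0" if y: "y \<in> P" for y
  proof -
    have "c' (bi y) = a * wt (bi y)" using a bi_bij y by (auto simp: bij_betw_def)
    then have "(\<Sum>x\<in>P. c x * tm x y) - a * (\<Sum>x\<in>P. \<alpha> x * tm x y) = 0"
      unfolding c'_def wt_def ib_bi[OF y] by simp
    moreover have "(\<Sum>x\<in>P. g x * tm x y) = (\<Sum>x\<in>P. c x * tm x y - a * (\<alpha> x * tm x y))"
      by (rule sum.cong[OF refl]) (simp only: g_def left_diff_distrib mult.assoc)
    ultimately show ?thesis by (simp only: sum_subtractf sum_distrib_left)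
  qed
  have "g y = 0" if "y \<in> P" for y
    using that
  \<comment> \<open>Downward induction within a block: in the equation of \<open>y\<close> only
    members of larger index could interfere, and these are settled first.\<close>
  proof (induction "n (fst y) - snd y" arbitrary: y rule: less_induct)
    case less
    have "g x * tm x y = (if x = y then g y * tm y y else 0)" if x: "x \<in> P" for x
    proof (cases "x \<noteq> y \<and> tm x y \<noteq> 0")
      case True
      then have xy: "fst x = fst y" "snd y < snd x" by (auto simp: tm_def prod_eq_iff split: if_splits)
      moreover have "snd y < n (fst y)" using less.prems by (auto simp: P_def)
      ultimately have "n (fst x) - snd x < n (fst y) - snd y" by simp
      from less.hyps[OF this x] show ?thesis using True by (simp add: form_apply)
    qed auto
    then have "(\<Sum>x\<in>P. g x * tm x y) = (\<Sum>x\<in>P. if x = y then g y * tm y y else 0)" by (intro sum.cong) auto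
    also have "\<dots> = g y * tm y y" using less.prems finite_P by simp
    finally show ?case using g[OF less.prems] tm_diag[OF less.prems] by simp
  qed
  then show ?thesis unfolding g_def by (intro exI[of _ a]) auto
qed

end

lemma filter_upt_eq: "J \<subseteq> {..<m} \<Longrightarrow> filter (\<lambda>i. i \<in> J) [0..<m] = sorted_list_of_set J"
proof -
  assume "J \<subseteq> {..<m}"
  then have "set (filter (\<lambda>i. i \<in> J) [0..<m]) = J" by auto
  then show ?thesis
    using sorted_list_of_set.idem_if_sorted_distinct[of "filter (\<lambda>i. i \<in> J) [0..<m]"] by (simp add: sorted_wrt_filter)
qed

lemma nths_eq_map: "J \<subseteq> {..<length xs} \<Longrightarrow> nths xs J = map ((!) xs) (sorted_list_of_set J)"
proof -
  assume J: "J \<subseteq> {..<length xs}"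
  let ?l = "filter (\<lambda>i. i \<in> J) [0..<length xs]"
  have "zip xs [0..<length xs] = map (\<lambda>i. (xs ! i, i)) [0..<length xs]"
    by (rule nth_equalityI) auto
  then have "nths xs J = map ((!) xs) ?l" by (simp add: nths_def filter_map comp_def)
  moreover have "?l = sorted_list_of_set J" by (rule filter_upt_eq[OF J])
  ultimately show ?thesis by simp
qed

context veronese_data
begin

abbreviation ln :: "nat \<Rightarrow> nat \<Rightarrow> ratfun" where "ln k \<equiv> lin (W0 k) (W1 k)"

text \<open>The difference serves both cases of the theorem: if the last point is x = infinity, then
  \<open>dtheta 0 (ln q)\<close> is zero.\<close>

definition mem :: "nat \<times> nat \<Rightarrow> form" where
  "mem x = (if snd x = 0 then dtheta 0 (ln (fst x)) - dtheta 0 (ln q) else dtheta (snd x) (ln (fst x)))"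

lemma linv_Y: "t \<in> Y \<Longrightarrow> k \<le> q \<Longrightarrow> linv (W0 k) (W1 k) 0 t \<noteq> 0"
  by (simp add: Y_def)

lemma lin_nonzero:
  assumes "k \<le> q"
  shows "ln k 0 \<noteq> 0"
proof
  assume "ln k 0 = 0"
  then have "inverse (TT 0) * (\<Prod>s\<in>{1..r}. AA (W0 k) (W1 k) s 0) = 0"
    using rsub_lin_0[of "W0 k" "W1 k"] by (simp add: yy.rsub_hom)
  then show False using AA_nonzero[OF EF_nonzero[OF assms]] TT0_nonzero by simp
qed

lemma mem_higher:
  assumes x: "(k, i) \<in> P" and i: "1 \<le> i"
  shows "mem (k, i) \<in> Omega r Y 1" "pb r yy (mem (k, i)) = TrF r (ph (k, i))"
proof -
  have k: "k \<le> q" using x by (simp add: P_def)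
  have mem: "mem (k, i) = dfun (theta i (ln k))" using i by (simp add: mem_def dtheta_def)
  have g: "global_fun r Y (theta i (ln k))"
    unfolding global_fun_def using linv_Y[OF _ k] by (auto intro: theta_fracs theta_local_ring)
  show "mem (k, i) \<in> Omega r Y 1" unfolding mem by (rule Omega_dfun[OF g])
  obtain c where "\<forall>s. theta i (AA (W0 k) (W1 k) s) = (\<Sum>m\<le>i. rconst (c m) * bb (k, m) s)"
    using theta_bb_member[OF x i] by blast
  then have eq: "(\<lambda>s. theta i (AA (W0 k) (W1 k) s)) = (\<lambda>s. \<Sum>m\<le>i. rconst (c m) * bb (k, m) s)" by (intro ext) (rule spec)
  have FF: "(\<lambda>s. theta i (AA (W0 k) (W1 k) s)) \<in> FF Z"
    unfolding eq by (rule FF_sum[OF FF_scale[OF line.bb_FF]])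
  have "pb r yy (mem (k, i)) = dfun (\<Sum>s\<in>{1..r}. theta i (AA (W0 k) (W1 k) s))"
    unfolding mem yy.pb_dfun[OF theta_fracs] rsub_theta_lin[OF EF_nonzero[OF k]] ..
  also have "\<dots> = TrF r (\<lambda>s. rat_pd s (theta i (AA (W0 k) (W1 k) s)))" by (rule dfun_trace[OF FF])
  also have "(\<lambda>s. rat_pd s (theta i (AA (W0 k) (W1 k) s))) = ph (k, i)" using i by (intro ext) (simp add: ph_def)
  finally show "pb r yy (mem (k, i)) = TrF r (ph (k, i))" .
qed

text \<open>A single logarithmic form may have a pole where t_0 vanishes, but the quotient of two
  linear forms and its inverse are both regular on \<open>Y\<close>, so the difference is regular
  there.\<close>

lemma dlog_quotient:
  assumes "f \<noteq> 0" "g \<noteq> 0"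
  shows "fscale (1 / f) (dfun f) - fscale (1 / g) (dfun g) = fscale (g / f) (dfun (f / g))"
proof (rule one_form_eqI)
  have "fscale (1 / f) (dfun f) - fscale (1 / g) (dfun g) = fscale (1 / f) (dfun f) + fscale (- (1 / g)) (dfun g)"
    by (simp only: fscale_neg diff_conv_add_uminus)
  moreover have "one_form (fscale (1 / f) (dfun f) + fscale (- (1 / g)) (dfun g))"
    by (intro one_form_add one_form_fscale one_form_dfun)
  ultimately show "one_form (fscale (1 / f) (dfun f) - fscale (1 / g) (dfun g))" by (simp only:)
  show "one_form (fscale (g / f) (dfun (f / g)))" by (intro one_form_fscale one_form_dfun)
  fix i
  show "(fscale (1 / f) (dfun f) - fscale (1 / g) (dfun g)) {i} = fscale (g / f) (dfun (f / g)) {i}"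
    using assms by (simp add: minus_apply fscale_eq rat_pd_divide) (simp add: field_simps)
qed

lemma mem_residue:
  assumes k: "k < q"
  shows "mem (k, 0) \<in> Omega r Y 1" "pb r yy (mem (k, 0)) = TrF r (ph (k, 0))"
proof -
  let ?g = "ln k 0 / ln q 0" and ?h = "ln q 0 / ln k 0"
  have nz: "ln k 0 \<noteq> 0" "ln q 0 \<noteq> 0" using lin_nonzero[of k] lin_nonzero[of q] k by auto
  have mem: "mem (k, 0) = fscale ?h (dfun ?g)"
    using dlog_quotient[OF nz] by (simp add: mem_def dtheta_def)
  have gl: "global_fun r Y (ln a 0 / ln b 0)" if "a \<le> q" "b \<le> q" for a b
    unfolding global_fun_def using linv_Y[OF _ that(2)] by (auto intro: fracs_closed lin_fracs lin_local_ring)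
  have gg: "global_fun r Y ?g" "global_fun r Y ?h" using k by (auto intro: gl)
  show "mem (k, 0) \<in> Omega r Y 1" unfolding mem by (intro Omega_fscale Omega_dfun gg)
  define a where "a = rconst (F k 0) * inverse (rconst (E q 0))"
  \<comment> \<open>The quotient of the two linear forms in a single variable; the pulled back
    quotient is the product of these, and its logarithmic derivative is a sum of simple
    poles.\<close>
  define X where "X s = a * (rvar s - rconst (pt k))" for s
  have a: "a \<noteq> 0" using F_nonzero[OF k] E_q by (simp add: a_def rconst_eq_0_iff)
  have E0: "rconst (E q 0) \<noteq> 0" using E_q by (simp add: rconst_eq_0_iff)
  have "AA (W0 k) (W1 k) s 0 = X s * AA (W0 q) (W1 q) s 0" for s
    using AA_0[of k "W0 k" "W1 k" s] AA_0[of q "W0 q" "W1 q" s] k E0 by (simp add: X_def a_def)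
  then have "(\<Prod>s\<in>{1..r}. AA (W0 k) (W1 k) s 0) = (\<Prod>s\<in>{1..r}. X s) * (\<Prod>s\<in>{1..r}. AA (W0 q) (W1 q) s 0)"
    by (simp add: prod.distrib)
  moreover have "(\<Prod>s\<in>{1..r}. AA (W0 q) (W1 q) s 0) \<noteq> 0" using AA_nonzero[OF EF_nonzero] by simp
  ultimately have g: "rsub yy ?g = (\<Prod>s\<in>{1..r}. X s)"
    using TT0_nonzero by (simp add: yy.rsub_hom rsub_lin_0)
  have Xnz: "X s \<noteq> 0" for s using a rvar_minus_const_nonzero[of s "pt k"] by (simp add: X_def)
  have "rsub yy ?h = inverse (rsub yy ?g)" by (simp add: yy.rsub_hom)
  then have h: "rsub yy ?h = inverse (\<Prod>s\<in>{1..r}. X s)" unfolding g .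
  have frg: "?g \<in> fracs {1..r}" using gg(1) by (simp add: global_fun_def)
  have "pb r yy (mem (k, 0)) = fscale (rsub yy ?h) (dfun (rsub yy ?g))"
    unfolding mem yy.pb_fscale yy.pb_dfun[OF frg] ..
  also have "\<dots> = TrF r (ph (k, 0))"
  proof (rule TrF_eqI)
    show "one_form (fscale (rsub yy ?h) (dfun (rsub yy ?g)))" by (intro one_form_fscale one_form_dfun)
    fix j
    let ?D = "\<lambda>s. if s = j then bb (k, 1) j else 0"
    have "rat_pd j (X s) = ?D s * X s" for s
    proof (cases "s = j")
      case True
      have "bb (k, 1) j * X j = a" using k rvar_minus_const_nonzero[of j "pt k"] by (simp add: line.bb_def X_def)
      moreover have "rat_pd j a = 0" by (simp add: a_def rat_pd_mult rat_pd_inverse)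
      ultimately show ?thesis using True by (simp add: X_def rat_pd_mult rat_pd_diff rat_pd_rvar)
    next
      case False
      moreover have "rat_pd j a = 0" by (simp add: a_def rat_pd_mult rat_pd_inverse)
      ultimately show ?thesis by (simp add: X_def rat_pd_mult rat_pd_diff rat_pd_rvar)
    qed
    then have "rat_pd j (\<Prod>s\<in>{1..r}. X s) = (\<Sum>s\<in>{1..r}. ?D s) * (\<Prod>s\<in>{1..r}. X s)"
      by (rule rat_pd_prod_log)
    then have "fscale (rsub yy ?h) (dfun (rsub yy ?g)) {j} = (\<Sum>s\<in>{1..r}. ?D s)"
      unfolding h g using Xnz by (simp add: fscale_eq)
    then show "fscale (rsub yy ?h) (dfun (rsub yy ?g)) {j} = (if j \<in> {1..r} then ph (k, 0) j else 0)"
      by (simp add: ph_def)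
  qed
  finally show "pb r yy (mem (k, 0)) = TrF r (ph (k, 0))" .
qed

lemma mem_props:
  assumes "x \<in> P"
  shows "mem x \<in> Omega r Y 1" "pb r yy (mem x) = TrF r (ph x)"
proof -
  obtain k i where x: "x = (k, i)" by (cases x)
  have "mem x \<in> Omega r Y 1 \<and> pb r yy (mem x) = TrF r (ph x)"
  proof (cases "i = 0")
    case True
    then have "k < q" using assms x by (auto simp: P_def)
    then show ?thesis using mem_residue[of k] True x by simp
  next
    case False
    then show ?thesis using mem_higher[of k i] assms x by simp
  qed
  then show "mem x \<in> Omega r Y 1" "pb r yy (mem x) = TrF r (ph x)" by simp_all
qed

text \<open>As the coefficients \<alpha>(k, 0) add up to 0, the logarithmic form of the last block
  can be subtracted from all the others, which removes its own summand.\<close>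

lemma omega_members:
  "(\<Sum>k\<le>q. \<Sum>i<n k. fscale (rconst (\<alpha> (k, i))) (dtheta i (ln k))) = (\<Sum>x\<in>P. fscale (rconst (\<alpha> x)) (mem x))"
proof -
  let ?d = "\<lambda>x. dtheta (snd x) (ln (fst x))"
  have q0: "(q, 0) \<notin> P" by (simp add: P_def)
  have Sig: "(SIGMA k:{..q}. {..<n k}) = insert (q, 0) P" using n_pos[of q] by (auto simp: P_def)
  have "(\<Sum>k\<le>q. \<Sum>i<n k. fscale (rconst (\<alpha> (k, i))) (dtheta i (ln k))) =
    (\<Sum>x\<in>(SIGMA k:{..q}. {..<n k}). fscale (rconst (\<alpha> x)) (?d x))"
    by (subst sum.Sigma) (auto simp: case_prod_unfold)
  also have "\<dots> = fscale (rconst (\<alpha> (q, 0))) (dtheta 0 (ln q)) + (\<Sum>x\<in>P. fscale (rconst (\<alpha> x)) (?d x))"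
    unfolding Sig by (subst sum.insert[OF finite_P q0]) simp
  finally have 1: "(\<Sum>k\<le>q. \<Sum>i<n k. fscale (rconst (\<alpha> (k, i))) (dtheta i (ln k))) =
    fscale (rconst (\<alpha> (q, 0))) (dtheta 0 (ln q)) + (\<Sum>x\<in>P. fscale (rconst (\<alpha> x)) (?d x))" .
  have "(\<Sum>x\<in>P. fscale (rconst (\<alpha> x)) (mem x)) =
    (\<Sum>x\<in>P. fscale (rconst (\<alpha> x)) (?d x) - fscale (rconst (if snd x = 0 then \<alpha> x else 0)) (dtheta 0 (ln q)))"
    by (rule sum.cong) (auto simp: mem_def fscale_diff rconst_simps fscale_simps)
  also have "\<dots> = (\<Sum>x\<in>P. fscale (rconst (\<alpha> x)) (?d x)) - fscale (rconst (\<Sum>x\<in>P. if snd x = 0 then \<alpha> x else 0)) (dtheta 0 (ln q))"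
    unfolding sum_subtractf rconst_hom(8) fscale_sum_left ..
  also have "(\<Sum>x\<in>P. if snd x = 0 then \<alpha> x else 0) = (\<Sum>x\<in>(\<lambda>k. (k, 0)) ` {..<q}. \<alpha> x)"
  proof -
    have "0 < n k" if "k < q" for k using n_pos[of k] that by simp
    then have "{x \<in> P. snd x = 0} = (\<lambda>k. (k, 0)) ` {..<q}" by (auto simp: P_def)
    then show ?thesis using finite_P by (simp add: sum.inter_filter[symmetric])
  qed
  also have "\<dots> = (\<Sum>k<q. \<alpha> (k, 0))" by (subst sum.reindex) (auto simp: inj_on_def)
  also have "\<dots> = - \<alpha> (q, 0)"
    using \<alpha>_sum unfolding lessThan_Suc_atMost[symmetric] sum.lessThan_Suc by (simp add: eq_neg_iff_add_eq_0)
  finally show ?thesis unfolding 1 by (simp add: rconst_hom fscale_neg add.commute)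
qed

text \<open>On the image of the quotient map each linear form is the product of its values at the
  parameters, and these are nonzero off the punctures; at the last block the factor is
  constant.\<close>

lemma Y_point:
  assumes c: "\<And>s. c s \<notin> Z"
  shows "vec (r + 1) (tv c) \<in> Y"
proof -
  have linv: "linv (W0 k) (W1 k) 0 (vec (r + 1) (tv c)) \<noteq> 0" if k: "k \<le> q" for k
  proof -
    let ?a = "fps_nth (W0 k) 0" and ?b = "fps_nth (W1 k) 0"
    have "linv (W0 k) (W1 k) 0 (vec (r + 1) (tv c)) = (\<Sum>i\<le>r. tv c i * (?a ^ (r - i) * ?b ^ i))"
      unfolding linv_0 by (rule sum.cong) auto
    also have "\<dots> = (\<Prod>s\<in>{1..r}. x0 (c s) * ?a + x1 (c s) * ?b)"
      unfolding tv_def tt_identity ..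
    finally have eq: "linv (W0 k) (W1 k) 0 (vec (r + 1) (tv c)) = (\<Prod>s\<in>{1..r}. x0 (c s) * ?a + x1 (c s) * ?b)" .
    have "x0 (c s) * ?a + x1 (c s) * ?b \<noteq> 0" for s
    proof -
      have "x0 (c s) * ?a + x1 (c s) * ?b = E k 0 + F k 0 * c s"
        unfolding x0_def x1_def E_def F_def by (simp only: ring_distribs mult_ac add_ac)
      moreover have "E k 0 + F k 0 * c s \<noteq> 0"
      proof (cases "k < q")
        case True
        then have "c s \<noteq> pt k" using c[of s] by auto
        moreover have "E k 0 = F k 0 * - pt k" using F_nonzero[OF True] by (simp add: pt_def)
        then have "E k 0 + F k 0 * c s = F k 0 * (c s - pt k)" by (simp add: right_diff_distrib)
        ultimately show ?thesis using F_nonzero[OF True] by simp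
      next
        case False
        then show ?thesis using F_q E_q k by (simp add: form_apply)
      qed
      ultimately show ?thesis by simp
    qed
    then show ?thesis unfolding eq by simp
  qed
  have "vec (r + 1) (tv c) \<noteq> 0\<^sub>v (r + 1)"
  proof
    assume "vec (r + 1) (tv c) = 0\<^sub>v (r + 1)"
    then have "linv (W0 q) (W1 q) 0 (vec (r + 1) (tv c)) = 0" unfolding linv_def by (simp add: form_apply)
    then show False using linv[of q] by simp
  qed
  then show ?thesis using linv unfolding Y_def by simp
qed

text \<open>On the line the members span and satisfy one relation with coefficients \<alpha>, namely
  that \<open>DD\<close> of the constant 1 is the twisting form. Omitting a member with nonzero
  coefficient therefore leaves a basis.\<close>

theorem veronese_basis:
  assumes \<omega>: "\<omega> = (\<Sum>k\<le>q. \<Sum>i<n k. fscale (rconst (\<alpha> (k, i))) (dtheta i (ln k)))"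
    and xs: "distinct xs" "set xs = P - {xe}" "length xs = K" and xe: "xe \<in> P" "\<alpha> xe \<noteq> 0" and K: "r \<le> K"
  defines "\<psi> \<equiv> map mem xs"
  shows "set \<psi> \<subseteq> Omega r Y 1 \<and>
    (\<forall>J\<in>{J. J \<subseteq> {..<K} \<and> card J = r}. wedge_list (nths \<psi> J) \<in> Omega r Y r) \<and>
    inj_on (\<lambda>J. coh_class r Y \<omega> r (wedge_list (nths \<psi> J))) {J. J \<subseteq> {..<K} \<and> card J = r} \<and>
    vectorspace.basis class_ring (cohomology r Y \<omega> r)
      ((\<lambda>J. coh_class r Y \<omega> r (wedge_list (nths \<psi> J))) ` {J. J \<subseteq> {..<K} \<and> card J = r})"
proof -
  define \<phi> where "\<phi> i = (if i < K then ph (xs ! i) else (\<lambda>_. 0))" for i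
  define \<Phi> where "\<Phi> i = (if i < K then mem (xs ! i) else 0)" for i
  have bij: "bij_betw ((!) xs) {..<K} (P - {xe})"
    using bij_betw_nth[OF xs(1), of "{..<K}" "P - {xe}"] xs(2,3) by simp
  have nth_P: "xs ! i \<in> P" if "i < K" for i using nth_mem[of i xs] that xs by auto
  have om1: "tw.DD (\<lambda>_. 1) j = tw.om j" for j by (simp add: tw.DD_def)
  have DD_lin: "tw.DD (\<lambda>j. d j + rconst a * 1) j = tw.DD d j + rconst a * tw.om j" for d a j
    by (simp only: tw.DD_add tw.DD_scale om1)
  interpret sc: sym_cohomology r e0 e1 f0 f1 q pt n wt Y \<omega> K \<phi> \<Phi>
  proof
    show "vec (r + 1) (tv c) \<in> Y" if "\<And>s. c s \<notin> pt ` {..<q}" for c using that by (rule Y_point)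
    show "\<exists>\<tau>. global_fun r Y \<tau> \<and> rsub yy \<tau> = (\<Sum>s\<in>{1..r}. bb p s)" if "p \<in> line.II" "0 < snd p" for p
      using trace_bb[of "fst p" "snd p"] that by (auto simp: line.II_def)
    show "\<exists>T\<in>Omega r Y 1. pb r yy T = TrF r (bb (k, 1))" if "k < q" for k
    proof -
      have "ph (k, 0) = bb (k, 1)" by (rule ext) (simp add: ph_def)
      then show ?thesis using mem_residue[OF that] by metis
    qed
    show "\<omega> \<in> Omega r Y 1"
      unfolding \<omega> omega_members by (intro Omega_sum Omega_closed(3) mem_props(1))
    have "pb r yy \<omega> = (\<Sum>x\<in>P. fscale (rconst (\<alpha> x)) (TrF r (ph x)))"
      unfolding \<omega> omega_members yy.pb_sum yy.pb_fscale yy.rsub_rconst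
      by (rule sum.cong) (simp_all add: mem_props(2))
    also have "\<dots> = TrF r tw.om" unfolding TrF_lincomb by (simp only: om_eq[symmetric])
    finally show "pb r yy \<omega> = TrF r tw.om" .
    show "\<phi> i \<in> FF (pt ` {..<q})" for i by (cases "i < K") (simp_all add: \<phi>_def ph_FF nth_P FF_zero)
    show "\<Phi> i \<in> Omega r Y 1" for i
      by (cases "i < K") (simp_all add: \<Phi>_def mem_props(1) nth_P Omega_closed(1))
    show "pb r yy (\<Phi> i) = TrF r (\<phi> i)" for i
    proof (cases "i < K")
      case False
      have "TrF r (\<lambda>_. 0) = 0" by (rule ext) (simp add: TrF_def zero_fun_apply)
      then show ?thesis using False by (simp add: \<phi>_def \<Phi>_def yy.pb_zero)
    qed (simp add: \<phi>_def \<Phi>_def mem_props(2) nth_P)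
    show "r \<le> K" by (rule K)
  next
    fix f assume "f \<in> FF (pt ` {..<q})"
    then obtain c d where d: "d \<in> FF Z" and f: "f = (\<lambda>j. (\<Sum>x\<in>P. rconst (c x) * ph x j) + tw.DD d j)"
      using ph_span by blast
    \<comment> \<open>The multiple of the relation that eliminates the omitted member; it is
      compensated by adding the constant \<open>t\<close> to the primitive.\<close>
    define t where "t = c xe / \<alpha> xe"
    define c' where "c' x = c x - t * \<alpha> x" for x
    have t: "c' xe = 0" using xe(2) by (simp add: c'_def t_def)
    have "f j = (\<Sum>i<K. rconst (c' (xs ! i)) * \<phi> i j) + tw.DD (\<lambda>j. d j + rconst t * 1) j" for j
    proof -
      have "(\<Sum>i<K. rconst (c' (xs ! i)) * \<phi> i j) = (\<Sum>i<K. rconst (c' (xs ! i)) * ph (xs ! i) j)"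
        by (rule sum.cong) (simp_all add: \<phi>_def)
      also have "\<dots> = (\<Sum>x\<in>P - {xe}. rconst (c' x) * ph x j)" by (rule sum.reindex_bij_betw[OF bij])
      also have "\<dots> = (\<Sum>x\<in>P. rconst (c' x) * ph x j)"
        using t finite_P xe(1) by (simp add: sum.remove rconst_simps)
      also have "\<dots> = (\<Sum>x\<in>P. rconst (c x) * ph x j - rconst t * (rconst (\<alpha> x) * ph x j))"
        by (rule sum.cong[OF refl]) (simp only: c'_def rconst_hom left_diff_distrib mult.assoc)
      also have "\<dots> = (\<Sum>x\<in>P. rconst (c x) * ph x j) - rconst t * tw.om j"
        by (simp only: sum_subtractf sum_distrib_left om_eq)
      finally show ?thesis using fun_cong[OF f, of j] by (simp only: DD_lin) simp
    qed
    then have "f = (\<lambda>j. (\<Sum>i<K. rconst (c' (xs ! i)) * \<phi> i j) + tw.DD (\<lambda>j. d j + rconst t * 1) j)" by (rule ext)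
    moreover have "(\<lambda>j. d j + rconst t * 1) \<in> FF (pt ` {..<q})" by (rule FF.add[OF d FF_scale[OF FF_one]])
    ultimately show "\<exists>c. \<exists>d\<in>FF (pt ` {..<q}). f = (\<lambda>j. (\<Sum>i<K. rconst (c i) * \<phi> i j) + tw.DD d j)"
      by (intro exI[of _ "\<lambda>i. c' (xs ! i)"] bexI)
  next
    fix d c
    assume d: "d \<in> FF (pt ` {..<q})" and eq: "\<And>v. v \<notin> pt ` {..<q} \<Longrightarrow> (\<Sum>i<K. c i * fv (\<phi> i) v) = fv (tw.DD d) v"
    \<comment> \<open>Extension by 0 at the omitted member. By \<open>ph_relation\<close> it is a
      multiple of \<alpha>; since \<alpha> is nonzero at this member, the multiple is 0.\<close>
    define c' where "c' x = (if x = xe then 0 else c (inv_into {..<K} ((!) xs) x))" for x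
    have c': "c' (xs ! i) = c i" if "i < K" for i
    proof -
      have "inv_into {..<K} ((!) xs) (xs ! i) = i"
        using inv_into_f_f[OF bij_betw_imp_inj_on[OF bij], of i] that by simp
      moreover have "xs ! i \<noteq> xe" using nth_mem[of i xs] that xs by auto
      ultimately show ?thesis by (simp add: c'_def)
    qed
    have eq': "(\<Sum>x\<in>P. c' x * fv (ph x) v) = fv (tw.DD d) v" if v: "v \<notin> Z" for v
    proof -
      have "(\<Sum>i<K. c i * fv (\<phi> i) v) = (\<Sum>i<K. c' (xs ! i) * fv (ph (xs ! i)) v)"
        by (rule sum.cong) (simp_all add: \<phi>_def c')
      also have "\<dots> = (\<Sum>x\<in>P - {xe}. c' x * fv (ph x) v)" by (rule sum.reindex_bij_betw[OF bij])
      also have "\<dots> = (\<Sum>x\<in>P. c' x * fv (ph x) v)"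
        using finite_P xe(1) sum.remove[of P xe "\<lambda>x. c' x * fv (ph x) v"] by (simp add: c'_def[of xe] form_apply)
      finally show ?thesis using eq[OF v] by simp
    qed
    from ph_relation[OF d eq'] obtain a where a: "\<forall>x\<in>P. c' x = a * \<alpha> x" by blast
    then have "a = 0" using xe by (auto simp: c'_def)
    then have "c' x = 0" if "x \<in> P" for x using a that by (simp add: form_apply)
    then show "\<forall>i<K. c i = 0" using c' nth_P by metis
  qed
  have nths: "wedge_list (nths \<psi> J) = EE \<Phi> J" if "J \<subseteq> {..<K}" for J
  proof -
    have "finite J" using that finite_subset by blast
    then have eq: "map ((!) \<psi>) (sorted_list_of_set J) = map \<Phi> (sorted_list_of_set J)"
      using that xs(3) by (auto simp: \<psi>_def \<Phi>_def)
    have "nths \<psi> J = map ((!) \<psi>) (sorted_list_of_set J)"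
      by (rule nths_eq_map) (use that xs(3) in \<open>simp add: \<psi>_def\<close>)
    then show ?thesis unfolding EE_def eq by (simp only:)
  qed
  have "set \<psi> \<subseteq> Omega r Y 1" using xs(2) mem_props(1) by (auto simp: \<psi>_def)
  moreover have "\<forall>J\<in>sc.JS. wedge_list (nths \<psi> J) \<in> Omega r Y r"
  proof
    fix J assume J: "J \<in> sc.JS"
    then have "wedge_list (nths \<psi> J) = EE \<Phi> J" using nths by simp
    then show "wedge_list (nths \<psi> J) \<in> Omega r Y r"
      unfolding EE_def using sc.Omega_wedge_Phi[OF sc.sl_props(2)[OF J]] by simp
  qed
  moreover have "inj_on (\<lambda>J. coh_class r Y \<omega> r (wedge_list (nths \<psi> J))) sc.JS \<longleftrightarrow> inj_on (\<lambda>J. coh_class r Y \<omega> r (EE \<Phi> J)) sc.JS"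
    by (rule inj_on_cong) (simp add: nths)
  moreover have "(\<lambda>J. coh_class r Y \<omega> r (wedge_list (nths \<psi> J))) ` sc.JS = (\<lambda>J. coh_class r Y \<omega> r (EE \<Phi> J)) ` sc.JS"
    by (rule image_cong) (simp_all add: nths)
  ultimately show ?thesis using sc.cohomology_top_basis by simp
qed

end

section \<open>From the matrix to the data on the line\<close>

subsection \<open>Blocks of the matrices\<close>

lemma det_two:
  fixes A :: "'a::comm_ring_1 mat"
  assumes "A \<in> carrier_mat 2 2"
  shows "det A = A $$ (0, 0) * A $$ (1, 1) - A $$ (0, 1) * A $$ (1, 0)"
proof -
  have "det (mat_delete A 0 j) = A $$ (1, 1 - j)" if "j < 2" for j
  proof -
    have "mat_delete A 0 j \<in> carrier_mat 1 1" using assms by (auto simp: mat_delete_def)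
    moreover have "mat_delete A 0 j $$ (0, 0) = A $$ (1, 1 - j)"
      using assms that by (cases j) (auto simp: mat_delete_def One_nat_def)
    ultimately show ?thesis by (simp add: det_single)
  qed
  then have "det A = (\<Sum>j<2. A $$ (0, j) * ((-1) ^ j * A $$ (1, 1 - j)))"
    using laplace_expansion_row[OF assms, of 0] by (simp add: cofactor_def)
  then show ?thesis by (simp add: numeral_2_eq_2 One_nat_def)
qed

lemma concat_nth_block:
  assumes "\<And>k. k < length lam \<Longrightarrow> length (f k) = lam ! k" "k < length lam" "j < lam ! k"
  shows "concat (map f [0..<length lam]) ! (sum_list (take k lam) + j) = f k ! j"
    "sum_list (take k lam) + j < length (concat (map f [0..<length lam]))"
proof -
  have split: "[0..<length lam] = [0..<k] @ k # [Suc k..<length lam]"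
    using assms(2) by (metis le_add1 less_imp_le_nat plus_nat.add_0 upt_add_eq_append upt_conv_Cons less_imp_add_positive)
  have "map (\<lambda>i. length (f i)) [0..<k] = take k lam"
    using assms(1,2) by (intro nth_equalityI) auto
  then have len: "length (concat (map f [0..<k])) = sum_list (take k lam)"
    by (simp add: length_concat comp_def)
  show "concat (map f [0..<length lam]) ! (sum_list (take k lam) + j) = f k ! j"
    "sum_list (take k lam) + j < length (concat (map f [0..<length lam]))"
    unfolding split using assms by (simp_all add: nth_append len[symmetric])
qed

lemma concat_map_filter: "concat (map f xs) = concat (map f (filter (\<lambda>x. f x \<noteq> []) xs))"
  by (induction xs) auto

lemma take_cols: "m \<le> dim_col A \<Longrightarrow> take m (cols A) = map (col A) [0..<m]"
  by (simp add: cols_def take_map)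

lemma block_dim [simp]: "dim_row (block lam z k) = dim_row z" "dim_col (block lam z k) = lam ! k"
  by (simp_all add: block_def)

lemma generic_between:
  assumes z: "z \<in> generic_stratum 2 lam" and k: "k < k'" "k' < length lam" and pos: "\<forall>n\<in>set lam. 1 \<le> n"
  shows "block lam z k $$ (0, 0) * block lam z k' $$ (1, 0) - block lam z k' $$ (0, 0) * block lam z k $$ (1, 0) \<noteq> 0"
proof -
  \<comment> \<open>One column from each of the blocks \<open>k\<close> and \<open>k'\<close>, so
    the condition of the stratum is the nonvanishing of the determinant of their first
    columns.\<close>
  let ?\<mu> = "(replicate (length lam) (0 :: nat))[k := 1, k' := 1]"
  let ?g = "\<lambda>i. take (?\<mu> ! i) (cols (block lam z i))"
  have l: "1 \<le> lam ! i" if "i < length lam" for i using pos nth_mem[OF that] by blast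
  have dz: "dim_row z = 2" using z by (auto simp: generic_stratum_def)
  have \<mu>: "?\<mu> ! i = (if i = k \<or> i = k' then 1 else 0)" if "i < length lam" for i
    using that k by (simp add: nth_list_update)
  have "sum_list ?\<mu> = 2" using k by (simp add: sum_list_update)
  then have d: "det (sub_columns lam z ?\<mu>) \<noteq> 0"
    using z l \<mu> unfolding generic_stratum_def by auto
  have g: "?g i = (if i = k \<or> i = k' then [col (block lam z i) 0] else [])" if "i < length lam" for i
  proof -
    have "take 1 (cols (block lam z i)) = [col (block lam z i) 0]"
      using l[OF that] take_cols[of 1 "block lam z i"] by (simp add: One_nat_def)
    then show ?thesis unfolding \<mu>[OF that] by simp
  qed
  have "concat (map ?g [0..<length lam]) = concat (map ?g (filter (\<lambda>i. i \<in> {k, k'}) [0..<length lam]))"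
    by (subst concat_map_filter) (intro arg_cong[where f = concat] map_cong filter_cong refl; use g in \<open>auto split: if_splits\<close>)
  also have "filter (\<lambda>i. i \<in> {k, k'}) [0..<length lam] = sorted_list_of_set {k, k'}"
    by (rule filter_upt_eq) (use k in auto)
  also have "sorted_list_of_set {k, k'} = [k, k']"
    using sorted_list_of_set.idem_if_sorted_distinct[of "[k, k']"] k by simp
  also have "concat (map ?g [k, k']) = [col (block lam z k) 0, col (block lam z k') 0]"
    using g[of k] g[of k'] k by simp
  finally have s: "sub_columns lam z ?\<mu> = mat_of_cols 2 [col (block lam z k) 0, col (block lam z k') 0]"
    by (simp add: sub_columns_def dz)
  have c: "mat_of_cols 2 [v, v'] \<in> carrier_mat 2 2" for v v' :: "complex vec"
    using mat_of_cols_carrier(1)[of 2 "[v, v']"] by (simp add: numeral_2_eq_2)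
  show ?thesis using d l[of k] l[of k'] k dz unfolding s det_two[OF c]
    by (simp add: mat_of_cols_index mult.commute)
qed

lemma generic_within:
  assumes z: "z \<in> generic_stratum 2 lam" and k: "k < length lam" "2 \<le> lam ! k"
  shows "block lam z k $$ (0, 0) * block lam z k $$ (1, 1) - block lam z k $$ (0, 1) * block lam z k $$ (1, 0) \<noteq> 0"
proof -
  \<comment> \<open>Both columns are taken from the same block.\<close>
  let ?\<mu> = "(replicate (length lam) (0 :: nat))[k := 2]"
  let ?g = "\<lambda>i. take (?\<mu> ! i) (cols (block lam z i))"
  have dz: "dim_row z = 2" using z by (auto simp: generic_stratum_def)
  have \<mu>: "?\<mu> ! i = (if i = k then 2 else 0)" if "i < length lam" for i
    using that k by (simp add: nth_list_update)
  have "sum_list ?\<mu> = 2" using k by (simp add: sum_list_update)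
  then have d: "det (sub_columns lam z ?\<mu>) \<noteq> 0"
    using z k \<mu> unfolding generic_stratum_def by auto
  have g: "?g i = (if i = k then [col (block lam z i) 0, col (block lam z i) 1] else [])" if "i < length lam" for i
    using that k by (simp add: \<mu> take_cols numeral_2_eq_2 One_nat_def)
  have "concat (map ?g [0..<length lam]) = concat (map ?g (filter (\<lambda>i. i \<in> {k}) [0..<length lam]))"
    by (subst concat_map_filter) (intro arg_cong[where f = concat] map_cong filter_cong refl; use g in \<open>auto split: if_splits\<close>)
  also have "filter (\<lambda>i. i \<in> {k}) [0..<length lam] = sorted_list_of_set {k}"
    by (rule filter_upt_eq) (use k in auto)
  also have "concat (map ?g (sorted_list_of_set {k})) = [col (block lam z k) 0, col (block lam z k) 1]"
    using g[of k] k by simp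
  finally have s: "sub_columns lam z ?\<mu> = mat_of_cols 2 [col (block lam z k) 0, col (block lam z k) 1]"
    by (simp add: sub_columns_def dz)
  have c: "mat_of_cols 2 [v, v'] \<in> carrier_mat 2 2" for v v' :: "complex vec"
    using mat_of_cols_carrier(1)[of 2 "[v, v']"] by (simp add: numeral_2_eq_2)
  show ?thesis using d k dz unfolding s det_two[OF c]
    by (simp add: mat_of_cols_index mult.commute)
qed

text \<open>As a power series in T, a row turns the sums defining the Veronese map into coefficients
  of products of powers.\<close>

definition row_fps :: "complex mat \<Rightarrow> nat \<Rightarrow> complex fps" where
  "row_fps B i = Abs_fps (\<lambda>j. if j < dim_col B then B $$ (i, j) else 0)"

text \<open>Multiplying out \<open>r\<close> power series, \<open>r - i\<close> equal to the upper
  row and \<open>i\<close> equal to the lower one, sums over exactly the index tuples of the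
  definition.\<close>

lemma veronese_block_entry:
  assumes r: "0 < r" and i: "i \<le> r" and j: "j < dim_col B"
  shows "veronese_block r B $$ (i, j) = fps_nth (row_fps B 0 ^ (r - i) * row_fps B 1 ^ i) j"
proof -
  define A where "A s = (if s < r - i then row_fps B 0 else row_fps B 1)" for s
  have split: "{0..r - 1} = {..<r - i} \<union> {r - i..<r}" "{..<r - i} \<inter> {r - i..<r} = {}" using r by auto
  have "prod A {0..r - 1} = prod A {..<r - i} * prod A {r - i..<r}"
    unfolding split(1) by (rule prod.union_disjoint) (use split in auto)
  also have "\<dots> = row_fps B 0 ^ (r - i) * row_fps B 1 ^ i" using i by (simp add: A_def)
  finally have "fps_nth (row_fps B 0 ^ (r - i) * row_fps B 1 ^ i) j =
      (\<Sum>v\<in>natpermute j r. \<Prod>s\<in>{0..r - 1}. fps_nth (A s) (v ! s))"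
    using fps_prod_nth[of A "r - 1" j] r by simp
  \<comment> \<open>Entries of a tuple with sum \<open>j\<close> are at most \<open>j\<close>, hence
    automatically below the number of columns.\<close>
  also have "natpermute j r = {js. length js = r \<and> set js \<subseteq> {..<dim_col B} \<and> sum_list js = j}"
    using j member_le_sum_list unfolding natpermute_def by (fastforce dest: member_le_sum_list)
  also have "(\<Sum>js\<in>\<dots>. \<Prod>s\<in>{0..r - 1}. fps_nth (A s) (js ! s)) =
    (\<Sum>js\<in>{js. length js = r \<and> set js \<subseteq> {..<dim_col B} \<and> sum_list js = j}.
       (\<Prod>s<r - i. B $$ (0, js ! s)) * (\<Prod>s\<in>{r - i..<r}. B $$ (1, js ! s)))"
  proof (rule sum.cong[OF refl])
    fix js assume "js \<in> {js. length js = r \<and> set js \<subseteq> {..<dim_col B} \<and> sum_list js = j}"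
    then have "length js = r" "set js \<subseteq> {..<dim_col B}" by simp_all
    then have js: "js ! s < dim_col B" if "s < r" for s using nth_mem[of s js] that by blast
    have "(\<Prod>s\<in>{0..r - 1}. fps_nth (A s) (js ! s)) =
      (\<Prod>s<r - i. fps_nth (A s) (js ! s)) * (\<Prod>s\<in>{r - i..<r}. fps_nth (A s) (js ! s))"
      unfolding split(1) by (rule prod.union_disjoint) (use split in auto)
    also have "(\<Prod>s<r - i. fps_nth (A s) (js ! s)) = (\<Prod>s<r - i. B $$ (0, js ! s))"
      by (rule prod.cong) (use js in \<open>auto simp: A_def row_fps_def\<close>)
    also have "(\<Prod>s\<in>{r - i..<r}. fps_nth (A s) (js ! s)) = (\<Prod>s\<in>{r - i..<r}. B $$ (1, js ! s))"
      by (rule prod.cong) (use js in \<open>auto simp: A_def row_fps_def\<close>)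
    finally show "(\<Prod>s\<in>{0..r - 1}. fps_nth (A s) (js ! s)) =
      (\<Prod>s<r - i. B $$ (0, js ! s)) * (\<Prod>s\<in>{r - i..<r}. B $$ (1, js ! s))" .
  qed
  also have "\<dots> = veronese_block r B $$ (i, j)" using i j by (simp add: veronese_block_def)
  finally show ?thesis by simp
qed

lemma veronese_col:
  assumes r: "0 < r" and k: "k < length lam" and j: "j < lam ! k" and i: "i \<le> r"
  shows "col (block lam (veronese r lam z) k) j $ i =
    fps_nth (row_fps (block lam z k) 0 ^ (r - i) * row_fps (block lam z k) 1 ^ i) j"
proof -
  let ?f = "\<lambda>k. cols (veronese_block r (block lam z k))"
  have len: "length (?f k) = lam ! k" for k by (simp add: veronese_block_def)
  note c = concat_nth_block[of lam ?f k j, OF len k j]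
  have "col (block lam (veronese r lam z) k) j $ i = veronese r lam z $$ (i, sum_list (take k lam) + j)"
    using i j by (simp add: block_def veronese_def)
  also have "\<dots> = ?f k ! j $ i" unfolding veronese_def using c i by (simp add: mat_of_cols_index)
  also have "\<dots> = veronese_block r (block lam z k) $$ (i, j)"
    using i j by (simp add: veronese_block_def)
  finally show ?thesis using veronese_block_entry[OF r i, of j "block lam z k"] j by simp
qed

context sym_param
begin

lemma yw_lin:
  assumes k: "k < length lam" and j: "j < lam ! k"
  shows "yw r lam (veronese r lam z) k j = lin (row_fps (block lam z k) 0) (row_fps (block lam z k) 1) j"
proof -
  have d: "dim_row (veronese r lam z) = r + 1" by (simp add: veronese_def)
  have "yw r lam (veronese r lam z) k j =
    (\<Sum>i\<in>{0..<r + 1}. ycoord i * rconst (col (block lam (veronese r lam z) k) j $ i))"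
    using j d by (simp add: yw_def scalar_prod_def)
  also have "\<dots> = (\<Sum>i\<le>r. ycoord i * rconst (fps_nth (row_fps (block lam z k) 0 ^ (r - i) * row_fps (block lam z k) 1 ^ i) j))"
    by (rule sum.cong) (auto simp: veronese_col[OF r_pos k j])
  finally show ?thesis by (simp add: lin_def)
qed

lemma linv_hyperplane:
  assumes k: "k < length lam" and j: "0 < lam ! k" and t: "t \<in> carrier_vec (r + 1)"
  shows "t \<bullet> col (block lam (veronese r lam z) k) 0 = linv (row_fps (block lam z k) 0) (row_fps (block lam z k) 1) 0 t"
proof -
  have d: "dim_row (veronese r lam z) = r + 1" by (simp add: veronese_def)
  have "t \<bullet> col (block lam (veronese r lam z) k) 0 =
    (\<Sum>i\<in>{0..<r + 1}. t $ i * col (block lam (veronese r lam z) k) 0 $ i)"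
    using d by (simp add: scalar_prod_def)
  also have "\<dots> = (\<Sum>i\<le>r. t $ i * fps_nth (row_fps (block lam z k) 0 ^ (r - i) * row_fps (block lam z k) 1 ^ i) 0)"
    by (rule sum.cong) (auto simp: veronese_col[OF r_pos k j])
  finally show ?thesis by (simp add: linv_def)
qed

lemma dtheta_lin:
  assumes k: "k < length lam" and i: "i < lam ! k"
  shows "dtheta i (yw r lam (veronese r lam z) k) = dtheta i (lin (row_fps (block lam z k) 0) (row_fps (block lam z k) 1))"
proof -
  have "theta i (yw r lam (veronese r lam z) k) = theta i (lin (row_fps (block lam z k) 0) (row_fps (block lam z k) 1))"
    by (rule theta_cong) (use yw_lin[OF k] i in auto)
  moreover have "yw r lam (veronese r lam z) k 0 = lin (row_fps (block lam z k) 0) (row_fps (block lam z k) 1) 0"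
    by (rule yw_lin[OF k]) (use i in simp)
  ultimately show ?thesis unfolding dtheta_def by (simp only:)
qed

text \<open>If the lower entry of the first column is 0, only the coordinate t_0 enters the linear
  form, which is then constant in the affine coordinates.\<close>

lemma dtheta_0_infinity:
  assumes "fps_nth W1 0 = 0"
  shows "dtheta 0 (lin W0 W1) = 0"
proof -
  have z: "fps_nth (W0 ^ (r - i) * W1 ^ i) 0 = 0" if "i \<noteq> 0" for i
    using assms that by (simp add: fps_mult_nth_0 fps_nth_power_0)
  have "lin W0 W1 0 = (\<Sum>i\<le>r. if i = 0 then rconst (fps_nth W0 0 ^ r) else 0)"
    unfolding lin_def
  proof (intro sum.cong refl)
    fix i
    show "ycoord i * rconst (fps_nth (W0 ^ (r - i) * W1 ^ i) 0) = (if i = 0 then rconst (fps_nth W0 0 ^ r) else 0)"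
    proof (cases "i = 0")
      case True
      then show ?thesis by (simp add: ycoord_def fps_nth_power_0)
    next
      case False
      then show ?thesis by (simp only: z[OF False] rconst_simps mult_zero_right if_False)
    qed
  qed
  then have c: "lin W0 W1 0 = rconst (fps_nth W0 0 ^ r)" by simp
  have "dfun (rconst a) = 0" for a by (rule one_form_eqI[OF one_form_dfun]) (simp_all add: one_form_def zero_fun_apply)
  then show ?thesis unfolding dtheta_def c by (simp add: fscale_simps)
qed

end

declare form_apply [simp]

lemma concat_length_upt: "length (concat (map (\<lambda>k. map (f k) [1..<g k]) [0..<m])) = (\<Sum>k<m. g k - 1)"
  by (induction m) (simp_all add: length_concat)

lemma remove_nth:
  assumes "distinct xs" "e < length xs"
  shows "distinct (take e xs @ drop (Suc e) xs)" "set (take e xs @ drop (Suc e) xs) = set xs - {xs ! e}"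
    "length (take e xs @ drop (Suc e) xs) = length xs - 1"
proof -
  have xs: "xs = take e xs @ xs ! e # drop (Suc e) xs" by (rule id_take_nth_drop[OF assms(2)])
  have "distinct (take e xs @ xs ! e # drop (Suc e) xs)" using assms(1) xs by simp
  moreover have "set xs = set (take e xs @ xs ! e # drop (Suc e) xs)" using xs by simp
  ultimately show "distinct (take e xs @ drop (Suc e) xs)" "set (take e xs @ drop (Suc e) xs) = set xs - {xs ! e}"
    by auto
  show "length (take e xs @ drop (Suc e) xs) = length xs - 1" using assms(2) by simp
qed

theorem proposition5p3:
  fixes r N e :: nat
    and lam :: "nat list"
    and z w :: "complex mat"
    and \<alpha> :: "complex vec"
    and Y :: "complex vec set"
    and \<omega> :: form
    and L :: "(complex \<times> form) list"
    and \<psi> :: "form list"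
  assumes r: "0 < r" "r + 1 < N"
    and lam: "sum_list lam = N" "\<forall>n\<in>set lam. 1 \<le> n"
    and z: "z \<in> generic_stratum 2 lam"
    and w: "w = veronese r lam z"
    and Y: "Y = hyperplane_complement r lam w"
    and \<alpha>: "\<alpha> \<in> carrier_vec N"
    and \<alpha>_sum: "(\<Sum>k<length lam. block_entry lam \<alpha> k 0) = 0"
    and \<alpha>_generic: "\<forall>k<length lam.
      (lam ! k = 1 \<longrightarrow> block_entry lam \<alpha> k (lam ! k - 1) \<notin> \<int>) \<and>
      (lam ! k > 1 \<longrightarrow> block_entry lam \<alpha> k (lam ! k - 1) \<noteq> 0)"
    and \<omega>: "\<omega> = omega r lam w \<alpha>"
    and L: "(\<forall>k<length lam. p_point lam z k \<noteq> infinity_point) \<and> L = members_a r lam w \<alpha> \<or>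
            p_point lam z (length lam - 1) = infinity_point \<and> L = members_b r lam w \<alpha>"
    and omitted: "e < length L" "fst (L ! e) \<noteq> 0"
    and \<psi>: "\<psi> = map snd (take e L @ drop (Suc e) L)"
  shows "length \<psi> = N - 2 \<and>
    set \<psi> \<subseteq> Omega r Y 1 \<and>
    (\<forall>J\<in>{J. J \<subseteq> {..<N - 2} \<and> card J = r}. wedge_list (nths \<psi> J) \<in> Omega r Y r) \<and>
    inj_on (\<lambda>J. coh_class r Y \<omega> r (wedge_list (nths \<psi> J))) {J. J \<subseteq> {..<N - 2} \<and> card J = r} \<and>
    vectorspace.basis class_ring (cohomology r Y \<omega> r)
      ((\<lambda>J. coh_class r Y \<omega> r (wedge_list (nths \<psi> J))) ` {J. J \<subseteq> {..<N - 2} \<and> card J = r})"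
proof -
  define q where "q = length lam - 1"
  have "lam \<noteq> []" using lam r by auto
  then have len: "length lam = Suc q" by (simp add: q_def)
  have lt: "k < length lam \<longleftrightarrow> k \<le> q" for k using len by auto
  have lt': "{..<length lam} = {..q}" using len by auto
  have pos: "1 \<le> lam ! k" if "k \<le> q" for k using lam(2) nth_mem[of k lam] that lt by blast
  have pos0: "0 < lam ! k" if "k \<le> q" for k using pos[OF that] by simp
  define W where "W i k = row_fps (block lam z k) i" for i k
  define n where "n k = lam ! k" for k
  define A where "A x = block_entry lam \<alpha> (fst x) (snd x)" for x
  let ?a = "\<lambda>k j. fps_nth (W 0 k) j" and ?b = "\<lambda>k j. fps_nth (W 1 k) j"
  have Wn: "fps_nth (W i k) j = block lam z k $$ (i, j)" if "j < lam ! k" for i k j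
    using that by (simp add: W_def row_fps_def)
  have between: "?a k 0 * ?b k' 0 - ?a k' 0 * ?b k 0 \<noteq> 0" if "k < k'" "k' \<le> q" for k k'
    using generic_between[OF z that(1) _ lam(2)] that lt[of k'] pos[of k] pos[of k'] by (simp add: Wn)
  have within: "?a k 0 * ?b k 1 - ?a k 1 * ?b k 0 \<noteq> 0" if "k \<le> q" "2 \<le> lam ! k" for k
    using generic_within[OF z, of k] that lt[of k] by (simp add: Wn)
  define a b where "a = ?a q 0" and "b = ?b q 0"
  have ab: "a \<noteq> 0 \<or> b \<noteq> 0"
  proof (cases "q = 0")
    \<comment> \<open>With a single block there is no second point to compare with, but
      \<open>N > 2\<close> provides two columns.\<close>
    case True
    then obtain m where "lam = [m]" using len by (cases lam) auto
    then have "2 \<le> lam ! q" using lam(1) r True by simp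
    then show ?thesis using within[of q] by (auto simp: a_def b_def)
  next
    case False
    then show ?thesis using between[of 0 q] by (auto simp: a_def b_def)
  qed
  \<comment> \<open>These constants put \<open>p\<close> of the last block at the parameter value \<open>\<infinity>\<close>.\<close>
  define e0 e1 :: complex where "e0 = (if a = 0 then 0 else 1)" and "e1 = (if a = 0 then 1 else 0)"
  have det: "e0 * a - e1 * (- b) \<noteq> 0" using ab by (auto simp: e0_def e1_def)
  \<comment> \<open>The vector with entries \<open>- b\<close> and \<open>a\<close> annihilates the
    first column of the last block, which makes \<open>F q 0\<close> vanish; \<open>e0\<close> and
    \<open>e1\<close> complete it to a basis.\<close>
  interpret vf: veronese_fixes r e0 e1 "- b" a q n "W 0" "W 1" A Y
    by unfold_locales (use r(1) det in auto)
  have detEF: "vf.E k j * vf.F k' j' - vf.E k' j' * vf.F k j = (e0 * a - e1 * (- b)) * (?a k j * ?b k' j' - ?b k j * ?a k' j')" for k j k' j'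
    unfolding vf.E_def vf.F_def by (rule det_mult)
  have Fk: "vf.F k 0 = ?b k 0 * a - ?a k 0 * b" for k unfolding vf.F_def by (simp add: mult.commute)
  have Fnz: "vf.F k 0 \<noteq> 0" if "k < q" for k
    using between[OF that order.refl] unfolding Fk unfolding a_def b_def by (simp add: mult.commute)
  have Yeq: "Y = {t \<in> carrier_vec (r + 1). t \<noteq> 0\<^sub>v (r + 1) \<and> (\<forall>k\<le>q. vf.linv (W 0 k) (W 1 k) 0 t \<noteq> 0)}"
  proof -
    have "t \<bullet> col (block lam w k) 0 = vf.linv (W 0 k) (W 1 k) 0 t" if "t \<in> carrier_vec (r + 1)" "k \<le> q" for t k
      unfolding w W_def by (rule vf.linv_hyperplane) (use that lt pos[of k] in auto)
    then show ?thesis unfolding Y hyperplane_complement_def lt by auto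
  qed
  interpret vd: veronese_data r e0 e1 "- b" a q n "W 0" "W 1" A Y
  proof unfold_locales
    show "vf.F q 0 = 0" unfolding Fk unfolding a_def b_def by (simp add: mult.commute)
    show "vf.E q 0 \<noteq> 0" using det by (simp add: vf.E_def a_def b_def)
    show "vf.F k 0 \<noteq> 0" if "k < q" for k by (rule Fnz[OF that])
    show "inj_on vf.pt {..<q}"
    proof (rule inj_onI, rule ccontr)
      fix k k' assume k: "k \<in> {..<q}" "k' \<in> {..<q}" "vf.pt k = vf.pt k'" "k \<noteq> k'"
      then have nz: "vf.F k 0 \<noteq> 0" "vf.F k' 0 \<noteq> 0" using Fnz by auto
      have "vf.E k 0 * vf.F k' 0 = vf.E k' 0 * vf.F k 0"
        using k(3) nz unfolding vf.pt_def by (simp add: frac_eq_eq)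
      then have "?a k 0 * ?b k' 0 - ?b k 0 * ?a k' 0 = 0" using detEF[of k 0 k' 0] det by simp
      then show False using between[of k k'] between[of k' k] k by (cases "k < k'") (auto simp: mult.commute)
    qed
    show "vf.E k 0 * vf.F k 1 \<noteq> vf.E k 1 * vf.F k 0" if "k \<le> q" "2 \<le> n k" for k
      using detEF[of k 0 k 1] det within[of k] that by (auto simp: n_def mult.commute)
    show "1 \<le> n k" if "k \<le> q" for k using pos[OF that] by (simp add: n_def)
    show "Y = {t \<in> carrier_vec (r + 1). t \<noteq> 0\<^sub>v (r + 1) \<and> (\<forall>k\<le>q. vf.linv (W 0 k) (W 1 k) 0 t \<noteq> 0)}" by (rule Yeq)
    show "(\<Sum>k\<le>q. A (k, 0)) = 0" using \<alpha>_sum by (simp add: A_def lt')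
    show "A (k, 0) \<notin> \<int>" if "k \<le> q" "n k = 1" for k using \<alpha>_generic that lt[of k] by (auto simp: A_def n_def)
    show "A (k, n k - 1) \<noteq> 0" if "k \<le> q" "1 < n k" for k using \<alpha>_generic that lt[of k] by (auto simp: A_def n_def)
  qed
  have dth: "dtheta i (yw r lam w k) = dtheta i (vd.ln k)" if "k \<le> q" "i < lam ! k" for i k
    unfolding w W_def by (rule vf.dtheta_lin) (use that lt in auto)
  have om: "\<omega> = (\<Sum>k\<le>q. \<Sum>i<n k. fscale (rconst (A (k, i))) (dtheta i (vd.ln k)))"
    unfolding \<omega> omega_def lt' by (intro sum.cong refl) (auto simp: A_def n_def dth)
  \<comment> \<open>The elements of \<open>P\<close> in the order in which the theorem lists the
    members.\<close>
  define xsl where "xsl = concat (map (\<lambda>k. map (\<lambda>i. (k, i)) [1..<lam ! k]) [0..<length lam]) @ map (\<lambda>k. (k, 0)) [0..<length lam - 1]"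
  have set_xsl: "set xsl = vd.P"
  proof -
    have "set xsl = (SIGMA k:{..q}. {1..<lam ! k}) \<union> (\<lambda>k. (k, 0)) ` {..<q}"
      by (auto simp: xsl_def len atLeast0LessThan lessThan_Suc_atMost simp del: upt_Suc)
    also have "\<dots> = vd.P"
    proof -
      have "0 < lam ! k" if "k < q" for k using pos[of k] that by simp
      then show ?thesis by (auto simp: vd.P_def n_def)
    qed
    finally show ?thesis .
  qed
  have sum_lam: "(\<Sum>k\<le>q. lam ! k) = N" using lam(1) by (simp add: sum_list_sum_nth lt' atLeast0LessThan)
  have len_xsl: "length xsl = N - 1"
  proof -
    have "length xsl = (\<Sum>k\<le>q. lam ! k - 1) + q"
      unfolding xsl_def using concat_length_upt[of "\<lambda>k i. (k, i)" "\<lambda>k. lam ! k" "length lam"] lt'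
      by (simp add: len del: upt_Suc sum.lessThan_Suc)
    moreover have "(\<Sum>k\<le>q. lam ! k - 1) + Suc q = (\<Sum>k\<le>q. (lam ! k - 1) + 1)" by (simp only: sum.distrib) simp
    moreover have "\<dots> = (\<Sum>k\<le>q. lam ! k)" by (rule sum.cong) (use pos in force)+
    ultimately show ?thesis using sum_lam by simp
  qed
  \<comment> \<open>Compared with the length of \<open>xsl\<close>, this yields that no index is
    listed twice.\<close>
  have "card vd.P = N - 1"
  proof -
    have "(SIGMA k:{..q}. {..<n k}) = insert (q, 0) vd.P" using pos[of q] by (auto simp: vd.P_def n_def)
    moreover have "card (SIGMA k:{..q}. {..<n k}) = N" using sum_lam by (simp add: n_def)
    moreover have "(q, 0) \<notin> vd.P" by (simp add: vd.P_def)
    ultimately show ?thesis using vd.finite_P by simp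
  qed
  then have dist: "distinct xsl" using set_xsl len_xsl card_distinct[of xsl] by simp
  have L_eq: "L = map (\<lambda>x. (A x, vd.mem x)) xsl"
  proof -
    have higher: "members_higher r lam w \<alpha> =
        map (\<lambda>x. (A x, vd.mem x)) (concat (map (\<lambda>k. map (\<lambda>i. (k, i)) [1..<lam ! k]) [0..<length lam]))"
      unfolding members_higher_def map_concat
      by (intro arg_cong[where f = concat]) (auto simp: A_def vd.mem_def dth lt)
    have "members_a r lam w \<alpha> = map (\<lambda>x. (A x, vd.mem x)) xsl"
      unfolding members_a_def higher xsl_def map_append
      by (auto simp: A_def vd.mem_def dth pos0 len intro!: arg_cong2[where f = "(-)"])
    moreover have "members_b r lam w \<alpha> = members_a r lam w \<alpha>" if inf: "p_point lam z (length lam - 1) = infinity_point"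
    proof -
      have dz: "dim_row z = 2" using z by (auto simp: generic_stratum_def)
      \<comment> \<open>The vector (0, 1) represents x = infinity; being orthogonal to the first
        column of the last block, it shows that the lower entry is 0.\<close>
      have "vec 2 (\<lambda>i. if i = 1 then 1 else 0) \<in> infinity_point"
        by (auto simp: infinity_point_def vec_eq_iff intro!: exI[of _ 1])
      then have "vec 2 (\<lambda>i. if i = 1 then 1 else 0) \<in> p_point lam z q"
        using inf by (simp add: len)
      then have "vec 2 (\<lambda>i. if i = 1 then 1 else 0) \<bullet> col (block lam z q) 0 = 0"
        by (simp add: p_point_def)
      then have "fps_nth (W 1 q) 0 = 0" using dz pos[of q] by (simp add: Wn scalar_prod_def numeral_2_eq_2 One_nat_def)
      then have "dtheta 0 (vd.ln q) = 0" by (rule vf.dtheta_0_infinity)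
      then have "dtheta 0 (yw r lam w (length lam - 1)) = 0" using dth[of q 0] pos[of q] by (simp add: len)
      then show ?thesis unfolding members_a_def members_b_def by simp
    qed
    ultimately show ?thesis using L by auto
  qed
  let ?xs = "take e xsl @ drop (Suc e) xsl"
  have e: "e < length xsl" using omitted(1) by (simp add: L_eq)
  have \<psi>_eq: "\<psi> = map vd.mem ?xs" unfolding \<psi> L_eq by (simp add: take_map drop_map comp_def)
  note rem = remove_nth[OF dist e]
  have len_xs: "length ?xs = N - 2" using rem(3) len_xsl by simp
  have "xsl ! e \<in> vd.P" using e set_xsl nth_mem by blast
  moreover have "A (xsl ! e) \<noteq> 0" using omitted(2) e by (simp add: L_eq)
  moreover have "r \<le> N - 2" using r by simp
  ultimately have "set \<psi> \<subseteq> Omega r Y 1 \<and>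
    (\<forall>J\<in>{J. J \<subseteq> {..<N - 2} \<and> card J = r}. wedge_list (nths \<psi> J) \<in> Omega r Y r) \<and>
    inj_on (\<lambda>J. coh_class r Y \<omega> r (wedge_list (nths \<psi> J))) {J. J \<subseteq> {..<N - 2} \<and> card J = r} \<and>
    vectorspace.basis class_ring (cohomology r Y \<omega> r)
      ((\<lambda>J. coh_class r Y \<omega> r (wedge_list (nths \<psi> J))) ` {J. J \<subseteq> {..<N - 2} \<and> card J = r})"
    unfolding \<psi>_eq using vd.veronese_basis[OF om rem(1) rem(2)[unfolded set_xsl] len_xs] by blast
  moreover have "length \<psi> = N - 2" unfolding \<psi>_eq using len_xs by simp
  ultimately show ?thesis by blast
qed

end
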